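(* Let $k\in\mathbb R$ be such that $M_1=-4k-2\in\mathbb N=\{1,2,\dots\}$. Then the Ramond extremal irreducible highest weight Ramond twisted $W^k_{\min}(spo(2|3))$-modules $L^W\big(0,\tfrac{M_1-1}{16}\big)$ and $L^W\big(\tfrac{M_1}2\theta_1,\tfrac{M_1-1}{16}+\tfrac{M_1}4\big)$ are both unitary.
   Context: $\mathfrak g=spo(2|3)$, $\mathfrak g_{\bar0}=\mathfrak s\oplus\mathfrak g^\natural$ with $\mathfrak s=\mathrm{span}(e,x,f)\cong sl_2$ ($[x,e]=e,[x,f]=-f,[e,f]=x$) and $\mathfrak g^\natural\cong so_3\cong sl_2$ the centralizer of $\mathfrak s$, with positive root $\theta_1=\epsilon_1$. $(\cdot|\cdot)$ is the invariant form with $(x|x)=\frac12$, so $(\epsilon_1|\epsilon_1)=-\frac12$; $h^\vee=\frac12$; $\mathrm{ad}\,x$-grading $\mathfrak g=\mathbb Cf\oplus\mathfrak g_{-1/2}\oplus(\mathbb Cx\oplus\mathfrak g^\natural)\oplus\mathfrak g_{1/2}\oplus\mathbb Ce$; $\mathfrak g_{-1/2}$ is odd with $\mathfrak h^\natural$-weights $\epsilon_1,0,-\epsilon_1$ ($\mathfrak h^\natural$ a Cartan subalgebra of $\mathfrak g^\natural$). $p(k)=(k+\frac12)(k+\frac34)$. $W^k_{\min}(\mathfrak g)$ ($k\ne-\frac12$) is the universal minimal quantum affine $W$-algebra, strongly and freely generated by a Virasoro vector $L$ of central charge $\frac{k\,\mathrm{sdim}\,\mathfrak g}{k+h^\vee}-6k+h^\vee-4$,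 even primary $J^{\{a\}}$ ($a\in\mathfrak g^\natural$) of weight 1, odd primary $G^{\{u\}}$ ($u\in\mathfrak g_{-1/2}$) of weight $\frac32$, with $[J^{\{a\}}{}_\lambda J^{\{b\}}]=J^{\{[a,b]\}}+\lambda(k+\tfrac12)(a|b)$, $[J^{\{a\}}{}_\lambda G^{\{u\}}]=G^{\{[a,u]\}}$, and $[G^{\{u\}}{}_\lambda G^{\{v\}}]=-2(k+h^\vee)\langle u,v\rangle L+\langle u,v\rangle\sum_\alpha:J^{\{a^\alpha\}}J^{\{a_\alpha\}}:+2\sum_{\alpha,\beta}\langle[a_\alpha,u],[v,a^\beta]\rangle:J^{\{a^\alpha\}}J^{\{a_\beta\}}:+2(k+1)(\partial+2\lambda)J^{\{[[e,u],v]^\natural\}}+2\lambda\sum_{\alpha,\beta}\langle[a_\alpha,u],[v,a^\beta]\rangle J^{\{[a^\alpha,a_\beta]\}}+2\lambda^2\langle u,v\rangle p(k)|0\rangle$, where $\{a_\alpha\},\{a^\alpha\}$ are dual bases of $\mathfrak g^\natural$, $\langle u,v\rangle=(e|[u,v])$, $b^\natural$ is the projection of $b\in\mathfrak g_0$ to $\mathfrak g^\natural$. (Tensored with one free fermion it is the $N=3$ superconformal algebra.) Ramond twisted modules are modules twisted by the parity automorphism: $G^{\{u\}}(z)=\sum_{n\in\mathbb Z}G^{\{u\}}_nz^{-n-3/2}$, and $J_n^{\{a\}},L_n$ have $n\in\mathbb Z$. $L^W(\nu,\ell_0)$ is the irreducible one generated by a vector $v$ with $L_0v=\ell_0v$,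 $J_0^{\{h\}}v=\nu(h)v$ ($h\in\mathfrak h^\natural$), $J_n^{\{a\}}v=G_n^{\{u\}}v=L_nv=0$ for $n>0$, $J_0^{\{a\}}v=0$ for $a$ in the root space of $\epsilon_1$, and $G_0^{\{u\}}v=0$ for $u\in\mathfrak g_{-1/2}$ of weight $\epsilon_1$. Let $\phi$ be an almost compact conjugate-linear involution of $\mathfrak g$ (fixing $e,x,f$ and restricting to a compact involution of $\mathfrak g^\natural$). $L^W(\nu,\ell_0)$ is unitary if it carries a positive definite Hermitian form with $L_n^*=L_{-n}$, $(J_n^{\{a\}})^*=-J_{-n}^{\{\phi(a)\}}$, $(G_n^{\{u\}})^*=G_{-n}^{\{\phi(u)\}}$. The Ramond extremal weights are $\nu=0$ and $\nu=\frac{M_1}2\theta_1$.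
   Formalization: The almost compact involution φ is additionally normalised by ⟨φ(u),u⟩>0 for nonzero u in g_{-1/2}; exactly one of φ and φ∘parity satisfies this, and for M_1≥2 unitarity fails for the other choice. *)

theory Defs
  imports
    "HOL-Analysis.Analysis"
    "HOL-Library.Groups_Big_Fun"
    "HOL-Library.More_List"
begin

section \<open>The Lie superalgebra \<open>spo(2|3)\<close>\<close>

text \<open>Supermatrices on \<open>C^{2|3}\<close>: the indices \<open>Inl _\<close> are even, the indices \<open>Inr _\<close> are odd.
  Parities are booleans, with \<open>True\<close> for odd.\<close>

type_synonym smat = "complex ^ (2 + 3) ^ (2 + 3)"

definition mscale :: "complex \<Rightarrow> smat \<Rightarrow> smat" where
  "mscale c A = (\<chi> i j. c * A $ i $ j)"

definition munit :: "2 + 3 \<Rightarrow> 2 + 3 \<Rightarrow> smat" where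
  "munit r c = (\<chi> i j. if i = r \<and> j = c then 1 else 0)"

definition mpart :: "bool \<Rightarrow> smat \<Rightarrow> smat" where
  "mpart p A = (\<chi> i j. if (isl i \<noteq> isl j) = p then A $ i $ j else 0)"

definition koszul :: "bool \<Rightarrow> bool \<Rightarrow> complex" where
  "koszul p q = (if p \<and> q then -1 else 1)"

definition sbracket :: "smat \<Rightarrow> smat \<Rightarrow> smat" where
  "sbracket A B =
     A ** B - (\<Sum>p\<in>UNIV. \<Sum>q\<in>UNIV. mscale (koszul p q) (mpart q B ** mpart p A))"

definition str :: "smat \<Rightarrow> complex" where
  "str A = (\<Sum>i\<in>UNIV. (if isl i then 1 else -1) * A $ i $ i)"

text \<open>The bilinear form on \<open>C^{2|3}\<close> defining \<open>spo(2|3)\<close>: symplectic on the even part and symmetric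
  (antidiagonal, so that the diagonal matrices of \<open>so_3\<close> form a Cartan subalgebra) on the odd part.
  The numeral 3 of type 3 is its element 0.\<close>

definition form23 :: "2 + 3 \<Rightarrow> 2 + 3 \<Rightarrow> complex" where
  "form23 i j =
     (if i = Inl 1 \<and> j = Inl 2 then 1
      else if i = Inl 2 \<and> j = Inl 1 then -1
      else if (i, j) \<in> {(Inr 1, Inr 3), (Inr 2, Inr 2), (Inr 3, Inr 1)} then 1
      else 0)"

text \<open>The condition on the part of parity \<open>p\<close> is \<open>(Ay,z) + (-1)^{p p(y)} (y,Az) = 0\<close> for basis
  vectors \<open>y\<close>, \<open>z\<close>.\<close>

definition spo23 :: "smat set" where
  "spo23 = {A. \<forall>p i j.
     (\<Sum>l\<in>UNIV. mpart p A $ l $ i * form23 l j)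
       + koszul p (\<not> isl i) * (\<Sum>l\<in>UNIV. mpart p A $ l $ j * form23 i l) = 0}"

definition sdim_spo23 :: int where
  "sdim_spo23 = int (vector_space.dim mscale {A \<in> spo23. mpart False A = A})
              - int (vector_space.dim mscale {A \<in> spo23. mpart True A = A})"

text \<open>The invariant bilinear form normalised by \<open>(x|x) = 1/2\<close> is the supertrace form.\<close>

definition inv_form :: "smat \<Rightarrow> smat \<Rightarrow> complex" where
  "inv_form A B = str (A ** B)"

definition e_mat :: smat where "e_mat = munit (Inl 1) (Inl 2)"

definition x_mat :: smat where
  "x_mat = mscale (1/2) (munit (Inl 1) (Inl 1) - munit (Inl 2) (Inl 2))"

definition f_mat :: smat where "f_mat = mscale (1/2) (munit (Inl 2) (Inl 1))"

definition g_nat :: "smat set" where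
  "g_nat = {a \<in> spo23. \<forall>s\<in>{e_mat, x_mat, f_mat}. sbracket s a = 0}"

definition g_mhalf :: "smat set" where
  "g_mhalf = {u \<in> spo23. sbracket x_mat u = mscale (-1/2) u}"

text \<open>The basis \<open>e_\<theta>, h, f_\<theta>\<close> of \<open>so_3\<close> (root vectors of \<open>\<epsilon>\<^sub>1\<close> and \<open>-\<epsilon>\<^sub>1\<close>, and the element \<open>h\<close> with
  \<open>\<epsilon>\<^sub>1(h) = 1\<close>), and the basis of \<open>g_{-1/2}\<close> of weights \<open>\<epsilon>\<^sub>1, 0, -\<epsilon>\<^sub>1\<close>.\<close>

definition nat_basis :: "3 \<Rightarrow> smat" where
  "nat_basis \<alpha> =
     (if \<alpha> = 1 then munit (Inr 1) (Inr 2) - munit (Inr 2) (Inr 3)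
      else if \<alpha> = 2 then munit (Inr 1) (Inr 1) - munit (Inr 3) (Inr 3)
      else munit (Inr 2) (Inr 1) - munit (Inr 3) (Inr 2))"

text \<open>The dual basis: \<open>(nat_dual \<alpha> | nat_basis \<beta>) = \<delta>\<^sub>\<alpha>\<^sub>\<beta>\<close>.  The sums below do not depend
  on the choice of the basis.\<close>

definition nat_dual :: "3 \<Rightarrow> smat" where
  "nat_dual \<alpha> = mscale (-1/2) (nat_basis (if \<alpha> = 1 then 3 else if \<alpha> = 2 then 2 else 1))"

definition mhalf_basis :: "3 \<Rightarrow> smat" where
  "mhalf_basis j = munit (Inr j) (Inl 1)
     - munit (Inl 2) (Inr (if j = 1 then 3 else if j = 2 then 2 else 1))"

definition cartan_nat :: "smat set" where
  "cartan_nat = range (\<lambda>c. mscale c (nat_basis 2))"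

text \<open>\<open>\<theta>\<^sub>1 = \<epsilon>\<^sub>1\<close>, as a linear functional on the diagonal matrices.\<close>

definition theta1 :: "smat \<Rightarrow> complex" where
  "theta1 h = h $ Inr 1 $ Inr 1"

definition weight_space :: "smat set \<Rightarrow> (smat \<Rightarrow> complex) \<Rightarrow> smat set" where
  "weight_space S \<mu> = {a \<in> S. \<forall>h\<in>cartan_nat. sbracket h a = mscale (\<mu> h) a}"

definition ang :: "smat \<Rightarrow> smat \<Rightarrow> complex" where
  "ang u v = inv_form e_mat (sbracket u v)"

text \<open>The projection of \<open>g_0 = C x \<oplus> g^\<natural>\<close> to \<open>g^\<natural>\<close>; the two summands are orthogonal.\<close>

definition proj_nat :: "smat \<Rightarrow> smat" where
  "proj_nat b = b - mscale (inv_form b x_mat / inv_form x_mat x_mat) x_mat"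

text \<open>The Killing form of \<open>g^\<natural>\<close>: the trace of \<open>ad a ad b\<close> on \<open>g^\<natural>\<close>.\<close>

definition killing_nat :: "smat \<Rightarrow> smat \<Rightarrow> complex" where
  "killing_nat a b =
     (\<Sum>\<alpha>\<in>UNIV. inv_form (nat_dual \<alpha>) (sbracket a (sbracket b (nat_basis \<alpha>))))"

text \<open>The involution is compact on \<open>g^\<natural>\<close> if the Killing form is negative definite on the real form
  fixed by it (where it takes real values).  Composing an almost compact involution with the parity
  automorphism gives another one, for which the definite Hermitian form \<open>ang (\<phi> u) v\<close> on
  \<open>g_{-1/2}\<close> changes its sign.\<close>

definition almost_compact :: "(smat \<Rightarrow> smat) \<Rightarrow> bool" where
  "almost_compact \<phi> \<longleftrightarrow>
     (\<forall>a\<in>spo23. \<phi> a \<in> spo23 \<and> \<phi> (\<phi> a) = a) \<and>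
     (\<forall>a\<in>spo23. \<forall>p. \<phi> (mpart p a) = mpart p (\<phi> a)) \<and>
     (\<forall>a\<in>spo23. \<forall>b\<in>spo23. \<phi> (a + b) = \<phi> a + \<phi> b) \<and>
     (\<forall>a\<in>spo23. \<forall>c. \<phi> (mscale c a) = mscale (cnj c) (\<phi> a)) \<and>
     (\<forall>a\<in>spo23. \<forall>b\<in>spo23. \<phi> (sbracket a b) = sbracket (\<phi> a) (\<phi> b)) \<and>
     \<phi> e_mat = e_mat \<and> \<phi> x_mat = x_mat \<and> \<phi> f_mat = f_mat \<and>
     (\<forall>a\<in>g_nat. \<phi> a = a \<and> a \<noteq> 0 \<longrightarrow> Re (killing_nat a a) < 0)"

section \<open>Vertex superalgebras and their parity-twisted modules\<close>

locale superspace = vector_space scale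
  for scale :: "complex \<Rightarrow> 'v::ab_group_add \<Rightarrow> 'v" +
  fixes par :: "bool \<Rightarrow> 'v set"
  assumes par_subspace: "subspace (par p)"
    and par_sum: "\<exists>a\<in>par False. \<exists>b\<in>par True. w = a + b"
    and par_disjoint: "par False \<inter> par True = {0}"

text \<open>\<open>prd a n b\<close> is the \<open>n\<close>-th product \<open>a_(n) b\<close>, that is, \<open>Y(a,z) = \<Sum> a_(n) z^{-n-1}\<close>.  By the
  truncation axiom all sums below are finite.\<close>

locale vertex_superalgebra = superspace sV parV
  for sV :: "complex \<Rightarrow> 'v::ab_group_add \<Rightarrow> 'v" and parV :: "bool \<Rightarrow> 'v set" +
  fixes vac :: 'v and prd :: "'v \<Rightarrow> int \<Rightarrow> 'v \<Rightarrow> 'v"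
  assumes prd_add_left: "prd (a + b) n c = prd a n c + prd b n c"
    and prd_add_right: "prd a n (b + c) = prd a n b + prd a n c"
    and prd_scale_left: "prd (sV t a) n b = sV t (prd a n b)"
    and prd_scale_right: "prd a n (sV t b) = sV t (prd a n b)"
    and prd_par: "a \<in> parV p \<Longrightarrow> b \<in> parV q \<Longrightarrow> prd a n b \<in> parV (p \<noteq> q)"
    and prd_truncation: "\<exists>N. \<forall>n\<ge>N. prd a n b = 0"
    and vac_even: "vac \<in> parV False"
    and vac_left: "prd vac n a = (if n = -1 then a else 0)"
    and vac_right: "prd a (-1) vac = a" "n \<ge> 0 \<Longrightarrow> prd a n vac = 0"
    and borcherds: "a \<in> parV p \<Longrightarrow> b \<in> parV q \<Longrightarrow>
      Sum_any (\<lambda>j. sV (of_int m gchoose j) (prd (prd a (l + int j) b) (m + n - int j) c)) =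
      Sum_any (\<lambda>j. sV ((-1) ^ j * (of_int l gchoose j))
        (prd a (m + l - int j) (prd b (n + int j) c)
          - sV (koszul p q * (-1) powi l) (prd b (n + l - int j) (prd a (m + int j) c))))"
begin

definition translation :: "'v \<Rightarrow> 'v" where
  "translation a = prd a (-2) vac"

definition normal_ord :: "'v \<Rightarrow> 'v \<Rightarrow> 'v" where
  "normal_ord a b = prd a (-1) b"

text \<open>\<open>lambda_bracket a b n\<close> is the coefficient of \<open>\<lambda>^n\<close> in \<open>[a\<^sub>\<lambda> b]\<close>; polynomials in \<open>\<lambda>\<close> are given
  as \<open>nth_default 0 [c\<^sub>0, c\<^sub>1, \<dots>]\<close>.\<close>

definition lambda_bracket :: "'v \<Rightarrow> 'v \<Rightarrow> nat \<Rightarrow> 'v" where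
  "lambda_bracket a b n = sV (1 / fact n) (prd a (int n) b)"

text \<open>PBW monomials in the modes \<open>(g_i)_(-1-m)\<close>, encoded by lists of pairs \<open>(i,m)\<close> increasing in the
  lexicographic order, in which only pairs belonging to even generators may be repeated.  The state
  \<open>(g_i)_(-1-m) w\<close> is \<open>: (T^m g_i) w : / m!\<close>.\<close>

definition pbw_lists :: "'v list \<Rightarrow> (nat \<times> nat) list set" where
  "pbw_lists gs = {xs. (\<forall>(i, m)\<in>set xs. i < length gs) \<and>
     sorted_wrt (\<lambda>(i, m) (j, n).
       i < j \<or> i = j \<and> (m < n \<or> m = n \<and> gs ! i \<in> parV False)) xs}"

definition pbw_monomial :: "'v list \<Rightarrow> (nat \<times> nat) list \<Rightarrow> 'v" where
  "pbw_monomial gs xs = foldr (\<lambda>(i, m) w. prd (gs ! i) (-1 - int m) w) xs vac"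

definition strongly_freely_generated :: "'v list \<Rightarrow> bool" where
  "strongly_freely_generated gs \<longleftrightarrow>
     inj_on (pbw_monomial gs) (pbw_lists gs) \<and>
     independent (pbw_monomial gs ` pbw_lists gs) \<and>
     span (pbw_monomial gs ` pbw_lists gs) = UNIV"

end

text \<open>Modules over a vertex superalgebra twisted by the parity automorphism.  \<open>md a n\<close> is the mode
  \<open>a_(n)\<close> of \<open>Y(a,z) = \<Sum> a_(n) z^{-n-1}\<close>, where \<open>n\<close> runs over the integers for even \<open>a\<close> and over
  \<open>1/2 + Z\<close> for odd \<open>a\<close>; the other modes are 0.\<close>

locale parity_twisted_module =
  vertex_superalgebra sV parV vac prd + M: superspace sM parM
  for sV :: "complex \<Rightarrow> 'v::ab_group_add \<Rightarrow> 'v" and parV :: "bool \<Rightarrow> 'v set"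
    and vac :: 'v and prd :: "'v \<Rightarrow> int \<Rightarrow> 'v \<Rightarrow> 'v"
    and sM :: "complex \<Rightarrow> 'm::ab_group_add \<Rightarrow> 'm" and parM :: "bool \<Rightarrow> 'm set" +
  fixes md :: "'v \<Rightarrow> rat \<Rightarrow> 'm \<Rightarrow> 'm"
  assumes md_add_left: "md (a + b) r w = md a r w + md b r w"
    and md_add_right: "md a r (w + w') = md a r w + md a r w'"
    and md_scale_left: "md (sV t a) r w = sM t (md a r w)"
    and md_scale_right: "md a r (sM t w) = sM t (md a r w)"
    and md_par: "a \<in> parV p \<Longrightarrow> w \<in> parM q \<Longrightarrow> md a r w \<in> parM (p \<noteq> q)"
    and md_twist: "a \<in> parV p \<Longrightarrow> r - of_bool p / 2 \<notin> \<int> \<Longrightarrow> md a r w = 0"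
    and md_truncation: "\<exists>N. \<forall>r\<ge>N. md a r w = 0"
    and md_vac: "md vac r w = (if r = -1 then w else 0)"
    and md_borcherds: "a \<in> parV p \<Longrightarrow> b \<in> parV q \<Longrightarrow>
      r - of_bool p / 2 \<in> \<int> \<Longrightarrow> s - of_bool q / 2 \<in> \<int> \<Longrightarrow>
      Sum_any (\<lambda>j. sM (of_rat r gchoose j) (md (prd a (l + int j) b) (r + s - of_nat j) w)) =
      Sum_any (\<lambda>j. sM ((-1) ^ j * (of_int l gchoose j))
        (md a (r + of_int l - of_nat j) (md b (s + of_nat j) w)
          - sM (koszul p q * (-1) powi l)
              (md b (s + of_int l - of_nat j) (md a (r + of_nat j) w))))"
begin

definition submod :: "'m set \<Rightarrow> bool" where
  "submod N \<longleftrightarrow> M.subspace N \<and>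
     (\<forall>w\<in>N. \<exists>w0\<in>N \<inter> parM False. \<exists>w1\<in>N \<inter> parM True. w = w0 + w1) \<and>
     (\<forall>a r. \<forall>w\<in>N. md a r w \<in> N)"

definition irreducible_module :: bool where
  "irreducible_module \<longleftrightarrow>
     (UNIV :: 'm set) \<noteq> {0} \<and> (\<forall>N. submod N \<longrightarrow> N = {0} \<or> N = UNIV)"

end

section \<open>The minimal \<open>W\<close>-algebra of \<open>spo(2|3)\<close> and its Ramond twisted modules\<close>

definition h_dual :: real where "h_dual = 1/2"

definition central_charge :: "real \<Rightarrow> real" where
  "central_charge k = k * of_int sdim_spo23 / (k + h_dual) - 6 * k + h_dual - 4"

definition p_poly :: "real \<Rightarrow> real" where
  "p_poly k = (k + 1/2) * (k + 3/4)"

text \<open>\<open>J\<close> and \<open>G\<close> are only relevant on \<open>g^\<natural>\<close> and \<open>g_{-1/2}\<close>.\<close>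

locale minimal_W_spo23 = vertex_superalgebra sV parV vac prd
  for sV :: "complex \<Rightarrow> 'v::ab_group_add \<Rightarrow> 'v" and parV :: "bool \<Rightarrow> 'v set"
    and vac :: 'v and prd :: "'v \<Rightarrow> int \<Rightarrow> 'v \<Rightarrow> 'v" +
  fixes k :: real and L :: 'v and J :: "smat \<Rightarrow> 'v" and G :: "smat \<Rightarrow> 'v"
  assumes noncritical: "k \<noteq> -1/2"
    and J_add: "a \<in> g_nat \<Longrightarrow> b \<in> g_nat \<Longrightarrow> J (a + b) = J a + J b"
    and J_scale: "a \<in> g_nat \<Longrightarrow> J (mscale t a) = sV t (J a)"
    and G_add: "u \<in> g_mhalf \<Longrightarrow> v \<in> g_mhalf \<Longrightarrow> G (u + v) = G u + G v"
    and G_scale: "u \<in> g_mhalf \<Longrightarrow> G (mscale t u) = sV t (G u)"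
    and L_even: "L \<in> parV False"
    and J_even: "a \<in> g_nat \<Longrightarrow> J a \<in> parV False"
    and G_odd: "u \<in> g_mhalf \<Longrightarrow> G u \<in> parV True"
    and LL: "lambda_bracket L L =
      nth_default 0 [translation L, sV 2 L, 0, sV (of_real (central_charge k / 12)) vac]"
    and LJ: "a \<in> g_nat \<Longrightarrow>
      lambda_bracket L (J a) = nth_default 0 [translation (J a), J a]"
    and LG: "u \<in> g_mhalf \<Longrightarrow>
      lambda_bracket L (G u) = nth_default 0 [translation (G u), sV (3/2) (G u)]"
    and JJ: "a \<in> g_nat \<Longrightarrow> b \<in> g_nat \<Longrightarrow>
      lambda_bracket (J a) (J b) =
        nth_default 0 [J (sbracket a b), sV (of_real (k + 1/2) * inv_form a b) vac]"
    and JG: "a \<in> g_nat \<Longrightarrow> u \<in> g_mhalf \<Longrightarrow>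
      lambda_bracket (J a) (G u) = nth_default 0 [G (sbracket a u)]"
    and GG: "u \<in> g_mhalf \<Longrightarrow> v \<in> g_mhalf \<Longrightarrow>
      lambda_bracket (G u) (G v) = nth_default 0
       [sV (- 2 * of_real (k + h_dual) * ang u v) L
          + sV (ang u v) (\<Sum>\<alpha>\<in>UNIV. normal_ord (J (nat_dual \<alpha>)) (J (nat_basis \<alpha>)))
          + sV 2 (\<Sum>\<alpha>\<in>UNIV. \<Sum>\<beta>\<in>UNIV.
              sV (ang (sbracket (nat_basis \<alpha>) u) (sbracket v (nat_dual \<beta>)))
                 (normal_ord (J (nat_dual \<alpha>)) (J (nat_basis \<beta>))))
          + sV (of_real (2 * (k + 1))) (translation (J (proj_nat (sbracket (sbracket e_mat u) v)))),
        sV (of_real (4 * (k + 1))) (J (proj_nat (sbracket (sbracket e_mat u) v)))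
          + sV 2 (\<Sum>\<alpha>\<in>UNIV. \<Sum>\<beta>\<in>UNIV.
              sV (ang (sbracket (nat_basis \<alpha>) u) (sbracket v (nat_dual \<beta>)))
                 (J (sbracket (nat_dual \<alpha>) (nat_basis \<beta>)))),
        sV (2 * ang u v * of_real (p_poly k)) vac]"
    and generation: "strongly_freely_generated
      [L, J (nat_basis 1), J (nat_basis 2), J (nat_basis 3),
       G (mhalf_basis 1), G (mhalf_basis 2), G (mhalf_basis 3)]"

locale Ramond_W_module =
  minimal_W_spo23 sV parV vac prd k L J G + parity_twisted_module sV parV vac prd sM parM md
  for sV :: "complex \<Rightarrow> 'v::ab_group_add \<Rightarrow> 'v" and parV :: "bool \<Rightarrow> 'v set"
    and vac :: 'v and prd :: "'v \<Rightarrow> int \<Rightarrow> 'v \<Rightarrow> 'v"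
    and k :: real and L :: 'v and J :: "smat \<Rightarrow> 'v" and G :: "smat \<Rightarrow> 'v"
    and sM :: "complex \<Rightarrow> 'm::ab_group_add \<Rightarrow> 'm" and parM :: "bool \<Rightarrow> 'm set"
    and md :: "'v \<Rightarrow> rat \<Rightarrow> 'm \<Rightarrow> 'm"
begin

text \<open>A field of conformal weight \<open>d\<close> is \<open>\<Sum> a_n z^{-n-d}\<close>, so \<open>a_n = a_(n+d-1)\<close>.\<close>

definition L_mode :: "int \<Rightarrow> 'm \<Rightarrow> 'm" where
  "L_mode n = md L (of_int n + 1)"

definition J_mode :: "smat \<Rightarrow> int \<Rightarrow> 'm \<Rightarrow> 'm" where
  "J_mode a n = md (J a) (of_int n)"

definition G_mode :: "smat \<Rightarrow> int \<Rightarrow> 'm \<Rightarrow> 'm" where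
  "G_mode u n = md (G u) (of_int n + 1/2)"

definition highest_weight_vector :: "(smat \<Rightarrow> complex) \<Rightarrow> complex \<Rightarrow> 'm \<Rightarrow> bool" where
  "highest_weight_vector \<nu> l0 v \<longleftrightarrow>
     v \<noteq> 0 \<and>
     L_mode 0 v = sM l0 v \<and>
     (\<forall>h\<in>cartan_nat. J_mode h 0 v = sM (\<nu> h) v) \<and>
     (\<forall>n>0. L_mode n v = 0 \<and> (\<forall>a\<in>g_nat. J_mode a n v = 0) \<and> (\<forall>u\<in>g_mhalf. G_mode u n v = 0)) \<and>
     (\<forall>a\<in>weight_space g_nat theta1. J_mode a 0 v = 0) \<and>
     (\<forall>u\<in>weight_space g_mhalf theta1. G_mode u 0 v = 0)"

text \<open>The module is a realisation of \<open>L^W(\<nu>, l0)\<close>.\<close>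

definition irreducible_highest_weight :: "(smat \<Rightarrow> complex) \<Rightarrow> complex \<Rightarrow> bool" where
  "irreducible_highest_weight \<nu> l0 \<longleftrightarrow>
     irreducible_module \<and>
     (\<exists>v. highest_weight_vector \<nu> l0 v \<and> (\<forall>N. submod N \<and> v \<in> N \<longrightarrow> N = UNIV))"

definition unitary :: "(smat \<Rightarrow> smat) \<Rightarrow> bool" where
  "unitary \<phi> \<longleftrightarrow> (\<exists>H :: 'm \<Rightarrow> 'm \<Rightarrow> complex.
     (\<forall>w w1 w2. H w (w1 + w2) = H w w1 + H w w2) \<and>
     (\<forall>w w' t. H w (sM t w') = t * H w w') \<and>
     (\<forall>w w'. H w w' = cnj (H w' w)) \<and>
     (\<forall>w. w \<noteq> 0 \<longrightarrow> Re (H w w) > 0) \<and>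
     (\<forall>n w w'. H (L_mode n w) w' = H w (L_mode (-n) w')) \<and>
     (\<forall>a\<in>g_nat. \<forall>n w w'. H (J_mode a n w) w' = - H w (J_mode (\<phi> a) (-n) w')) \<and>
     (\<forall>u\<in>g_mhalf. \<forall>n w w'. H (G_mode u n w) w' = H w (G_mode (\<phi> u) (-n) w')))"

end

end

theory Submission
  imports Defs
begin

text \<open>The unitary modules are found inside Fock spaces.  There operators satisfying the commutation
  relations of \<open>J\<close>, \<open>L\<close> and \<open>G\<close> at level \<open>M\<^sub>1\<close> act, the adjoint of a mode being
  the opposite mode, and there is a highest weight vector of each of the two extremal weights which is killed by the
  zero mode of \<open>G\<close> of weight 0.  If \<open>u\<close> is a homogeneous highest weight vector of
  the irreducible module and \<open>v\<close> the one in the Fock space, the submodule generated by \<open>(u, v)\<close> in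
  the direct sum is the graph of a linear map.  Indeed, modulo the images of the lowering operators, whose adjoints
  kill \<open>v\<close>, it is spanned by \<open>(u, v)\<close> and \<open>(G\<^sub>0 u, 0)\<close> for that zero mode, so a vector
  \<open>(0, y)\<close> in it has \<open>y\<close> orthogonal to \<open>v\<close>; the set of such \<open>y\<close> is stable under all
  modes and lies in the module generated by \<open>v\<close>, so \<open>y\<close> is orthogonal to itself.
  This map is injective on each parity component by irreducibility, and the
  sum over the two parities of the pullbacks of the positive definite form of the Fock space is the invariant
  form.\<close>

text \<open>The level is built up one unit at a time. At level 1 the currents are bilinear in two
  complex fermions, \<open>L\<close> is their Sugawara field and \<open>G\<close> is 0. This is
  consistent because at level 1 the symmetrised products of two currents are multiples of the
  Sugawara field, so that the right side of the bracket of \<open>G\<close> with itself vanishes. To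
  pass from level M to M + 1 one adjoins two more complex fermions, with their current c, and a real
  fermion phi with integer modes: \<open>J\<close> becomes J + c, \<open>L\<close> is increased by
  the two new stress tensors, and \<open>G\<close>, suitably normalised, by a multiple of phi (J - M
  c). The combination J - M c is the one orthogonal to J + c. Its Cartan zero mode kills a vector of
  weight M s for J and s for c, which is why the zero mode of \<open>G\<close> of weight 0 kills the
  highest weight vector as long as all sites carry the same spin s. Each of the M1 - 1 real fermions
  contributes 1/16 to the lowest energy, and a spin 1/2 at each of the M1 sites contributes 1/4;
  these are the two energies in question.\<close>

section \<open>Fock space: the exterior algebra on countably many oscillators\<close>

typedef fock = "{f :: nat set \<Rightarrow> complex. finite {S. f S \<noteq> 0} \<and> (\<forall>S. f S \<noteq> 0 \<longrightarrow> finite S)}"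
  morphisms coef Abs_fock
  by (rule exI[of _ "\<lambda>_. 0"]) simp

setup_lifting type_definition_fock

lemma fock_eqI: "(\<And>S. coef x S = coef y S) \<Longrightarrow> x = y"
  by (simp add: coef_inject[symmetric] ext)

lemma finite_coef: "finite {S. coef x S \<noteq> 0}"
  using coef[of x] by simp

lemma coef_finite: "coef x S \<noteq> 0 \<Longrightarrow> finite S"
  using coef[of x] by simp

instantiation fock :: real_vector
begin

lift_definition zero_fock :: fock is "\<lambda>_. 0" by simp

lift_definition plus_fock :: "fock \<Rightarrow> fock \<Rightarrow> fock" is "\<lambda>f g S. f S + g S"
proof
  fix f g :: "nat set \<Rightarrow> complex"
  assume fg: "finite {S. f S \<noteq> 0} \<and> (\<forall>S. f S \<noteq> 0 \<longrightarrow> finite S)" "finite {S. g S \<noteq> 0} \<and> (\<forall>S. g S \<noteq> 0 \<longrightarrow> finite S)"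
  then have "finite ({S. f S \<noteq> 0} \<union> {S. g S \<noteq> 0})" by simp
  then show "finite {S. f S + g S \<noteq> 0}" by (rule rev_finite_subset) auto
  show "\<forall>S. f S + g S \<noteq> 0 \<longrightarrow> finite S" proof (intro allI impI)
    fix S show "finite S" if "f S + g S \<noteq> 0" using fg that by (cases "f S = 0") auto
  qed
qed

lift_definition uminus_fock :: "fock \<Rightarrow> fock" is "\<lambda>f S. - f S" by simp

lift_definition minus_fock :: "fock \<Rightarrow> fock \<Rightarrow> fock" is "\<lambda>f g S. f S - g S"
proof
  fix f g :: "nat set \<Rightarrow> complex"
  assume fg: "finite {S. f S \<noteq> 0} \<and> (\<forall>S. f S \<noteq> 0 \<longrightarrow> finite S)" "finite {S. g S \<noteq> 0} \<and> (\<forall>S. g S \<noteq> 0 \<longrightarrow> finite S)"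
  then have "finite ({S. f S \<noteq> 0} \<union> {S. g S \<noteq> 0})" by simp
  then show "finite {S. f S - g S \<noteq> 0}" by (rule rev_finite_subset) auto
  show "\<forall>S. f S - g S \<noteq> 0 \<longrightarrow> finite S" proof (intro allI impI)
    fix S show "finite S" if "f S - g S \<noteq> 0" using fg that by (cases "f S = 0") auto
  qed
qed

lift_definition scaleR_fock :: "real \<Rightarrow> fock \<Rightarrow> fock" is "\<lambda>c f S. of_real c * f S"
  by auto

instance
  by standard (transfer, simp add: algebra_simps fun_eq_iff)+

end

text \<open>All structure constants on the Fock side are real, so the real type classes suffice for
  operators; complex scalars occur on vectors only and are kept as a separate operation.\<close>

lift_definition cscale :: "complex \<Rightarrow> fock \<Rightarrow> fock" is "\<lambda>c f S. c * f S"
  by auto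

lift_definition fvac :: fock is "\<lambda>S. if S = {} then 1 else 0"
  by simp

lemma coef_simps [simp]:
  "coef 0 S = 0" "coef (x + y) S = coef x S + coef y S" "coef (x - y) S = coef x S - coef y S"
  "coef (- x) S = - coef x S" "coef (c *\<^sub>R x) S = of_real c * coef x S"
  "coef (cscale d x) S = d * coef x S" "coef fvac S = (if S = {} then 1 else 0)"
  by (transfer, simp)+

lemma cscale_simps:
  "cscale c (x + y) = cscale c x + cscale c y" "cscale (c + d) x = cscale c x + cscale d x"
  "cscale c (cscale d x) = cscale (c * d) x" "cscale 1 x = x" "cscale c 0 = 0" "cscale 0 x = 0"
  "cscale (of_real r) x = r *\<^sub>R x" "cscale c (x - y) = cscale c x - cscale c y"
  "cscale c (- x) = - cscale c x" "cscale c (r *\<^sub>R x) = r *\<^sub>R cscale c x"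
  by (rule fock_eqI; simp add: algebra_simps)+

definition inner_fock :: "fock \<Rightarrow> fock \<Rightarrow> complex" where
  "inner_fock x y = (\<Sum>S | coef x S \<noteq> 0. cnj (coef x S) * coef y S)"

lemma inner_fock_superset:
  assumes "finite A" "{S. coef x S \<noteq> 0} \<subseteq> A"
  shows "inner_fock x y = (\<Sum>S\<in>A. cnj (coef x S) * coef y S)"
  unfolding inner_fock_def by (rule sum.mono_neutral_left) (use assms in auto)

lemma inner_fock_cnj: "inner_fock x y = cnj (inner_fock y x)"
proof -
  let ?A = "{S. coef x S \<noteq> 0} \<union> {S. coef y S \<noteq> 0}"
  show ?thesis
    using inner_fock_superset[of ?A x y] inner_fock_superset[of ?A y x] finite_coef
    by (simp add: mult.commute)
qed

lemma inner_fock_right: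
  "inner_fock x (y + z) = inner_fock x y + inner_fock x z"
  "inner_fock x (cscale c y) = c * inner_fock x y"
  by (simp_all add: inner_fock_def algebra_simps sum.distrib sum_distrib_left)

lemma inner_fock_pos: "x \<noteq> 0 \<Longrightarrow> Re (inner_fock x x) > 0"
proof -
  assume "x \<noteq> 0"
  then obtain S where S: "coef x S \<noteq> 0"
    by (metis coef_simps(1) fock_eqI)
  have "Re (inner_fock x x) = (\<Sum>S | coef x S \<noteq> 0. (cmod (coef x S))\<^sup>2)"
    unfolding inner_fock_def Re_sum
    by (rule sum.cong) (auto simp: cmod_power2 simp flip: power2_eq_square)
  also have "\<dots> > 0"
    by (rule sum_pos2[of _ S]) (use S finite_coef in auto)
  finally show ?thesis .
qed

lemma inner_fock_zero [simp]: "inner_fock x 0 = 0" "inner_fock 0 x = 0"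
  by (simp_all add: inner_fock_def)

lemma inner_fock_add_left: "inner_fock (x + y) z = inner_fock x z + inner_fock y z"
  by (simp add: inner_fock_cnj[of _ z] inner_fock_right)

lemma inner_fock_cscale_left: "inner_fock (cscale c x) z = cnj c * inner_fock x z"
  by (simp add: inner_fock_cnj[of _ z] inner_fock_right)

section \<open>Linear operators and locally finite sums of operators\<close>

text \<open>As a type of its own the linear operators are an instance of
  \<open>real_algebra_1\<close>, so that operator identities become identities in a ring.\<close>

typedef fop = "{f :: fock \<Rightarrow> fock. (\<forall>x y. f (x + y) = f x + f y) \<and> (\<forall>c x. f (cscale c x) = cscale c (f x))}"
  morphisms app Abs_fop
  by (rule exI[of _ "\<lambda>_. 0"]) (simp add: cscale_simps)

setup_lifting type_definition_fop

lemma app_add: "app A (x + y) = app A x + app A y"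
  and app_cscale: "app A (cscale c x) = cscale c (app A x)"
  using app[of A] by auto

lemma app_zero [simp]: "app A 0 = 0"
  using app_add[of A 0 0] by simp

lemma app_scaleR: "app A (r *\<^sub>R x) = r *\<^sub>R app A x"
  by (metis app_cscale cscale_simps(7))

lemma app_sum: "app A (\<Sum>i\<in>B. f i) = (\<Sum>i\<in>B. app A (f i))"
  by (induction B rule: infinite_finite_induct) (auto simp: app_add)

lemma app_minus: "app A (- x) = - app A x"
  using app_scaleR[of A "-1" x] by simp

lemma fop_eqI: "(\<And>x. app A x = app B x) \<Longrightarrow> A = B"
  by (simp add: app_inject[symmetric] ext)

instantiation fop :: real_algebra_1
begin

lift_definition zero_fop :: fop is "\<lambda>_. 0" by (simp add: cscale_simps)
lift_definition one_fop :: fop is "\<lambda>x. x" by (simp add: cscale_simps)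
lift_definition plus_fop :: "fop \<Rightarrow> fop \<Rightarrow> fop" is "\<lambda>f g x. f x + g x"
  by (simp add: cscale_simps)
lift_definition minus_fop :: "fop \<Rightarrow> fop \<Rightarrow> fop" is "\<lambda>f g x. f x - g x"
  by (simp add: cscale_simps)
lift_definition uminus_fop :: "fop \<Rightarrow> fop" is "\<lambda>f x. - f x"
  by (simp add: cscale_simps)
lift_definition times_fop :: "fop \<Rightarrow> fop \<Rightarrow> fop" is "\<lambda>f g x. f (g x)"
  by simp
lift_definition scaleR_fop :: "real \<Rightarrow> fop \<Rightarrow> fop" is "\<lambda>r f x. r *\<^sub>R f x"
  by (simp add: cscale_simps scaleR_add_right)

instance
proof
  fix a b c :: fop and r s :: real
  show "a + b + c = a + (b + c)" "a + b = b + a" "0 + a = a" "- a + a = 0" "a - b = a + - b"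
    "a * b * c = a * (b * c)" "1 * a = a" "a * 1 = a" "(a + b) * c = a * c + b * c"
    "r *\<^sub>R (a + b) = r *\<^sub>R a + r *\<^sub>R b" "(r + s) *\<^sub>R a = r *\<^sub>R a + s *\<^sub>R a"
    "r *\<^sub>R s *\<^sub>R a = (r * s) *\<^sub>R a" "1 *\<^sub>R a = a" "r *\<^sub>R a * b = r *\<^sub>R (a * b)"
    by (transfer; simp add: algebra_simps fun_eq_iff)+
  show "a * (b + c) = a * b + a * c"
    by (rule fop_eqI) (simp add: times_fop.rep_eq plus_fop.rep_eq app_add)
  show "a * r *\<^sub>R b = r *\<^sub>R (a * b)"
    by (rule fop_eqI) (simp add: times_fop.rep_eq scaleR_fop.rep_eq app_scaleR)
  show "(0::fop) \<noteq> 1"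
  proof
    assume "(0::fop) = 1"
    then have "app 0 fvac = app 1 fvac" by simp
    then have "coef 0 {} = coef fvac {}"
      by (simp add: zero_fop.rep_eq one_fop.rep_eq)
    then show False by simp
  qed
qed

end

lemma app_simps [simp]:
  "app 0 x = 0" "app 1 x = x" "app (A + B) x = app A x + app B x"
  "app (A - B) x = app A x - app B x" "app (- A) x = - app A x"
  "app (A * B) x = app A (app B x)" "app (r *\<^sub>R A) x = r *\<^sub>R app A x"
  by (simp_all add: zero_fop.rep_eq one_fop.rep_eq plus_fop.rep_eq minus_fop.rep_eq
      uminus_fop.rep_eq times_fop.rep_eq scaleR_fop.rep_eq)

lemma app_sum_left: "app (\<Sum>i\<in>B. f i) x = (\<Sum>i\<in>B. app (f i) x)"
  by (induction B rule: infinite_finite_induct) auto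

definition lfin :: "('i \<Rightarrow> fop) \<Rightarrow> bool" where
  "lfin F \<longleftrightarrow> (\<forall>x. finite {i. app (F i) x \<noteq> 0})"

text \<open>Normally ordered products are infinite sums that are finite only on each single vector.
  The value 0 on all other families makes the result linear in every case, as the type
  demands.\<close>

lift_definition lsum :: "('i \<Rightarrow> fop) \<Rightarrow> fop" is
  "\<lambda>F x. if \<forall>x. finite {i. F i x \<noteq> 0} then Sum_any (\<lambda>i. F i x) else 0"
proof -
  fix F :: "'i \<Rightarrow> fock \<Rightarrow> fock"
  assume "\<And>i. (\<forall>x y. F i (x + y) = F i x + F i y) \<and> (\<forall>c x. F i (cscale c x) = cscale c (F i x))"
  then have 1: "\<And>i x y. F i (x + y) = F i x + F i y" "\<And>i c x. F i (cscale c x) = cscale c (F i x)"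
    by auto
  show "(\<forall>x y. (if \<forall>x. finite {i. F i x \<noteq> 0} then \<Sum>i. F i (x + y) else 0) =
           (if \<forall>x. finite {i. F i x \<noteq> 0} then \<Sum>i. F i x else 0) +
           (if \<forall>x. finite {i. F i x \<noteq> 0} then \<Sum>i. F i y else 0)) \<and>
        (\<forall>c x. (if \<forall>x. finite {i. F i x \<noteq> 0} then \<Sum>i. F i (cscale c x) else 0) =
           cscale c (if \<forall>x. finite {i. F i x \<noteq> 0} then \<Sum>i. F i x else 0))"
  proof (cases "\<forall>x. finite {i. F i x \<noteq> 0}")
    case True
    have cs: "cscale c (\<Sum>i\<in>A. f i) = (\<Sum>i\<in>A. cscale c (f i))" for c A and f :: "'i \<Rightarrow> fock"
      by (induction A rule: infinite_finite_induct) (auto simp: cscale_simps)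
    have "(\<Sum>i. F i (cscale c x)) = cscale c (\<Sum>i. F i x)" for c x
    proof -
      have "(\<Sum>i. F i (cscale c x)) = (\<Sum>i | F i x \<noteq> 0. F i (cscale c x))"
        by (rule Sum_any.expand_superset) (use True 1(2) in \<open>auto simp: cscale_simps\<close>)
      also have "\<dots> = cscale c (\<Sum>i. F i x)"
        unfolding Sum_any.expand_set cs by (simp add: 1)
      finally show ?thesis .
    qed
    with True show ?thesis
      by (simp add: 1(1) Sum_any.distrib)
  next
    case False
    then show ?thesis
      unfolding if_not_P[OF False] by (simp add: cscale_simps)
  qed
qed

lemma app_lsum: "lfin F \<Longrightarrow> app (lsum F) x = Sum_any (\<lambda>i. app (F i) x)"
  by (simp add: lsum.rep_eq lfin_def)

lemma app_lsum_sum: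
  assumes "lfin F" "finite A" "\<And>i. app (F i) x \<noteq> 0 \<Longrightarrow> i \<in> A"
  shows "app (lsum F) x = (\<Sum>i\<in>A. app (F i) x)"
  unfolding app_lsum[OF assms(1)] by (rule Sum_any.expand_superset) (use assms in auto)

lemma app_lsum_zero: "lfin F \<Longrightarrow> (\<And>i. app (F i) x = 0) \<Longrightarrow> app (lsum F) x = 0"
  by (simp add: app_lsum)

lemma lfin_add [intro]: "lfin F \<Longrightarrow> lfin G \<Longrightarrow> lfin (\<lambda>i. F i + G i)"
  unfolding lfin_def
proof
  fix x assume "\<forall>x. finite {i. app (F i) x \<noteq> 0}" "\<forall>x. finite {i. app (G i) x \<noteq> 0}"
  then have "finite ({i. app (F i) x \<noteq> 0} \<union> {i. app (G i) x \<noteq> 0})" by simp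
  then show "finite {i. app (F i + G i) x \<noteq> 0}" by (rule rev_finite_subset) auto
qed

lemma lfin_mult_left [intro]: "lfin F \<Longrightarrow> lfin (\<lambda>i. D * F i)"
  unfolding lfin_def
proof
  fix x assume "\<forall>x. finite {i. app (F i) x \<noteq> 0}"
  then have "finite {i. app (F i) x \<noteq> 0}" by simp
  then show "finite {i. app (D * F i) x \<noteq> 0}" by (rule rev_finite_subset) auto
qed

lemma lfin_mult_right [intro]: "lfin F \<Longrightarrow> lfin (\<lambda>i. F i * D)"
  unfolding lfin_def by simp

lemma lfin_scaleR [intro]: "lfin F \<Longrightarrow> lfin (\<lambda>i. r *\<^sub>R F i)"
  using lfin_mult_left[of F "r *\<^sub>R 1"] by simp

lemma lfin_uminus [intro]: "lfin F \<Longrightarrow> lfin (\<lambda>i. - F i)"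
  using lfin_scaleR[of F "-1"] by simp

lemma lfin_diff [intro]: "lfin F \<Longrightarrow> lfin G \<Longrightarrow> lfin (\<lambda>i. F i - G i)"
  using lfin_add[of F "\<lambda>i. - G i"] by (auto simp: lfin_uminus)

lemma lsum_add: "lfin F \<Longrightarrow> lfin G \<Longrightarrow> lsum (\<lambda>i. F i + G i) = lsum F + lsum G"
  by (rule fop_eqI) (simp add: app_lsum lfin_add, simp add: Sum_any.distrib lfin_def)

lemma lsum_mult_left: "lfin F \<Longrightarrow> lsum (\<lambda>i. D * F i) = D * lsum F"
proof (rule fop_eqI)
  fix x assume F: "lfin F"
  then have fin: "finite {i. app (F i) x \<noteq> 0}" by (simp add: lfin_def)
  show "app (lsum (\<lambda>i. D * F i)) x = app (D * lsum F) x"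
    using app_lsum_sum[OF lfin_mult_left[OF F] fin, of D x] app_lsum_sum[OF F fin, of x]
    by (force simp: app_sum)
qed

lemma lsum_mult_right: "lfin F \<Longrightarrow> lsum (\<lambda>i. F i * D) = lsum F * D"
  by (rule fop_eqI) (simp add: app_lsum lfin_mult_right)

lemma lsum_scaleR: "lfin F \<Longrightarrow> lsum (\<lambda>i. r *\<^sub>R F i) = r *\<^sub>R lsum F"
  using lsum_mult_left[of F "r *\<^sub>R 1"] by simp

lemma lsum_uminus: "lfin F \<Longrightarrow> lsum (\<lambda>i. - F i) = - lsum F"
  using lsum_scaleR[of F "-1"] by simp

lemma lsum_diff: "lfin F \<Longrightarrow> lfin G \<Longrightarrow> lsum (\<lambda>i. F i - G i) = lsum F - lsum G"
  using lsum_add[of F "\<lambda>i. - G i"] lsum_uminus[of G] lfin_uminus[of G] by simp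

lemma lfin_reindex: "bij h \<Longrightarrow> lfin (\<lambda>i. F (h i)) \<longleftrightarrow> lfin F"
  using finite_vimage_iff[of h "{i. app (F i) _ \<noteq> 0}"] by (simp add: lfin_def vimage_def)

lemma lsum_reindex: "bij h \<Longrightarrow> lsum (\<lambda>i. F (h i)) = lsum F"
proof (cases "lfin F")
  case True
  assume h: "bij h"
  show ?thesis
  proof (rule fop_eqI)
    fix x
    have "Sum_any (\<lambda>i. app (F (h i)) x) = Sum_any (\<lambda>i. app (F i) x)"
      by (rule Sum_any.reindex_cong[of h, symmetric]) (use h in \<open>auto simp: o_def bij_is_inj bij_is_surj\<close>)
    then show "app (lsum (\<lambda>i. F (h i))) x = app (lsum F) x"
      using True h lfin_reindex[OF h, of F] by (simp add: app_lsum)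
  qed
next
  case False
  assume h: "bij h"
  then have "\<not> lfin (\<lambda>i. F (h i))" using False lfin_reindex[OF h, of F] by simp
  with False show ?thesis
    by (intro fop_eqI) (auto simp: lsum.rep_eq lfin_def)
qed

lemma lfin_finite: "finite A \<Longrightarrow> (\<And>i. i \<notin> A \<Longrightarrow> F i = 0) \<Longrightarrow> lfin F"
  unfolding lfin_def by (intro allI, erule rev_finite_subset) force

lemma lsum_finite: "finite A \<Longrightarrow> (\<And>i. i \<notin> A \<Longrightarrow> F i = 0) \<Longrightarrow> lsum F = (\<Sum>i\<in>A. F i)"
proof (rule fop_eqI)
  fix x assume "finite A" and 0: "\<And>i. i \<notin> A \<Longrightarrow> F i = 0"
  show "app (lsum F) x = app (\<Sum>i\<in>A. F i) x"
    unfolding app_sum_left using 0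
    by (subst app_lsum_sum[OF lfin_finite[OF \<open>finite A\<close>, of F] \<open>finite A\<close>]) force+
qed

lemma lsum_single: "(\<And>i. i \<noteq> a \<Longrightarrow> F i = 0) \<Longrightarrow> lsum F = F a"
  using lsum_finite[of "{a}" F] by simp

text \<open>On each vector the finitely many nonzero pairs lie in one finite rectangle, over which
  both iterated sums can be computed. Finiteness in each index separately would not give such a
  rectangle.\<close>

lemma lsum_swap:
  assumes F: "\<And>i. lfin (F i)" "\<And>j. lfin (\<lambda>i. F i j)"
    and fin: "\<And>x. finite {(i, j). app (F i j) x \<noteq> 0}"
  shows "lsum (\<lambda>i. lsum (F i)) = lsum (\<lambda>j. lsum (\<lambda>i. F i j))"
proof -
  define P where "P x = {(i, j). app (F i j) x \<noteq> 0}" for x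
  have P: "i \<in> fst ` P x" "j \<in> snd ` P x" if "app (F i j) x \<noteq> 0" for i j x
    using that unfolding P_def by (force simp: image_iff)+
  have fin_P: "finite (fst ` P x)" "finite (snd ` P x)" for x
    using fin[of x] by (simp_all add: P_def)
  have z1: "app (lsum (F i)) x = (\<Sum>j\<in>snd ` P x. app (F i j) x)" for i x
    by (rule app_lsum_sum[OF F(1) fin_P(2)]) (rule P(2))
  have z2: "app (lsum (\<lambda>i. F i j)) x = (\<Sum>i\<in>fst ` P x. app (F i j) x)" for j x
    by (rule app_lsum_sum[OF F(2) fin_P(1)]) (rule P(1))
  have n1: "i \<in> fst ` P x" if "app (lsum (F i)) x \<noteq> 0" for i x
    using that P(1)[of i _ x] sum.not_neutral_contains_not_neutral unfolding z1 by metis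
  have n2: "j \<in> snd ` P x" if "app (lsum (\<lambda>i. F i j)) x \<noteq> 0" for j x
    using that P(2)[of _ j x] sum.not_neutral_contains_not_neutral unfolding z2 by metis
  have l1: "lfin (\<lambda>i. lsum (F i))"
    unfolding lfin_def using n1 by (intro allI finite_subset[OF _ fin_P(1)]) blast
  have l2: "lfin (\<lambda>j. lsum (\<lambda>i. F i j))"
    unfolding lfin_def using n2 by (intro allI finite_subset[OF _ fin_P(2)]) blast
  show ?thesis
  proof (rule fop_eqI)
    fix x
    have "app (lsum (\<lambda>i. lsum (F i))) x = (\<Sum>i\<in>fst ` P x. \<Sum>j\<in>snd ` P x. app (F i j) x)"
      unfolding z1[symmetric] by (rule app_lsum_sum[OF l1 fin_P(1) n1])
    also have "\<dots> = (\<Sum>j\<in>snd ` P x. \<Sum>i\<in>fst ` P x. app (F i j) x)"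
      by (rule sum.swap)
    also have "\<dots> = app (lsum (\<lambda>j. lsum (\<lambda>i. F i j))) x"
      unfolding z2[symmetric] by (rule app_lsum_sum[OF l2 fin_P(2) n2, symmetric])
    finally show "app (lsum (\<lambda>i. lsum (F i))) x = app (lsum (\<lambda>j. lsum (\<lambda>i. F i j))) x" .
  qed
qed

definition adjoint_ops :: "fop \<Rightarrow> fop \<Rightarrow> bool" where
  "adjoint_ops A B \<longleftrightarrow> (\<forall>x y. inner_fock (app A x) y = inner_fock x (app B y))"

lemma inner_fock_sum:
  "inner_fock x (\<Sum>i\<in>A. f i) = (\<Sum>i\<in>A. inner_fock x (f i))"
  "inner_fock (\<Sum>i\<in>A. f i) x = (\<Sum>i\<in>A. inner_fock (f i) x)"
  by (induction A rule: infinite_finite_induct) (auto simp: inner_fock_right inner_fock_add_left)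

lemma inner_fock_scaleR:
  "inner_fock x (r *\<^sub>R y) = of_real r * inner_fock x y"
  "inner_fock (r *\<^sub>R x) y = of_real r * inner_fock x y"
  by (simp_all add: inner_fock_right inner_fock_cscale_left flip: cscale_simps(7))

lemma inner_fock_minus:
  "inner_fock x (- y) = - inner_fock x y" "inner_fock (- x) y = - inner_fock x y"
  using inner_fock_scaleR(1)[where r = "-1"] inner_fock_scaleR(2)[where r = "-1"] by simp_all

lemma adjoint_add: "adjoint_ops A A' \<Longrightarrow> adjoint_ops B B' \<Longrightarrow> adjoint_ops (A + B) (A' + B')"
  and adjoint_mult: "adjoint_ops A A' \<Longrightarrow> adjoint_ops B B' \<Longrightarrow> adjoint_ops (A * B) (B' * A')"
  and adjoint_scaleR: "adjoint_ops A A' \<Longrightarrow> adjoint_ops (r *\<^sub>R A) (r *\<^sub>R A')"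
  and adjoint_uminus: "adjoint_ops A A' \<Longrightarrow> adjoint_ops (- A) (- A')"
  and adjoint_one: "adjoint_ops 1 1"
  and adjoint_zero: "adjoint_ops 0 0"
  by (simp_all add: adjoint_ops_def inner_fock_right inner_fock_add_left inner_fock_scaleR inner_fock_minus)

lemma adjoint_diff: "adjoint_ops A A' \<Longrightarrow> adjoint_ops B B' \<Longrightarrow> adjoint_ops (A - B) (A' - B')"
  using adjoint_add[of A A' "- B" "- B'"] adjoint_uminus[of B B'] by simp

lemma adjoint_sym: "adjoint_ops A B \<Longrightarrow> adjoint_ops B A"
  unfolding adjoint_ops_def by (intro allI, subst inner_fock_cnj, subst (2) inner_fock_cnj) simp

lemma adjoint_lsum:
  assumes "lfin F" "lfin F'" "\<And>i. adjoint_ops (F i) (F' i)"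
  shows "adjoint_ops (lsum F) (lsum F')"
  unfolding adjoint_ops_def
proof (intro allI)
  fix x y
  let ?A = "{i. app (F i) x \<noteq> 0} \<union> {i. app (F' i) y \<noteq> 0}"
  have fin: "finite ?A" using assms(1,2) by (auto simp: lfin_def)
  have "app (lsum F) x = (\<Sum>i\<in>?A. app (F i) x)" "app (lsum F') y = (\<Sum>i\<in>?A. app (F' i) y)"
    by (rule app_lsum_sum[OF assms(1) fin], simp) (rule app_lsum_sum[OF assms(2) fin], simp)
  then show "inner_fock (app (lsum F) x) y = inner_fock x (app (lsum F') y)"
    using assms(3) by (simp add: inner_fock_sum adjoint_ops_def)
qed

section \<open>Fields and their normally ordered products\<close>

text \<open>The truncation condition that makes a family of modes a field.\<close>

definition smooth :: "(int \<Rightarrow> fop) \<Rightarrow> bool" where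
  "smooth A \<longleftrightarrow> (\<forall>x. \<exists>N. \<forall>n\<ge>N. app (A n) x = 0)"

lemma smoothD: "smooth A \<Longrightarrow> \<exists>N. \<forall>n\<ge>N. app (A n) x = 0"
  by (simp add: smooth_def)

lemma smooth_add: "smooth A \<Longrightarrow> smooth B \<Longrightarrow> smooth (\<lambda>n. A n + B n)"
  unfolding smooth_def
proof
  fix x assume "\<forall>x. \<exists>N. \<forall>n\<ge>N. app (A n) x = 0" "\<forall>x. \<exists>N. \<forall>n\<ge>N. app (B n) x = 0"
  then obtain N M where "\<forall>n\<ge>N. app (A n) x = 0" "\<forall>n\<ge>M. app (B n) x = 0" by blast
  then show "\<exists>N. \<forall>n\<ge>N. app (A n + B n) x = 0"
    by (intro exI[of _ "max N M"]) simp
qed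

lemma smooth_weight: "smooth A \<Longrightarrow> smooth (\<lambda>n. c n *\<^sub>R A n)"
  unfolding smooth_def by (metis app_simps(7) scaleR_zero_right)

lemma smooth_uminus: "smooth A \<Longrightarrow> smooth (\<lambda>n. - A n)"
  using smooth_weight[of A "\<lambda>_. -1"] by simp

lemma smooth_diff: "smooth A \<Longrightarrow> smooth B \<Longrightarrow> smooth (\<lambda>n. A n - B n)"
  using smooth_add[of A "\<lambda>n. - B n"] smooth_uminus[of B] by simp

lemma smooth_shift: "smooth A \<Longrightarrow> smooth (\<lambda>n. A (m + n))"
  unfolding smooth_def
proof
  fix x assume "\<forall>x. \<exists>N. \<forall>n\<ge>N. app (A n) x = 0"
  then obtain N where "\<forall>n\<ge>N. app (A n) x = 0" by blast
  then show "\<exists>N. \<forall>n\<ge>N. app (A (m + n)) x = 0"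
    by (intro exI[of _ "N - m"]) simp
qed

lemma smooth_delta: "smooth (\<lambda>n. if m + n = 0 then A else 0)"
  unfolding smooth_def by (intro allI exI[of _ "1 - m"]) auto

lemma smooth_zero: "smooth (\<lambda>n. 0)"
  by (simp add: smooth_def)

lemmas smooth_intros = smooth_add smooth_diff smooth_uminus smooth_weight smooth_shift smooth_delta smooth_zero

text \<open>\<open>\<epsilon>\<close> is the sign of the exchange of the two fields. A general cut
  \<open>m\<close> is needed because commuting an operator with a product of cut 0 shifts the modes
  of the left factor and the cut with them. The terms met when the cut is brought back to 0 are
  where the central terms arise.\<close>

definition nterm :: "real \<Rightarrow> int \<Rightarrow> (int \<Rightarrow> fop) \<Rightarrow> (int \<Rightarrow> fop) \<Rightarrow> int \<Rightarrow> int \<Rightarrow> fop" where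
  "nterm \<epsilon> m A B p j = (if j < m then A j * B (p - j) else \<epsilon> *\<^sub>R (B (p - j) * A j))"

definition nprod :: "real \<Rightarrow> int \<Rightarrow> (int \<Rightarrow> fop) \<Rightarrow> (int \<Rightarrow> fop) \<Rightarrow> int \<Rightarrow> fop" where
  "nprod \<epsilon> m A B p = lsum (nterm \<epsilon> m A B p)"

lemma lfin_nterm:
  assumes "smooth A" "smooth B"
  shows "lfin (nterm \<epsilon> m A B p)"
  unfolding lfin_def
proof
  fix x
  obtain N M where NM: "\<forall>n\<ge>N. app (A n) x = 0" "\<forall>n\<ge>M. app (B n) x = 0"
    using assms smoothD by metis
  have "app (nterm \<epsilon> m A B p i) x = 0" if "i \<notin> {min m (p - M)..max m N}" for i
    using that NM by (auto simp: nterm_def not_le)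
  then have "{i. app (nterm \<epsilon> m A B p i) x \<noteq> 0} \<subseteq> {min m (p - M)..max m N}" by blast
  then show "finite {i. app (nterm \<epsilon> m A B p i) x \<noteq> 0}" by (rule finite_subset) simp
qed

text \<open>Finite symmetric truncations, valid from some bound on, are the form in which normally
  ordered products enter the relation \<open>GG\<close> of \<open>wmod\<close>.\<close>

lemma app_nprod:
  assumes "smooth A" "smooth B"
  shows "\<exists>K. \<forall>K'\<ge>K. app (nprod \<epsilon> m A B p) x = (\<Sum>j=-K'..K'. app (nterm \<epsilon> m A B p j) x)"
proof -
  obtain N M where NM: "\<forall>n\<ge>N. app (A n) x = 0" "\<forall>n\<ge>M. app (B n) x = 0"
    using assms smoothD by metis
  have *: "app (nterm \<epsilon> m A B p i) x = 0" if "i \<notin> {min m (p - M)..max m N}" for i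
    using that NM by (auto simp: nterm_def not_le)
  show ?thesis unfolding nprod_def
  proof (intro exI[of _ "max (- min m (p - M)) (max m N)"] allI impI app_lsum_sum lfin_nterm assms)
    fix K' i assume "max (- min m (p - M)) (max m N) \<le> K'" "app (nterm \<epsilon> m A B p i) x \<noteq> 0"
    with * show "i \<in> {-K'..K'}" by force
  qed simp
qed

text \<open>Since the factors commute up to a sign, either of them can be moved next to the vector,
  and for n >= N + M one of the modes j and n - j exceeds its bound.\<close>

lemma smooth_nprod:
  assumes A: "smooth A" and B: "smooth B"
    and z: "\<And>m n. A m * B n = \<epsilon> *\<^sub>R (B n * A m)"
  shows "smooth (nprod \<epsilon> c A B)"
  unfolding smooth_def
proof
  fix x
  obtain N M where NM: "\<forall>n\<ge>N. app (A n) x = 0" "\<forall>n\<ge>M. app (B n) x = 0"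
    using A B smoothD by metis
  have "app (nterm \<epsilon> c A B n j) x = 0" if "n \<ge> N + M" for n j
  proof (cases "j \<ge> N")
    case True
    then show ?thesis using NM z by (simp add: nterm_def)
  next
    case False
    with that have "n - j \<ge> M" by linarith
    then have "app (B (n - j)) x = 0" using NM by blast
    then have "app (A j * B (n - j)) x = 0" by simp
    then show ?thesis using z[of j "n - j"] by (simp add: nterm_def)
  qed
  then show "\<exists>N. \<forall>n\<ge>N. app (nprod \<epsilon> c A B n) x = 0"
    unfolding nprod_def by (metis app_lsum_zero lfin_nterm A B)
qed

lemma nprod_add_left:
  "smooth A \<Longrightarrow> smooth A' \<Longrightarrow> smooth B \<Longrightarrow> nprod \<epsilon> m (\<lambda>i. A i + A' i) B p = nprod \<epsilon> m A B p + nprod \<epsilon> m A' B p"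
  unfolding nprod_def by (subst lsum_add[symmetric]) (auto simp: lfin_nterm nterm_def algebra_simps fun_eq_iff intro!: arg_cong[of _ _ lsum])

lemma nprod_add_right:
  "smooth A \<Longrightarrow> smooth B \<Longrightarrow> smooth B' \<Longrightarrow> nprod \<epsilon> m A (\<lambda>i. B i + B' i) p = nprod \<epsilon> m A B p + nprod \<epsilon> m A B' p"
  unfolding nprod_def by (subst lsum_add[symmetric]) (auto simp: lfin_nterm nterm_def algebra_simps fun_eq_iff intro!: arg_cong[of _ _ lsum])

lemma nprod_scaleR_left:
  "smooth A \<Longrightarrow> smooth B \<Longrightarrow> nprod \<epsilon> m (\<lambda>i. r *\<^sub>R A i) B p = r *\<^sub>R nprod \<epsilon> m A B p"
  unfolding nprod_def by (subst lsum_scaleR[symmetric]) (auto simp: lfin_nterm nterm_def fun_eq_iff intro!: arg_cong[of _ _ lsum])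

lemma nprod_scaleR_right:
  "smooth A \<Longrightarrow> smooth B \<Longrightarrow> nprod \<epsilon> m A (\<lambda>i. r *\<^sub>R B i) p = r *\<^sub>R nprod \<epsilon> m A B p"
  unfolding nprod_def by (subst lsum_scaleR[symmetric]) (auto simp: lfin_nterm nterm_def fun_eq_iff intro!: arg_cong[of _ _ lsum])

lemma nprod_uminus_left:
  "smooth A \<Longrightarrow> smooth B \<Longrightarrow> nprod \<epsilon> m (\<lambda>i. - A i) B p = - nprod \<epsilon> m A B p"
  using nprod_scaleR_left[of A B \<epsilon> m "-1"] by simp

lemma nprod_uminus_right:
  "smooth A \<Longrightarrow> smooth B \<Longrightarrow> nprod \<epsilon> m A (\<lambda>i. - B i) p = - nprod \<epsilon> m A B p"
  using nprod_scaleR_right[of A B \<epsilon> m "-1"] by simp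

lemma nprod_diff_left:
  "smooth A \<Longrightarrow> smooth A' \<Longrightarrow> smooth B \<Longrightarrow> nprod \<epsilon> m (\<lambda>i. A i - A' i) B p = nprod \<epsilon> m A B p - nprod \<epsilon> m A' B p"
  using nprod_add_left[of A "\<lambda>i. - A' i" B] by (simp add: smooth_intros nprod_uminus_left)

lemma nprod_diff_right:
  "smooth A \<Longrightarrow> smooth B \<Longrightarrow> smooth B' \<Longrightarrow> nprod \<epsilon> m A (\<lambda>i. B i - B' i) p = nprod \<epsilon> m A B p - nprod \<epsilon> m A B' p"
  using nprod_add_right[of A B "\<lambda>i. - B' i"] by (simp add: smooth_intros nprod_uminus_right)

lemmas nprod_linear = nprod_add_left nprod_add_right nprod_scaleR_left nprod_scaleR_right
  nprod_uminus_left nprod_uminus_right nprod_diff_left nprod_diff_right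

lemma nprod_zero [simp]: "nprod \<epsilon> m (\<lambda>i. 0) B p = 0" "nprod \<epsilon> m A (\<lambda>i. 0) p = 0"
  unfolding nprod_def by (subst lsum_single[of 0]; simp add: nterm_def)+

text \<open>The cut is measured in the modes of the left factor, so a shift there moves it; a shift
  of the right factor does not.\<close>

lemma nprod_shift_left: "nprod \<epsilon> c (\<lambda>j. K (m + j)) B p = nprod \<epsilon> (m + c) K B (p + m)"
proof -
  have "bij (\<lambda>j::int. m + j)"
    by (rule bijI') (auto intro: exI[of _ "_ - m"])
  from lsum_reindex[OF this, of "nterm \<epsilon> (m + c) K B (p + m)"]
  show ?thesis unfolding nprod_def
    by (rule trans[rotated]) (rule arg_cong[of _ _ lsum], auto simp: nterm_def fun_eq_iff)
qed

lemma nprod_shift_right: "nprod \<epsilon> c A (\<lambda>j. K (m + j)) p = nprod \<epsilon> c A K (p + m)"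
  unfolding nprod_def by (rule arg_cong[of _ _ lsum]) (simp add: nterm_def fun_eq_iff add_diff_eq diff_add_eq add.commute)

lemma nprod_cut_Suc:
  assumes "smooth A" "smooth B"
  shows "nprod \<epsilon> (m + 1) A B p = nprod \<epsilon> m A B p + (A m * B (p - m) - \<epsilon> *\<^sub>R (B (p - m) * A m))"
proof -
  let ?D = "\<lambda>j. nterm \<epsilon> (m + 1) A B p j - nterm \<epsilon> m A B p j"
  have "nprod \<epsilon> (m + 1) A B p - nprod \<epsilon> m A B p = lsum ?D"
    unfolding nprod_def by (rule lsum_diff[symmetric]) (auto intro: lfin_nterm assms)
  also have "\<dots> = ?D m"
    by (rule lsum_single) (auto simp: nterm_def)
  finally show ?thesis by (simp add: nterm_def algebra_simps)
qed

text \<open>Raising the cut by one changes a single term, by its supercommutator. \<open>T\<close>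
  is a discrete primitive of these changes, which therefore telescope.\<close>

lemma nprod_cut:
  assumes "smooth A" "smooth B"
    and T: "\<And>i. A i * B (p - i) = \<epsilon> *\<^sub>R (B (p - i) * A i) + (T (i + 1) - T i)"
  shows "nprod \<epsilon> m A B p = nprod \<epsilon> 0 A B p + (T m - T 0)"
proof (induction m rule: int_induct[where k = 0])
  have step: "nprod \<epsilon> (i + 1) A B p = nprod \<epsilon> i A B p + (T (i + 1) - T i)" for i
    using nprod_cut_Suc[OF assms(1,2), of \<epsilon> i p] T[of i] by simp
  {
    case (step1 i)
    then show ?case using step[of i] by simp
  next
    case (step2 i)
    have "nprod \<epsilon> (i - 1) A B p = nprod \<epsilon> i A B p - (T i - T (i - 1))"
      using step[of "i - 1"] by simp
    then show ?case using step2 by simp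
  }
qed simp

text \<open>The Leibniz rule for a supercommutator with \<open>D\<close>. An odd \<open>D\<close>
  changes the parity of the factor it hits, so the exchange sign of the new product is multiplied by
  the sign with which \<open>D\<close> passes the other factor.\<close>

lemma nprod_deriv:
  assumes sm: "smooth A" "smooth B" "smooth A'" "smooth B'"
    and A: "\<And>j. D * A j = \<sigma> *\<^sub>R (A j * D) + A' j"
    and B: "\<And>j. D * B j = \<tau> *\<^sub>R (B j * D) + B' j"
    and \<sigma>: "\<sigma> * \<sigma> = 1"
  shows "D * nprod \<epsilon> m A B p = (\<sigma> * \<tau>) *\<^sub>R (nprod \<epsilon> m A B p * D)
    + nprod (\<epsilon> * \<tau>) m A' B p + \<sigma> *\<^sub>R nprod (\<epsilon> * \<sigma>) m A B' p"
proof -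
  have f: "lfin (nterm \<epsilon> m A B p)" "lfin (nterm (\<epsilon> * \<tau>) m A' B p)" "lfin (nterm (\<epsilon> * \<sigma>) m A B' p)"
    by (intro lfin_nterm sm)+
  have *: "D * nterm \<epsilon> m A B p j = (\<sigma> * \<tau>) *\<^sub>R (nterm \<epsilon> m A B p j * D)
     + nterm (\<epsilon> * \<tau>) m A' B p j + \<sigma> *\<^sub>R nterm (\<epsilon> * \<sigma>) m A B' p j" for j
  proof -
    have 1: "D * (A j * B q) = (\<sigma> * \<tau>) *\<^sub>R (A j * B q * D) + A' j * B q + \<sigma> *\<^sub>R (A j * B' q)" for q
    proof -
      have "D * (A j * B q) = \<sigma> *\<^sub>R (A j * (D * B q)) + A' j * B q"
        unfolding mult.assoc[symmetric] A by (simp add: distrib_right)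
      then show ?thesis unfolding B by (simp add: algebra_simps)
    qed
    have 2: "D * (B q * A j) = (\<sigma> * \<tau>) *\<^sub>R (B q * A j * D) + \<tau> *\<^sub>R (B q * A' j) + B' q * A j" for q
    proof -
      have "D * (B q * A j) = \<tau> *\<^sub>R (B q * (D * A j)) + B' q * A j"
        unfolding mult.assoc[symmetric] B by (simp add: distrib_right)
      then show ?thesis unfolding A by (simp add: algebra_simps)
    qed
    have "\<sigma> * (\<epsilon> * \<sigma>) = \<epsilon>" using \<sigma> by (metis mult.commute mult.left_commute mult.right_neutral)
    then show ?thesis
      unfolding nterm_def by (simp add: 1 2 algebra_simps)
  qed
  let ?X = "nterm \<epsilon> m A B p" and ?Y = "nterm (\<epsilon> * \<tau>) m A' B p" and ?Z = "nterm (\<epsilon> * \<sigma>) m A B' p"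
  have "D * lsum ?X = lsum (\<lambda>j. (\<sigma> * \<tau>) *\<^sub>R (?X j * D) + ?Y j + \<sigma> *\<^sub>R ?Z j)"
    unfolding lsum_mult_left[OF f(1), symmetric] * ..
  also have "\<dots> = lsum (\<lambda>j. (\<sigma> * \<tau>) *\<^sub>R (?X j * D)) + lsum ?Y + lsum (\<lambda>j. \<sigma> *\<^sub>R ?Z j)"
    by (simp add: lsum_add f lfin_add lfin_scaleR lfin_mult_right)
  finally show ?thesis
    by (simp add: nprod_def lsum_scaleR lsum_mult_right f lfin_mult_right)
qed

text \<open>For factors that commute up to sign the order inside each term is immaterial, and so are
  both cuts; what remains is the reflection j to p - j of the summation index.\<close>

lemma nprod_commute:
  assumes sm: "smooth A" "smooth B" and z: "\<And>m n. A m * B n = \<epsilon> *\<^sub>R (B n * A m)" and "\<epsilon> * \<epsilon> = 1"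
  shows "nprod \<epsilon> m A B p = \<epsilon> *\<^sub>R nprod \<epsilon> m' B A p"
proof -
  have b: "bij (\<lambda>j::int. p - j)" by (rule bijI') (auto intro: exI[of _ "p - _"])
  have *: "nterm \<epsilon> m A B p j = \<epsilon> *\<^sub>R nterm \<epsilon> m' B A p (p - j)" for j
    using \<open>\<epsilon> * \<epsilon> = 1\<close> by (simp add: nterm_def z)
  have "lsum (nterm \<epsilon> m A B p) = lsum (\<lambda>j. \<epsilon> *\<^sub>R nterm \<epsilon> m' B A p (p - j))"
    by (simp flip: *)
  also have "\<dots> = \<epsilon> *\<^sub>R lsum (\<lambda>j. nterm \<epsilon> m' B A p (p - j))"
    by (rule lsum_scaleR) (use lfin_reindex[OF b, of "nterm \<epsilon> m' B A p"] lfin_nterm[OF sm(2,1)] in simp)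
  also have "\<dots> = \<epsilon> *\<^sub>R lsum (nterm \<epsilon> m' B A p)"
    unfolding lsum_reindex[OF b, of "nterm \<epsilon> m' B A p"] ..
  finally show ?thesis by (simp add: nprod_def)
qed

section \<open>Creation and annihilation operators with Jordan-Wigner signs\<close>

definition sgn_below :: "nat \<Rightarrow> nat set \<Rightarrow> real" where
  "sgn_below i S = (-1) ^ card {j \<in> S. j < i}"

lemma sgn_below_insert:
  assumes "finite S" "j \<notin> S"
  shows "sgn_below i (insert j S) = (if j < i then - sgn_below i S else sgn_below i S)"
proof -
  have "{l \<in> insert j S. l < i} = (if j < i then insert j {l \<in> S. l < i} else {l \<in> S. l < i})" by auto
  then show ?thesis using assms by (simp add: sgn_below_def)
qed

lemma sgn_below_remove:
  assumes "finite S" "j \<in> S"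
  shows "sgn_below i (S - {j}) = (if j < i then - sgn_below i S else sgn_below i S)"
  using sgn_below_insert[of "S - {j}" j i] assms by (simp add: insert_absorb)

lemma sgn_below_square [simp]: "sgn_below i S * sgn_below i S = 1"
  by (simp add: sgn_below_def flip: power_mult_distrib)

lift_definition ann0 :: "nat \<Rightarrow> fock \<Rightarrow> fock" is
  "\<lambda>i f S. if i \<in> S then 0 else of_real (sgn_below i S) * f (insert i S)"
proof
  fix i and f :: "nat set \<Rightarrow> complex"
  assume f: "finite {S. f S \<noteq> 0} \<and> (\<forall>S. f S \<noteq> 0 \<longrightarrow> finite S)"
  then have "finite ((\<lambda>S. S - {i}) ` {S. f S \<noteq> 0})" by simp
  then show "finite {S. (if i \<in> S then 0 else complex_of_real (sgn_below i S) * f (insert i S)) \<noteq> 0}"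
    by (rule rev_finite_subset) (auto simp: image_iff split: if_splits intro!: exI[of _ "insert i _"])
  show "\<forall>S. (if i \<in> S then 0 else complex_of_real (sgn_below i S) * f (insert i S)) \<noteq> 0 \<longrightarrow> finite S"
    using f by (metis finite_insert mult_zero_right)
qed

lift_definition cre0 :: "nat \<Rightarrow> fock \<Rightarrow> fock" is
  "\<lambda>i f S. if i \<in> S then of_real (sgn_below i S) * f (S - {i}) else 0"
proof
  fix i and f :: "nat set \<Rightarrow> complex"
  assume f: "finite {S. f S \<noteq> 0} \<and> (\<forall>S. f S \<noteq> 0 \<longrightarrow> finite S)"
  then have "finite (insert i ` {S. f S \<noteq> 0})" by simp
  then show "finite {S. (if i \<in> S then complex_of_real (sgn_below i S) * f (S - {i}) else 0) \<noteq> 0}"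
    by (rule rev_finite_subset) (auto simp: image_iff split: if_splits intro!: exI[of _ "_ - {i}"])
  show "\<forall>S. (if i \<in> S then complex_of_real (sgn_below i S) * f (S - {i}) else 0) \<noteq> 0 \<longrightarrow> finite S"
    using f by (metis finite_Diff2 finite.emptyI finite_insert mult_zero_right)
qed

lift_definition ann :: "nat \<Rightarrow> fop" is ann0
  by (auto intro!: fock_eqI simp: ann0.rep_eq algebra_simps)

lift_definition cre :: "nat \<Rightarrow> fop" is cre0
  by (auto intro!: fock_eqI simp: cre0.rep_eq algebra_simps)

lemma coef_ann: "coef (app (ann i) x) S = (if i \<in> S then 0 else of_real (sgn_below i S) * coef x (insert i S))"
  by (simp add: ann.rep_eq ann0.rep_eq)

lemma coef_cre: "coef (app (cre i) x) S = (if i \<in> S then of_real (sgn_below i S) * coef x (S - {i}) else 0)"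
  by (simp add: cre.rep_eq cre0.rep_eq)

lemma coef_infinite: "infinite S \<Longrightarrow> coef x S = 0"
  using coef_finite by blast

lemma ann_ann: "ann i * ann j = - (ann j * ann i)"
proof (intro fop_eqI fock_eqI)
  fix x S
  show "coef (app (ann i * ann j) x) S = coef (app (- (ann j * ann i)) x) S"
    by (cases "finite S") (auto simp: coef_ann sgn_below_insert insert_commute coef_infinite not_less_iff_gr_or_eq)
qed

lemma cre_cre: "cre i * cre j = - (cre j * cre i)"
proof (intro fop_eqI fock_eqI)
  fix x S
  have "S - {i} - {j} = S - {j} - {i}" by auto
  then show "coef (app (cre i * cre j) x) S = coef (app (- (cre j * cre i)) x) S"
    by (cases "finite S") (auto simp: coef_cre sgn_below_remove coef_infinite not_less_iff_gr_or_eq)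
qed

lemma ann_cre: "ann i * cre j = (if i = j then 1 else 0) - cre j * ann i"
proof (intro fop_eqI fock_eqI)
  fix x S
  show "coef (app (ann i * cre j) x) S = coef (app ((if i = j then 1 else 0) - cre j * ann i) x) S"
  proof (cases "i = j")
    case True
    have "complex_of_real (sgn_below j S) * (complex_of_real (sgn_below j S) * z) = z" for z
      by (metis mult.assoc mult_1 of_real_1 of_real_mult sgn_below_square)
    with True show ?thesis
      by (cases "finite S") (auto simp: coef_cre coef_ann sgn_below_remove sgn_below_insert coef_infinite insert_absorb)
  next
    case False
    then have "insert i S - {j} = insert i (S - {j})" by auto
    with False show ?thesis
      by (cases "finite S") (auto simp: coef_cre coef_ann sgn_below_remove sgn_below_insert coef_infinite not_less_iff_gr_or_eq)
  qed
qed

text \<open>Removing \<open>i\<close> is a bijection from the sets with \<open>i\<close> to the sets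
  without it, and the sign, which counts smaller elements only, is the same on both; so the two sums
  agree term by term.\<close>

lemma adjoint_ann: "adjoint_ops (ann i) (cre i)"
  unfolding adjoint_ops_def
proof (intro allI)
  fix x y
  let ?A = "{T. coef x T \<noteq> 0 \<and> i \<in> T}" and ?B = "(\<lambda>T. T - {i}) ` {T. coef x T \<noteq> 0}"
  have fin: "finite {T. coef x T \<noteq> 0}" by (rule finite_coef)
  have "inner_fock (app (ann i) x) y = (\<Sum>S\<in>?B. cnj (coef (app (ann i) x) S) * coef y S)"
    by (rule inner_fock_superset) (use fin in \<open>auto simp: coef_ann image_iff intro!: exI[of _ "insert i _"] split: if_splits\<close>)
  also have "\<dots> = (\<Sum>S\<in>(\<lambda>T. T - {i}) ` ?A. cnj (coef (app (ann i) x) S) * coef y S)"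
  proof (rule sum.mono_neutral_right)
    show "finite ?B" using fin by simp
    show "\<forall>S\<in>?B - (\<lambda>T. T - {i}) ` ?A. cnj (coef (app (ann i) x) S) * coef y S = 0"
      by (auto simp: coef_ann image_iff)
  qed auto
  also have "\<dots> = (\<Sum>T\<in>?A. cnj (coef (app (ann i) x) (T - {i})) * coef y (T - {i}))"
    by (subst sum.reindex) (auto simp: inj_on_def o_def)
  also have "\<dots> = (\<Sum>T\<in>?A. cnj (coef x T) * coef (app (cre i) y) T)"
  proof (rule sum.cong)
    fix T assume "T \<in> ?A"
    then have "i \<in> T" "finite T" using coef_finite by auto
    then show "cnj (coef (app (ann i) x) (T - {i})) * coef y (T - {i}) = cnj (coef x T) * coef (app (cre i) y) T"
      by (simp add: coef_ann coef_cre insert_absorb sgn_below_remove)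
  qed simp
  also have "\<dots> = (\<Sum>T | coef x T \<noteq> 0. cnj (coef x T) * coef (app (cre i) y) T)"
    by (rule sum.mono_neutral_left) (use fin in \<open>auto simp: coef_cre\<close>)
  finally show "inner_fock (app (ann i) x) y = inner_fock x (app (cre i) y)"
    by (simp add: inner_fock_def)
qed

lemma ann_vac: "app (ann i) fvac = 0"
  by (rule fock_eqI) (simp add: coef_ann)

text \<open>A vector involves finitely many oscillators, and an injective enumeration meets them
  finitely often.\<close>

lemma ann_smooth:
  assumes "inj c"
  shows "\<exists>N::int. \<forall>n\<ge>N. n \<ge> 0 \<and> app (ann (c (nat n))) x = 0"
proof -
  have "finite (\<Union>{S. coef x S \<noteq> 0})"
    using finite_coef coef_finite by blast
  then have "finite (c -` \<Union>{S. coef x S \<noteq> 0})"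
    using assms by (intro finite_vimageI)
  then obtain N where N: "\<And>n. n \<in> c -` \<Union>{S. coef x S \<noteq> 0} \<Longrightarrow> n < N"
    by (metis finite_nat_bounded lessThan_iff subsetD)
  have "app (ann (c (nat n))) x = 0" if "n \<ge> int N" for n
  proof (rule fock_eqI)
    fix S
    have "c (nat n) \<notin> \<Union>{S. coef x S \<noteq> 0}" using N[of "nat n"] that by fastforce
    then have "coef x (insert (c (nat n)) S) = 0" by auto
    then show "coef (app (ann (c (nat n))) x) S = coef 0 S" by (simp add: coef_ann)
  qed
  then show ?thesis by (intro exI[of _ "int N"]) auto
qed

section \<open>The fermions of the sites\<close>

text \<open>An injective numbering of all oscillators: \<open>i\<close> is the site,
  \<open>k\<close> the species (0 to 3 for the two complex fermions, 4 for the real one) and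
  \<open>n\<close> the mode.\<close>

definition mcode :: "nat \<Rightarrow> nat \<Rightarrow> nat \<Rightarrow> nat" where
  "mcode i k n = prod_encode (i, prod_encode (k, n))"

lemma mcode_eq [simp]: "mcode i k n = mcode i' k' n' \<longleftrightarrow> i = i' \<and> k = k' \<and> n = n'"
  by (simp add: mcode_def prod_encode_eq)

text \<open>Integer modes keep all mode sums over the integers. The zero mode of \<open>fa\<close>
  annihilates the vacuum and that of \<open>fad\<close> creates; this choice makes the vacuum a
  singlet for the currents of each site (\<open>site_hw_vac\<close>).\<close>

definition fa :: "nat \<Rightarrow> nat \<Rightarrow> int \<Rightarrow> fop" where
  "fa i k n = (if n \<ge> 0 then ann (mcode i (2 * k) (nat n)) else cre (mcode i (2 * k + 1) (nat (- n))))"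

definition fad :: "nat \<Rightarrow> nat \<Rightarrow> int \<Rightarrow> fop" where
  "fad i k n = (if n \<ge> 1 then ann (mcode i (2 * k + 1) (nat n)) else cre (mcode i (2 * k) (nat (- n))))"

text \<open>The zero mode must be self-adjoint with square 1/2. A normalised sum of one further
  annihilator and its adjoint has these properties.\<close>

definition fphi :: "nat \<Rightarrow> int \<Rightarrow> fop" where
  "fphi i n = (if n > 0 then ann (mcode i 4 (nat n)) else if n < 0 then cre (mcode i 4 (nat (- n)))
     else sqrt (1/2) *\<^sub>R (ann (mcode i 4 0) + cre (mcode i 4 0)))"

lemma even_odd_neq: "2 * (k::nat) \<noteq> 2 * l + 1" "2 * k + 1 \<noteq> 2 * (l::nat)"
  by presburger+

lemma CAR_simps:
  "ann i * ann j + ann j * ann i = 0" "cre i * cre j + cre j * cre i = 0"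
  "ann i * cre j + cre j * ann i = (if i = j then 1 else 0)"
  "cre i * ann j + ann j * cre i = (if i = j then 1 else 0)"
  using ann_ann[of i j] cre_cre[of i j] ann_cre[of i j] ann_cre[of j i] by auto

lemma fermion_CAR:
  "fa i k m * fa i' k' n + fa i' k' n * fa i k m = 0"
  "fad i k m * fad i' k' n + fad i' k' n * fad i k m = 0"
  "fa i k m * fad i' k' n + fad i' k' n * fa i k m = (if i = i' \<and> k = k' \<and> m + n = 0 then 1 else 0)"
  using even_odd_neq by (auto simp: fa_def fad_def CAR_simps)

lemma fphi_CAR:
  assumes "k < 2"
  shows "fphi i m * fa i' k n + fa i' k n * fphi i m = 0"
    "fphi i m * fad i' k n + fad i' k n * fphi i m = 0"
proof -
  have *: "(r *\<^sub>R (X + Y)) * Z + Z * (r *\<^sub>R (X + Y)) = r *\<^sub>R ((X * Z + Z * X) + (Y * Z + Z * Y))" for r and X Y Z :: fop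
    by (simp add: algebra_simps)
  have "4 \<noteq> 2 * k" "4 \<noteq> 2 * k + 1" using assms by presburger+
  then show "fphi i m * fa i' k n + fa i' k n * fphi i m = 0"
    "fphi i m * fad i' k n + fad i' k n * fphi i m = 0"
    by (auto simp: fa_def fad_def fphi_def * CAR_simps simp del: mult_scaleR_left mult_scaleR_right)
qed

lemma fphi_fphi: "fphi i m * fphi i' n + fphi i' n * fphi i m = (if i = i' \<and> m + n = 0 then 1 else 0)"
proof -
  have 1: "(r *\<^sub>R (X + Y)) * Z + Z * (r *\<^sub>R (X + Y)) = r *\<^sub>R ((X * Z + Z * X) + (Y * Z + Z * Y))"
    and 2: "Z * (r *\<^sub>R (X + Y)) + (r *\<^sub>R (X + Y)) * Z = r *\<^sub>R ((X * Z + Z * X) + (Y * Z + Z * Y))"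
    and 3: "(r *\<^sub>R (X + Y)) * (r *\<^sub>R (X' + Y')) + (r *\<^sub>R (X' + Y')) * (r *\<^sub>R (X + Y))
      = (r * r) *\<^sub>R ((X * X' + X' * X) + (X * Y' + Y' * X) + (Y * X' + X' * Y) + (Y * Y' + Y' * Y))"
    for r and X Y Z X' Y' :: fop
    by (simp_all add: algebra_simps)
  have 4: "sqrt (1/2) * (2 * sqrt (1/2)) = 1"
    using real_sqrt_pow2[of "1/2"] unfolding power2_eq_square by linarith
  show ?thesis
    by (auto simp: fphi_def 1 2 3 4 CAR_simps simp del: mult_scaleR_left mult_scaleR_right simp flip: scaleR_left_distrib)
qed

lemma fermion_adjoint:
  "adjoint_ops (fa i k n) (fad i k (- n))" "adjoint_ops (fad i k n) (fa i k (- n))"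
  "adjoint_ops (fphi i n) (fphi i (- n))"
  using adjoint_ann adjoint_sym[OF adjoint_ann]
  using adjoint_scaleR[OF adjoint_add[OF adjoint_sym[OF adjoint_ann] adjoint_ann], of "sqrt (1/2)" "mcode i 4 0" "mcode i 4 0"]
  by (auto simp: fa_def fad_def fphi_def add.commute)

lemma fermion_smooth: "smooth (fa i k)" "smooth (fad i k)" "smooth (fphi i)"
proof -
  have 1: "inj (\<lambda>n. mcode i k n)" for k by (simp add: inj_def)
  show "smooth (fa i k)" unfolding smooth_def
  proof
    fix x
    obtain N where "\<forall>n\<ge>N. n \<ge> 0 \<and> app (ann (mcode i (2 * k) (nat n))) x = 0"
      using ann_smooth[OF 1] by blast
    then show "\<exists>N. \<forall>n\<ge>N. app (fa i k n) x = 0"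
      by (intro exI[of _ "max N 1"]) (auto simp: fa_def)
  qed
  show "smooth (fad i k)" unfolding smooth_def
  proof
    fix x
    obtain N where "\<forall>n\<ge>N. n \<ge> 0 \<and> app (ann (mcode i (2 * k + 1) (nat n))) x = 0"
      using ann_smooth[OF 1] by blast
    then show "\<exists>N. \<forall>n\<ge>N. app (fad i k n) x = 0"
      by (intro exI[of _ "max N 1"]) (auto simp: fad_def)
  qed
  show "smooth (fphi i)" unfolding smooth_def
  proof
    fix x
    obtain N where "\<forall>n\<ge>N. n \<ge> 0 \<and> app (ann (mcode i 4 (nat n))) x = 0"
      using ann_smooth[OF 1] by blast
    then show "\<exists>N. \<forall>n\<ge>N. app (fphi i n) x = 0"
      by (intro exI[of _ "max N 1"]) (auto simp: fphi_def)
  qed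
qed

lemma fermion_vac:
  "n \<ge> 0 \<Longrightarrow> app (fa i k n) fvac = 0" "n \<ge> 1 \<Longrightarrow> app (fad i k n) fvac = 0"
  "n \<ge> 1 \<Longrightarrow> app (fphi i n) fvac = 0"
  by (auto simp: fa_def fad_def fphi_def ann_vac)

lemma nprod_delta_left:
  "nprod 1 m (\<lambda>j. if r + j = 0 then c *\<^sub>R 1 else 0) B p = c *\<^sub>R B (p + r)"
  unfolding nprod_def by (subst lsum_single[of "-r"]) (auto simp: nterm_def)

lemma nprod_delta_right:
  "nprod 1 m A (\<lambda>j. if r + j = 0 then c *\<^sub>R 1 else 0) p = c *\<^sub>R A (p + r)"
  unfolding nprod_def by (subst lsum_single[of "p + r"]) (auto simp: nterm_def)

lemma nprod_deriv_even:
  assumes sm: "smooth A" "smooth B" "smooth A'" "smooth B'"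
    and A: "\<And>j. D * A j = A j * D + A' j"
    and B: "\<And>j. D * B j = B j * D + B' j"
  shows "D * nprod \<epsilon> m A B p = nprod \<epsilon> m A B p * D + nprod \<epsilon> m A' B p + nprod \<epsilon> m A B' p"
  using nprod_deriv[of A B A' B' D 1 1 \<epsilon> m p] assms by simp

text \<open>The case of a bilinear and a single fermion: the anticommutators of \<open>D\<close>
  with the factors are scalars, so the products left by the Leibniz rule collapse to single
  modes.\<close>

lemma nprod_deriv_odd:
  assumes sm: "smooth A" "smooth B"
    and A: "\<And>j. D * A j = - (A j * D) + (if r + j = 0 then \<alpha> *\<^sub>R 1 else 0)"
    and B: "\<And>j. D * B j = - (B j * D) + (if r + j = 0 then \<beta> *\<^sub>R 1 else 0)"
  shows "nprod (-1) m A B p * D = D * nprod (-1) m A B p - \<alpha> *\<^sub>R B (p + r) + \<beta> *\<^sub>R A (p + r)"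
  using nprod_deriv[OF sm smooth_delta[of r "\<alpha> *\<^sub>R 1"] smooth_delta[of r "\<beta> *\<^sub>R 1"], of D "-1" "-1" "-1" m p] A B
  by (simp add: nprod_delta_left nprod_delta_right)

lemma nprod_central:
  assumes "smooth A" "smooth B" and "\<And>j. D * A j = \<sigma> *\<^sub>R (A j * D)" "\<And>j. D * B j = \<tau> *\<^sub>R (B j * D)" "\<sigma> * \<sigma> = 1"
  shows "D * nprod \<epsilon> m A B p = (\<sigma> * \<tau>) *\<^sub>R (nprod \<epsilon> m A B p * D)"
  using nprod_deriv[of A B "\<lambda>_. 0" "\<lambda>_. 0" D \<sigma> \<tau> \<epsilon> m p] assms by (simp add: smooth_zero)

lemma nprod_cut_const:
  assumes "smooth A" "smooth B" "\<And>i. A i * B (p - i) = \<epsilon> *\<^sub>R (B (p - i) * A i) + E"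
  shows "nprod \<epsilon> m A B p = nprod \<epsilon> 0 A B p + of_int m *\<^sub>R E"
  using nprod_cut[of A B p \<epsilon> "\<lambda>i. of_int i *\<^sub>R E" m] assms by (simp add: algebra_simps)

lemma lfin_int_box:
  assumes "\<And>x. \<exists>K L. \<forall>i. app (F i) x \<noteq> 0 \<longrightarrow> K \<le> i \<and> i \<le> (L::int)"
  shows "lfin F"
  unfolding lfin_def
proof
  fix x
  obtain K L where "\<forall>i. app (F i) x \<noteq> 0 \<longrightarrow> K \<le> i \<and> i \<le> L" using assms by blast
  then have "{i. app (F i) x \<noteq> 0} \<subseteq> {K..L}" by auto
  then show "finite {i. app (F i) x \<noteq> 0}" by (rule finite_subset) simp
qed

lemma lsum_swap_box:
  assumes "\<And>x. \<exists>K L. \<forall>i j. app (F i j) x \<noteq> 0 \<longrightarrow> K \<le> i \<and> i \<le> L \<and> K \<le> j \<and> j \<le> (L::int)"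
  shows "lsum (\<lambda>i. lsum (F i)) = lsum (\<lambda>j. lsum (\<lambda>i. F i j))"
proof (rule lsum_swap)
  show "lfin (F i)" for i by (rule lfin_int_box) (use assms in metis)
  show "lfin (\<lambda>i. F i j)" for j by (rule lfin_int_box) (use assms in metis)
  fix x
  obtain K L where "\<forall>i j. app (F i j) x \<noteq> 0 \<longrightarrow> K \<le> i \<and> i \<le> L \<and> K \<le> j \<and> j \<le> L" using assms by blast
  then have "{(i, j). app (F i j) x \<noteq> 0} \<subseteq> {K..L} \<times> {K..L}" by auto
  then show "finite {(i, j). app (F i j) x \<noteq> 0}" by (rule finite_subset) simp
qed

lemma fop_double_eq_0: "x = - x \<Longrightarrow> x = (0::fop)"
  by (metis add.inverse_inverse add_eq_0_iff scaleR_2 scaleR_eq_0_iff zero_neq_numeral)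

lemma bij_uminus_int: "bij (\<lambda>j::int. p - j)"
  by (rule bijI') (auto intro: exI[of _ "p - _"])

lemma bij_plus_int: "bij (\<lambda>j::int. p + j)"
  by (rule bijI') (auto intro: exI[of _ "_ - p"])

section \<open>Currents of level 1 from two complex fermions\<close>

datatype idx = P | Z | N

fun brk :: "idx \<Rightarrow> idx \<Rightarrow> idx" where
  "brk P N = Z" | "brk N P = Z" | "brk Z i = i" | "brk i Z = i" | "brk i j = i"

text \<open>The structure constants of so_3 for a basis of weights 1, 0, -1: the bracket of the
  vectors \<open>i\<close> and \<open>k\<close> is \<open>cf i k\<close> times the vector
  \<open>brk i k\<close>. Since \<open>J\<close> and \<open>G\<close> both transform in the adjoint
  representation, one table serves both. \<open>dt\<close> is the invariant form, with the Cartan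
  vector of length 1.\<close>

fun cf :: "idx \<Rightarrow> idx \<Rightarrow> real" where
  "cf P N = 2" | "cf N P = -2" | "cf Z P = 1" | "cf P Z = -1" | "cf Z N = -1" | "cf N Z = 1" | "cf _ _ = 0"

fun dt :: "idx \<Rightarrow> idx \<Rightarrow> real" where
  "dt P N = 2" | "dt N P = 2" | "dt Z Z = 1" | "dt _ _ = 0"

lemma idx_sym: "brk i j = brk j i" "cf j i = - cf i j" "dt j i = dt i j"
  by (cases i; cases j; simp)+

text \<open>The two orders of a normally ordered product differ by a derivative of a current.
  Symmetrising makes the quadratic term in the bracket of \<open>G\<close> with itself symmetric in
  the two indices.\<close>

definition psym :: "(idx \<Rightarrow> int \<Rightarrow> fop) \<Rightarrow> idx \<Rightarrow> idx \<Rightarrow> int \<Rightarrow> fop" where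
  "psym J i k p = (1/2) *\<^sub>R (nprod 1 0 (J i) (J k) p + nprod 1 0 (J k) (J i) p)"

locale su2_site =
  fixes a ad b bd :: "int \<Rightarrow> fop"
  assumes smooth_a: "smooth a" and smooth_ad: "smooth ad" and smooth_b: "smooth b" and smooth_bd: "smooth bd"
    and CAR0: "a m * a n + a n * a m = 0" "ad m * ad n + ad n * ad m = 0"
      "b m * b n + b n * b m = 0" "bd m * bd n + bd n * bd m = 0"
      "a m * b n + b n * a m = 0" "a m * bd n + bd n * a m = 0"
      "ad m * b n + b n * ad m = 0" "ad m * bd n + bd n * ad m = 0"
    and CAR1: "a m * ad n + ad n * a m = (if m + n = 0 then 1 else 0)"
      "b m * bd n + bd n * b m = (if m + n = 0 then 1 else 0)"
begin

lemmas smooths = smooth_a smooth_ad smooth_b smooth_bd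

lemma odd_forms:
  "a r * a j = - (a j * a r) + (if r + j = 0 then 0 *\<^sub>R 1 else 0)"
  "a r * b j = - (b j * a r) + (if r + j = 0 then 0 *\<^sub>R 1 else 0)"
  "a r * bd j = - (bd j * a r) + (if r + j = 0 then 0 *\<^sub>R 1 else 0)"
  "a r * ad j = - (ad j * a r) + (if r + j = 0 then 1 *\<^sub>R 1 else 0)"
  "b r * a j = - (a j * b r) + (if r + j = 0 then 0 *\<^sub>R 1 else 0)"
  "b r * ad j = - (ad j * b r) + (if r + j = 0 then 0 *\<^sub>R 1 else 0)"
  "b r * b j = - (b j * b r) + (if r + j = 0 then 0 *\<^sub>R 1 else 0)"
  "b r * bd j = - (bd j * b r) + (if r + j = 0 then 1 *\<^sub>R 1 else 0)"
  "ad r * a j = - (a j * ad r) + (if r + j = 0 then 1 *\<^sub>R 1 else 0)"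
  "ad r * b j = - (b j * ad r) + (if r + j = 0 then 0 *\<^sub>R 1 else 0)"
  "ad r * ad j = - (ad j * ad r) + (if r + j = 0 then 0 *\<^sub>R 1 else 0)"
  "ad r * bd j = - (bd j * ad r) + (if r + j = 0 then 0 *\<^sub>R 1 else 0)"
  "bd r * a j = - (a j * bd r) + (if r + j = 0 then 0 *\<^sub>R 1 else 0)"
  "bd r * b j = - (b j * bd r) + (if r + j = 0 then 1 *\<^sub>R 1 else 0)"
  "bd r * ad j = - (ad j * bd r) + (if r + j = 0 then 0 *\<^sub>R 1 else 0)"
  "bd r * bd j = - (bd j * bd r) + (if r + j = 0 then 0 *\<^sub>R 1 else 0)"
  using CAR0(1-4)[of r j] CAR0(5-8)[of r j] CAR0(5-8)[of j r] CAR1[of r j] CAR1[of j r]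
  by (auto simp: eq_neg_iff_add_eq_0 add.commute eq_diff_eq diff_eq_eq)

text \<open>The currents rotate the doublets (\<open>a\<close>, \<open>bd\<close>) and
  (\<open>b\<close>, \<open>ad\<close>).\<close>

definition eP :: "int \<Rightarrow> fop" where "eP = nprod (-1) 0 a b"
definition fN :: "int \<Rightarrow> fop" where "fN = nprod (-1) 0 bd ad"
definition hZ :: "int \<Rightarrow> fop" where "hZ n = nprod (-1) 0 a ad n - nprod (-1) 0 bd b n"

lemma comm_eP: "eP p * a r = a r * eP p + 0" "eP p * b r = b r * eP p + 0"
  "eP p * ad r = ad r * eP p + - b (p + r)" "eP p * bd r = bd r * eP p + a (p + r)"
  using nprod_deriv_odd[OF smooth_a smooth_b odd_forms(1,2), where m = 0 and p = p]
    nprod_deriv_odd[OF smooth_a smooth_b odd_forms(5,7), where m = 0 and p = p]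
    nprod_deriv_odd[OF smooth_a smooth_b odd_forms(9,10), where m = 0 and p = p]
    nprod_deriv_odd[OF smooth_a smooth_b odd_forms(13,14), where m = 0 and p = p]
  by (simp_all add: eP_def)

lemma comm_fN: "fN p * a r = a r * fN p + bd (p + r)" "fN p * b r = b r * fN p + - ad (p + r)"
  "fN p * ad r = ad r * fN p + 0" "fN p * bd r = bd r * fN p + 0"
  using nprod_deriv_odd[OF smooth_bd smooth_ad odd_forms(3,4), where m = 0 and p = p]
    nprod_deriv_odd[OF smooth_bd smooth_ad odd_forms(8,6), where m = 0 and p = p]
    nprod_deriv_odd[OF smooth_bd smooth_ad odd_forms(12,11), where m = 0 and p = p]
    nprod_deriv_odd[OF smooth_bd smooth_ad odd_forms(16,15), where m = 0 and p = p]
  by (simp_all add: fN_def)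

lemma comm_hZ: "hZ p * a r = a r * hZ p + a (p + r)" "hZ p * b r = b r * hZ p + b (p + r)"
  "hZ p * ad r = ad r * hZ p + - ad (p + r)" "hZ p * bd r = bd r * hZ p + - bd (p + r)"
  using nprod_deriv_odd[OF smooth_a smooth_ad odd_forms(1,4), where m = 0 and p = p]
    nprod_deriv_odd[OF smooth_a smooth_ad odd_forms(5,6), where m = 0 and p = p]
    nprod_deriv_odd[OF smooth_a smooth_ad odd_forms(9,11), where m = 0 and p = p]
    nprod_deriv_odd[OF smooth_a smooth_ad odd_forms(13,15), where m = 0 and p = p]
    nprod_deriv_odd[OF smooth_bd smooth_b odd_forms(3,2), where m = 0 and p = p]
    nprod_deriv_odd[OF smooth_bd smooth_b odd_forms(8,7), where m = 0 and p = p]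
    nprod_deriv_odd[OF smooth_bd smooth_b odd_forms(12,10), where m = 0 and p = p]
    nprod_deriv_odd[OF smooth_bd smooth_b odd_forms(16,14), where m = 0 and p = p]
  by (simp_all add: hZ_def left_diff_distrib right_diff_distrib)

text \<open>Commuting \<open>eP m\<close> through \<open>fN n\<close> turns \<open>bd\<close> into
  \<open>a\<close> shifted by m. Moving the cut back from m to 0 crosses m terms, each contributing
  one anticommutator; this is the central term of level 1.\<close>

lemma eP_fN: "eP m * fN n = fN n * eP m + hZ (m + n) + (if m + n = 0 then of_int m *\<^sub>R 1 else 0)"
proof -
  have "eP m * fN n = fN n * eP m + nprod (-1) m a ad (n + m) - nprod (-1) 0 bd b (n + m)"
    using nprod_deriv_even[OF smooth_bd smooth_ad smooth_shift[OF smooth_a, of m] smooth_uminus[OF smooth_shift[OF smooth_b, of m]] comm_eP(4,3), where \<epsilon> = "-1" and m = 0 and p = n]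
      nprod_shift_left[of "-1" 0 a m ad n] nprod_shift_right[of "-1" 0 bd b m n]
    by (simp add: fN_def nprod_uminus_right smooths smooth_shift)
  moreover have "nprod (-1) m a ad (n + m) = nprod (-1) 0 a ad (n + m) + of_int m *\<^sub>R (if n + m = 0 then 1 else 0)"
    by (rule nprod_cut_const[OF smooth_a smooth_ad]) (simp add: odd_forms(4))
  ultimately show ?thesis by (simp add: hZ_def add.commute)
qed

lemma smooth_eP: "smooth eP"
  unfolding eP_def by (rule smooth_nprod[OF smooth_a smooth_b]) (simp add: odd_forms(2))

lemma smooth_fN: "smooth fN"
  unfolding fN_def by (rule smooth_nprod[OF smooth_bd smooth_ad]) (simp add: odd_forms(15))

text \<open>The factors of \<open>hZ\<close> do not anticommute exactly, so
  \<open>smooth_nprod\<close> does not apply. Instead \<open>hZ n\<close> is read off as the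
  commutator of \<open>eP n\<close> and \<open>fN 0\<close>.\<close>

lemma smooth_hZ: "smooth hZ"
  unfolding smooth_def
proof
  fix x
  obtain A B where AB: "\<And>n. n \<ge> A \<Longrightarrow> app (eP n) x = 0" "\<And>n. n \<ge> B \<Longrightarrow> app (eP n) (app (fN 0) x) = 0"
    using smooth_eP unfolding smooth_def by metis
  have "app (hZ n) x = 0" if "n \<ge> max (max A B) 1" for n
    using arg_cong[OF eP_fN[of n 0], of "\<lambda>y. app y x"] AB(1)[of n] AB(2)[of n] that by simp
  then show "\<exists>N. \<forall>n\<ge>N. app (hZ n) x = 0" by blast
qed

lemma hZ_eP: "hZ m * eP n = eP n * hZ m + 2 *\<^sub>R eP (m + n)"
proof -
  have "hZ m * eP n = eP n * hZ m + nprod (-1) m a b (n + m) + nprod (-1) 0 a b (n + m)"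
    using nprod_deriv_even[OF smooth_a smooth_b smooth_shift[OF smooth_a, of m] smooth_shift[OF smooth_b, of m] comm_hZ(1,2), where \<epsilon> = "-1" and m = 0 and p = n]
      nprod_shift_left[of "-1" 0 a m b n] nprod_shift_right[of "-1" 0 a b m n]
    by (simp add: eP_def)
  moreover have "nprod (-1) m a b (n + m) = nprod (-1) 0 a b (n + m) + of_int m *\<^sub>R 0"
    by (rule nprod_cut_const[OF smooth_a smooth_b]) (simp add: odd_forms(2))
  ultimately show ?thesis by (simp add: eP_def add.commute scaleR_2)
qed

lemma hZ_fN: "hZ m * fN n = fN n * hZ m + (-2) *\<^sub>R fN (m + n)"
proof -
  have "hZ m * fN n = fN n * hZ m - nprod (-1) m bd ad (n + m) - nprod (-1) 0 bd ad (n + m)"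
    using nprod_deriv_even[OF smooth_bd smooth_ad smooth_uminus[OF smooth_shift[OF smooth_bd, of m]]
        smooth_uminus[OF smooth_shift[OF smooth_ad, of m]] comm_hZ(4,3), where \<epsilon> = "-1" and m = 0 and p = n]
      nprod_shift_left[of "-1" 0 bd m ad n] nprod_shift_right[of "-1" 0 bd ad m n]
    by (simp add: fN_def nprod_uminus_right nprod_uminus_left smooths smooth_shift)
  moreover have "nprod (-1) m bd ad (n + m) = nprod (-1) 0 bd ad (n + m) + of_int m *\<^sub>R 0"
    by (rule nprod_cut_const[OF smooth_bd smooth_ad]) (simp add: odd_forms(15))
  ultimately show ?thesis by (simp add: fN_def add.commute scaleR_2)
qed

lemma hZ_hZ: "hZ m * hZ n = hZ n * hZ m + (if m + n = 0 then (2 * of_int m) *\<^sub>R 1 else 0)"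
proof -
  have "hZ m * nprod (-1) 0 a ad n = nprod (-1) 0 a ad n * hZ m + nprod (-1) m a ad (n + m) - nprod (-1) 0 a ad (n + m)"
    using nprod_deriv_even[OF smooth_a smooth_ad smooth_shift[OF smooth_a, of m]
        smooth_uminus[OF smooth_shift[OF smooth_ad, of m]] comm_hZ(1,3), where \<epsilon> = "-1" and m = 0 and p = n]
      nprod_shift_left[of "-1" 0 a m ad n] nprod_shift_right[of "-1" 0 a ad m n]
    by (simp add: nprod_uminus_right nprod_uminus_left smooths smooth_shift)
  moreover have "nprod (-1) m a ad (n + m) = nprod (-1) 0 a ad (n + m) + of_int m *\<^sub>R (if n + m = 0 then 1 else 0)"
    by (rule nprod_cut_const[OF smooth_a smooth_ad]) (simp add: odd_forms(4))
  moreover have "hZ m * nprod (-1) 0 bd b n = nprod (-1) 0 bd b n * hZ m - nprod (-1) m bd b (n + m) + nprod (-1) 0 bd b (n + m)"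
    using nprod_deriv_even[OF smooth_bd smooth_b smooth_uminus[OF smooth_shift[OF smooth_bd, of m]]
        smooth_shift[OF smooth_b, of m] comm_hZ(4,2), where \<epsilon> = "-1" and m = 0 and p = n]
      nprod_shift_left[of "-1" 0 bd m b n] nprod_shift_right[of "-1" 0 bd b m n]
    by (simp add: nprod_uminus_right nprod_uminus_left smooths smooth_shift)
  moreover have "nprod (-1) m bd b (n + m) = nprod (-1) 0 bd b (n + m) + of_int m *\<^sub>R (if n + m = 0 then 1 else 0)"
    by (rule nprod_cut_const[OF smooth_bd smooth_b]) (simp add: odd_forms(14))
  ultimately have "hZ m * nprod (-1) 0 a ad n = nprod (-1) 0 a ad n * hZ m + of_int m *\<^sub>R (if n + m = 0 then 1 else 0)"
    "hZ m * nprod (-1) 0 bd b n = nprod (-1) 0 bd b n * hZ m - of_int m *\<^sub>R (if n + m = 0 then 1 else 0)"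
    by simp_all
  then show ?thesis
    by (simp add: hZ_def[of n] right_diff_distrib left_diff_distrib add.commute[of n] flip: scaleR_left_distrib)
qed

lemma eP_eP: "eP m * eP n = eP n * eP m"
  using nprod_deriv_even[OF smooth_a smooth_b smooth_zero smooth_zero comm_eP(1,2), where \<epsilon> = "-1" and m = 0 and p = n]
  by (simp add: eP_def)

lemma fN_fN: "fN m * fN n = fN n * fN m"
  using nprod_deriv_even[OF smooth_bd smooth_ad smooth_zero smooth_zero comm_fN(4,3), where \<epsilon> = "-1" and m = 0 and p = n]
  by (simp add: fN_def)

section \<open>The null fields of level 1\<close>

lemma eP_lsum: "eP n = lsum (\<lambda>j. a j * b (n - j))"
  unfolding eP_def nprod_def by (rule arg_cong[of _ _ lsum]) (simp add: nterm_def fun_eq_iff odd_forms(2))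

lemma lfin_eP: "lfin (\<lambda>j. a j * b (n - j))"
proof -
  have "nterm (-1) 0 a b n = (\<lambda>j. a j * b (n - j))"
    by (simp add: nterm_def fun_eq_iff odd_forms(2))
  then show ?thesis using lfin_nterm[OF smooth_a smooth_b, of "-1" 0 n] by simp
qed

lemma lfin_eP_a: "lfin (\<lambda>i. eP (q - i) * a i)"
proof -
  have "nterm 1 0 a eP q = (\<lambda>i. eP (q - i) * a i)"
    by (simp add: nterm_def fun_eq_iff comm_eP(1))
  then show ?thesis using lfin_nterm[OF smooth_a smooth_eP, of 1 0 q] by simp
qed

text \<open>This is a mode of the field a(z) a(z) b(z), which vanishes with a(z) a(z): exchanging
  the two modes of \<open>a\<close> reverses each term, while exchanging the summations preserves
  the double sum.\<close>

lemma eP_a_zero: "lsum (\<lambda>i. eP (q - i) * a i) = 0"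
proof -
  let ?F = "\<lambda>i j. a j * b (q - i - j) * a i"
  have "lsum (\<lambda>i. eP (q - i) * a i) = lsum (\<lambda>i. lsum (?F i))"
    unfolding eP_lsum lsum_mult_right[OF lfin_eP] ..
  have swap: "?F i j = - ?F j i" for i j
  proof -
    have "a j * b s * a i = - (a i * b s * a j)" for s
    proof -
      have "a j * b s * a i = - (b s * a j * a i)" by (simp add: odd_forms(2)[of j s])
      also have "\<dots> = b s * a i * a j" using odd_forms(1)[of j i] by (simp add: mult.assoc)
      also have "\<dots> = - (a i * b s * a j)" by (simp add: odd_forms(2)[of i s])
      finally show ?thesis .
    qed
    then show ?thesis by (simp add: algebra_simps)
  qed
  \<comment> \<open>High modes of \<open>a\<close> and of \<open>b\<close> kill \<open>x\<close>,
    which bounds i, j and q - i - j from above; together these bounds also bound i and j from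
    below.\<close>
  have box: "\<exists>K L. \<forall>i j. app (?F i j) x \<noteq> 0 \<longrightarrow> K \<le> i \<and> i \<le> L \<and> K \<le> j \<and> j \<le> L" for x
  proof -
    obtain A B where AB: "\<And>n. n \<ge> A \<Longrightarrow> app (a n) x = 0" "\<And>n. n \<ge> B \<Longrightarrow> app (b n) x = 0"
      using smooths unfolding smooth_def by metis
    have 1: "i \<le> A" if "app (?F i j) x \<noteq> 0" for i j
      using that AB(1)[of i] by (cases "i \<le> A") auto
    have 2: "j \<le> A" if "app (?F i j) x \<noteq> 0" for i j
    proof -
      have "app (?F i j) x = - app (?F j i) x" by (subst swap[of i j]) simp
      with that 1[where i = j and j = i] show ?thesis by simp
    qed
    have 3: "q - i - j \<le> B" if "app (?F i j) x \<noteq> 0" for i j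
    proof (rule ccontr)
      assume "\<not> q - i - j \<le> B"
      moreover have "?F i j = - (a j * a i * b (q - i - j))"
        by (simp add: mult.assoc odd_forms(5)[of _ i])
      ultimately show False using that AB(2)[of "q - i - j"] by simp
    qed
    have "q - B - A \<le> i \<and> i \<le> A \<and> q - B - A \<le> j \<and> j \<le> A" if "app (?F i j) x \<noteq> 0" for i j
      using 1[OF that] 2[OF that] 3[OF that] by linarith
    then show ?thesis by blast
  qed
  have "lsum (\<lambda>i. lsum (?F i)) = lsum (\<lambda>j. lsum (\<lambda>i. ?F i j))"
    by (rule lsum_swap_box[OF box])
  also have "\<dots> = lsum (\<lambda>j. lsum (\<lambda>i. - ?F j i))"
    using swap by (intro arg_cong[of _ _ lsum] ext) metis
  also have "\<dots> = - lsum (\<lambda>j. lsum (?F j))"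
  proof -
    have "lfin (?F j)" for j
      using lfin_mult_right[OF lfin_eP] by simp
    moreover have "lfin (\<lambda>j. lsum (?F j))"
      unfolding lsum_mult_right[OF lfin_eP] eP_lsum[symmetric] by (rule lfin_eP_a)
    ultimately show ?thesis by (simp add: lsum_uminus)
  qed
  finally show ?thesis
    using fop_double_eq_0 \<open>lsum (\<lambda>i. eP (q - i) * a i) = lsum (\<lambda>i. lsum (?F i))\<close> by simp
qed

text \<open>The null field e(z)^2 of level 1. The right factor is expanded into a(i - l) b(l); for
  fixed \<open>l\<close> the sum over \<open>i\<close> is \<open>eP_a_zero\<close>.\<close>

lemma null_PP: "nprod 1 0 eP eP p = 0"
proof -
  let ?F = "\<lambda>i l. eP (p - i) * (a (i - l) * b l)"
  have "nterm 1 0 eP eP p = (\<lambda>i. eP (p - i) * eP i)"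
    by (simp add: nterm_def fun_eq_iff eP_eP)
  moreover have "eP i = lsum (\<lambda>l. a (i - l) * b l)" for i
    using lsum_reindex[OF bij_uminus_int, of "\<lambda>j. a j * b (i - j)" i] by (simp add: eP_lsum)
  moreover have lf: "lfin (\<lambda>l. a (i - l) * b l)" for i
    using lfin_reindex[OF bij_uminus_int, of "\<lambda>j. a j * b (i - j)" i] lfin_eP by simp
  ultimately have "nprod 1 0 eP eP p = lsum (\<lambda>i. lsum (?F i))"
    by (simp add: nprod_def lsum_mult_left)
  also have "\<dots> = lsum (\<lambda>l. lsum (\<lambda>i. ?F i l))"
  proof (rule lsum_swap_box)
    fix x
    obtain A B E where AB: "\<And>n. n \<ge> A \<Longrightarrow> app (a n) x = 0" "\<And>n. n \<ge> B \<Longrightarrow> app (b n) x = 0" "\<And>n. n \<ge> E \<Longrightarrow> app (eP n) x = 0"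
      using smooths smooth_eP unfolding smooth_def by metis
    have 1: "l \<le> B" if "app (?F i l) x \<noteq> 0" for i l
      using that AB(2)[of l] by (cases "l \<le> B") auto
    have 2: "i - l \<le> A" if "app (?F i l) x \<noteq> 0" for i l
    proof (rule ccontr)
      assume "\<not> i - l \<le> A"
      moreover have "a (i - l) * b l = - (b l * a (i - l))"
        using odd_forms(2)[of "i - l" l] by (simp split: if_splits)
      then have "?F i l = - (eP (p - i) * b l * a (i - l))" by (simp add: mult.assoc)
      ultimately show False using that AB(1)[of "i - l"] by simp
    qed
    have 3: "p - i \<le> E" if "app (?F i l) x \<noteq> 0" for i l
    proof (rule ccontr)
      assume "\<not> p - i \<le> E"
      moreover have "?F i l = a (i - l) * b l * eP (p - i)"
        using comm_eP(1)[of "p - i" "i - l"] comm_eP(2)[of "p - i" l] by (simp add: mult.assoc[symmetric]) (simp add: mult.assoc)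
      ultimately show False using that AB(3)[of "p - i"] by simp
    qed
    have "min (p - E) (p - E - A) \<le> i \<and> i \<le> max B (A + B) \<and> min (p - E) (p - E - A) \<le> l \<and> l \<le> max B (A + B)"
      if "app (?F i l) x \<noteq> 0" for i l
      using 1[OF that] 2[OF that] 3[OF that] by linarith
    then show "\<exists>K L. \<forall>i j. app (?F i j) x \<noteq> 0 \<longrightarrow> K \<le> i \<and> i \<le> L \<and> K \<le> j \<and> j \<le> L"
      by blast
  qed
  also have "\<dots> = lsum (\<lambda>l. lsum (\<lambda>i. eP (p - i) * a (i - l)) * b l)"
  proof -
    have "lfin (\<lambda>i. eP (p - i) * a (i - l))" for l
      using lfin_reindex[OF bij_plus_int[of "-l"], of "\<lambda>i. eP (p - l - i) * a i"] lfin_eP_a[of "p - l"]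
      by simp
    then show ?thesis by (simp add: lsum_mult_right mult.assoc[symmetric])
  qed
  also have "\<dots> = 0"
  proof -
    have "lsum (\<lambda>i. eP (p - i) * a (i - l)) = 0" for l
      using lsum_reindex[OF bij_plus_int, of "\<lambda>i. eP (p - i) * a (i - l)" l] eP_a_zero[of "p - l"]
      by (simp add: algebra_simps)
    then show ?thesis by (simp add: lsum_finite[of "{}"])
  qed
  finally show ?thesis .
qed

lemma fN_comm: "fN 0 * eP j = eP j * fN 0 + - hZ j" "fN 0 * hZ j = hZ j * fN 0 + 2 *\<^sub>R fN j"
  "fN 0 * fN j = fN j * fN 0 + 0"
  using eP_fN[of j 0] hZ_fN[of j 0] fN_fN[of 0 j] by auto

text \<open>Repeated brackets with \<open>fN 0\<close> carry e(z)^2 = 0 through the five-dimensional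
  representation of so_3 that it generates. This and the next three lemmas are the remaining
  vectors.\<close>

lemma null_PZ: "nprod 1 0 hZ eP p + nprod 1 0 eP hZ p = 0"
  using nprod_deriv_even[OF smooth_eP smooth_eP smooth_uminus[OF smooth_hZ] smooth_uminus[OF smooth_hZ] fN_comm(1,1), where \<epsilon> = 1 and m = 0 and p = p]
  by (simp add: null_PP nprod_linear smooth_eP smooth_hZ add_eq_0_iff eq_neg_iff_add_eq_0)

lemmas sm3 = smooth_eP smooth_fN smooth_hZ

lemma null_PN: "nprod 1 0 fN eP p + nprod 1 0 eP fN p = nprod 1 0 hZ hZ p"
proof -
  have d: "fN 0 * nprod 1 0 hZ eP p = nprod 1 0 hZ eP p * fN 0 + 2 *\<^sub>R nprod 1 0 fN eP p - nprod 1 0 hZ hZ p"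
    "fN 0 * nprod 1 0 eP hZ p = nprod 1 0 eP hZ p * fN 0 - nprod 1 0 hZ hZ p + 2 *\<^sub>R nprod 1 0 eP fN p"
    using nprod_deriv_even[OF smooth_hZ smooth_eP smooth_weight[OF smooth_fN, of "\<lambda>_. 2"] smooth_uminus[OF smooth_hZ] fN_comm(2,1), where \<epsilon> = 1 and m = 0 and p = p]
      nprod_deriv_even[OF smooth_eP smooth_hZ smooth_uminus[OF smooth_hZ] smooth_weight[OF smooth_fN, of "\<lambda>_. 2"] fN_comm(1,2), where \<epsilon> = 1 and m = 0 and p = p]
    by (simp_all add: nprod_linear sm3)
  have "2 *\<^sub>R (nprod 1 0 fN eP p + nprod 1 0 eP fN p - nprod 1 0 hZ hZ p)
     = fN 0 * (nprod 1 0 hZ eP p + nprod 1 0 eP hZ p) - (nprod 1 0 hZ eP p + nprod 1 0 eP hZ p) * fN 0"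
    unfolding distrib_left distrib_right d by (simp add: scaleR_2 algebra_simps)
  then show ?thesis unfolding null_PZ by simp
qed

lemma null_ZN: "nprod 1 0 hZ fN p + nprod 1 0 fN hZ p = 0"
proof -
  have d: "fN 0 * nprod 1 0 hZ hZ p = nprod 1 0 hZ hZ p * fN 0 + 2 *\<^sub>R nprod 1 0 fN hZ p + 2 *\<^sub>R nprod 1 0 hZ fN p"
    "fN 0 * nprod 1 0 fN eP p = nprod 1 0 fN eP p * fN 0 - nprod 1 0 fN hZ p"
    "fN 0 * nprod 1 0 eP fN p = nprod 1 0 eP fN p * fN 0 - nprod 1 0 hZ fN p"
    using nprod_deriv_even[OF smooth_hZ smooth_hZ smooth_weight[OF smooth_fN, of "\<lambda>_. 2"] smooth_weight[OF smooth_fN, of "\<lambda>_. 2"] fN_comm(2,2), where \<epsilon> = 1 and m = 0 and p = p]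
      nprod_deriv_even[OF smooth_fN smooth_eP smooth_zero smooth_uminus[OF smooth_hZ] fN_comm(3,1), where \<epsilon> = 1 and m = 0 and p = p]
      nprod_deriv_even[OF smooth_eP smooth_fN smooth_uminus[OF smooth_hZ] smooth_zero fN_comm(1,3), where \<epsilon> = 1 and m = 0 and p = p]
    by (simp_all add: nprod_linear sm3)
  have three: "3 *\<^sub>R x = x + 2 *\<^sub>R x" for x :: fop
    using scaleR_left_distrib[of 1 2 x] by simp
  \<comment> \<open>The bracket of \<open>fN 0\<close> with the square of \<open>hZ\<close>
    contributes this sum twice, and that with the products of \<open>eP\<close> and
    \<open>fN\<close> contributes it once with the opposite sign.\<close>
  have "3 *\<^sub>R (nprod 1 0 hZ fN p + nprod 1 0 fN hZ p) = (fN 0 * nprod 1 0 hZ hZ p - nprod 1 0 hZ hZ p * fN 0)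
     - (fN 0 * (nprod 1 0 fN eP p + nprod 1 0 eP fN p) - (nprod 1 0 fN eP p + nprod 1 0 eP fN p) * fN 0)"
    unfolding distrib_left distrib_right d three by (simp add: scaleR_2 algebra_simps)
  then show ?thesis unfolding null_PN by simp
qed

lemma null_NN: "nprod 1 0 fN fN p = 0"
proof -
  have d: "fN 0 * nprod 1 0 hZ fN p = nprod 1 0 hZ fN p * fN 0 + 2 *\<^sub>R nprod 1 0 fN fN p"
    "fN 0 * nprod 1 0 fN hZ p = nprod 1 0 fN hZ p * fN 0 + 2 *\<^sub>R nprod 1 0 fN fN p"
    using nprod_deriv_even[OF smooth_hZ smooth_fN smooth_weight[OF smooth_fN, of "\<lambda>_. 2"] smooth_zero fN_comm(2,3), where \<epsilon> = 1 and m = 0 and p = p]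
      nprod_deriv_even[OF smooth_fN smooth_hZ smooth_zero smooth_weight[OF smooth_fN, of "\<lambda>_. 2"] fN_comm(3,2), where \<epsilon> = 1 and m = 0 and p = p]
    by (simp_all add: nprod_linear sm3)
  have four: "4 *\<^sub>R x = 2 *\<^sub>R x + 2 *\<^sub>R x" for x :: fop
    using scaleR_left_distrib[of 2 2 x] by simp
  have "4 *\<^sub>R nprod 1 0 fN fN p = fN 0 * (nprod 1 0 hZ fN p + nprod 1 0 fN hZ p) - (nprod 1 0 hZ fN p + nprod 1 0 fN hZ p) * fN 0"
    unfolding distrib_left distrib_right d four by (simp add: scaleR_2 algebra_simps)
  then show ?thesis unfolding null_ZN by simp
qed

fun cur :: "idx \<Rightarrow> int \<Rightarrow> fop" where
  "cur P n = eP n" | "cur Z n = (1/2) *\<^sub>R hZ n" | "cur N n = fN n"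

text \<open>The Sugawara field: modulo the null fields it is the square of the Cartan current alone,
  so its Virasoro relations can be computed inside one Heisenberg algebra.\<close>

definition LS :: "int \<Rightarrow> fop" where
  "LS p = nprod 1 0 (cur Z) (cur Z) p"

lemma cur_fun: "cur P = eP" "cur Z = (\<lambda>n. (1/2) *\<^sub>R hZ n)" "cur N = fN"
  by (auto simp: fun_eq_iff)

lemma smooth_cur: "smooth (cur i)"
  by (cases i) (simp_all add: cur_fun sm3 smooth_weight)

lemma cur_cur: "cur i m * cur k n = cur k n * cur i m + cf i k *\<^sub>R cur (brk i k) (m + n)
    + (if m + n = 0 then (of_int m / 2 * dt i k) *\<^sub>R 1 else 0)"
proof -
  have n: "n = - m" if "m + n = 0" using that by linarith
  show ?thesis
    using n
    by (cases i; cases k)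
      (auto simp: eP_eP[of m n] fN_fN[of m n] eP_fN hZ_eP hZ_fN hZ_hZ[of m n] add.commute[of n m]
        scaleR_add_right scaleR_diff_right simp flip: scaleR_left_distrib of_int_add)
qed

text \<open>The symmetric square of the adjoint representation is the sum of dimensions 5 and 1. The
  first part consists of null fields, so only the trace part survives.\<close>

lemma psym_cur: "psym cur i k p = dt i k *\<^sub>R LS p"
  using null_PP[of p] null_PZ[of p] null_PN[of p] null_ZN[of p] null_NN[of p]
  by (cases i; cases k) (simp_all add: psym_def LS_def cur_fun nprod_linear sm3 smooth_weight add.commute
      flip: scaleR_add_right scaleR_2)

end

section \<open>Virasoro relations of the Sugawara field\<close>

definition virasoro :: "real \<Rightarrow> (int \<Rightarrow> fop) \<Rightarrow> bool" where
  "virasoro c L \<longleftrightarrow> (\<forall>m n. L m * L n = L n * L m + of_int (m - n) *\<^sub>R L (m + n)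
     + (if m + n = 0 then (c / 12 * (of_int m ^ 3 - of_int m)) *\<^sub>R 1 else 0))"

lemma scaleR_cancel_twice: "c *\<^sub>R x + c *\<^sub>R x = (2 * c) *\<^sub>R (x :: fop)"
  by (simp flip: scaleR_left_distrib)

context su2_site
begin

declare cur.simps [simp del]

text \<open>The symmetrised product drops out by \<open>psym_cur\<close>. For the root currents the
  coefficient n comes from moving the cut and is n (cf i Z)^2; for the Cartan current it comes from
  the central term and is n times \<open>dt Z Z\<close>.\<close>

lemma LS_cur: "LS m * cur i n = cur i n * LS m + (- of_int n) *\<^sub>R cur i (m + n)"
proof -
  have D: "cur i n * cur Z j = cur Z j * cur i n + (cf i Z *\<^sub>R cur i (n + j)
      + (if n + j = 0 then (of_int n / 2 * dt i Z) *\<^sub>R 1 else 0))" for j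
    using cur_cur[of i n Z j] by (cases i) simp_all
  have sm: "smooth (\<lambda>j. cf i Z *\<^sub>R cur i (n + j))" "smooth (\<lambda>j. if n + j = 0 then (of_int n / 2 * dt i Z) *\<^sub>R (1::fop) else 0)"
    by (intro smooth_weight smooth_shift smooth_cur smooth_delta)+
  have "cur i n * LS m = LS m * cur i n + (cf i Z *\<^sub>R nprod 1 n (cur i) (cur Z) (m + n) + (of_int n / 2 * dt i Z) *\<^sub>R cur Z (m + n))
     + (cf i Z *\<^sub>R nprod 1 0 (cur Z) (cur i) (m + n) + (of_int n / 2 * dt i Z) *\<^sub>R cur Z (m + n))"
    using nprod_deriv_even[OF smooth_cur smooth_cur smooth_add[OF sm] smooth_add[OF sm] D D, where \<epsilon> = 1 and m = 0 and p = m]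
      nprod_add_left[OF sm smooth_cur[of Z], of 1 0 m] nprod_add_right[OF smooth_cur[of Z] sm, of 1 0 m]
      nprod_scaleR_left[OF smooth_shift[OF smooth_cur[of i], of n] smooth_cur[of Z], of 1 0 _ m]
      nprod_scaleR_right[OF smooth_cur[of Z] smooth_shift[OF smooth_cur[of i], of n], of 1 0 _ m]
      nprod_delta_left[of 0 n "of_int n / 2 * dt i Z" "cur Z" m] nprod_delta_right[of 0 "cur Z" n "of_int n / 2 * dt i Z" m]
      nprod_shift_left[of 1 0 "cur i" n "cur Z" m] nprod_shift_right[of 1 0 "cur Z" "cur i" n m]
    by (simp add: LS_def)
  moreover have "cf i Z *\<^sub>R nprod 1 n (cur i) (cur Z) (m + n) = cf i Z *\<^sub>R nprod 1 0 (cur i) (cur Z) (m + n)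
      + (of_int n * (cf i Z * cf i Z)) *\<^sub>R cur i (m + n)"
  proof (cases "i = Z")
    case False
    then have c: "cur i l * cur Z q = cur Z q * cur i l + cf i Z *\<^sub>R cur i (l + q)" for l q
      using cur_cur[of i l Z q] by (cases i) simp_all
    have "nprod 1 n (cur i) (cur Z) (m + n) = nprod 1 0 (cur i) (cur Z) (m + n) + of_int n *\<^sub>R (cf i Z *\<^sub>R cur i (m + n))"
      by (intro nprod_cut_const smooth_cur) (simp add: c)
    then show ?thesis by (simp add: scaleR_add_right mult_ac)
  qed simp
  moreover have "cf i Z *\<^sub>R (nprod 1 0 (cur i) (cur Z) (m + n) + nprod 1 0 (cur Z) (cur i) (m + n)) = 0"
    using psym_cur[of i Z "m + n"] by (cases i) (simp_all add: psym_def)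
  ultimately have "cur i n * LS m = LS m * cur i n + (of_int n * (cf i Z * cf i Z)) *\<^sub>R cur i (m + n)
     + (of_int n * dt i Z) *\<^sub>R cur Z (m + n)"
    by (simp add: scaleR_add_right algebra_simps scaleR_cancel_twice)
  then show ?thesis by (cases i) simp_all
qed

text \<open>For n >= 1 the two factors of each term commute, and one of their modes is at least
  n/2.\<close>

lemma smooth_LS: "smooth LS"
proof -
  have "LS n = LS n" for n ..
  have "app (LS n) x = 0" if A: "\<And>n. n \<ge> A \<Longrightarrow> app (cur Z n) x = 0" and n: "n \<ge> max 1 (2 * A)" for A n x
    unfolding LS_def nprod_def
  proof (rule app_lsum_zero)
    show "lfin (nterm 1 0 (cur Z) (cur Z) n)" by (rule lfin_nterm[OF smooth_cur smooth_cur])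
    fix j
    have c: "cur Z j * cur Z (n - j) = cur Z (n - j) * cur Z j"
      using cur_cur[of Z j Z "n - j"] n by simp
    have "app (cur Z j * cur Z (n - j)) x = 0"
    proof (cases "j \<ge> A")
      case True
      then show ?thesis unfolding c using A[of j] by simp
    next
      case False
      then show ?thesis using A[of "n - j"] n by simp
    qed
    then show "app (nterm 1 0 (cur Z) (cur Z) n j) x = 0"
      using c by (simp add: nterm_def)
  qed
  moreover have "\<exists>A. \<forall>n\<ge>A. app (cur Z n) x = 0" for x
    by (rule smoothD[OF smooth_cur])
  ultimately show ?thesis unfolding smooth_def by meson
qed

lemma virasoro_LS: "virasoro 1 LS"
  unfolding virasoro_def
proof (intro allI)
  fix m n :: int
  \<comment> \<open>The bracket of \<open>LS m\<close> with the Cartan current, indexed by the mode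
    i = m + j of the result.\<close>
  define K where "K i = (of_int (m - i)) *\<^sub>R cur Z i" for i :: int
  have K: "smooth K" unfolding K_def by (intro smooth_weight smooth_cur)
  have D: "LS m * cur Z j = cur Z j * LS m + K (m + j)" for j
    using LS_cur[of m Z j] by (simp add: K_def)
  have "LS m * LS n = LS n * LS m + nprod 1 m K (cur Z) (n + m) + nprod 1 0 (cur Z) K (n + m)"
    using nprod_deriv_even[OF smooth_cur smooth_cur smooth_shift[OF K] smooth_shift[OF K] D D, where \<epsilon> = 1 and m = 0 and p = n]
      nprod_shift_left[of 1 0 K m "cur Z" n] nprod_shift_right[of 1 0 "cur Z" K m n]
    by (simp add: LS_def[of n])
  \<comment> \<open>A discrete primitive of (m - i) i / 2, the central term crossed at i when the
    cut moves from 0 to m. The total gives (m^3 - m)/12, hence central charge 1.\<close>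
  moreover define T :: "int \<Rightarrow> real" where
    "T i = of_int m * of_int i * (of_int i - 1) / 4 - (of_int i - 1) * of_int i * (2 * of_int i - 1) / 12" for i
  have "nprod 1 m K (cur Z) (n + m) = nprod 1 0 K (cur Z) (n + m)
     + ((\<lambda>i. if m + n = 0 then T i *\<^sub>R (1::fop) else 0) m - (\<lambda>i. if m + n = 0 then T i *\<^sub>R (1::fop) else 0) 0)"
  proof (rule nprod_cut[OF K smooth_cur])
    fix i :: int
    have e: "of_int (m - i) * (of_int i / 2) = T (i + 1) - T i"
      by (simp add: field_simps T_def)
    have c: "cur Z i * cur Z (n + m - i) = cur Z (n + m - i) * cur Z i + (if m + n = 0 then (of_int i / 2) *\<^sub>R 1 else 0)"
      using cur_cur[of Z i Z "n + m - i"] by (simp add: add.commute)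
    have "K i * cur Z (n + m - i) = cur Z (n + m - i) * K i + (if m + n = 0 then (of_int (m - i) * (of_int i / 2)) *\<^sub>R 1 else 0)"
      unfolding K_def mult_scaleR_left mult_scaleR_right c scaleR_add_right by simp
    then show "K i * cur Z (n + m - i) = 1 *\<^sub>R (cur Z (n + m - i) * K i) +
      ((if m + n = 0 then T (i + 1) *\<^sub>R 1 else 0) - (if m + n = 0 then T i *\<^sub>R 1 else 0))"
      unfolding e by (simp add: scaleR_left_diff_distrib)
  qed
  moreover have "nprod 1 0 K (cur Z) (n + m) + nprod 1 0 (cur Z) K (n + m) = of_int (m - n) *\<^sub>R LS (m + n)"
    unfolding nprod_def LS_def
    by (subst lsum_add[symmetric], (intro lfin_nterm K smooth_cur)+, subst lsum_scaleR[symmetric], intro lfin_nterm smooth_cur,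
        rule arg_cong[of _ _ lsum])
      (auto simp: nterm_def K_def fun_eq_iff add.commute simp flip: scaleR_left_distrib)
  moreover have T: "T m - T 0 = 1 / 12 * (of_int m ^ 3 - of_int m)"
    by (simp add: T_def field_simps power3_eq_cube)
  ultimately show "LS m * LS n = LS n * LS m + of_int (m - n) *\<^sub>R LS (m + n)
     + (if m + n = 0 then (1 / 12 * (of_int m ^ 3 - of_int m)) *\<^sub>R 1 else 0)"
    by (simp add: scaleR_left_diff_distrib[symmetric] T add.assoc)
qed

end

section \<open>The real fermion with integer modes\<close>

locale ramond_fermion =
  fixes phi :: "int \<Rightarrow> fop"
  assumes smooth_phi: "smooth phi"
    and phi_CAR: "phi m * phi n + phi n * phi m = (if m + n = 0 then 1 else 0)"
begin

text \<open>Half of z d/dz applied to the sum of the \<open>phi i\<close> z^(-i).\<close>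

definition wphi :: "int \<Rightarrow> fop" where "wphi i = (- of_int i / 2) *\<^sub>R phi i"

text \<open>The constant 1/16 is the energy of the Ramond ground state; it is forced by the Virasoro
  relations, see the end of \<open>virasoro_LR\<close>.\<close>

definition LR :: "int \<Rightarrow> fop" where
  "LR p = nprod (-1) 0 wphi phi p + (if p = 0 then (1/16) *\<^sub>R 1 else 0)"

lemma smooth_wphi: "smooth wphi"
  unfolding wphi_def by (intro smooth_weight smooth_phi)

lemma phi_swap: "phi m * phi n = - (phi n * phi m) + (if m + n = 0 then 1 else 0)"
  using phi_CAR[of m n] unfolding eq_diff_eq[symmetric] uminus_add_conv_diff .

lemma LR_phi: "LR p * phi r = phi r * LR p + (- (of_int p / 2 + of_int r)) *\<^sub>R phi (p + r)"
proof -
  have 1: "phi r * wphi j = - (wphi j * phi r) + (if r + j = 0 then (of_int r / 2) *\<^sub>R 1 else 0)" for j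
  proof -
    have "(- of_int j / 2) *\<^sub>R (if r + j = 0 then 1 else 0) = (if r + j = 0 then (of_int r / 2) *\<^sub>R (1::fop) else 0)"
    proof (cases "r + j = 0")
      case True
      then have "r = - j" by linarith
      then show ?thesis by simp
    qed simp
    then show ?thesis unfolding wphi_def mult_scaleR_left mult_scaleR_right phi_swap[of r j] scaleR_add_right
      by (simp del: scaleR_left.minus divide_minus_left)
  qed
  have 2: "phi r * phi j = - (phi j * phi r) + (if r + j = 0 then 1 *\<^sub>R 1 else 0)" for j
    using phi_swap[of r j] by simp
  have "nprod (-1) 0 wphi phi p * phi r = phi r * nprod (-1) 0 wphi phi p - (of_int r / 2) *\<^sub>R phi (p + r) + 1 *\<^sub>R wphi (p + r)"
    by (rule nprod_deriv_odd[OF smooth_wphi smooth_phi 1 2])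
  also have "\<dots> = phi r * nprod (-1) 0 wphi phi p + (- (of_int p / 2 + of_int r)) *\<^sub>R phi (p + r)"
    by (simp add: wphi_def field_simps flip: scaleR_left_distrib scaleR_left_diff_distrib)
  finally show ?thesis by (simp add: LR_def distrib_left distrib_right)
qed

text \<open>Reflecting the summation index reverses the sign of every term except the one with both
  modes 0, which is minus the square of \<open>phi 0\<close>, that is -1/2. Adding 1/2 there makes
  the whole sum antisymmetric, hence 0.\<close>

lemma nprod_phi_phi: "nprod (-1) 0 phi phi p = (if p = 0 then (-1/2) *\<^sub>R 1 else 0)"
proof -
  let ?D = "\<lambda>j::int. if p = 0 \<and> j = 0 then (1/2) *\<^sub>R (1::fop) else 0"
  let ?F = "\<lambda>j. nterm (-1) 0 phi phi p j + ?D j"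
  have D: "lfin ?D" by (rule lfin_finite[of "{0}"]) auto
  have F: "lfin ?F" by (intro lfin_add lfin_nterm smooth_phi D)
  have "phi 0 * phi 0 = (1/2) *\<^sub>R 1"
    using arg_cong[OF phi_CAR[of 0 0], of "\<lambda>x. (1/2) *\<^sub>R x"] by (simp flip: scaleR_2)
  then have "?F (p - j) = - ?F j" for j
    using phi_swap[of j "p - j"] phi_swap[of "p - j" j] by (auto simp: nterm_def simp flip: scaleR_left_distrib)
  then have "lsum ?F = lsum (\<lambda>j. - ?F j)"
    using lsum_reindex[OF bij_uminus_int, of ?F p] by simp
  then have "lsum ?F = 0" using fop_double_eq_0 lsum_uminus[OF F] by simp
  moreover have "lsum ?F = nprod (-1) 0 phi phi p + lsum ?D"
    unfolding nprod_def by (rule lsum_add[OF lfin_nterm[OF smooth_phi smooth_phi] D])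
  moreover have "lsum ?D = (if p = 0 then (1/2) *\<^sub>R 1 else 0)"
    by (subst lsum_single[of 0]) auto
  ultimately show ?thesis by (auto simp: eq_neg_iff_add_eq_0)
qed

lemma smooth_LR: "smooth LR"
proof -
  have "app (LR n) x = 0" if A: "\<And>n. n \<ge> A \<Longrightarrow> app (phi n) x = 0" and n: "n \<ge> max 1 (2 * A)" for A n x
  proof -
    have "app (nprod (-1) 0 wphi phi n) x = 0" unfolding nprod_def
    proof (rule app_lsum_zero)
      show "lfin (nterm (-1) 0 wphi phi n)" by (rule lfin_nterm[OF smooth_wphi smooth_phi])
      fix j
      have c: "phi j * phi (n - j) = - (phi (n - j) * phi j)"
        using phi_swap[of j "n - j"] n by simp
      have "app (phi j * phi (n - j)) x = 0"
      proof (cases "j \<ge> A")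
        case True
        then show ?thesis unfolding c using A[of j] by simp
      next
        case False
        then show ?thesis using A[of "n - j"] n by simp
      qed
      then show "app (nterm (-1) 0 wphi phi n j) x = 0"
        using c by (simp add: nterm_def wphi_def)
    qed
    then show ?thesis using n by (simp add: LR_def)
  qed
  moreover have "\<exists>A. \<forall>n\<ge>A. app (phi n) x = 0" for x
    by (rule smoothD[OF smooth_phi])
  ultimately show ?thesis unfolding smooth_def by meson
qed

lemma virasoro_LR: "virasoro (1/2) LR"
  unfolding virasoro_def
proof (intro allI)
  fix m n :: int
  define K where "K i = (of_int (i - m) * (of_int i - of_int m / 2) / 2) *\<^sub>R phi i" for i :: int
  define K' where "K' i = (of_int m / 2 - of_int i) *\<^sub>R phi i" for i :: int
  have K: "smooth K" "smooth K'" unfolding K_def K'_def by (intro smooth_weight smooth_phi)+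
  have D2: "LR m * phi j = phi j * LR m + K' (m + j)" for j
  proof -
    have "of_int m / 2 - of_int (m + j) = - (of_int m / 2 + real_of_int j)" by simp
    then show ?thesis unfolding K'_def by (simp only: LR_phi)
  qed
  have D1: "LR m * wphi j = wphi j * LR m + K (m + j)" for j
  proof -
    have "(- of_int j / 2) * (of_int m / 2 - of_int (m + j)) = of_int (m + j - m) * (of_int (m + j) - real_of_int m / 2) / 2"
      by (simp add: field_simps)
    then show ?thesis
      unfolding wphi_def mult_scaleR_left mult_scaleR_right D2 scaleR_add_right K_def K'_def scaleR_scaleR by (simp only:)
  qed
  note D = D1 D2
  have e1: "LR m * nprod (-1) 0 wphi phi n = nprod (-1) 0 wphi phi n * LR m + nprod (-1) m K phi (n + m) + nprod (-1) 0 wphi K' (n + m)"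
    using nprod_deriv_even[OF smooth_wphi smooth_phi smooth_shift[OF K(1)] smooth_shift[OF K(2)] D, where \<epsilon> = "-1" and m = 0 and p = n]
      nprod_shift_left[of "-1" 0 K m phi n] nprod_shift_right[of "-1" 0 wphi K' m n]
    by simp
  \<comment> \<open>A discrete primitive of (i - m)(i - m/2)/2, the coefficient in
    \<open>K\<close>.\<close>
  define T :: "int \<Rightarrow> real" where
    "T i = (of_int i - 1) * of_int i * (2 * of_int i - 1) / 12 - 3 * of_int m * of_int i * (of_int i - 1) / 8 + of_int m ^ 2 * of_int i / 4" for i
  have e2: "nprod (-1) m K phi (n + m) = nprod (-1) 0 K phi (n + m)
     + ((\<lambda>i. if m + n = 0 then T i *\<^sub>R (1::fop) else 0) m - (\<lambda>i. if m + n = 0 then T i *\<^sub>R (1::fop) else 0) 0)"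
  proof (rule nprod_cut[OF K(1) smooth_phi])
    fix i :: int
    have e: "(of_int (i - m) * (of_int i - of_int m / 2) / 2 :: real) = T (i + 1) - T i"
      by (simp add: field_simps T_def power2_eq_square)
    have c: "phi i * phi (n + m - i) = (-1) *\<^sub>R (phi (n + m - i) * phi i) + (if m + n = 0 then 1 else 0)"
      using phi_swap[of i "n + m - i"] by (simp add: add.commute)
    have "K i * phi (n + m - i) = (-1) *\<^sub>R (phi (n + m - i) * K i)
      + (if m + n = 0 then (of_int (i - m) * (of_int i - real_of_int m / 2) / 2) *\<^sub>R 1 else 0)"
      unfolding K_def mult_scaleR_left mult_scaleR_right c scaleR_add_right by simp
    then show "K i * phi (n + m - i) = (-1) *\<^sub>R (phi (n + m - i) * K i) +
      ((if m + n = 0 then T (i + 1) *\<^sub>R 1 else 0) - (if m + n = 0 then T i *\<^sub>R 1 else 0))"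
      unfolding e by (simp add: scaleR_left_diff_distrib)
  qed
  \<comment> \<open>The coefficients of the two products add up to (m - n)(-j/2) + m^2/4. The first
    part belongs to \<open>wphi\<close>; the second leaves the scalar of
    \<open>nprod_phi_phi\<close>.\<close>
  have e3: "nprod (-1) 0 K phi (n + m) + nprod (-1) 0 wphi K' (n + m)
     = of_int (m - n) *\<^sub>R nprod (-1) 0 wphi phi (m + n) + (of_int m ^ 2 / 4) *\<^sub>R nprod (-1) 0 phi phi (m + n)"
  proof -
    have "nterm (-1) 0 K phi (n + m) j + nterm (-1) 0 wphi K' (n + m) j
      = of_int (m - n) *\<^sub>R nterm (-1) 0 wphi phi (m + n) j + (of_int m ^ 2 / 4) *\<^sub>R nterm (-1) 0 phi phi (m + n) j" for j
      by (auto simp: nterm_def K_def K'_def wphi_def add.commute[of n m] simp flip: scaleR_left_distrib scaleR_left_diff_distrib scaleR_minus_left)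
        (auto simp: field_simps power2_eq_square)
    then show ?thesis
      unfolding nprod_def
      by (subst lsum_add[symmetric], (intro lfin_nterm K smooth_phi smooth_wphi)+,
          subst lsum_scaleR[symmetric], intro lfin_nterm smooth_phi smooth_wphi,
          subst lsum_scaleR[symmetric], intro lfin_nterm smooth_phi,
          subst lsum_add[symmetric], intro lfin_scaleR lfin_nterm smooth_phi smooth_wphi,
          intro lfin_scaleR lfin_nterm smooth_phi smooth_wphi) simp
  qed
  have "LR m * nprod (-1) 0 wphi phi n = nprod (-1) 0 wphi phi n * LR m + (nprod (-1) 0 K phi (n + m) + nprod (-1) 0 wphi K' (n + m))
     + (if m + n = 0 then (T m - T 0) *\<^sub>R 1 else 0)"
    unfolding e1 e2 by (simp add: scaleR_left_diff_distrib)
  then have "LR m * nprod (-1) 0 wphi phi n = nprod (-1) 0 wphi phi n * LR m + of_int (m - n) *\<^sub>R nprod (-1) 0 wphi phi (m + n)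
     + (if m + n = 0 then (T m - T 0 - of_int m ^ 2 / 8) *\<^sub>R 1 else 0)"
    unfolding e3 by (simp add: nprod_phi_phi scaleR_left_diff_distrib)
  then have "LR m * LR n = LR n * LR m + of_int (m - n) *\<^sub>R nprod (-1) 0 wphi phi (m + n)
     + (if m + n = 0 then (T m - T 0 - of_int m ^ 2 / 8) *\<^sub>R 1 else 0)"
    unfolding LR_def[of n] by (simp add: distrib_left distrib_right)
  \<comment> \<open>For n = -m the surplus over the cubic expression is m/8 = 2m/16, exactly what
    the constant 1/16 in \<open>LR 0\<close> supplies.\<close>
  moreover have "T m - T 0 - of_int m ^ 2 / 8 = of_int (m - n) / 16 + 1 / 24 * (of_int m ^ 3 - of_int m)" if "m + n = 0"
  proof -
    have "n = - m" using that by linarith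
    then show ?thesis by (simp add: T_def field_simps power2_eq_square power3_eq_cube)
  qed
  ultimately show "LR m * LR n = LR n * LR m + of_int (m - n) *\<^sub>R LR (m + n)
     + (if m + n = 0 then (1 / 2 / 12 * (of_int m ^ 3 - of_int m)) *\<^sub>R 1 else 0)"
    unfolding LR_def[of "m + n"] by (simp add: scaleR_add_right scaleR_left_distrib)
qed

end

text \<open>Under j to p - j the condition j < 0 becomes p - j >= p + 1, whence the cut p +
  1.\<close>

lemma nprod_flip: "nprod 1 0 B A p = nprod 1 (p + 1) A B p"
proof -
  have "nterm 1 (p + 1) A B p (p - j) = nterm 1 0 B A p j" for j
    by (auto simp: nterm_def)
  then show ?thesis
    using lsum_reindex[OF bij_uminus_int, of "nterm 1 (p + 1) A B p" p] by (simp add: nprod_def)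
qed

section \<open>The relations at level M\<close>

text \<open>The relations of the W-algebra modes in the basis \<open>idx\<close>, with
  \<open>G\<close> equal to -i sqrt M times \<open>g\<close>. The central charge (3M - 1)/2 is that
  of M sites with c = 1 and M - 1 real fermions with c = 1/2.\<close>

locale wlevel =
  fixes M :: real and J :: "idx \<Rightarrow> int \<Rightarrow> fop" and L :: "int \<Rightarrow> fop" and g :: "idx \<Rightarrow> int \<Rightarrow> fop"
  assumes M_ge: "M \<ge> 1"
    and smooth_J: "smooth (J i)" and smooth_L: "smooth L" and smooth_g: "smooth (g i)"
    and JJ: "J i m * J k n = J k n * J i m + cf i k *\<^sub>R J (brk i k) (m + n)
      + (if m + n = 0 then (M * (of_int m / 2 * dt i k)) *\<^sub>R 1 else 0)"
    and Jg: "J i m * g k n = g k n * J i m + cf i k *\<^sub>R g (brk i k) (m + n)"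
    and LJ: "L m * J i n = J i n * L m + (- of_int n) *\<^sub>R J i (m + n)"
    and Lg: "L m * g i n = g i n * L m + (of_int m / 2 - of_int n) *\<^sub>R g i (m + n)"
    and LL: "virasoro ((3 * M - 1) / 2) L"
    and gg: "g i m * g k n = - (g k n * g i m) + dt i k *\<^sub>R L (m + n) - (1 / M) *\<^sub>R psym J i k (m + n)
      + ((M - 1) / M * (of_int (m - n) / 2 * cf i k)) *\<^sub>R J (brk i k) (m + n)
      + (if m + n = 0 then ((M - 1) / 4 * (of_int m ^ 2 - 1 / 4) * dt i k) *\<^sub>R 1 else 0)"

text \<open>For M = 1 the terms with the factor M - 1 disappear and the relation \<open>gg\<close>
  reads 0 = dt L - psym, which is \<open>psym_cur\<close>.\<close>

lemma (in su2_site) wlevel_1: "wlevel 1 cur LS (\<lambda>_ _. 0)"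
proof
  show "cur i m * cur k n = cur k n * cur i m + cf i k *\<^sub>R cur (brk i k) (m + n)
      + (if m + n = 0 then (1 * (of_int m / 2 * dt i k)) *\<^sub>R 1 else 0)" for i m k n
    unfolding mult_1 by (rule cur_cur)
qed (simp_all add: smooth_cur smooth_LS smooth_zero LS_cur virasoro_LS psym_cur)

context su2_site
begin

text \<open>The sign picked up at each fermion cancels in bilinear expressions.\<close>

lemma cur_comm:
  assumes "\<And>n. D * a n = \<sigma> *\<^sub>R (a n * D)" "\<And>n. D * ad n = \<sigma> *\<^sub>R (ad n * D)"
    "\<And>n. D * b n = \<sigma> *\<^sub>R (b n * D)" "\<And>n. D * bd n = \<sigma> *\<^sub>R (bd n * D)" "\<sigma> * \<sigma> = 1"
  shows "D * cur i n = cur i n * D"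
proof -
  have "D * eP n = eP n * D" "D * fN n = fN n * D"
    "D * nprod (-1) 0 a ad n = nprod (-1) 0 a ad n * D" "D * nprod (-1) 0 bd b n = nprod (-1) 0 bd b n * D"
    using nprod_central[OF smooth_a smooth_b assms(1,3,5)] nprod_central[OF smooth_bd smooth_ad assms(4,2,5)]
      nprod_central[OF smooth_a smooth_ad assms(1,2,5)] nprod_central[OF smooth_bd smooth_b assms(4,3,5)]
    by (simp_all add: eP_def fN_def \<open>\<sigma> * \<sigma> = 1\<close>)
  then show ?thesis
    by (cases i) (simp_all add: cur.simps hZ_def right_diff_distrib left_diff_distrib)
qed

lemma LS_comm:
  assumes "\<And>n. D * cur Z n = cur Z n * D"
  shows "D * LS n = LS n * D"
  unfolding LS_def using nprod_central[OF smooth_cur smooth_cur, where D = D and \<sigma> = 1 and \<tau> = 1] assms by simp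

end

section \<open>The step from level M to level M + 1\<close>

locale wstep = wlevel M J L g + su2_site a ad b bd + ramond_fermion phi
  for M J L g a ad b bd phi +
  assumes J_comm: "J i m * a n = a n * J i m" "J i m * ad n = ad n * J i m" "J i m * b n = b n * J i m"
      "J i m * bd n = bd n * J i m" "J i m * phi n = phi n * J i m"
    and L_comm: "L m * a n = a n * L m" "L m * ad n = ad n * L m" "L m * b n = b n * L m"
      "L m * bd n = bd n * L m" "L m * phi n = phi n * L m"
    and g_comm: "g i m * a n = - (a n * g i m)" "g i m * ad n = - (ad n * g i m)" "g i m * b n = - (b n * g i m)"
      "g i m * bd n = - (bd n * g i m)" "g i m * phi n = - (phi n * g i m)"
    and phi_comm: "phi m * a n = - (a n * phi m)" "phi m * ad n = - (ad n * phi m)" "phi m * b n = - (b n * phi m)"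
      "phi m * bd n = - (bd n * phi m)"
begin

lemma cur_comms:
  "J k m * cur i n = cur i n * J k m" "L m * cur i n = cur i n * L m"
  "g k m * cur i n = cur i n * g k m" "phi m * cur i n = cur i n * phi m"
  using cur_comm[of "J k m" 1] cur_comm[of "L m" 1] cur_comm[of "g k m" "-1"] cur_comm[of "phi m" "-1"]
  by (simp_all add: J_comm L_comm g_comm phi_comm)

lemma LS_comms:
  "J k m * LS n = LS n * J k m" "L m * LS n = LS n * L m" "g k m * LS n = LS n * g k m" "phi m * LS n = LS n * phi m"
  using LS_comm cur_comms by auto

lemma LR_comm:
  assumes "\<And>n. D * phi n = \<sigma> *\<^sub>R (phi n * D)" "\<sigma> * \<sigma> = 1"
  shows "D * LR n = LR n * D"
proof -
  have w: "D * wphi n = \<sigma> *\<^sub>R (wphi n * D)" for n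
    by (simp add: wphi_def assms)
  show ?thesis
    using nprod_central[OF smooth_wphi smooth_phi w assms(1,2), where \<epsilon> = "-1" and m = 0 and p = n] assms(2)
    by (simp add: LR_def distrib_left distrib_right)
qed

lemma LR_comms:
  "J k m * LR n = LR n * J k m" "L m * LR n = LR n * L m" "g k m * LR n = LR n * g k m"
  "cur k m * LR n = LR n * cur k m" "LS m * LR n = LR n * LS m"
  using LR_comm[of "J k m" 1] LR_comm[of "L m" 1] LR_comm[of "g k m" "-1"] LR_comm[of "cur k m" 1] LR_comm[of "LS m" 1]
  by (simp_all add: J_comm L_comm g_comm cur_comms LS_comms)

text \<open>The value for which \<open>X\<close> has the central term of a current of level 1: nrm^2
  (M + M^2) = 1.\<close>

definition nrm :: real where "nrm = 1 / sqrt (M * (M + 1))"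

lemma nrm_square: "nrm * nrm = 1 / (M * (M + 1))"
  using M_ge by (simp add: nrm_def)

lemma nrm_simps:
  "1 / M = 1 / (M + 1) + nrm * nrm" "nrm * nrm * M = 1 / (M + 1)" "nrm * nrm * (M * M) = 1 - 1 / (M + 1)"
  "(M - 1) / M + nrm * nrm = (M + 1 - 1) / (M + 1)" "nrm * nrm * (M * M) = (M + 1 - 1) / (M + 1)"
proof -
  have nz: "M \<noteq> 0" "M + 1 \<noteq> 0" using M_ge by auto
  show 1: "1 / M = 1 / (M + 1) + nrm * nrm"
    unfolding nrm_square using nz by (simp add: divide_simps)
  show 2: "nrm * nrm * M = 1 / (M + 1)"
    unfolding nrm_square using nz by (simp add: divide_simps)
  have "nrm * nrm * (M * M) = M / (M + 1)"
    unfolding mult.assoc[symmetric] 2 by simp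
  also have "M / (M + 1) = 1 - 1 / (M + 1)"
    using nz by (simp add: divide_simps)
  finally show "nrm * nrm * (M * M) = 1 - 1 / (M + 1)" .
  with \<open>M / (M + 1) = 1 - 1 / (M + 1)\<close> show "nrm * nrm * (M * M) = (M + 1 - 1) / (M + 1)" by simp
  have "(M - 1) / M = 1 - 1 / M" using nz by (simp add: divide_simps)
  with 1 \<open>M / (M + 1) = 1 - 1 / (M + 1)\<close> show "(M - 1) / M + nrm * nrm = (M + 1 - 1) / (M + 1)" by simp
qed

definition J' :: "idx \<Rightarrow> int \<Rightarrow> fop" where "J' i n = J i n + cur i n"
definition L' :: "int \<Rightarrow> fop" where "L' n = L n + LS n + LR n"
text \<open>The combination whose bracket with the diagonal current \<open>J'\<close> has no central
  term: the level M of \<open>J\<close> cancels against M times the level 1 of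
  \<open>cur\<close>.\<close>

definition X :: "idx \<Rightarrow> int \<Rightarrow> fop" where "X i n = nrm *\<^sub>R (J i n - M *\<^sub>R cur i n)"
text \<open>The current in the bracket of \<open>X\<close> with itself; the coefficients of
  \<open>X\<close> are squared, so -M becomes M^2.\<close>

definition Y :: "idx \<Rightarrow> int \<Rightarrow> fop" where "Y i n = (nrm * nrm) *\<^sub>R (J i n + (M * M) *\<^sub>R cur i n)"
definition Q :: "idx \<Rightarrow> int \<Rightarrow> fop" where "Q i = nprod 1 0 phi (X i)"
definition R :: "idx \<Rightarrow> int \<Rightarrow> fop" where "R i = nprod 1 0 phi (Y i)"
definition g' :: "idx \<Rightarrow> int \<Rightarrow> fop" where "g' i n = g i n + Q i n"

lemma smooth_XY: "smooth (X i)" "smooth (Y i)"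
  unfolding X_def Y_def by (intro smooth_intros smooth_J smooth_cur)+

lemma phi_XY: "phi m * X i n = X i n * phi m" "phi m * Y i n = Y i n * phi m"
  by (simp_all add: X_def Y_def J_comm cur_comms algebra_simps)

lemma smooth_QR: "smooth (Q i)" "smooth (R i)"
  unfolding Q_def R_def
  by (rule smooth_nprod[OF smooth_phi smooth_XY(1)], simp add: phi_XY,
      rule smooth_nprod[OF smooth_phi smooth_XY(2)], simp add: phi_XY)

lemma XX: "X i m * X k n = X k n * X i m + cf i k *\<^sub>R Y (brk i k) (m + n)
    + (if m + n = 0 then (of_int m / 2 * dt i k) *\<^sub>R 1 else 0)"
proof -
  have "nrm * nrm * (M * (of_int m / 2 * dt i k) + M * M * (of_int m / 2 * dt i k)) = of_int m / 2 * dt i k"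
  proof -
    have "M * (M + 1) \<noteq> 0" using M_ge by simp
    have "nrm * nrm * (M * (of_int m / 2 * dt i k) + M * M * (of_int m / 2 * dt i k))
      = (nrm * nrm) * (M * (M + 1)) * (of_int m / 2 * dt i k)"
      by (simp add: algebra_simps)
    then show ?thesis using \<open>M * (M + 1) \<noteq> 0\<close> by (simp add: nrm_square)
  qed
  then have c: "(nrm * nrm) *\<^sub>R ((M * (of_int m / 2 * dt i k)) *\<^sub>R 1 + (M * M) *\<^sub>R ((of_int m / 2 * dt i k) *\<^sub>R 1)) = (of_int m / 2 * dt i k) *\<^sub>R (1::fop)"
    unfolding scaleR_left_distrib[symmetric] scaleR_scaleR by simp
  have "X i m * X k n - X k n * X i m = (nrm * nrm) *\<^sub>R ((J i m * J k n - J k n * J i m) + (M * M) *\<^sub>R (cur i m * cur k n - cur k n * cur i m))"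
    by (simp add: X_def algebra_simps cur_comms)
  also have "\<dots> = cf i k *\<^sub>R Y (brk i k) (m + n) + (if m + n = 0 then (of_int m / 2 * dt i k) *\<^sub>R 1 else 0)"
  proof -
    have "J i m * J k n - J k n * J i m = cf i k *\<^sub>R J (brk i k) (m + n) + (if m + n = 0 then (M * (of_int m / 2 * dt i k)) *\<^sub>R 1 else 0)"
      "cur i m * cur k n - cur k n * cur i m = cf i k *\<^sub>R cur (brk i k) (m + n) + (if m + n = 0 then (of_int m / 2 * dt i k) *\<^sub>R 1 else 0)"
      unfolding JJ[of i m k n] cur_cur[of i m k n] by simp_all
    then have "(nrm * nrm) *\<^sub>R ((J i m * J k n - J k n * J i m) + (M * M) *\<^sub>R (cur i m * cur k n - cur k n * cur i m))
      = cf i k *\<^sub>R Y (brk i k) (m + n) + (if m + n = 0 then (nrm * nrm) *\<^sub>R ((M * (of_int m / 2 * dt i k)) *\<^sub>R 1 + (M * M) *\<^sub>R ((of_int m / 2 * dt i k) *\<^sub>R 1)) else 0)"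
      by (simp only: Y_def split: if_split) (simp add: scaleR_add_right mult_ac)
    then show ?thesis unfolding c .
  qed
  finally show ?thesis by (simp add: diff_eq_eq ac_simps)
qed

lemma J'X: "J' i m * X k n = X k n * J' i m + cf i k *\<^sub>R X (brk i k) (m + n)"
proof -
  have "J' i m * X k n - X k n * J' i m = nrm *\<^sub>R ((J i m * J k n - J k n * J i m) - M *\<^sub>R (cur i m * cur k n - cur k n * cur i m))"
    by (simp add: X_def J'_def algebra_simps cur_comms)
  also have "\<dots> = cf i k *\<^sub>R X (brk i k) (m + n)"
    unfolding JJ[of i m k n] cur_cur[of i m k n] by (simp add: X_def algebra_simps)
  finally show ?thesis by (simp add: diff_eq_eq ac_simps)
qed

lemma L'X: "L' m * X k n = X k n * L' m + (- of_int n) *\<^sub>R X k (m + n)"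
proof -
  have "L' m * X k n - X k n * L' m = nrm *\<^sub>R ((L m * J k n - J k n * L m) - M *\<^sub>R (LS m * cur k n - cur k n * LS m))"
    by (simp add: X_def L'_def algebra_simps cur_comms LS_comms LR_comms)
  also have "\<dots> = (- of_int n) *\<^sub>R X k (m + n)"
    unfolding LJ LS_cur by (simp add: X_def algebra_simps)
  finally show ?thesis by (simp add: diff_eq_eq ac_simps)
qed

lemma gX: "g i m * X k n = X k n * g i m + (nrm * cf i k) *\<^sub>R g (brk i k) (m + n)"
proof -
  have "g i m * X k n - X k n * g i m = - (nrm *\<^sub>R (J k n * g i m - g i m * J k n))"
    by (simp add: X_def algebra_simps cur_comms)
  also have "\<dots> = (nrm * cf i k) *\<^sub>R g (brk i k) (m + n)"
    unfolding Jg by (simp add: idx_sym(2)[of k i] idx_sym(1)[of k i] add.commute)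
  finally show ?thesis by (simp add: diff_eq_eq ac_simps)
qed

lemma Q_phi: "Q i m * phi j = - (phi j * Q i m) + X i (m + j)"
proof -
  have A: "phi j * phi l = (-1) *\<^sub>R (phi l * phi j) + (if j + l = 0 then 1 *\<^sub>R 1 else 0)" for l
    using phi_swap[of j l] by simp
  have B: "phi j * X i l = 1 *\<^sub>R (X i l * phi j) + 0" for l by (simp add: phi_XY)
  have "phi j * Q i m = - (Q i m * phi j) + X i (m + j)"
    using nprod_deriv[OF smooth_phi smooth_XY(1) smooth_delta[of j "1 *\<^sub>R 1"] smooth_zero A B, where \<epsilon> = 1 and m = 0 and p = m]
      nprod_delta_left[of 0 j 1 "X i" m]
    by (simp add: Q_def)
  then show ?thesis by simp
qed

lemma Q_X: "Q i m * X k q = X k q * Q i m + cf i k *\<^sub>R R (brk i k) (m + q) - (of_int q / 2 * dt i k) *\<^sub>R phi (m + q)"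
proof -
  have B: "X k q * X i l = X i l * X k q + (cf k i *\<^sub>R Y (brk k i) (q + l) + (if q + l = 0 then (of_int q / 2 * dt k i) *\<^sub>R 1 else 0))" for l
    using XX[of k q i l] by simp
  have A: "X k q * phi l = phi l * X k q + 0" for l by (simp add: phi_XY)
  have sm: "smooth (\<lambda>l. cf k i *\<^sub>R Y (brk k i) (q + l))" "smooth (\<lambda>l. if q + l = 0 then (of_int q / 2 * dt k i) *\<^sub>R (1::fop) else 0)"
    by (intro smooth_weight smooth_shift smooth_XY smooth_delta)+
  have "X k q * Q i m = Q i m * X k q + cf k i *\<^sub>R R (brk k i) (m + q) + (of_int q / 2 * dt k i) *\<^sub>R phi (m + q)"
    unfolding Q_def R_def
    using nprod_deriv_even[OF smooth_phi smooth_XY(1) smooth_zero smooth_add[OF sm] A B, where \<epsilon> = 1 and m = 0 and p = m]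
      nprod_add_right[OF smooth_phi sm, of 1 0 m]
      nprod_scaleR_right[OF smooth_phi smooth_shift[OF smooth_XY(2)], of 1 0 "cf k i" "brk k i" q m]
      nprod_shift_right[of 1 0 phi "Y (brk k i)" q m]
      nprod_delta_right[of 0 phi q "of_int q / 2 * dt k i" m]
    by simp
  then show ?thesis
    by (simp add: idx_sym(1)[of k i] idx_sym(2)[of k i] idx_sym(3)[of k i])
qed

text \<open>A mode of the field phi(z) phi(z) Y(z), in which phi(z) phi(z) reduces to a scalar as in
  \<open>nprod_phi_phi\<close>. The two modes of \<open>phi\<close> are summed over
  antisymmetrically.\<close>

lemma phi_R: "nprod (-1) 0 phi (R i) p = (-1/2) *\<^sub>R Y i p"
proof -
  define F where "F j t = (if j < 0 then phi j * phi t else - (phi t * phi j)) * Y i (p - j - t)" for j t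
  \<comment> \<open>At j = t = 0 the summand \<open>F\<close> is -1/2 times \<open>Y i p\<close>;
    the correction makes \<open>F'\<close> antisymmetric in j and t.\<close>
  define F' where "F' j t = F j t + (if j = 0 \<and> t = 0 then (1/2) *\<^sub>R Y i p else 0)" for j t
  have Yt: "nterm 1 0 phi (Y i) l = (\<lambda>t. phi t * Y i (l - t))" for l
    by (simp add: nterm_def fun_eq_iff phi_XY)
  have lY: "lfin (\<lambda>t. phi t * Y i (l - t))" for l
    using lfin_nterm[OF smooth_phi smooth_XY(2), of 1 0 i l] by (simp add: Yt)
  have Rl: "R i l = lsum (\<lambda>t. phi t * Y i (l - t))" for l
    by (simp add: R_def nprod_def Yt)
  have inner: "nterm (-1) 0 phi (R i) p j = lsum (F j)" and lF: "lfin (F j)" for j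
  proof -
    have F: "F j = (if j < 0 then (\<lambda>t. phi j * (phi t * Y i (p - j - t))) else (\<lambda>t. - (phi t * Y i (p - j - t) * phi j)))"
      by (simp add: F_def fun_eq_iff mult.assoc phi_XY(2)[symmetric])
    show "nterm (-1) 0 phi (R i) p j = lsum (F j)"
      unfolding F by (simp add: nterm_def Rl lsum_mult_left lY lsum_mult_right lsum_uminus lfin_mult_right)
    show "lfin (F j)"
      unfolding F by (simp add: lfin_mult_left lY lfin_uminus lfin_mult_right)
  qed
  have "phi 0 * phi 0 = (1/2) *\<^sub>R 1"
    using arg_cong[OF phi_CAR[of 0 0], of "\<lambda>x. (1/2) *\<^sub>R x"] by (simp flip: scaleR_2)
  then have "(if j < 0 then phi j * phi t else - (phi t * phi j)) + (if t < 0 then phi t * phi j else - (phi j * phi t))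
      = (if j = 0 \<and> t = 0 then -1 else 0)" for j t
  proof (cases "j = 0 \<and> t = 0")
    case True
    have "- ((1/2) *\<^sub>R (1::fop)) - (1/2) *\<^sub>R 1 = - ((1/2 + 1/2) *\<^sub>R 1)"
      unfolding scaleR_left_distrib by simp
    with True \<open>phi 0 * phi 0 = (1/2) *\<^sub>R 1\<close> show ?thesis by simp
  next
    case False
    show ?thesis
    proof (cases "j + t = 0")
      case True
      with False have "(j < 0) \<noteq> (t < 0)" by linarith
      then show ?thesis using False by auto
    next
      case nz: False
      then have "phi j * phi t = - (phi t * phi j)" by (simp add: phi_swap[of j t])
      then show ?thesis using False by auto
    qed
  qed
  then have "F j t + F t j = (if j = 0 \<and> t = 0 then -1 else 0) * Y i (p - j - t)" for j t
    unfolding F_def diff_diff_eq add.commute[of t j] distrib_right[symmetric] by simp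
  moreover have "F' j t + F' t j = (F j t + F t j) + (if j = 0 \<and> t = 0 then (1/2 + 1/2) *\<^sub>R Y i p else 0)" for j t
    unfolding F'_def scaleR_left_distrib by simp
  ultimately have "F' j t + F' t j = 0" for j t
    by simp
  then have anti: "F' j t = - F' t j" for j t
    by (simp add: eq_neg_iff_add_eq_0)
  have box: "\<exists>K L. \<forall>j t. app (F' j t) x \<noteq> 0 \<longrightarrow> K \<le> j \<and> j \<le> L \<and> K \<le> t \<and> t \<le> L" for x
  proof -
    obtain A B where AB: "\<And>n. n \<ge> A \<Longrightarrow> app (phi n) x = 0" "\<And>n. n \<ge> B \<Longrightarrow> app (Y i n) x = 0"
      using smooth_phi smooth_XY unfolding smooth_def by metis
    have 1: "j \<le> max 0 A" if h: "app (F' j t) x \<noteq> 0" for j t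
    proof (rule ccontr)
      assume "\<not> j \<le> max 0 A"
      then have "F' j t = - (phi t * Y i (p - j - t) * phi j)" "app (phi j) x = 0"
        using AB(1)[of j] by (auto simp: F'_def F_def mult.assoc phi_XY(2)[symmetric])
      with h show False by simp
    qed
    have 2: "t \<le> max 0 A" if h: "app (F' j t) x \<noteq> 0" for j t
    proof -
      have "app (F' j t) x = - app (F' t j) x" by (subst anti) simp
      with h 1[of t j] show ?thesis by simp
    qed
    have 3: "p - j - t \<le> max p B" if h: "app (F' j t) x \<noteq> 0" for j t
    proof (rule ccontr)
      assume "\<not> p - j - t \<le> max p B"
      then have "\<not> (j = 0 \<and> t = 0)" "app (Y i (p - j - t)) x = 0" using AB(2)[of "p - j - t"] by auto
      with h show False by (auto simp: F'_def F_def)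
    qed
    have "p - max p B - max 0 A \<le> j \<and> j \<le> max 0 A \<and> p - max p B - max 0 A \<le> t \<and> t \<le> max 0 A"
      if "app (F' j t) x \<noteq> 0" for j t
      using 1[OF that] 2[OF that] 3[OF that] by linarith
    then show ?thesis by blast
  qed
  have lF': "lfin (F' j)" for j
    by (rule lfin_int_box) (use box in metis)
  let ?D = "\<lambda>j::int. if j = 0 then (1/2) *\<^sub>R Y i p else 0"
  have D: "lsum (F' j) = lsum (F j) + ?D j" for j
  proof -
    have "lsum (F' j) = lsum (F j) + lsum (\<lambda>t::int. if j = 0 \<and> t = 0 then (1/2) *\<^sub>R Y i p else 0)"
      unfolding F'_def by (rule lsum_add[OF lF]) (rule lfin_finite[of "{0}"]; auto)
    then show ?thesis by (subst (asm) (2) lsum_single[of 0]) auto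
  qed
  have l: "lfin (\<lambda>j. lsum (F j))" unfolding inner[symmetric] by (rule lfin_nterm[OF smooth_phi smooth_QR(2)])
  have lD: "lfin ?D" by (rule lfin_finite[of "{0}"]) auto
  have l': "lfin (\<lambda>j. lsum (F' j))" unfolding D by (rule lfin_add[OF l lD])
  have "lsum (\<lambda>j. lsum (F' j)) = lsum (\<lambda>t. lsum (\<lambda>j. F' j t))" by (rule lsum_swap_box[OF box])
  also have "\<dots> = lsum (\<lambda>t. lsum (\<lambda>j. - F' t j))"
    using anti by (intro arg_cong[of _ _ lsum] ext) metis
  also have "\<dots> = - lsum (\<lambda>t. lsum (F' t))"
    by (simp add: lsum_uminus lF' l')
  finally have "lsum (\<lambda>j. lsum (F' j)) = 0" by (rule fop_double_eq_0)
  then have "lsum (\<lambda>j. lsum (F j)) + lsum ?D = 0"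
    unfolding D by (simp add: lsum_add[OF l lD])
  moreover have "lsum ?D = (1/2) *\<^sub>R Y i p" by (subst lsum_single[of 0]) auto
  moreover have "nterm (-1) 0 phi (R i) p = (\<lambda>j. lsum (F j))" using inner by auto
  ultimately show ?thesis
    by (simp add: nprod_def eq_neg_iff_add_eq_0)
qed

text \<open>By \<open>nprod_flip\<close> the symmetrised product is the mean of the products with
  cuts 0 and p + 1, which explains the shift by (p + 1)/2.\<close>

lemma psym_X: "nprod 1 m (X i) (X k) p = psym X i k p + ((of_int m - (of_int p + 1) / 2) * cf i k) *\<^sub>R Y (brk i k) p
    + (if p = 0 then (of_int m * (of_int m - 1) / 4 * dt i k) *\<^sub>R 1 else 0)"
proof -
  define T :: "int \<Rightarrow> fop" where "T l = (of_int l * cf i k) *\<^sub>R Y (brk i k) p + (if p = 0 then (of_int l * (of_int l - 1) / 4 * dt i k) *\<^sub>R 1 else 0)" for l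
  have cut: "nprod 1 m (X i) (X k) p = nprod 1 0 (X i) (X k) p + (T m - T 0)" for m
  proof (rule nprod_cut[OF smooth_XY(1) smooth_XY(1)])
    fix l
    define t y where "t l = of_int l * (of_int l - 1) / 4 * dt i k" and "y l = of_int l * cf i k" for l :: int
    have "T l = y l *\<^sub>R Y (brk i k) p + (if p = 0 then t l *\<^sub>R 1 else 0)" for l
      by (simp add: T_def t_def y_def)
    then have "T (l + 1) - T l = (y (l + 1) - y l) *\<^sub>R Y (brk i k) p + (if p = 0 then (t (l + 1) - t l) *\<^sub>R 1 else 0)"
      by (simp add: scaleR_left_diff_distrib)
    moreover have "t (l + 1) - t l = of_int l / 2 * dt i k" "y (l + 1) - y l = cf i k"
      by (simp_all add: t_def y_def field_simps)
    ultimately have "T (l + 1) - T l = cf i k *\<^sub>R Y (brk i k) p + (if p = 0 then (of_int l / 2 * dt i k) *\<^sub>R 1 else 0)"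
      by simp
    then show "X i l * X k (p - l) = 1 *\<^sub>R (X k (p - l) * X i l) + (T (l + 1) - T l)"
      using XX[of i l k "p - l"] by simp
  qed
  have "T (p + 1) = ((of_int p + 1) * cf i k) *\<^sub>R Y (brk i k) p" "T 0 = 0"
    by (auto simp: T_def)
  then have "psym X i k p = nprod 1 0 (X i) (X k) p + ((of_int p + 1) / 2 * cf i k) *\<^sub>R Y (brk i k) p"
    unfolding psym_def nprod_flip[of "X k" "X i"] cut[of "p + 1"] by (simp add: scaleR_add_right) (simp flip: scaleR_left_distrib)
  then show ?thesis unfolding cut[of m] using \<open>T 0 = 0\<close> by (simp add: T_def left_diff_distrib scaleR_left_diff_distrib)
qed

text \<open>The Leibniz rule leaves three products: X X gives the symmetrised square and the cut
  terms, phi R gives a multiple of \<open>Y\<close>, and phi times \<open>W\<close> gives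
  \<open>LR\<close>. The scalars m (m - 1)/4, from the cut of X X, and m/4 - 1/16, from the ordering
  of phi, add up to (m^2 - 1/4)/4.\<close>

lemma QQ: "Q i m * Q k n = - (Q k n * Q i m) + psym X i k (m + n) + (of_int (m - n) / 2 * cf i k) *\<^sub>R Y (brk i k) (m + n)
    + dt i k *\<^sub>R LR (m + n) + (if m + n = 0 then (1 / 4 * (of_int m ^ 2 - 1 / 4) * dt i k) *\<^sub>R 1 else 0)"
proof -
  \<comment> \<open>The central part of \<open>Q_X\<close> in terms of the mode l = m + q of the
    result.\<close>
  define W where "W l = (of_int (m - l) / 2) *\<^sub>R phi l" for l
  define K where "K l = cf i k *\<^sub>R R (brk i k) l + dt i k *\<^sub>R W l" for l
  have W: "smooth W" unfolding W_def by (intro smooth_weight smooth_phi)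
  have K: "smooth K" unfolding K_def by (intro smooth_add smooth_weight smooth_QR W)
  have B: "Q i m * X k q = 1 *\<^sub>R (X k q * Q i m) + K (m + q)" for q
    using Q_X[of i m k q] by (simp add: K_def W_def mult.commute)
  have A: "Q i m * phi j = (-1) *\<^sub>R (phi j * Q i m) + X i (m + j)" for j
    using Q_phi[of i m j] by simp
  have e: "Q i m * Q k n = - (Q k n * Q i m) + nprod 1 m (X i) (X k) (n + m) - nprod (-1) 0 phi K (n + m)"
    using nprod_deriv[OF smooth_phi smooth_XY(1) smooth_shift[OF smooth_XY(1)] smooth_shift[OF K] A B, where \<epsilon> = 1 and m = 0 and p = n]
      nprod_shift_left[of 1 0 "X i" m "X k" n] nprod_shift_right[of "-1" 0 phi K m n]
    by (simp add: Q_def[of k])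
  have "nterm (-1) 0 phi W p j = (of_int (m - p) / 2) *\<^sub>R nterm (-1) 0 phi phi p j + - nterm (-1) 0 wphi phi p j" for p j
  proof -
    have "real_of_int (m - (p - j)) / 2 = of_int (m - p) / 2 + of_int j / 2" by (simp add: field_simps)
    then have "W (p - j) = (of_int (m - p) / 2) *\<^sub>R phi (p - j) + (of_int j / 2) *\<^sub>R phi (p - j)"
      unfolding W_def scaleR_left_distrib[symmetric] by simp
    then show ?thesis by (simp add: nterm_def wphi_def distrib_left distrib_right)
  qed
  then have w: "nterm (-1) 0 phi W p = (\<lambda>j. (of_int (m - p) / 2) *\<^sub>R nterm (-1) 0 phi phi p j + - nterm (-1) 0 wphi phi p j)" for p
    by (intro ext)
  have "nprod (-1) 0 phi W p = (of_int (m - p) / 2) *\<^sub>R nprod (-1) 0 phi phi p + - nprod (-1) 0 wphi phi p" for p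
    unfolding nprod_def w
    by (subst lsum_add[OF lfin_scaleR[OF lfin_nterm[OF smooth_phi smooth_phi]] lfin_uminus[OF lfin_nterm[OF smooth_wphi smooth_phi]]])
      (simp add: lsum_scaleR lsum_uminus lfin_nterm smooth_phi smooth_wphi)
  then have Wp: "nprod (-1) 0 phi W p = - LR p + (if p = 0 then (1/16 - of_int m / 4) *\<^sub>R 1 else 0)" for p
    by (auto simp: nprod_phi_phi LR_def scaleR_left_diff_distrib)
  have "nprod (-1) 0 phi K p = cf i k *\<^sub>R nprod (-1) 0 phi (R (brk i k)) p + dt i k *\<^sub>R nprod (-1) 0 phi W p" for p
    unfolding K_def by (simp add: nprod_linear smooth_phi smooth_QR W smooth_weight)
  then have Kp: "nprod (-1) 0 phi K p = (- 1 / 2 * cf i k) *\<^sub>R Y (brk i k) p - dt i k *\<^sub>R LR p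
      + (if p = 0 then ((1/16 - of_int m / 4) * dt i k) *\<^sub>R 1 else 0)" for p
    by (simp add: phi_R Wp scaleR_diff_right scaleR_add_right mult.commute)
  have c1: "(of_int m - (of_int (n + m) + 1) / 2) * cf i k - - 1 / 2 * cf i k = of_int (m - n) / 2 * cf i k"
    by (simp add: field_simps)
  have c2: "of_int m * (of_int m - 1) / 4 * dt i k - (1/16 - of_int m / 4) * dt i k = 1 / 4 * (of_int m ^ 2 - 1 / 4) * dt i k"
    by (simp add: field_simps power2_eq_square)
  show ?thesis
    unfolding e psym_X Kp c1[symmetric] c2[symmetric] scaleR_left_diff_distrib by (simp add: add.commute[of n m])
qed

text \<open>The last term changes its sign when (i, m) and (k, n) are exchanged, since
  \<open>cf\<close> is antisymmetric. This makes the mixed brackets cancel in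
  \<open>wlevel_step\<close>.\<close>

lemma g_Q: "g i m * Q k n = - (Q k n * g i m) - (nrm * cf i k) *\<^sub>R nprod (-1) 0 phi (g (brk i k)) (m + n)"
proof -
  have A: "g i m * phi j = (-1) *\<^sub>R (phi j * g i m) + 0" for j by (simp add: g_comm)
  have B: "g i m * X k q = 1 *\<^sub>R (X k q * g i m) + (nrm * cf i k) *\<^sub>R g (brk i k) (m + q)" for q
    using gX by simp
  show ?thesis
    using nprod_deriv[OF smooth_phi smooth_XY(1) smooth_zero smooth_weight[OF smooth_shift[OF smooth_g]] A B, where \<epsilon> = 1 and m = 0 and p = n]
      nprod_scaleR_right[OF smooth_phi smooth_shift[OF smooth_g], of "-1" 0 "nrm * cf i k" "brk i k" m n]
      nprod_shift_right[of "-1" 0 phi "g (brk i k)" m n]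
    by (simp add: Q_def add.commute)
qed

text \<open>Three coefficients have to match: 1/M - nrm^2 = 1/(M + 1) for the squares of
  \<open>J\<close>, nrm^2 M = 1/(M + 1) for the mixed products \<open>B\<close>, and nrm^2 M^2 = 1 -
  1/(M + 1) for the squares of \<open>cur\<close>, which are multiples of \<open>LS\<close>.\<close>

lemma psym_combine:
  "- ((1 / M) *\<^sub>R psym J i k p) + psym X i k p = - ((1 / (M + 1)) *\<^sub>R psym J' i k p) + dt i k *\<^sub>R LS p"
proof -
  define B where "B = (1/2) *\<^sub>R (nprod 1 0 (J i) (cur k) p + nprod 1 0 (cur i) (J k) p + nprod 1 0 (J k) (cur i) p + nprod 1 0 (cur k) (J i) p)"
  have fn: "J' i = (\<lambda>n. J i n + cur i n)" "X i = (\<lambda>n. nrm *\<^sub>R (J i n - M *\<^sub>R cur i n))" for i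
    by (simp_all add: J'_def X_def fun_eq_iff)
  note sm = smooth_J smooth_cur smooth_weight smooth_diff smooth_add
  have 1: "psym J' i k p = psym J i k p + B + dt i k *\<^sub>R LS p"
    unfolding psym_cur[symmetric]
    by (simp add: psym_def B_def fn nprod_linear sm scaleR_add_right)
  have 2: "psym X i k p = (nrm * nrm) *\<^sub>R (psym J i k p - M *\<^sub>R B + (M * M) *\<^sub>R (dt i k *\<^sub>R LS p))"
    unfolding psym_cur[symmetric]
    by (simp add: psym_def B_def fn nprod_linear sm algebra_simps)
  note c = nrm_simps(1-3)
  define s where "s = 1 / (M + 1)"
  have B: "(nrm * nrm) *\<^sub>R M *\<^sub>R B = s *\<^sub>R B" "(nrm * nrm) *\<^sub>R (M * M) *\<^sub>R C = C - s *\<^sub>R C" for C :: fop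
    by (simp only: scaleR_scaleR c s_def) (simp only: scaleR_scaleR c s_def scaleR_left_diff_distrib scaleR_one)
  show ?thesis
    unfolding 1 2 c(1) s_def[symmetric] scaleR_add_right scaleR_diff_right B by (simp add: scaleR_left_distrib)
qed

lemma wlevel_step: "wlevel (M + 1) J' L' g'"
proof
  show "1 \<le> M + 1" using M_ge by simp
  show "smooth (J' i)" "smooth L'" "smooth (g' i)" for i
    unfolding J'_def L'_def g'_def by (intro smooth_add smooth_J smooth_cur smooth_L smooth_LS smooth_LR smooth_g smooth_QR)+
  show "J' i m * J' k n = J' k n * J' i m + cf i k *\<^sub>R J' (brk i k) (m + n) +
       (if m + n = 0 then ((M + 1) * (of_int m / 2 * dt i k)) *\<^sub>R 1 else 0)" for i m k n
  proof -
    define q where "q = of_int m / 2 * dt i k"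
    show ?thesis
      using JJ[of i m k n, folded q_def] cur_cur[of i m k n, folded q_def] unfolding q_def[symmetric]
      by (simp add: J'_def distrib_left distrib_right scaleR_add_right cur_comms scaleR_left_distrib)
  qed
  show "J' i m * g' k n = g' k n * J' i m + cf i k *\<^sub>R g' (brk i k) (m + n)" for i m k n
  proof -
    have A: "J' i m * phi j = phi j * J' i m + 0" for j
      by (simp add: J'_def J_comm cur_comms distrib_left distrib_right)
    have "J' i m * Q k n = Q k n * J' i m + cf i k *\<^sub>R Q (brk i k) (m + n)"
      using nprod_deriv_even[OF smooth_phi smooth_XY(1) smooth_zero smooth_weight[OF smooth_shift[OF smooth_XY(1)]] A J'X, where \<epsilon> = 1 and m = 0 and p = n]
        nprod_scaleR_right[OF smooth_phi smooth_shift[OF smooth_XY(1)], of 1 0 "cf i k" "brk i k" m n]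
        nprod_shift_right[of 1 0 phi "X (brk i k)" m n]
      by (simp add: Q_def add.commute)
    then show ?thesis
      using Jg[of i m k n] cur_comms(3)[of k n i m]
      by (simp add: g'_def distrib_left distrib_right scaleR_add_right J'_def)
  qed
  show "L' m * J' i n = J' i n * L' m + (- of_int n) *\<^sub>R J' i (m + n)" for m i n
    using LJ[of m i n] LS_cur[of m i n] LS_comms(1)[of i n m] LR_comms(1)[of i n m] LR_comms(4)[of i n m] cur_comms(2)[of m i n]
    by (simp add: J'_def L'_def distrib_left distrib_right scaleR_add_right)
  show "L' m * g' i n = g' i n * L' m + (of_int m / 2 - of_int n) *\<^sub>R g' i (m + n)" for m i n
  proof -
    define K1 where "K1 l = (of_int m / 2 - of_int l) *\<^sub>R phi l" for l
    define K2 where "K2 l = (of_int m - of_int l) *\<^sub>R X i l" for l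
    have K: "smooth K1" "smooth K2" unfolding K1_def K2_def by (intro smooth_weight smooth_phi smooth_XY)+
    have A: "L' m * phi j = phi j * L' m + K1 (m + j)" for j
    proof -
      have "of_int m / 2 - of_int (m + j) = - (of_int m / 2 + real_of_int j)" by simp
      then show ?thesis
        unfolding K1_def using LR_phi[of m j] L_comm(5)[of m j] LS_comms(4)[of j m]
        by (simp only: L'_def distrib_left distrib_right) simp
    qed
    have B: "L' m * X i q = X i q * L' m + K2 (m + q)" for q
      using L'X[of m i q] by (simp add: K2_def)
    have "L' m * Q i n = Q i n * L' m + nprod 1 m K1 (X i) (n + m) + nprod 1 0 phi K2 (n + m)"
      using nprod_deriv_even[OF smooth_phi smooth_XY(1) smooth_shift[OF K(1)] smooth_shift[OF K(2)] A B, where \<epsilon> = 1 and m = 0 and p = n]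
        nprod_shift_left[of 1 0 K1 m "X i" n] nprod_shift_right[of 1 0 phi K2 m n]
      by (simp add: Q_def)
    moreover have "nprod 1 m K1 (X i) (n + m) + nprod 1 0 phi K2 (n + m) = (of_int m / 2 - of_int n) *\<^sub>R nprod 1 0 phi (X i) (m + n)"
    proof -
      have "nterm 1 m K1 (X i) (n + m) j + nterm 1 0 phi K2 (n + m) j = (of_int m / 2 - of_int n) *\<^sub>R nterm 1 0 phi (X i) (m + n) j" for j
      proof -
        \<comment> \<open>The weight 1/2 of \<open>phi\<close> and the weight 1 of \<open>X\<close>
          add up to the weight 3/2 of \<open>g\<close>: the dependence on j cancels.\<close>
        have "(of_int m / 2 - of_int j) + (of_int m - of_int (n + m - j)) = of_int m / 2 - real_of_int n" by simp
        then show ?thesis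
          by (simp add: nterm_def K1_def K2_def phi_XY add.commute[of n m] flip: scaleR_left_distrib)
      qed
      note * = this
      have "nprod 1 m K1 (X i) (n + m) + nprod 1 0 phi K2 (n + m) = lsum (\<lambda>j. nterm 1 m K1 (X i) (n + m) j + nterm 1 0 phi K2 (n + m) j)"
        unfolding nprod_def by (rule lsum_add[symmetric]) (rule lfin_nterm[OF K(1) smooth_XY(1)], rule lfin_nterm[OF smooth_phi K(2)])
      also have "\<dots> = (of_int m / 2 - of_int n) *\<^sub>R nprod 1 0 phi (X i) (m + n)"
        unfolding nprod_def * by (rule lsum_scaleR) (rule lfin_nterm[OF smooth_phi smooth_XY(1)])
      finally show ?thesis .
    qed
    ultimately have "L' m * Q i n = Q i n * L' m + (of_int m / 2 - of_int n) *\<^sub>R Q i (m + n)"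
      by (simp add: Q_def)
    then show ?thesis
      using Lg[of m i n] LS_comms(3)[of i n m] LR_comms(3)[of i n m]
      by (simp add: g'_def L'_def distrib_left distrib_right scaleR_add_right)
  qed
  show "virasoro ((3 * (M + 1) - 1) / 2) L'"
    unfolding virasoro_def
  proof (intro allI)
    fix m n
    have "L' m * L' n - L' n * L' m = (L m * L n - L n * L m) + (LS m * LS n - LS n * LS m) + (LR m * LR n - LR n * LR m)"
      using LS_comms(2)[of m n] LS_comms(2)[of n m] LR_comms(2)[of m n] LR_comms(2)[of n m] LR_comms(5)[of m n] LR_comms(5)[of n m]
      by (simp add: L'_def distrib_left distrib_right)
    also have "\<dots> = of_int (m - n) *\<^sub>R L' (m + n)
     + (if m + n = 0 then ((((3 * M - 1) / 2) / 12 + 1 / 12 + (1 / 2) / 12) * (of_int m ^ 3 - of_int m)) *\<^sub>R 1 else 0)"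
    proof -
      define q where "q = real_of_int m ^ 3 - of_int m"
      have v: "A m * A n - A n * A m = of_int (m - n) *\<^sub>R A (m + n) + (if m + n = 0 then (c / 12 * q) *\<^sub>R 1 else 0)"
        if "virasoro c A" for c A
        using that[unfolded virasoro_def, rule_format, of m n] unfolding q_def by (simp only: add.assoc add_diff_cancel_left')
      show ?thesis
        unfolding v[OF LL] v[OF virasoro_LS] v[OF virasoro_LR] L'_def q_def[symmetric] distrib_right
        by (cases "m + n = 0") (simp_all only: if_True if_False scaleR_add_right scaleR_left_distrib add_0_right add_0_left ac_simps refl)
    qed
    \<comment> \<open>The new site adds 1 to the central charge and the real fermion adds
      1/2.\<close>
    also have "((3 * M - 1) / 2) / 12 + 1 / 12 + (1 / 2) / 12 = (3 * (M + 1) - 1) / 2 / (12::real)"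
      by (simp add: field_simps)
    finally show "L' m * L' n = L' n * L' m + of_int (m - n) *\<^sub>R L' (m + n)
       + (if m + n = 0 then ((3 * (M + 1) - 1) / 2 / 12 * (of_int m ^ 3 - of_int m)) *\<^sub>R 1 else 0)"
      by (simp add: diff_eq_eq add.commute add.left_commute)
  qed
  show "g' i m * g' k n = - (g' k n * g' i m) + dt i k *\<^sub>R L' (m + n) - (1 / (M + 1)) *\<^sub>R psym J' i k (m + n)
      + ((M + 1 - 1) / (M + 1) * (of_int (m - n) / 2 * cf i k)) *\<^sub>R J' (brk i k) (m + n)
      + (if m + n = 0 then ((M + 1 - 1) / 4 * (of_int m ^ 2 - 1 / 4) * dt i k) *\<^sub>R 1 else 0)" for i m k n
  proof -
    have cross: "g i m * Q k n + Q i m * g k n = - (Q k n * g i m) - g k n * Q i m"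
      using g_Q[of i m k n] g_Q[of k n i m] idx_sym(1,2)[of k i] by (simp add: add.commute[of n m])
    \<comment> \<open>The old current gets the coefficient (M - 1)/M + nrm^2 and the new one nrm^2
      M^2; both are M/(M + 1).\<close>
    have JY: "((M - 1) / M * c) *\<^sub>R J l p + c *\<^sub>R Y l p = ((M + 1 - 1) / (M + 1) * c) *\<^sub>R J' l p" for c l p
    proof -
      have "((M + 1 - 1) / (M + 1) * c) *\<^sub>R J l p = ((M - 1) / M * c) *\<^sub>R J l p + (c * (nrm * nrm)) *\<^sub>R J l p"
        unfolding nrm_simps(4)[symmetric] distrib_right scaleR_left_distrib by (simp only: mult.commute[of c])
      moreover have "((M + 1 - 1) / (M + 1) * c) *\<^sub>R cur l p = (c * (nrm * nrm * (M * M))) *\<^sub>R cur l p"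
        unfolding nrm_simps(5) by (simp only: mult.commute[of c])
      ultimately show ?thesis
        unfolding J'_def Y_def scaleR_add_right scaleR_scaleR by (simp only: mult.assoc add.assoc)
    qed
    have ct: "(M + 1 - 1) / 4 * r * d = (M - 1) / 4 * r * d + 1 / 4 * r * d" for r d :: real
      by (simp add: field_simps)
    have "g' i m * g' k n = g i m * g k n + (g i m * Q k n + Q i m * g k n) + Q i m * Q k n"
      by (simp add: g'_def distrib_left distrib_right)
    also have "\<dots> = - (g' k n * g' i m) + dt i k *\<^sub>R (L (m + n) + LR (m + n)) + (- ((1 / M) *\<^sub>R psym J i k (m + n)) + psym X i k (m + n))
       + (((M - 1) / M * (of_int (m - n) / 2 * cf i k)) *\<^sub>R J (brk i k) (m + n) + (of_int (m - n) / 2 * cf i k) *\<^sub>R Y (brk i k) (m + n))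
       + (if m + n = 0 then ((M + 1 - 1) / 4 * (of_int m ^ 2 - 1 / 4) * dt i k) *\<^sub>R 1 else 0)"
      unfolding cross gg[of i m k n] QQ[of i m k n] ct
      by (simp add: g'_def distrib_left distrib_right scaleR_add_right scaleR_left_distrib)
    finally show ?thesis
      unfolding psym_combine JY by (simp add: L'_def scaleR_add_right)
  qed
qed

end

section \<open>Adjoints and highest weight vectors\<close>

lemma app_lsum_single:
  assumes "lfin F" "\<And>i. i \<noteq> a \<Longrightarrow> app (F i) x = 0"
  shows "app (lsum F) x = app (F a) x"
proof -
  have "app (lsum F) x = (\<Sum>i\<in>{a}. app (F i) x)"
    by (rule app_lsum_sum[OF assms(1)]) (use assms(2) in blast)+
  then show ?thesis by simp
qed

fun st :: "idx \<Rightarrow> idx" where "st P = N" | "st Z = Z" | "st N = P"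

text \<open>Adjoints reverse products and negate modes; j < 0 turns into -j >= 1, so the cut 0
  becomes 1.\<close>

lemma adjoint_nprod:
  assumes sm: "smooth A" "smooth B" "smooth A'" "smooth B'"
    and A: "\<And>n. adjoint_ops (A n) (A' (- n))" and B: "\<And>n. adjoint_ops (B n) (B' (- n))" and "\<epsilon> * \<epsilon> = 1"
  shows "adjoint_ops (nprod \<epsilon> 0 A B p) (\<epsilon> *\<^sub>R nprod \<epsilon> 1 A' B' (- p))"
proof -
  let ?F = "\<lambda>j. \<epsilon> *\<^sub>R nterm \<epsilon> 1 A' B' (- p) (0 - j)"
  have lf: "lfin (\<lambda>j. nterm \<epsilon> 1 A' B' (- p) (0 - j))"
    using lfin_reindex[OF bij_uminus_int, of "nterm \<epsilon> 1 A' B' (- p)" 0] lfin_nterm[OF sm(3,4)] by simp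
  have "adjoint_ops (nterm \<epsilon> 0 A B p j) (?F j)" for j
  proof (cases "j < 0")
    case True
    then show ?thesis
      using adjoint_mult[OF A[of j] B[of "p - j"]] \<open>\<epsilon> * \<epsilon> = 1\<close> by (simp add: nterm_def)
  next
    case False
    then show ?thesis
      using adjoint_scaleR[OF adjoint_mult[OF B[of "p - j"] A[of j]], of \<epsilon>] by (simp add: nterm_def)
  qed
  then have "adjoint_ops (nprod \<epsilon> 0 A B p) (lsum ?F)"
    unfolding nprod_def by (intro adjoint_lsum lfin_nterm sm lfin_scaleR lf)
  also have "lsum ?F = \<epsilon> *\<^sub>R nprod \<epsilon> 1 A' B' (- p)"
    using lsum_scaleR[OF lf] lsum_reindex[OF bij_uminus_int, of "nterm \<epsilon> 1 A' B' (- p)" 0] by (simp add: nprod_def)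
  finally show ?thesis .
qed

context su2_site
begin

definition site_hw :: "real \<Rightarrow> fock \<Rightarrow> bool" where
  "site_hw s v \<longleftrightarrow> (\<forall>n>0. \<forall>i. app (cur i n) v = 0) \<and> app (cur P 0) v = 0 \<and> app (cur Z 0) v = s *\<^sub>R v"

lemma site_hwI:
  assumes e: "\<And>n. n \<ge> 0 \<Longrightarrow> app (eP n) v = 0" and f: "\<And>n. n > 0 \<Longrightarrow> app (fN n) v = 0"
    and h: "app (hZ 0) v = (2 * s) *\<^sub>R v"
  shows "site_hw s v"
proof -
  have "app (hZ n) v = 0" if "n > 0" for n
    using arg_cong[OF eP_fN[of 0 n], of "\<lambda>y. app y v"] e[of 0] f[of n] that by simp
  then have "app (cur i n) v = 0" if "n > 0" for n i
    using that e f by (cases i) (simp_all add: cur.simps)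
  then show ?thesis using e[of 0] h by (simp add: site_hw_def cur.simps)
qed

lemma site_hw_vac:
  assumes "\<And>n. n \<ge> 0 \<Longrightarrow> app (a n) v = 0" "\<And>n. n \<ge> 1 \<Longrightarrow> app (ad n) v = 0"
    "\<And>n. n \<ge> 1 \<Longrightarrow> app (b n) v = 0" "\<And>n. n \<ge> 0 \<Longrightarrow> app (bd n) v = 0"
  shows "site_hw 0 v"
proof (rule site_hwI)
  show e: "app (eP n) v = 0" if "n \<ge> 0" for n
    unfolding eP_lsum
  proof (rule app_lsum_zero[OF lfin_eP])
    fix j
    show "app (a j * b (n - j)) v = 0"
    proof (cases "j \<ge> n")
      case True
      then show ?thesis using odd_forms(2)[of j "n - j"] assms(1)[of j] that by simp
    qed (simp add: assms(3))
  qed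
  have f: "app (fN n) v = 0" if "n \<ge> 0" for n
    unfolding fN_def nprod_def
  proof (rule app_lsum_zero[OF lfin_nterm[OF smooth_bd smooth_ad]])
    show "app (nterm (-1) 0 bd ad n j) v = 0" for j
      using assms(4)[of j] assms(2)[of "n - j"] that by (simp add: nterm_def)
  qed
  show "app (fN n) v = 0" if "n > 0" for n using f that by simp
  show "app (hZ 0) v = (2 * 0) *\<^sub>R v"
    using arg_cong[OF eP_fN[of 0 0], of "\<lambda>y. app y v"] e[of 0] f[of 0] by simp
qed

text \<open>This vector is also killed by \<open>eP\<close> at -1, as the highest weight vector of
  spin 1/2 at level 1 must be. The bracket of \<open>eP (-1)\<close> and \<open>fN 1\<close> is hZ 0
  - 1, which gives the eigenvalue 1 of \<open>hZ 0\<close>.\<close>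

lemma site_hw_spin:
  assumes "\<And>n. n \<ge> -1 \<Longrightarrow> app (a n) v = 0" "\<And>n. n \<ge> 2 \<Longrightarrow> app (ad n) v = 0"
    "\<And>n. n \<ge> 1 \<Longrightarrow> app (b n) v = 0" "\<And>n. n \<ge> 0 \<Longrightarrow> app (bd n) v = 0"
  shows "site_hw (1/2) v"
proof (rule site_hwI)
  have e: "app (eP n) v = 0" if "n \<ge> -1" for n
    unfolding eP_lsum
  proof (rule app_lsum_zero[OF lfin_eP])
    fix j
    show "app (a j * b (n - j)) v = 0"
    proof (cases "j \<ge> n")
      case True
      then show ?thesis using odd_forms(2)[of j "n - j"] assms(1)[of j] that by simp
    qed (simp add: assms(3))
  qed
  then show "app (eP n) v = 0" if "n \<ge> 0" for n using that by simp
  show f: "app (fN n) v = 0" if "n > 0" for n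
    unfolding fN_def nprod_def
  proof (rule app_lsum_zero[OF lfin_nterm[OF smooth_bd smooth_ad]])
    show "app (nterm (-1) 0 bd ad n j) v = 0" for j
      using assms(4)[of j] assms(2)[of "n - j"] that by (simp add: nterm_def)
  qed
  show "app (hZ 0) v = (2 * (1/2)) *\<^sub>R v"
    using arg_cong[OF eP_fN[of "-1" 1], of "\<lambda>y. app y v"] e[of "-1"] f[of 1] by simp
qed

text \<open>For n >= 0 only the term in which the Cartan zero mode acts first on \<open>v\<close>
  survives.\<close>

lemma LS_hw:
  assumes "site_hw s v"
  shows "n > 0 \<Longrightarrow> app (LS n) v = 0" "app (LS 0) v = (s * s) *\<^sub>R v"
proof -
  have "app (LS n) v = app (cur Z n) (s *\<^sub>R v)" if "n \<ge> 0" for n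
  proof -
    have "app (nterm 1 0 (cur Z) (cur Z) n j) v = 0" if "j \<noteq> 0" for j
      using assms \<open>n \<ge> 0\<close> that unfolding site_hw_def nterm_def by simp
    then have "app (LS n) v = app (nterm 1 0 (cur Z) (cur Z) n 0) v"
      unfolding LS_def nprod_def by (rule app_lsum_single[OF lfin_nterm[OF smooth_cur smooth_cur]])
    then show ?thesis using assms by (simp add: nterm_def site_hw_def)
  qed
  then show "n > 0 \<Longrightarrow> app (LS n) v = 0" "app (LS 0) v = (s * s) *\<^sub>R v"
    using assms by (simp_all add: site_hw_def app_scaleR)
qed

text \<open>\<open>hZ\<close> is treated as a commutator of \<open>eP\<close> and \<open>fN\<close>.
  For \<open>LS\<close> the cut 1 left by \<open>adjoint_nprod\<close> returns to 0, as the Cartan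
  zero mode commutes with the Cartan current.\<close>

lemma site_adjoint:
  assumes "\<And>n. adjoint_ops (a n) (ad (- n))" "\<And>n. adjoint_ops (b n) (bd (- n))"
  shows "adjoint_ops (cur i n) (cur (st i) (- n))" "adjoint_ops (LS n) (LS (- n))"
proof -
  have e: "adjoint_ops (eP n) (fN (- n))" for n
  proof -
    have "adjoint_ops (eP n) (- nprod (-1) 1 ad bd (- n))"
      using adjoint_nprod[OF smooth_a smooth_b smooth_ad smooth_bd assms, of "-1" n] by (simp add: eP_def)
    moreover have "nprod (-1) 1 ad bd (- n) = (-1) *\<^sub>R nprod (-1) 0 bd ad (- n)"
      by (rule nprod_commute[OF smooth_ad smooth_bd]) (simp_all add: odd_forms(12))
    ultimately show ?thesis by (simp add: fN_def)
  qed
  have h: "adjoint_ops (hZ n) (hZ (- n))" for n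
  proof -
    have "hZ n = eP n * fN 0 - fN 0 * eP n" "hZ (- n) = eP 0 * fN (- n) - fN (- n) * eP 0"
      using eP_fN[of n 0] eP_fN[of 0 "- n"] by (auto split: if_splits)
    then show ?thesis
      using adjoint_diff[OF adjoint_mult[OF e[of n] adjoint_sym[OF e[of 0]]] adjoint_mult[OF adjoint_sym[OF e[of 0]] e[of n]]]
      by simp
  qed
  show c: "adjoint_ops (cur i n) (cur (st i) (- n))" for i n
    using e h adjoint_sym[OF e[of "- n"]] by (cases i) (simp_all add: cur.simps adjoint_scaleR)
  have "adjoint_ops (LS n) (nprod 1 1 (cur Z) (cur Z) (- n))"
    using adjoint_nprod[OF smooth_cur smooth_cur smooth_cur smooth_cur c[of Z] c[of Z, simplified], of 1 n] by (simp add: LS_def)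
  moreover have "nprod 1 (0 + 1) (cur Z) (cur Z) (- n) = LS (- n)"
    unfolding nprod_cut_Suc[OF smooth_cur smooth_cur] using cur_cur[of Z 0 Z "- n"] by (simp add: LS_def)
  ultimately show "adjoint_ops (LS n) (LS (- n))" by simp
qed

end

context ramond_fermion
begin

lemma LR_hw:
  assumes "\<And>n. n > 0 \<Longrightarrow> app (phi n) v = 0"
  shows "n > 0 \<Longrightarrow> app (LR n) v = 0" "app (LR 0) v = (1/16) *\<^sub>R v"
proof -
  have "app (nprod (-1) 0 wphi phi n) v = 0" if "n \<ge> 0" for n
    unfolding nprod_def
  proof (rule app_lsum_zero[OF lfin_nterm[OF smooth_wphi smooth_phi]])
    show "app (nterm (-1) 0 wphi phi n j) v = 0" for j
      using assms[of j] assms[of "n - j"] that by (cases "j = 0") (auto simp: nterm_def wphi_def)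
  qed
  then show "n > 0 \<Longrightarrow> app (LR n) v = 0" "app (LR 0) v = (1/16) *\<^sub>R v"
    by (simp_all add: LR_def)
qed

lemma LR_adjoint:
  assumes "\<And>n. adjoint_ops (phi n) (phi (- n))"
  shows "adjoint_ops (LR n) (LR (- n))"
proof -
  have w: "adjoint_ops (wphi n) ((\<lambda>n. - wphi n) (- n))" for n
    using adjoint_scaleR[OF assms[of n], of "- of_int n / 2"] by (simp add: wphi_def)
  have "adjoint_ops (nprod (-1) 0 wphi phi n) (nprod (-1) 1 wphi phi (- n))"
    using adjoint_nprod[OF smooth_wphi smooth_phi smooth_uminus[OF smooth_wphi] smooth_phi w assms, of "-1" n]
    by (simp add: nprod_uminus_left smooth_wphi smooth_phi)
  moreover have "nprod (-1) (0 + 1) wphi phi (- n) = nprod (-1) 0 wphi phi (- n)"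
    unfolding nprod_cut_Suc[OF smooth_wphi smooth_phi] by (simp add: wphi_def)
  ultimately show ?thesis
    unfolding LR_def by (intro adjoint_add) (auto intro: adjoint_scaleR adjoint_one adjoint_zero)
qed

end

text \<open>\<open>s\<close> is the spin common to all sites. The energy consists of 1/16 for each
  of the M - 1 real fermions and s^2 for each of the M sites.\<close>

definition whw :: "real \<Rightarrow> real \<Rightarrow> (idx \<Rightarrow> int \<Rightarrow> fop) \<Rightarrow> (int \<Rightarrow> fop) \<Rightarrow> (idx \<Rightarrow> int \<Rightarrow> fop) \<Rightarrow> fock \<Rightarrow> bool" where
  "whw M s J L g v \<longleftrightarrow> (\<forall>n>0. app (L n) v = 0 \<and> (\<forall>i. app (J i n) v = 0 \<and> app (g i n) v = 0)) \<and>
     app (J P 0) v = 0 \<and> app (g P 0) v = 0 \<and> app (g Z 0) v = 0 \<and>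
     app (J Z 0) v = (M * s) *\<^sub>R v \<and> app (L 0) v = ((M - 1) / 16 + M * (s * s)) *\<^sub>R v"

definition wadj :: "(idx \<Rightarrow> int \<Rightarrow> fop) \<Rightarrow> (int \<Rightarrow> fop) \<Rightarrow> (idx \<Rightarrow> int \<Rightarrow> fop) \<Rightarrow> bool" where
  "wadj J L g \<longleftrightarrow> (\<forall>n. adjoint_ops (L n) (L (- n))) \<and>
     (\<forall>i n. adjoint_ops (J i n) (J (st i) (- n)) \<and> adjoint_ops (g i n) (g (st i) (- n)))"

context wstep
begin

text \<open>On \<open>v\<close> the Cartan zero modes of \<open>J\<close> and \<open>cur\<close>
  have the eigenvalues M s and s, so J - M cur kills it. Hence the new part phi X of
  \<open>g'\<close> has a zero mode of weight 0 that kills \<open>v\<close>.\<close>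

lemma whw_step:
  assumes h: "whw M s J L g v" and s: "site_hw s v" and p: "\<And>n. n > 0 \<Longrightarrow> app (phi n) v = 0"
  shows "whw (M + 1) s J' L' g' v"
proof -
  have X: "app (X i n) v = 0" if "n > 0" for i n
    using h s that by (simp add: X_def whw_def site_hw_def)
  have X0: "app (X P 0) v = 0" "app (X Z 0) v = 0"
    using h s by (simp_all add: X_def whw_def site_hw_def)
  have "app (Q i n) v = app (phi 0) (app (X i n) v)" if "n \<ge> 0" for i n
  proof -
    have "app (nterm 1 0 phi (X i) n j) v = 0" if "j \<noteq> 0" for j
      using X[of "n - j" i] p[of j] \<open>n \<ge> 0\<close> that by (simp add: nterm_def)
    then have "app (Q i n) v = app (nterm 1 0 phi (X i) n 0) v"
      unfolding Q_def nprod_def by (rule app_lsum_single[OF lfin_nterm[OF smooth_phi smooth_XY(1)]])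
    also have "nterm 1 0 phi (X i) n 0 = phi 0 * X i n" by (simp add: nterm_def phi_XY)
    finally show ?thesis by simp
  qed
  then have Q: "app (Q i n) v = 0" "app (Q P 0) v = 0" "app (Q Z 0) v = 0" if "n > 0" for i n
    using X X0 that by simp_all
  have "((M - 1) / 16 + M * (s * s)) *\<^sub>R v + (s * s) *\<^sub>R v + (1/16) *\<^sub>R v = ((M + 1 - 1) / 16 + (M + 1) * (s * s)) *\<^sub>R v"
    unfolding scaleR_left_distrib[symmetric] by (rule arg_cong[of _ _ "\<lambda>r. r *\<^sub>R v"]) (simp add: field_simps)
  then show ?thesis
    using h s Q Q(2,3)[of 1] LS_hw[OF s] LR_hw[of v, OF p]
    unfolding whw_def site_hw_def
    by (simp add: J'_def L'_def g'_def scaleR_left_distrib distrib_right)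
qed

lemma wadj_step:
  assumes h: "wadj J L g" and s: "\<And>n. adjoint_ops (a n) (ad (- n))" "\<And>n. adjoint_ops (b n) (bd (- n))"
    and p: "\<And>n. adjoint_ops (phi n) (phi (- n))"
  shows "wadj J' L' g'"
proof -
  have X: "adjoint_ops (X i n) (X (st i) (- n))" for i n
    using h unfolding X_def wadj_def by (intro adjoint_scaleR adjoint_diff site_adjoint s) auto
  have Q: "adjoint_ops (Q i n) (Q (st i) (- n))" for i n
  proof -
    have "adjoint_ops (Q i n) (nprod 1 1 phi (X (st i)) (- n))"
      using adjoint_nprod[OF smooth_phi smooth_XY(1) smooth_phi smooth_XY(1) p X, where \<epsilon> = 1 and p = n] by (simp add: Q_def)
    moreover have "nprod 1 (0 + 1) phi (X (st i)) (- n) = Q (st i) (- n)"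
      unfolding nprod_cut_Suc[OF smooth_phi smooth_XY(1)] by (simp add: Q_def phi_XY)
    ultimately show ?thesis by simp
  qed
  show ?thesis
    using h Q site_adjoint[OF s] LR_adjoint[OF p] unfolding wadj_def J'_def L'_def g'_def
    by (intro conjI allI adjoint_add; blast)
qed

lemma central_step:
  assumes "\<And>i n. D * J i n = J i n * D" "\<And>n. D * L n = L n * D" "\<And>i n. D * g i n = - (g i n * D)"
    "\<And>n. D * a n = - (a n * D)" "\<And>n. D * ad n = - (ad n * D)" "\<And>n. D * b n = - (b n * D)"
    "\<And>n. D * bd n = - (bd n * D)" "\<And>n. D * phi n = - (phi n * D)"
  shows "D * J' i n = J' i n * D" "D * L' n = L' n * D" "D * g' i n = - (g' i n * D)"
proof -
  have c: "D * cur i n = cur i n * D" for i n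
    using cur_comm[of D "-1"] assms by simp
  have LS: "D * LS n = LS n * D" using LS_comm c by blast
  have LR: "D * LR n = LR n * D" using LR_comm[of D "-1"] assms by simp
  have X: "D * X i n = 1 *\<^sub>R (X i n * D)" for i n
    by (simp add: X_def assms c right_diff_distrib left_diff_distrib)
  have p: "D * phi n = (-1) *\<^sub>R (phi n * D)" for n using assms by simp
  have Q: "D * Q i n = - (Q i n * D)"
    using nprod_central[OF smooth_phi smooth_XY(1) p X, where \<epsilon> = 1 and m = 0 and p = n] by (simp add: Q_def)
  show "D * J' i n = J' i n * D" "D * L' n = L' n * D" "D * g' i n = - (g' i n * D)"
    using assms c LS LR Q by (simp_all add: J'_def L'_def g'_def distrib_left distrib_right)
qed

end

section \<open>The systems of all levels inside one Fock space\<close>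

lemma fermion_CAR_swapped:
  "fad i' k' n * fa i k m + fa i k m * fad i' k' n = (if i = i' \<and> k = k' \<and> m + n = 0 then 1 else 0)"
  "k < 2 \<Longrightarrow> fa i' k n * fphi i m + fphi i m * fa i' k n = 0"
  "k < 2 \<Longrightarrow> fad i' k n * fphi i m + fphi i m * fad i' k n = 0"
  using fermion_CAR(3)[of i k m i' k' n] fphi_CAR[of k i m i' n] by (simp_all add: add.commute)

text \<open>The second fermion enters with its roles exchanged, so that both zero modes of the
  doublet (\<open>a\<close>, \<open>bd\<close>) annihilate the vacuum.\<close>

interpretation fsite: su2_site "fa i 0" "fad i 0" "fad i 1" "fa i 1" for i
proof
  show "fad i 0 m * fa i 1 n + fa i 1 n * fad i 0 m = 0" for m n
    using fermion_CAR(3)[of i 1 n i 0 m] by (simp add: add.commute)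
qed (use fermion_CAR(3)[of i 1 _ i 1] in \<open>simp_all add: fermion_smooth fermion_CAR add.commute\<close>)

interpretation fram: ramond_fermion "fphi i" for i
  by unfold_locales (simp_all add: fermion_smooth fphi_fphi)

definition fermions :: "nat \<Rightarrow> fop set" where
  "fermions i = range (fa i 0) \<union> range (fad i 0) \<union> range (fad i 1) \<union> range (fa i 1) \<union> range (fphi i)"

lemma fermions_anticomm:
  assumes "i \<noteq> i'" "x \<in> fermions i" "y \<in> fermions i'"
  shows "x * y = - (y * x)"
proof -
  have "x * y + y * x = 0"
    using assms unfolding fermions_def
    by (auto simp: fermion_CAR fermion_CAR_swapped fphi_CAR fphi_fphi)
  then show ?thesis by (simp add: eq_neg_iff_add_eq_0)
qed

definition site_cond :: "nat \<Rightarrow> real \<Rightarrow> fock \<Rightarrow> bool" where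
  "site_cond i s v \<longleftrightarrow> fsite.site_hw i s v \<and> (\<forall>n>0. app (fphi i n) v = 0)"

text \<open>The last clause strengthens the induction: the operators of the sites up to
  \<open>n\<close> must commute or anticommute with the fermions of every later site for the locale
  \<open>wstep\<close> to apply again.\<close>

lemma wlevel_exists:
  "\<exists>J L g. wlevel (real (Suc n)) J L g \<and> wadj J L g \<and>
     (\<forall>s v. (\<forall>i\<le>n. site_cond i s v) \<longrightarrow> whw (real (Suc n)) s J L g v) \<and>
     (\<forall>i>n. \<forall>D\<in>fermions i. (\<forall>k m. D * J k m = J k m * D \<and> D * g k m = - (g k m * D)) \<and> (\<forall>m. D * L m = L m * D))"
proof (induction n)
  case 0
  have "wlevel 1 (fsite.cur 0) (fsite.LS 0) (\<lambda>_ _. 0)" by (rule fsite.wlevel_1)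
  moreover have "wadj (fsite.cur 0) (fsite.LS 0) (\<lambda>_ _. 0)"
    unfolding wadj_def using fsite.site_adjoint[of 0] fermion_adjoint adjoint_zero by simp
  moreover have "whw 1 s (fsite.cur 0) (fsite.LS 0) (\<lambda>_ _. 0) v" if "site_cond 0 s v" for s v
    using that fsite.LS_hw[of 0 s v] unfolding whw_def site_cond_def fsite.site_hw_def by simp
  moreover have "D * fsite.cur 0 k m = fsite.cur 0 k m * D \<and> D * fsite.LS 0 m = fsite.LS 0 m * D"
    if "i > 0" "D \<in> fermions i" for i D k m
  proof -
    have an: "D * y = - (y * D)" if "y \<in> fermions 0" for y
      using fermions_anticomm[of i 0 D y] \<open>i > 0\<close> \<open>D \<in> fermions i\<close> that by simp
    have c: "D * fsite.cur 0 k m = fsite.cur 0 k m * D" for k m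
      using fsite.cur_comm[where D = D and \<sigma> = "-1"] an by (simp add: fermions_def)
    show ?thesis using c fsite.LS_comm[where D = D] by simp
  qed
  ultimately show ?case by (intro exI[of _ "fsite.cur 0"] exI[of _ "fsite.LS 0"] exI[of _ "\<lambda>_ _. 0"]) auto
next
  case (Suc n)
  then obtain J L g where w: "wlevel (real (Suc n)) J L g" and adj: "wadj J L g"
    and hw: "\<And>s v. (\<forall>i\<le>n. site_cond i s v) \<Longrightarrow> whw (real (Suc n)) s J L g v"
    and D: "\<And>i D k m. i > n \<Longrightarrow> D \<in> fermions i \<Longrightarrow> D * J k m = J k m * D"
      "\<And>i D k m. i > n \<Longrightarrow> D \<in> fermions i \<Longrightarrow> D * g k m = - (g k m * D)"
      "\<And>i D m. i > n \<Longrightarrow> D \<in> fermions i \<Longrightarrow> D * L m = L m * D"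
    by blast
  let ?i = "Suc n"
  interpret wlevel "real (Suc n)" J L g by (rule w)
  interpret wstep "real (Suc n)" J L g "fa ?i 0" "fad ?i 0" "fad ?i 1" "fa ?i 1" "fphi ?i"
  proof unfold_locales
    have f: "fa ?i 0 m \<in> fermions ?i" "fad ?i 0 m \<in> fermions ?i" "fad ?i 1 m \<in> fermions ?i"
      "fa ?i 1 m \<in> fermions ?i" "fphi ?i m \<in> fermions ?i" for m
      by (auto simp: fermions_def)
    fix k m l
    show "J k m * fa ?i 0 l = fa ?i 0 l * J k m" "J k m * fad ?i 0 l = fad ?i 0 l * J k m"
      "J k m * fad ?i 1 l = fad ?i 1 l * J k m" "J k m * fa ?i 1 l = fa ?i 1 l * J k m"
      "J k m * fphi ?i l = fphi ?i l * J k m"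
      "L m * fa ?i 0 l = fa ?i 0 l * L m" "L m * fad ?i 0 l = fad ?i 0 l * L m"
      "L m * fad ?i 1 l = fad ?i 1 l * L m" "L m * fa ?i 1 l = fa ?i 1 l * L m"
      "L m * fphi ?i l = fphi ?i l * L m"
      using D(1)[OF lessI f(1)] D(1)[OF lessI f(2)] D(1)[OF lessI f(3)] D(1)[OF lessI f(4)] D(1)[OF lessI f(5)]
        D(3)[OF lessI f(1)] D(3)[OF lessI f(2)] D(3)[OF lessI f(3)] D(3)[OF lessI f(4)] D(3)[OF lessI f(5)]
      by simp_all
    show "g k m * fa ?i 0 l = - (fa ?i 0 l * g k m)" "g k m * fad ?i 0 l = - (fad ?i 0 l * g k m)"
      "g k m * fad ?i 1 l = - (fad ?i 1 l * g k m)" "g k m * fa ?i 1 l = - (fa ?i 1 l * g k m)"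
      "g k m * fphi ?i l = - (fphi ?i l * g k m)"
      using D(2)[OF lessI f(1)] D(2)[OF lessI f(2)] D(2)[OF lessI f(3)] D(2)[OF lessI f(4)] D(2)[OF lessI f(5)]
      by simp_all
    show "fphi ?i m * fa ?i 0 l = - (fa ?i 0 l * fphi ?i m)" "fphi ?i m * fad ?i 0 l = - (fad ?i 0 l * fphi ?i m)"
      "fphi ?i m * fad ?i 1 l = - (fad ?i 1 l * fphi ?i m)" "fphi ?i m * fa ?i 1 l = - (fa ?i 1 l * fphi ?i m)"
      using fphi_CAR[of 0 ?i m ?i l] fphi_CAR[of 1 ?i m ?i l] by (simp_all add: eq_neg_iff_add_eq_0)
  qed
  have M: "real (Suc (Suc n)) = real (Suc n) + 1" by simp
  have "wadj J' L' g'" by (rule wadj_step[OF adj]) (use fermion_adjoint in auto)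
  moreover have "whw (real (Suc (Suc n))) s J' L' g' v" if "\<forall>i\<le>Suc n. site_cond i s v" for s v
    unfolding M by (rule whw_step) (use that hw in \<open>auto simp: site_cond_def\<close>)
  moreover have "D * J' k m = J' k m * D \<and> D * g' k m = - (g' k m * D) \<and> D * L' m = L' m * D"
    if "i > Suc n" "D \<in> fermions i" for i D k m
  proof -
    have an: "D * y = - (y * D)" if "y \<in> fermions ?i" for y
      using fermions_anticomm[of i ?i D y] \<open>i > Suc n\<close> \<open>D \<in> fermions i\<close> that by simp
    have in': "i > n" using that by simp
    show ?thesis
      using central_step[of D] D(1)[OF in' that(2)] D(2)[OF in' that(2)] D(3)[OF in' that(2)] an
      by (simp add: fermions_def)
  qed
  ultimately show ?case
    using wlevel_step unfolding M by (intro exI[of _ J'] exI[of _ L'] exI[of _ g']) auto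
qed

text \<open>The mode \<open>a\<close> at -1, occupied once at each of the first n sites, raises
  their spin from 0 to 1/2.\<close>

primrec spin_vec :: "nat \<Rightarrow> fock" where
  "spin_vec 0 = fvac"
| "spin_vec (Suc n) = app (fa n 0 (-1)) (spin_vec n)"

lemma spin_vec_kill:
  "i < n \<and> l \<ge> -1 \<or> l \<ge> 0 \<Longrightarrow> app (fa i 0 l) (spin_vec n) = 0"
  "i < n \<and> l \<ge> 2 \<or> i \<ge> n \<and> l \<ge> 1 \<Longrightarrow> app (fad i 0 l) (spin_vec n) = 0"
  "l \<ge> 1 \<Longrightarrow> app (fad i 1 l) (spin_vec n) = 0" "l \<ge> 0 \<Longrightarrow> app (fa i 1 l) (spin_vec n) = 0"
  "l \<ge> 1 \<Longrightarrow> app (fphi i l) (spin_vec n) = 0"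
proof (induction n)
  case 0
  {
    case 1 then show ?case by (simp add: fermion_vac)
  next
    case 2 then show ?case by (simp add: fermion_vac)
  next
    case 3 then show ?case by (simp add: fermion_vac)
  next
    case 4 then show ?case by (simp add: fermion_vac)
  next
    case 5 then show ?case by (simp add: fermion_vac)
  }
next
  case (Suc n)
  let ?y = "fa n 0 (-1)"
  have an: "app x (app ?y w) = - app ?y (app x w)" if "x * ?y + ?y * x = 0" for x w
    using arg_cong[OF that, of "\<lambda>z. app z w"] by (simp add: eq_neg_iff_add_eq_0)
  have yy: "app ?y (app ?y w) = 0" for w
  proof -
    have "?y * ?y = - (?y * ?y)"
      using fermion_CAR(1)[of n 0 "-1" n 0 "-1"] by (simp only: eq_neg_iff_add_eq_0)
    then have "?y * ?y = 0" by (rule fop_double_eq_0)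
    from arg_cong[OF this, of "\<lambda>z. app z w"] show ?thesis by simp
  qed
  {
    case 1
    show ?case
    proof (cases "i = n \<and> l = -1")
      case True
      then show ?thesis using yy by simp
    next
      case False
      then have "app (fa i 0 l) (spin_vec n) = 0" using 1 Suc(1) by (auto simp: less_Suc_eq)
      then show ?thesis using an[OF fermion_CAR(1)[of i 0 l n 0 "-1"], of "spin_vec n"] by simp
    qed
  next
    case 2
    then have "fad i 0 l * ?y + ?y * fad i 0 l = 0"
      using fermion_CAR(3)[of n 0 "-1" i 0 l] by (auto simp: add.commute)
    from an[OF this, of "spin_vec n"] show ?case using Suc(2) 2 by (auto simp: less_Suc_eq)
  next
    case 3
    have "fad i 1 l * ?y + ?y * fad i 1 l = 0"
      using fermion_CAR(3)[of n 0 "-1" i 1 l] by (simp add: add.commute)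
    from an[OF this, of "spin_vec n"] show ?case using Suc(3)[OF 3] by simp
  next
    case 4
    then show ?case using an[OF fermion_CAR(1)[of i 1 l n 0 "-1"], of "spin_vec n"] Suc(4) by simp
  next
    case 5
    then show ?case using an[OF fphi_CAR(1)[of 0 i l n "-1"], of "spin_vec n"] Suc(5) by simp
  }
qed

lemma spin_vec_nonzero: "spin_vec n \<noteq> 0"
proof (induction n)
  case 0
  have "coef fvac {} \<noteq> coef 0 {}" by simp
  then have "fvac \<noteq> 0" by metis
  then show ?case by simp
next
  case (Suc n)
  have "app (fad n 0 1) (spin_vec (Suc n)) = spin_vec n"
    using arg_cong[OF fermion_CAR(3)[of n 0 "-1" n 0 1], of "\<lambda>z. app z (spin_vec n)"] spin_vec_kill(2)[of n n 1] by simp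
  then show ?case using Suc by (metis app_zero)
qed

lemma fock_system:
  assumes "M1 \<ge> 1" "s = 0 \<or> s = 1/2"
  shows "\<exists>J L g v. wlevel (real M1) J L g \<and> wadj J L g \<and> whw (real M1) s J L g v \<and> v \<noteq> 0"
proof -
  obtain n where n: "M1 = Suc n" using assms by (cases M1) auto
  have "\<exists>v. v \<noteq> 0 \<and> (\<forall>i\<le>n. site_cond i s v)"
  proof (cases "s = 0")
    case True
    have "site_cond i 0 (spin_vec 0)" for i
      unfolding site_cond_def by (intro conjI allI impI fsite.site_hw_vac) (simp_all add: fermion_vac)
    then show ?thesis using spin_vec_nonzero[of 0] True by blast
  next
    case False
    have "site_cond i (1/2) (spin_vec M1)" if "i \<le> n" for i
      unfolding site_cond_def by (intro conjI allI impI fsite.site_hw_spin; rule spin_vec_kill; use that n in simp)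
    then show ?thesis using spin_vec_nonzero[of M1] False assms(2) by blast
  qed
  then show ?thesis using wlevel_exists[of n] unfolding n by blast
qed

section \<open>Reduction to words in lowering modes\<close>

locale pbw = vector_space scl
  for scl :: "complex \<Rightarrow> 'w::ab_group_add \<Rightarrow> 'w" +
  fixes act :: "'o \<Rightarrow> 'w \<Rightarrow> 'w" and wt :: "'o \<Rightarrow> nat" and low :: "'o set" and v :: 'w
  assumes act_add: "act b (x + y) = act b x + act b y"
    and act_scl: "act b (scl c x) = scl c (act b x)"
    and wt_pos: "wt b \<ge> 1"
begin

text \<open>The PBW filtration of the module generated by \<open>v\<close>, where each mode counts
  with its degree \<open>wt\<close>.\<close>

inductive words :: "nat \<Rightarrow> 'w \<Rightarrow> bool" where
  words_zero: "words r 0"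
| words_base: "words r v"
| words_add: "words r x \<Longrightarrow> words r y \<Longrightarrow> words r (x + y)"
| words_scl: "words r x \<Longrightarrow> words r (scl c x)"
| words_act: "words r x \<Longrightarrow> wt b + r \<le> s \<Longrightarrow> words s (act b x)"

inductive low_words :: "nat \<Rightarrow> 'w \<Rightarrow> bool" where
  low_zero: "low_words r 0"
| low_base: "low_words r v"
| low_add: "low_words r x \<Longrightarrow> low_words r y \<Longrightarrow> low_words r (x + y)"
| low_scl: "low_words r x \<Longrightarrow> low_words r (scl c x)"
| low_act: "b \<in> low \<Longrightarrow> low_words r x \<Longrightarrow> wt b + r \<le> s \<Longrightarrow> low_words s (act b x)"

lemma act_zero: "act b 0 = 0"
  using act_add[of b 0 0] by simp

lemma words_mono: "words r x \<Longrightarrow> r \<le> s \<Longrightarrow> words s x"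
proof (induction arbitrary: s rule: words.induct)
  case (words_act r x b s s')
  then show ?case using words.words_act[of r x b s'] by simp
qed (auto intro: words.intros)

lemma low_words_mono: "low_words r x \<Longrightarrow> r \<le> s \<Longrightarrow> low_words s x"
proof (induction arbitrary: s rule: low_words.induct)
  case (low_act b r x s s')
  then show ?case using low_words.low_act[of b r x s'] by simp
qed (auto intro: low_words.intros)

lemma low_words_words: "low_words r x \<Longrightarrow> words r x"
  by (induction rule: low_words.induct) (auto intro: words.intros)

text \<open>Moving a non-lowering operator to the right through a lowering word produces only words of
  smaller filtration degree, until it reaches the highest weight vector.\<close>

lemma words_low_words:
  assumes comm: "\<And>b c x r. b \<notin> low \<Longrightarrow> c \<in> low \<Longrightarrow> words r x \<Longrightarrow>
      \<exists>e z. act b (act c x) = scl e (act c (act b x)) + z \<and> words (r + wt b + wt c - 1) z"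
    and hw: "\<And>b. b \<notin> low \<Longrightarrow> \<exists>e. act b v = scl e v"
  shows "words t x \<Longrightarrow> low_words t x"
proof (induction t arbitrary: x rule: less_induct)
  case (less t)
  have up: "low_words t (act b x)" if nb: "b \<notin> low" and "low_words r x" "wt b + r \<le> t" for b r x
    using that(2,3)
  proof (induction rule: low_words.induct)
    case (low_base r)
    obtain e where "act b v = scl e v" using hw[OF nb] by blast
    then show ?case using low_words.low_base low_words.low_scl by simp
  next
    case (low_act c r x s)
    obtain e z where ez: "act b (act c x) = scl e (act c (act b x)) + z" "words (r + wt b + wt c - 1) z"
      using comm[OF nb low_act(1) low_words_words[OF low_act(2)]] by blast
    \<comment> \<open>Because \<open>c\<close> has positive degree, this vector has degree below
      \<open>t\<close>, where the outer hypothesis makes it a lowering word.\<close>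
    have "words (wt b + r) (act b x)"
      using low_words_words[OF low_act(2)] by (rule words_act) simp
    then have "low_words (wt b + r) (act b x)"
      using less.IH[of "wt b + r"] low_act wt_pos[of c] by simp
    then have "low_words t (act c (act b x))"
      by (rule low_words.low_act[OF low_act(1)]) (use low_act in simp)
    moreover have "low_words t z"
    proof (rule low_words_mono[OF less.IH[OF _ ez(2)]])
      show "r + wt b + wt c - 1 < t" "r + wt b + wt c - 1 \<le> t"
        using low_act wt_pos[of c] wt_pos[of b] by linarith+
    qed
    ultimately show ?case unfolding ez(1) by (intro low_add low_words.low_scl)
  qed (auto simp: act_zero act_add act_scl intro: low_words.intros)
  have "words s x \<Longrightarrow> s = t \<Longrightarrow> low_words t x" for s x
  proof (induction rule: words.induct)
    case (words_act r x b s)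
    then have "low_words r x" using less.IH[of r x] wt_pos[of b] by simp
    then show ?case
      using up[of b r x] low_words.low_act[of b r x t] words_act by (cases "b \<in> low") auto
  qed (auto intro: low_words.intros)
  with less.prems show ?case by blast
qed

end

section \<open>Modules given by mode relations\<close>

definition nt :: "(int \<Rightarrow> 'w \<Rightarrow> 'w) \<Rightarrow> (int \<Rightarrow> 'w \<Rightarrow> 'w) \<Rightarrow> int \<Rightarrow> int \<Rightarrow> 'w \<Rightarrow> 'w" where
  "nt A B p j w = (if j < 0 then A j (B (p - j) w) else B (p - j) (A j w))"

datatype wop = OL int | OJ idx int | OG idx int

text \<open>Chosen so that every bracket has degree at most one less than the sum of the two
  degrees. Tight cases are two currents (1) and a current with \<open>G\<close> (2); the current
  products in the bracket of two \<open>G\<close> have degree 2 against 3.\<close>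

fun wop_wt :: "wop \<Rightarrow> nat" where
  "wop_wt (OL n) = 2" | "wop_wt (OJ i n) = 1" | "wop_wt (OG i n) = 2"

text \<open>The zero mode of \<open>G\<close> of weight 0 counts as lowering, because
  \<open>hw\<close> does not make the vector an eigenvector of it.\<close>

definition wop_low :: "wop set" where
  "wop_low = {OL n |n. n < 0} \<union> {OJ i n |i n. n < 0 \<or> n = 0 \<and> i = N} \<union> {OG i n |i n. n < 0 \<or> n = 0 \<and> i \<noteq> P}"

text \<open>The relations are written for plain maps and with finite truncations of the mode sums,
  so that they can be imposed alike on the given module, on the Fock space and on their direct sum.
  \<open>OG\<close> stands for i G, which makes all coefficients real.\<close>

locale wmod = vector_space scl
  for scl :: "complex \<Rightarrow> 'w::ab_group_add \<Rightarrow> 'w" +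
  fixes M :: real and op :: "wop \<Rightarrow> 'w \<Rightarrow> 'w"
  assumes op_add: "op b (x + y) = op b x + op b y"
    and op_scl: "op b (scl c x) = scl c (op b x)"
    and JJ: "op (OJ i m) (op (OJ k n) w) = op (OJ k n) (op (OJ i m) w) + scl (of_real (cf i k)) (op (OJ (brk i k) (m + n)) w)
      + scl (if m + n = 0 then of_real (M * (of_int m / 2 * dt i k)) else 0) w"
    and JG: "op (OJ i m) (op (OG k n) w) = op (OG k n) (op (OJ i m) w) + scl (of_real (cf i k)) (op (OG (brk i k) (m + n)) w)"
    and LJ: "op (OL m) (op (OJ i n) w) = op (OJ i n) (op (OL m) w) + scl (of_int (- n)) (op (OJ i (m + n)) w)"
    and LG: "op (OL m) (op (OG i n) w) = op (OG i n) (op (OL m) w) + scl (of_real (of_int m / 2 - of_int n)) (op (OG i (m + n)) w)"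
    and LL: "op (OL m) (op (OL n) w) = op (OL n) (op (OL m) w) + scl (of_int (m - n)) (op (OL (m + n)) w)
      + scl (if m + n = 0 then of_real ((3 * M - 1) / 2 / 12 * (of_int m ^ 3 - of_int m)) else 0) w"
    and GG: "\<exists>K. \<forall>K'\<ge>K. op (OG i m) (op (OG k n) w) = scl (-1) (op (OG k n) (op (OG i m) w)) + (scl (of_real (M * dt i k)) (op (OL (m + n)) w)
      + scl (-1/2) (\<Sum>j=-K'..K'. nt (\<lambda>n. op (OJ i n)) (\<lambda>n. op (OJ k n)) (m + n) j w + nt (\<lambda>n. op (OJ k n)) (\<lambda>n. op (OJ i n)) (m + n) j w)
      + scl (of_real ((M - 1) * (of_int (m - n) / 2 * cf i k))) (op (OJ (brk i k) (m + n)) w)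
      + scl (if m + n = 0 then of_real (M * (M - 1) / 4 * (of_int m ^ 2 - 1 / 4) * dt i k) else 0) w)"
begin

lemma op_zero: "op b 0 = 0"
  using op_add[of b 0 0] by simp

definition hw :: "complex \<Rightarrow> complex \<Rightarrow> 'w \<Rightarrow> bool" where
  "hw l \<nu> v \<longleftrightarrow> (\<forall>n>0. op (OL n) v = 0 \<and> (\<forall>i. op (OJ i n) v = 0 \<and> op (OG i n) v = 0)) \<and>
     op (OJ P 0) v = 0 \<and> op (OG P 0) v = 0 \<and> op (OJ Z 0) v = scl \<nu> v \<and> op (OL 0) v = scl l v"

end

locale wmod_hw = wmod scl M op for scl :: "complex \<Rightarrow> 'w::ab_group_add \<Rightarrow> 'w" and M op +
  fixes v :: 'w and l \<nu> :: complex
  assumes hw_v: "hw l \<nu> v"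
begin

sublocale pbw scl op wop_wt wop_low v
proof unfold_locales
  show "1 \<le> wop_wt b" for b by (cases b) auto
qed (simp_all add: op_add op_scl)

lemma words_sum: "(\<And>j. j \<in> A \<Longrightarrow> words r (f j)) \<Longrightarrow> words r (\<Sum>j\<in>A. f j)"
  by (induction A rule: infinite_finite_induct) (auto intro: words.intros)

lemma words_comm:
  assumes "words r x"
  shows "\<exists>e z. op b (op c x) = scl e (op c (op b x)) + z \<and> words (r + wop_wt b + wop_wt c - 1) z"
proof -
  have m: "words s x" if "s \<ge> r" for s using words_mono[OF assms] that by simp
  have o: "words s (scl e (op d x))" if "wop_wt d + r \<le> s" for s d e
    by (intro words_scl words_act[OF assms that])
  have neg: "scl (of_real 1) y = y" for y by simp
  show ?thesis
  proof (cases b; cases c)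
    fix m n assume [simp]: "b = OL m" "c = OL n"
    have "op b (op c x) = scl 1 (op c (op b x)) + (scl (of_int (m - n)) (op (OL (m + n)) x) + scl (if m + n = 0 then of_real ((3 * M - 1) / 2 / 12 * (of_int m ^ 3 - of_int m)) else 0) x)"
      using LL[of m n x] by (simp add: add.assoc)
    moreover have "words (r + wop_wt b + wop_wt c - 1) (scl (of_int (m - n)) (op (OL (m + n)) x) + scl (if m + n = 0 then of_real ((3 * M - 1) / 2 / 12 * (of_int m ^ 3 - of_int m)) else 0) x)"
      by (intro words_add o words_scl[of _ x] m) simp_all
    ultimately show ?thesis by blast
  next
    fix m i n assume [simp]: "b = OL m" "c = OJ i n"
    have "op b (op c x) = scl 1 (op c (op b x)) + (scl (of_int (- n)) (op (OJ i (m + n)) x))"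
      using LJ[of m i n x] by (simp add: add.assoc)
    moreover have "words (r + wop_wt b + wop_wt c - 1) (scl (of_int (- n)) (op (OJ i (m + n)) x))"
      by (intro o) simp_all
    ultimately show ?thesis by blast
  next
    fix m i n assume [simp]: "b = OL m" "c = OG i n"
    have "op b (op c x) = scl 1 (op c (op b x)) + (scl (of_real (of_int m / 2 - of_int n)) (op (OG i (m + n)) x))"
      using LG[of m i n x] by (simp add: add.assoc)
    moreover have "words (r + wop_wt b + wop_wt c - 1) (scl (of_real (of_int m / 2 - of_int n)) (op (OG i (m + n)) x))"
      by (intro o) simp_all
    ultimately show ?thesis by blast
  next
    fix i m n assume [simp]: "b = OJ i m" "c = OL n"
    have "op b (op c x) = scl 1 (op c (op b x)) + scl (-1) (scl (of_int (- m)) (op (OJ i (n + m)) x))"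
      using LJ[of n i m x] by simp
    moreover have "words (r + wop_wt b + wop_wt c - 1) (scl (-1) (scl (of_int (- m)) (op (OJ i (n + m)) x)))"
      by (intro words_scl[of _ "scl _ _"] o) simp
    ultimately show ?thesis by blast
  next
    fix i m k n assume [simp]: "b = OJ i m" "c = OJ k n"
    have "op b (op c x) = scl 1 (op c (op b x)) + (scl (of_real (cf i k)) (op (OJ (brk i k) (m + n)) x) + scl (if m + n = 0 then of_real (M * (of_int m / 2 * dt i k)) else 0) x)"
      using JJ[of i m k n x] by (simp add: add.assoc)
    moreover have "words (r + wop_wt b + wop_wt c - 1) (scl (of_real (cf i k)) (op (OJ (brk i k) (m + n)) x) + scl (if m + n = 0 then of_real (M * (of_int m / 2 * dt i k)) else 0) x)"
      by (intro words_add o words_scl[of _ x] m) simp_all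
    ultimately show ?thesis by blast
  next
    fix i m k n assume [simp]: "b = OJ i m" "c = OG k n"
    have "op b (op c x) = scl 1 (op c (op b x)) + (scl (of_real (cf i k)) (op (OG (brk i k) (m + n)) x))"
      using JG[of i m k n x] by (simp add: add.assoc)
    moreover have "words (r + wop_wt b + wop_wt c - 1) (scl (of_real (cf i k)) (op (OG (brk i k) (m + n)) x))"
      by (intro o) simp_all
    ultimately show ?thesis by blast
  next
    fix i m n assume [simp]: "b = OG i m" "c = OL n"
    have "op b (op c x) = scl 1 (op c (op b x)) + scl (-1) (scl (of_real (of_int n / 2 - of_int m)) (op (OG i (n + m)) x))"
      using LG[of n i m x] by (simp flip: scale_left_distrib)
    moreover have "words (r + wop_wt b + wop_wt c - 1) (scl (-1) (scl (of_real (of_int n / 2 - of_int m)) (op (OG i (n + m)) x)))"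
      by (intro words_scl[of _ "scl _ _"] o) simp
    ultimately show ?thesis by blast
  next
    fix i m k n assume [simp]: "b = OG i m" "c = OJ k n"
    have "op b (op c x) = scl 1 (op c (op b x)) + scl (-1) (scl (of_real (cf k i)) (op (OG (brk k i) (n + m)) x))"
      using JG[of k n i m x] by simp
    moreover have "words (r + wop_wt b + wop_wt c - 1) (scl (-1) (scl (of_real (cf k i)) (op (OG (brk k i) (n + m)) x)))"
      by (intro words_scl[of _ "scl _ _"] o) simp
    ultimately show ?thesis by blast
  next
    fix i m k n assume [simp]: "b = OG i m" "c = OG k n"
    obtain K where e: "op (OG i m) (op (OG k n) x) = scl (-1) (op (OG k n) (op (OG i m) x)) + (scl (of_real (M * dt i k)) (op (OL (m + n)) x)
      + scl (-1/2) (\<Sum>j=-K..K. nt (\<lambda>n. op (OJ i n)) (\<lambda>n. op (OJ k n)) (m + n) j x + nt (\<lambda>n. op (OJ k n)) (\<lambda>n. op (OJ i n)) (m + n) j x)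
      + scl (of_real ((M - 1) * (of_int (m - n) / 2 * cf i k))) (op (OJ (brk i k) (m + n)) x)
      + scl (if m + n = 0 then of_real (M * (M - 1) / 4 * (of_int m ^ 2 - 1 / 4) * dt i k) else 0) x)"
      using GG[of i m k n x] by blast
    have JJ2: "words (r + 3) (op (OJ i' m') (op (OJ k' n') x))" for i' m' k' n'
      by (rule words_act[OF words_act[OF assms order_refl]]) simp
    then have "words (r + 3) (nt (\<lambda>n. op (OJ i' n)) (\<lambda>n. op (OJ k' n)) (m + n) j x)" for i' k' j
      by (simp add: nt_def)
    note nt3 = this
    have "words (r + 3) (scl (of_real (M * dt i k)) (op (OL (m + n)) x)
      + scl (-1/2) (\<Sum>j=-K..K. nt (\<lambda>n. op (OJ i n)) (\<lambda>n. op (OJ k n)) (m + n) j x + nt (\<lambda>n. op (OJ k n)) (\<lambda>n. op (OJ i n)) (m + n) j x)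
      + scl (of_real ((M - 1) * (of_int (m - n) / 2 * cf i k))) (op (OJ (brk i k) (m + n)) x)
      + scl (if m + n = 0 then of_real (M * (M - 1) / 4 * (of_int m ^ 2 - 1 / 4) * dt i k) else 0) x)"
    proof (intro words_add)
      show "words (r + 3) (scl e (\<Sum>j=-K..K. nt (\<lambda>n. op (OJ i n)) (\<lambda>n. op (OJ k n)) (m + n) j x + nt (\<lambda>n. op (OJ k n)) (\<lambda>n. op (OJ i n)) (m + n) j x))" for e
        by (intro words_scl words_sum words_add nt3)
      show "words (r + 3) (scl e x)" for e
        by (intro words_scl m) simp
    qed (intro o; simp)+
    note w = this
    have ix: "r + wop_wt (OG i m) + wop_wt (OG k n) - 1 = r + 3" by simp
    show ?thesis
      unfolding \<open>b = OG i m\<close> \<open>c = OG k n\<close> ix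
      by (rule exI[of _ "-1"], rule exI, rule conjI, rule e, rule w)
  qed
qed

lemma hw_nonlow: "b \<notin> wop_low \<Longrightarrow> \<exists>e. op b v = scl e v"
proof -
  assume b: "b \<notin> wop_low"
  have 0: "\<exists>e. y = scl e v" if "y = 0" for y using that scale_zero_left[of v] by metis
  show ?thesis
  proof (cases b)
    case (OL n)
    then show ?thesis using b hw_v 0 by (cases "n = 0") (auto simp: wop_low_def hw_def)
  next
    case (OJ i n)
    then show ?thesis using b hw_v 0 by (cases "n = 0"; cases i) (auto simp: wop_low_def hw_def)
  next
    case (OG i n)
    then show ?thesis using b hw_v 0 by (cases "n = 0") (auto simp: wop_low_def hw_def)
  qed
qed

lemma words_low: "words t x \<Longrightarrow> low_words t x"
  by (rule words_low_words[OF words_comm hw_nonlow])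

fun chg :: "idx \<Rightarrow> int" where "chg P = 1" | "chg Z = 0" | "chg N = -1"

text \<open>Monomials in lowering modes: \<open>d\<close> is the energy above that of
  \<open>v\<close>, and \<open>q\<close> the loss of charge.\<close>

inductive graded :: "int \<Rightarrow> int \<Rightarrow> 'w \<Rightarrow> bool" where
  graded_v: "graded 0 0 v"
| graded_L: "graded d q x \<Longrightarrow> OL n \<in> wop_low \<Longrightarrow> graded (d - n) q (op (OL n) x)"
| graded_J: "graded d q x \<Longrightarrow> OJ i n \<in> wop_low \<Longrightarrow> graded (d - n) (q - chg i) (op (OJ i n) x)"
| graded_G: "graded d q x \<Longrightarrow> OG i n \<in> wop_low \<Longrightarrow> graded (d - n) (q - chg i) (op (OG i n) x)"

lemma graded_op: "graded d q x \<Longrightarrow> b \<in> wop_low \<Longrightarrow> \<exists>d q. graded d q (op b x)"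
  by (cases b) (auto intro: graded.intros)

lemma low_words_graded: "low_words r x \<Longrightarrow> x \<in> span {y. \<exists>d q. graded d q y}"
proof (induction rule: low_words.induct)
  case (low_act b r x s)
  from low_act.IH show ?case
  proof (induction rule: span_induct_alt)
    case (step c y z)
    then show ?case using graded_op[of _ _ y b] low_act(1)
      by (auto simp: op_add op_scl intro!: span_add span_scale intro: span_base)
  qed (simp add: op_zero span_zero)
qed (auto intro: span_zero span_add span_scale span_base graded_v)

text \<open>No lowering mode decreases the energy, and those that keep it are the zero modes of
  \<open>J N\<close>, \<open>G Z\<close> and \<open>G N\<close>, none of which raises the
  charge.\<close>

lemma graded_pos: "graded d q x \<Longrightarrow> d \<ge> 0 \<and> (d = 0 \<longrightarrow> q \<ge> 0)"
proof (induction rule: graded.induct)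
  case (graded_J d q x i n)
  then show ?case by (cases i) (auto simp: wop_low_def)
next
  case (graded_G d q x i n)
  then show ?case by (cases i) (auto simp: wop_low_def)
qed (auto simp: wop_low_def)

lemma weight_comm:
  "op (OL 0) (op (OL n) x) = op (OL n) (op (OL 0) x) + scl (- of_int n) (op (OL n) x)"
  "op (OL 0) (op (OJ i n) x) = op (OJ i n) (op (OL 0) x) + scl (- of_int n) (op (OJ i n) x)"
  "op (OL 0) (op (OG i n) x) = op (OG i n) (op (OL 0) x) + scl (- of_int n) (op (OG i n) x)"
  "op (OJ Z 0) (op (OL n) x) = op (OL n) (op (OJ Z 0) x) + scl 0 (op (OL n) x)"
  "op (OJ Z 0) (op (OJ i n) x) = op (OJ i n) (op (OJ Z 0) x) + scl (of_int (chg i)) (op (OJ i n) x)"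
  "op (OJ Z 0) (op (OG i n) x) = op (OG i n) (op (OJ Z 0) x) + scl (of_int (chg i)) (op (OG i n) x)"
proof -
  have c: "complex_of_real (cf Z i) = of_int (chg i)" "brk Z i = i" by (cases i; simp)+
  show "op (OL 0) (op (OL n) x) = op (OL n) (op (OL 0) x) + scl (- of_int n) (op (OL n) x)"
    "op (OL 0) (op (OJ i n) x) = op (OJ i n) (op (OL 0) x) + scl (- of_int n) (op (OJ i n) x)"
    "op (OL 0) (op (OG i n) x) = op (OG i n) (op (OL 0) x) + scl (- of_int n) (op (OG i n) x)"
    "op (OJ Z 0) (op (OL n) x) = op (OL n) (op (OJ Z 0) x) + scl 0 (op (OL n) x)"
    using LL[of 0 n x] LJ[of 0 i n x] LG[of 0 i n x] LJ[of n Z 0 x] by simp_all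
  show "op (OJ Z 0) (op (OJ i n) x) = op (OJ i n) (op (OJ Z 0) x) + scl (of_int (chg i)) (op (OJ i n) x)"
    "op (OJ Z 0) (op (OG i n) x) = op (OG i n) (op (OJ Z 0) x) + scl (of_int (chg i)) (op (OG i n) x)"
    using JJ[of Z 0 i n x] JG[of Z 0 i n x] unfolding c by simp_all
qed

lemma graded_eigen: "graded d q x \<Longrightarrow> op (OL 0) x = scl (l + of_int d) x \<and> op (OJ Z 0) x = scl (\<nu> - of_int q) x"
proof (induction rule: graded.induct)
  case graded_v
  then show ?case using hw_v by (simp add: hw_def)
qed (simp_all add: weight_comm op_scl scale_left_distrib[symmetric] add_diff_eq diff_add_eq del: scale_minus_left)

end

section \<open>Separating the eigenvalue 0\<close>

locale lin_op = vector_space scl for scl :: "complex \<Rightarrow> 'w::ab_group_add \<Rightarrow> 'w" +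
  fixes E :: "'w \<Rightarrow> 'w"
  assumes E_add: "E (x + y) = E x + E y" and E_scl: "E (scl c x) = scl c (E x)"
begin

definition sh :: "complex \<Rightarrow> 'w \<Rightarrow> 'w" where "sh \<mu> x = E x - scl \<mu> x"

lemma sh_add: "sh \<mu> (x + y) = sh \<mu> x + sh \<mu> y"
  by (simp add: sh_def E_add scale_right_distrib)

lemma sh_scl: "sh \<mu> (scl c x) = scl c (sh \<mu> x)"
  by (simp add: sh_def E_scl scale_right_diff_distrib mult.commute)

lemma E_diff: "E (x - y) = E x - E y"
  using E_add[of "x - y" y] by (simp add: eq_diff_eq)

lemma sh_sh: "sh \<mu> (sh \<kappa> x) = sh \<kappa> (sh \<mu> x)"
  by (simp add: sh_def E_diff E_scl scale_right_diff_distrib mult.commute algebra_simps)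

definition pw :: "complex list \<Rightarrow> 'w \<Rightarrow> 'w" where "pw ls x = foldr sh ls x"

lemma pw_add: "pw ls (x + y) = pw ls x + pw ls y"
  by (induction ls) (simp_all add: pw_def sh_add)

lemma pw_scl: "pw ls (scl c x) = scl c (pw ls x)"
  by (induction ls) (simp_all add: pw_def sh_scl)

lemma pw_zero: "pw ls 0 = 0"
  using pw_add[of ls 0 0] by simp

lemma pw_sh: "pw ls (sh \<mu> x) = sh \<mu> (pw ls x)"
  by (induction ls) (simp_all add: pw_def sh_sh[of \<mu>])

lemma pw_append: "pw (ls @ ks) x = pw ls (pw ks x)"
  by (simp add: pw_def)

lemma pw_commute: "pw ls (pw ks x) = pw ks (pw ls x)"
proof (induction ks)
  case Nil
  then show ?case by (simp add: pw_def)
next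
  case (Cons k ks)
  have "pw (k # ks) y = sh k (pw ks y)" for y by (simp add: pw_def)
  then show ?case using Cons by (simp add: pw_sh)
qed

text \<open>A polynomial in \<open>E\<close> with nonzero roots kills \<open>x\<close>. Such vectors
  form a subspace that meets the kernel of \<open>E\<close> only in 0; this separates the eigenvalue
  0 without a decomposition into eigenspaces.\<close>

definition ann_poly :: "'w \<Rightarrow> bool" where
  "ann_poly x \<longleftrightarrow> (\<exists>ls. 0 \<notin> set ls \<and> pw ls x = 0)"

lemma ann_poly_add: "ann_poly x \<Longrightarrow> ann_poly y \<Longrightarrow> ann_poly (x + y)"
proof -
  assume "ann_poly x" "ann_poly y"
  then obtain ls ks where *: "0 \<notin> set ls" "pw ls x = 0" "0 \<notin> set ks" "pw ks y = 0"
    by (auto simp: ann_poly_def)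
  have "pw (ls @ ks) (x + y) = 0"
    using * pw_commute[of ls ks x] by (simp add: pw_append pw_add pw_zero)
  then show ?thesis unfolding ann_poly_def using * by (intro exI[of _ "ls @ ks"]) simp
qed

lemma ann_poly_scl: "ann_poly x \<Longrightarrow> ann_poly (scl c x)"
  unfolding ann_poly_def using pw_scl by (metis scale_zero_right)

lemma ann_poly_eigen: "E x = scl \<mu> x \<Longrightarrow> \<mu> \<noteq> 0 \<Longrightarrow> ann_poly x"
  unfolding ann_poly_def by (rule exI[of _ "[\<mu>]"]) (simp add: pw_def sh_def)

text \<open>On the kernel of \<open>E\<close> each factor of the polynomial acts as a nonzero
  scalar.\<close>

lemma ann_poly_kernel:
  assumes "ann_poly x" "E x = 0"
  shows "x = 0"
proof -
  obtain ls where ls: "0 \<notin> set ls" "pw ls x = 0" using assms by (auto simp: ann_poly_def)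
  have "\<exists>c. c \<noteq> 0 \<and> pw ls x = scl c x"
    using ls(1)
  proof (induction ls)
    case Nil
    then show ?case by (intro exI[of _ 1]) (simp add: pw_def)
  next
    case (Cons k ls)
    then obtain c where c: "c \<noteq> 0" "pw ls x = scl c x" by auto
    have "pw (k # ls) x = sh k (pw ls x)" by (simp add: pw_def)
    also have "\<dots> = scl (- k * c) x" by (simp add: c sh_def E_scl assms(2))
    finally show ?case using c Cons.prems by (intro exI[of _ "- k * c"]) auto
  qed
  then show ?thesis using ls(2) by auto
qed

end

text \<open>On \<open>v\<close> the right side of the anticommutator involves only
  \<open>OL 0\<close>, the square of the Cartan zero mode and constants. The value of the scalar is
  not computed: in \<open>glue\<close> the Fock component shows that it is 0.\<close>

lemma (in wmod_hw) GG_scalar: "\<exists>t. op (OG Z 0) (op (OG Z 0) v) + op (OG Z 0) (op (OG Z 0) v) = scl t v"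
proof -
  obtain K where e: "op (OG Z 0) (op (OG Z 0) v) = scl (-1) (op (OG Z 0) (op (OG Z 0) v)) + (scl (of_real (M * dt Z Z)) (op (OL (0 + 0)) v)
      + scl (-1/2) (\<Sum>j=-K..K. nt (\<lambda>n. op (OJ Z n)) (\<lambda>n. op (OJ Z n)) (0 + 0) j v + nt (\<lambda>n. op (OJ Z n)) (\<lambda>n. op (OJ Z n)) (0 + 0) j v)
      + scl (of_real ((M - 1) * (of_int (0 - 0) / 2 * cf Z Z))) (op (OJ (brk Z Z) (0 + 0)) v)
      + scl (if (0::int) + 0 = 0 then of_real (M * (M - 1) / 4 * (of_int 0 ^ 2 - 1 / 4) * dt Z Z) else 0) v)"
    using GG[of Z 0 Z 0 v] by blast
  have "nt (\<lambda>n. op (OJ Z n)) (\<lambda>n. op (OJ Z n)) (0 + 0) j v = scl (if j = 0 then \<nu> * \<nu> else 0) v" for j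
    using hw_v unfolding hw_def nt_def by (cases "j < 0"; cases "j = 0") (auto simp: op_zero op_scl)
  then have s: "(\<Sum>j=-K..K. nt (\<lambda>n. op (OJ Z n)) (\<lambda>n. op (OJ Z n)) (0 + 0) j v + nt (\<lambda>n. op (OJ Z n)) (\<lambda>n. op (OJ Z n)) (0 + 0) j v)
     = scl (\<Sum>j=-K..K. (if j = 0 then \<nu> * \<nu> else 0) + (if j = 0 then \<nu> * \<nu> else 0)) v"
    unfolding scale_sum_left scale_left_distrib by simp
  define r where "r = of_real M * l - 1/2 * (\<Sum>j=-K..K. (if j = 0 then \<nu> * \<nu> else 0) + (if j = 0 then \<nu> * \<nu> else 0))
     + of_real (M * (M - 1) / 4 * (of_int 0 ^ 2 - 1 / 4) * dt Z Z)"
  have "op (OL 0) v = scl l v" using hw_v by (simp add: hw_def)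
  then have "op (OG Z 0) (op (OG Z 0) v) = - op (OG Z 0) (op (OG Z 0) v) + scl r v"
    using e unfolding s r_def by (simp add: scale_left_distrib scale_left_diff_distrib)
  then have "op (OG Z 0) (op (OG Z 0) v) + op (OG Z 0) (op (OG Z 0) v) = scl r v"
    by (metis add.commute add.left_commute add_0_left add.right_inverse)
  then show ?thesis by blast
qed

section \<open>The map from the given module to the Fock space\<close>

fun dual :: "wop \<Rightarrow> wop" where
  "dual (OL n) = OL (- n)" | "dual (OJ i n) = OJ (st i) (- n)" | "dual (OG i n) = OG (st i) (- n)"

text \<open>The adjoint of a lowering mode is a raising one, except for the zero mode of
  \<open>G\<close> of weight 0, which is its own adjoint; hence the extra assumption on it.\<close>

lemma (in wmod_hw) dual_low_kill:
  assumes "b \<in> wop_low" "op (OG Z 0) v = 0"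
  shows "op (dual b) v = 0"
proof (cases b)
  case (OL n)
  then show ?thesis using assms hw_v by (simp add: wop_low_def hw_def)
next
  case (OJ i n)
  then show ?thesis using assms hw_v by (cases i) (auto simp: wop_low_def hw_def)
next
  case (OG i n)
  then show ?thesis using assms hw_v by (cases i; cases "n = 0") (auto simp: wop_low_def hw_def)
qed

theorem glue:
  fixes sM :: "complex \<Rightarrow> 'm::ab_group_add \<Rightarrow> 'm"
  assumes "wmod_hw sM M opM vM l \<nu>" and "wmod_hw cscale M opF v0 l \<nu>"
    and adj: "\<And>b x y. inner_fock (opF b x) y = inner_fock x (opF (dual b) y)"
    and GZ: "opF (OG Z 0) v0 = 0" and v0: "v0 \<noteq> 0" and vM: "vM \<noteq> 0"
    and gen: "\<And>S. vM \<in> S \<Longrightarrow> 0 \<in> S \<Longrightarrow> (\<And>x y. x \<in> S \<Longrightarrow> y \<in> S \<Longrightarrow> x + y \<in> S) \<Longrightarrow> (\<And>c x. x \<in> S \<Longrightarrow> sM c x \<in> S) \<Longrightarrow>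
      (\<And>b x. x \<in> S \<Longrightarrow> opM b x \<in> S) \<Longrightarrow> S = UNIV"
  shows "\<exists>f. (\<forall>x y. f (x + y) = f x + f y) \<and> (\<forall>c x. f (sM c x) = cscale c (f x)) \<and>
     (\<forall>b x. f (opM b x) = opF b (f x)) \<and> f vM = v0"
proof -
  interpret A: wmod_hw sM M opM vM l \<nu> by (rule assms)
  interpret B: wmod_hw cscale M opF v0 l \<nu> by (rule assms)
  define sP where "sP c p = (sM c (fst p), cscale c (snd p))" for c and p :: "'m \<times> fock"
  define opP where "opP b p = (opM b (fst p), opF b (snd p))" for b and p :: "'m \<times> fock"
  have P_fs [simp]: "fst (sP c p) = sM c (fst p)" "snd (sP c p) = cscale c (snd p)"
    "fst (opP b p) = opM b (fst p)" "snd (opP b p) = opF b (snd p)" for c b p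
    by (simp_all add: sP_def opP_def)
  have nt_fs: "fst (nt (\<lambda>n. opP (X n)) (\<lambda>n. opP (Y n)) q j p) = nt (\<lambda>n. opM (X n)) (\<lambda>n. opM (Y n)) q j (fst p)"
    "snd (nt (\<lambda>n. opP (X n)) (\<lambda>n. opP (Y n)) q j p) = nt (\<lambda>n. opF (X n)) (\<lambda>n. opF (Y n)) q j (snd p)" for X Y q j p
    by (simp_all add: nt_def)
  interpret QW: wmod sP M opP
  proof unfold_locales
    fix i k :: idx and m n :: int and w :: "'m \<times> fock"
    obtain K1 where K1: "\<And>K'. K' \<ge> K1 \<Longrightarrow> opM (OG i m) (opM (OG k n) (fst w)) = sM (-1) (opM (OG k n) (opM (OG i m) (fst w))) + (sM (of_real (M * dt i k)) (opM (OL (m + n)) (fst w))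
      + sM (-1/2) (\<Sum>j=-K'..K'. nt (\<lambda>n. opM (OJ i n)) (\<lambda>n. opM (OJ k n)) (m + n) j (fst w) + nt (\<lambda>n. opM (OJ k n)) (\<lambda>n. opM (OJ i n)) (m + n) j (fst w))
      + sM (of_real ((M - 1) * (of_int (m - n) / 2 * cf i k))) (opM (OJ (brk i k) (m + n)) (fst w))
      + sM (if m + n = 0 then of_real (M * (M - 1) / 4 * (of_int m ^ 2 - 1 / 4) * dt i k) else 0) (fst w))"
      using A.GG[of i m k n "fst w"] by blast
    obtain K2 where K2: "\<And>K'. K' \<ge> K2 \<Longrightarrow> opF (OG i m) (opF (OG k n) (snd w)) = cscale (-1) (opF (OG k n) (opF (OG i m) (snd w))) + (cscale (of_real (M * dt i k)) (opF (OL (m + n)) (snd w))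
      + cscale (-1/2) (\<Sum>j=-K'..K'. nt (\<lambda>n. opF (OJ i n)) (\<lambda>n. opF (OJ k n)) (m + n) j (snd w) + nt (\<lambda>n. opF (OJ k n)) (\<lambda>n. opF (OJ i n)) (m + n) j (snd w))
      + cscale (of_real ((M - 1) * (of_int (m - n) / 2 * cf i k))) (opF (OJ (brk i k) (m + n)) (snd w))
      + cscale (if m + n = 0 then of_real (M * (M - 1) / 4 * (of_int m ^ 2 - 1 / 4) * dt i k) else 0) (snd w))"
      using B.GG[of i m k n "snd w"] by blast
    show "\<exists>K. \<forall>K'\<ge>K. opP (OG i m) (opP (OG k n) w) = sP (-1) (opP (OG k n) (opP (OG i m) w)) + (sP (of_real (M * dt i k)) (opP (OL (m + n)) w)
      + sP (-1/2) (\<Sum>j=-K'..K'. nt (\<lambda>n. opP (OJ i n)) (\<lambda>n. opP (OJ k n)) (m + n) j w + nt (\<lambda>n. opP (OJ k n)) (\<lambda>n. opP (OJ i n)) (m + n) j w)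
      + sP (of_real ((M - 1) * (of_int (m - n) / 2 * cf i k))) (opP (OJ (brk i k) (m + n)) w)
      + sP (if m + n = 0 then of_real (M * (M - 1) / 4 * (of_int m ^ 2 - 1 / 4) * dt i k) else 0) w)"
    proof (intro exI[of _ "max K1 K2"] allI impI prod_eqI)
      fix K' assume "max K1 K2 \<le> K'"
      then have K: "K' \<ge> K1" "K' \<ge> K2" by auto
      show "fst (opP (OG i m) (opP (OG k n) w)) = fst (sP (-1) (opP (OG k n) (opP (OG i m) w)) + (sP (of_real (M * dt i k)) (opP (OL (m + n)) w)
        + sP (-1/2) (\<Sum>j=-K'..K'. nt (\<lambda>n. opP (OJ i n)) (\<lambda>n. opP (OJ k n)) (m + n) j w + nt (\<lambda>n. opP (OJ k n)) (\<lambda>n. opP (OJ i n)) (m + n) j w)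
        + sP (of_real ((M - 1) * (of_int (m - n) / 2 * cf i k))) (opP (OJ (brk i k) (m + n)) w)
        + sP (if m + n = 0 then of_real (M * (M - 1) / 4 * (of_int m ^ 2 - 1 / 4) * dt i k) else 0) w))"
        unfolding fst_add P_fs fst_sum nt_fs by (rule K1[OF K(1)])
      show "snd (opP (OG i m) (opP (OG k n) w)) = snd (sP (-1) (opP (OG k n) (opP (OG i m) w)) + (sP (of_real (M * dt i k)) (opP (OL (m + n)) w)
        + sP (-1/2) (\<Sum>j=-K'..K'. nt (\<lambda>n. opP (OJ i n)) (\<lambda>n. opP (OJ k n)) (m + n) j w + nt (\<lambda>n. opP (OJ k n)) (\<lambda>n. opP (OJ i n)) (m + n) j w)
        + sP (of_real ((M - 1) * (of_int (m - n) / 2 * cf i k))) (opP (OJ (brk i k) (m + n)) w)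
        + sP (if m + n = 0 then of_real (M * (M - 1) / 4 * (of_int m ^ 2 - 1 / 4) * dt i k) else 0) w))"
        unfolding snd_add P_fs snd_sum nt_fs by (rule K2[OF K(2)])
    qed
  next
    have vs: "vector_space sP"
      by unfold_locales
        (simp_all add: prod_eq_iff A.scale_right_distrib A.scale_left_distrib B.scale_right_distrib B.scale_left_distrib)
    then interpret vector_space sP .
    fix i k :: idx and m n :: int and w x y :: "'m \<times> fock" and b :: wop and c :: complex
    show "opP b (x + y) = opP b x + opP b y" "opP b (sP c x) = sP c (opP b x)"
      by (simp_all add: prod_eq_iff A.op_add B.op_add A.op_scl B.op_scl)
    show "opP (OJ i m) (opP (OJ k n) w) = opP (OJ k n) (opP (OJ i m) w) + sP (of_real (cf i k)) (opP (OJ (brk i k) (m + n)) w)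
      + sP (if m + n = 0 then of_real (M * (of_int m / 2 * dt i k)) else 0) w"
      by (rule prod_eqI) (simp_all only: fst_add snd_add P_fs A.JJ[of i m k n] B.JJ[of i m k n])
    show "opP (OJ i m) (opP (OG k n) w) = opP (OG k n) (opP (OJ i m) w) + sP (of_real (cf i k)) (opP (OG (brk i k) (m + n)) w)"
      by (rule prod_eqI) (simp_all only: fst_add snd_add P_fs A.JG[of i m k n] B.JG[of i m k n])
    show "opP (OL m) (opP (OJ i n) w) = opP (OJ i n) (opP (OL m) w) + sP (of_int (- n)) (opP (OJ i (m + n)) w)"
      by (rule prod_eqI) (simp_all only: fst_add snd_add P_fs A.LJ[of m i n] B.LJ[of m i n])
    show "opP (OL m) (opP (OG i n) w) = opP (OG i n) (opP (OL m) w) + sP (of_real (of_int m / 2 - of_int n)) (opP (OG i (m + n)) w)"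
      by (rule prod_eqI) (simp_all only: fst_add snd_add P_fs A.LG[of m i n] B.LG[of m i n])
    show "opP (OL m) (opP (OL n) w) = opP (OL n) (opP (OL m) w) + sP (of_int (m - n)) (opP (OL (m + n)) w)
      + sP (if m + n = 0 then of_real ((3 * M - 1) / 2 / 12 * (of_int m ^ 3 - of_int m)) else 0) w"
      using A.LL[of m n "fst w"] B.LL[of m n "snd w"] by (intro prod_eqI) (simp_all only: fst_add snd_add P_fs)
    show "sP c (x + y) = sP c x + sP c y" by (rule scale_right_distrib)
    show "sP (a + b) x = sP a x + sP b x" for a b by (rule scale_left_distrib)
    show "sP a (sP b x) = sP (a * b) x" for a b by simp
    show "sP 1 x = x" by simp
  qed
  have "QW.hw l \<nu> (vM, v0)"
    using A.hw_v B.hw_v unfolding QW.hw_def A.hw_def B.hw_def by (simp add: prod_eq_iff)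
  then interpret Q: wmod_hw sP M opP "(vM, v0)" l \<nu>
    by unfold_locales
  let ?v = "(vM, v0)"
  let ?G = "opP (OG Z 0) ?v"
  define N where "N p \<longleftrightarrow> (\<exists>r. Q.words r p)" for p
  have N0: "N 0" "N ?v" and N_scl: "N p \<Longrightarrow> N (sP c p)" and N_op: "N p \<Longrightarrow> N (opP b p)"
    and N_add: "N p \<Longrightarrow> N q \<Longrightarrow> N (p + q)" for p q c b
  proof -
    show "N 0" "N ?v" unfolding N_def by (blast intro: Q.words.intros)+
    show "N p \<Longrightarrow> N (sP c p)" "N p \<Longrightarrow> N (opP b p)" unfolding N_def by (blast intro: Q.words.intros)+
    show "N (p + q)" if pq: "N p" "N q"
    proof -
      from pq obtain r s where "Q.words r p" "Q.words s q" by (auto simp: N_def)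
      then have "Q.words (max r s) p" "Q.words (max r s) q" by (auto intro: Q.words_mono)
      then show ?thesis unfolding N_def by (blast intro: Q.words.intros)
    qed
  qed
  \<comment> \<open>One operator for both gradings: on the first component of a monomial with energy
    d and charge loss q it has the eigenvalue d + i q, which is 0 only for d = q = 0.\<close>
  define E where "E x = opM (OL 0) x - sM l x - sM \<i> (opM (OJ Z 0) x - sM \<nu> x)" for x
  interpret E: lin_op sM E
    by unfold_locales
      (simp_all add: E_def A.op_add A.op_scl A.scale_right_distrib A.scale_right_diff_distrib mult_ac)
  \<comment> \<open>Twice this vector is a multiple t of (\<open>vM\<close>, \<open>v0\<close>). Its
    second component is 0 while \<open>v0\<close> is not, so t = 0.\<close>
  have GGP: "opP (OG Z 0) ?G = 0"
  proof -
    obtain t where t: "opP (OG Z 0) ?G + opP (OG Z 0) ?G = sP t ?v" using Q.GG_scalar by blast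
    then have "cscale t v0 = snd (opP (OG Z 0) ?G + opP (OG Z 0) ?G)" by simp
    then have "cscale t v0 = 0" by (simp add: GZ B.op_zero)
    then have "t = 0" using v0 by simp
    then have "sP 2 (opP (OG Z 0) ?G) = 0"
      using t QW.scale_left_distrib[of 1 1 "opP (OG Z 0) ?G"] by simp
    then show ?thesis by simp
  qed
  \<comment> \<open>At energy and charge 0 only the zero mode of \<open>G\<close> of weight 0 can
    have been applied, and applying it twice gives 0.\<close>
  have top: "Q.graded d q x \<Longrightarrow> d = 0 \<and> q = 0 \<longrightarrow> x = ?v \<or> x = ?G \<or> x = 0" for d q x
  proof (induction rule: Q.graded.induct)
    case (graded_L d q x n)
    then show ?case using Q.graded_pos[of d q x] by (auto simp: wop_low_def)
  next
    case (graded_J d q x i n)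
    then show ?case using Q.graded_pos[of d q x] by (cases i) (auto simp: wop_low_def)
  next
    case (graded_G d q x i n)
    then show ?case using Q.graded_pos[of d q x] GGP QW.op_zero by (cases i) (auto simp: wop_low_def)
  qed simp
  have low_orth: "inner_fock v0 (opF b y) = 0" if "b \<in> wop_low" for b y
  proof -
    have "st (st i) = i" for i by (cases i) simp_all
    then have d: "dual (dual b) = b" by (cases b) simp_all
    have "inner_fock (opF (dual b) v0) y = inner_fock v0 (opF b y)"
      using adj[of "dual b" v0 y] by (simp add: d)
    then show ?thesis using B.dual_low_kill[OF that GZ] by simp
  qed
  have graded_orth: "inner_fock v0 (snd x) = 0" if "Q.graded d q x" "\<not> (d = 0 \<and> q = 0)" for d q x
    using that by (cases rule: Q.graded.cases) (auto intro: low_orth)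
  have eig: "E (fst x) = sM (of_int d + \<i> * of_int q) (fst x)" if "Q.graded d q x" for d q x
  proof -
    have "opP (OL 0) x = sP (l + of_int d) x" "opP (OJ Z 0) x = sP (\<nu> - of_int q) x"
      using Q.graded_eigen[OF that] by auto
    then have "opM (OL 0) (fst x) = sM (l + of_int d) (fst x)" "opM (OJ Z 0) (fst x) = sM (\<nu> - of_int q) (fst x)"
      by (metis P_fs)+
    then show ?thesis
      by (simp add: E_def flip: A.scale_left_diff_distrib) (simp add: algebra_simps)
  qed
  have decomp: "\<exists>\<alpha> \<beta> z. p = sP \<alpha> ?v + sP \<beta> ?G + z \<and> E.ann_poly (fst z) \<and> inner_fock v0 (snd z) = 0" if "N p" for p
  proof -
    from that have "p \<in> QW.span {y. \<exists>d q. Q.graded d q y}"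
      using Q.low_words_graded Q.words_low unfolding N_def by blast
    then show ?thesis
    proof (induction rule: QW.span_induct_alt)
      case base
      have "E.ann_poly 0" unfolding E.ann_poly_def by (rule exI[of _ "[]"]) (simp add: E.pw_def)
      then show ?case by (intro exI[of _ 0] exI[of _ "0"]) simp
    next
      case (step c y p)
      then obtain d q \<alpha> \<beta> z where y: "Q.graded d q y"
        and z: "p = sP \<alpha> ?v + sP \<beta> ?G + z" "E.ann_poly (fst z)" "inner_fock v0 (snd z) = 0" by blast
      show ?case
      proof (cases "d = 0 \<and> q = 0")
        case True
        then consider "y = ?v" | "y = ?G" | "y = 0" using top[OF y] by blast
        then show ?thesis
        proof cases
          case 1
          then have "sP c y + p = sP (c + \<alpha>) ?v + sP \<beta> ?G + z" by (simp add: z(1) QW.scale_left_distrib)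
          with z show ?thesis by blast
        next
          case 2
          then have "sP c y + p = sP \<alpha> ?v + sP (c + \<beta>) ?G + z" by (simp add: z(1) QW.scale_left_distrib)
          with z show ?thesis by blast
        next
          case 3
          then have "sP c y + p = sP \<alpha> ?v + sP \<beta> ?G + z" by (simp add: z(1))
          with z show ?thesis by blast
        qed
      next
        case False
        then have "of_int d + \<i> * of_int q \<noteq> (0::complex)" by (auto simp: complex_eq_iff)
        then have "E.ann_poly (fst (sP c y + z))"
          using E.ann_poly_eigen[OF eig[OF y]] z(2) by (simp add: E.ann_poly_add E.ann_poly_scl)
        moreover have "inner_fock v0 (snd (sP c y + z)) = 0"
          using graded_orth[OF y False] z(3) by (simp add: inner_fock_right)
        moreover have "sP c y + p = sP \<alpha> ?v + sP \<beta> ?G + (sP c y + z)" by (simp add: z(1))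
        ultimately show ?thesis by blast
      qed
    qed
  qed
  have orth0: "inner_fock v0 y = 0" if Ny: "N (0, y)" for y
  proof -
    obtain \<alpha> \<beta> z where z: "(0, y) = sP \<alpha> ?v + sP \<beta> ?G + z" "E.ann_poly (fst z)" "inner_fock v0 (snd z) = 0"
      using decomp[OF Ny] by blast
    let ?g = "opM (OG Z 0) vM"
    have 1: "0 = sM \<alpha> vM + sM \<beta> ?g + fst z" using arg_cong[OF z(1), of fst] by simp
    have "Q.graded 0 0 ?v" "Q.graded 0 0 ?G"
      using Q.graded_v Q.graded_G[OF Q.graded_v, of Z 0] by (simp_all add: wop_low_def)
    then have "E vM = 0" "E ?g = 0" using eig[of 0 0] by fastforce+
    then have E0: "E (sM \<alpha> vM + sM \<beta> ?g) = 0" by (simp add: E.E_add E.E_scl)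
    \<comment> \<open>This vector lies in the kernel of \<open>E\<close>, and its negative
      \<open>fst z\<close> is killed by a polynomial in \<open>E\<close> without the root 0; so it
      vanishes.\<close>
    define u where "u = sM \<alpha> vM + sM \<beta> ?g"
    have "u + fst z = 0" using 1 by (simp add: u_def)
    then have "fst z = - u" by (rule minus_unique[symmetric])
    then have "sM (-1) (fst z) = u" by simp
    then have k: "sM \<alpha> vM + sM \<beta> ?g = 0"
      using E.ann_poly_kernel[of u] E.ann_poly_scl[OF z(2), of "-1"] E0 unfolding u_def by metis
    \<comment> \<open>Applying the zero mode once more leaves \<alpha> times \<open>?g\<close>,
      which is therefore 0. If \<alpha> were nonzero, \<open>?g\<close> would vanish and the
      relation would reduce to \<alpha> times \<open>vM\<close> being 0.\<close>
    have gg: "opM (OG Z 0) ?g = 0" using arg_cong[OF GGP, of fst] by simp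
    have "opM (OG Z 0) (sM \<alpha> vM + sM \<beta> ?g) = sM \<alpha> ?g" by (simp add: A.op_add A.op_scl gg)
    then have "sM \<alpha> ?g = 0" using k by (simp add: A.op_zero)
    then have "\<alpha> = 0" using k vM by auto
    moreover have "y = cscale \<alpha> v0 + snd z" using arg_cong[OF z(1), of snd] by (simp add: GZ)
    ultimately show ?thesis using z(3) by (simp add: inner_fock_right)
  qed
  have orth: "Q.words r p \<Longrightarrow> (\<forall>y. N (0, y) \<longrightarrow> inner_fock (snd p) y = 0)" for r p
  proof (induction rule: Q.words.induct)
    case (words_act r x b s)
    show ?case
    proof (intro allI impI)
      fix y assume "N (0, y)"
      then have "N (opP (dual b) (0, y))" by (rule N_op)
      then have "N (0, opF (dual b) y)" by (simp add: opP_def A.op_zero)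
      then show "inner_fock (snd (opP b x)) y = 0" using words_act by (simp add: adj)
    qed
  qed (use orth0 in \<open>auto simp: inner_fock_add_left inner_fock_cscale_left\<close>)
  have zero: "y = 0" if "N (0, y)" for y
  proof -
    from that obtain r where "Q.words r (0, y)" by (auto simp: N_def)
    then have "inner_fock y y = 0" using orth that by fastforce
    then show ?thesis using inner_fock_pos[of y] by force
  qed
  have uniq: "y = y'" if "N (m, y)" "N (m, y')" for m y y'
  proof -
    have "N ((m, y) + sP (-1) (m, y'))" by (intro N_add N_scl that)
    moreover have "(m, y) + sP (-1) (m, y') = (0, y - y')"
      by (simp add: sP_def)
    ultimately show ?thesis using zero by fastforce
  qed
  have "{m. \<exists>y. N (m, y)} = UNIV"
  proof (rule gen)
    show "vM \<in> {m. \<exists>y. N (m, y)}" "0 \<in> {m. \<exists>y. N (m, y)}"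
      using N0 by (auto simp: zero_prod_def)
    show "x + x' \<in> {m. \<exists>y. N (m, y)}" if "x \<in> {m. \<exists>y. N (m, y)}" "x' \<in> {m. \<exists>y. N (m, y)}" for x x'
      using that N_add by fastforce
    show "sM c x \<in> {m. \<exists>y. N (m, y)}" if "x \<in> {m. \<exists>y. N (m, y)}" for c x
      using that N_scl[of "(x, _)" c] by (auto simp: sP_def)
    show "opM b x \<in> {m. \<exists>y. N (m, y)}" if "x \<in> {m. \<exists>y. N (m, y)}" for b x
      using that N_op[of "(x, _)" b] by (auto simp: opP_def)
  qed
  then obtain f where f: "\<And>m. N (m, f m)" using choice[of "\<lambda>m y. N (m, y)"] by blast
  show ?thesis
  proof (intro exI[of _ f] conjI allI)
    show "f (x + y) = f x + f y" for x y
      using uniq[OF f] N_add[OF f[of x] f[of y]] by simp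
    show "f (sM c x) = cscale c (f x)" for c x
      using uniq[OF f] N_scl[OF f[of x], of c] by (simp add: sP_def)
    show "f (opM b x) = opF b (f x)" for b x
      using uniq[OF f] N_op[OF f[of x], of b] by (simp add: opP_def)
    show "f vM = v0" by (rule uniq[OF f N0(2)])
  qed
qed

text \<open>The factor sqrt M clears the denominators M of the relation \<open>gg\<close>.\<close>

definition fock_op :: "real \<Rightarrow> (idx \<Rightarrow> int \<Rightarrow> fop) \<Rightarrow> (int \<Rightarrow> fop) \<Rightarrow> (idx \<Rightarrow> int \<Rightarrow> fop) \<Rightarrow> wop \<Rightarrow> fop" where
  "fock_op M J L g b = (case b of OL n \<Rightarrow> L n | OJ i n \<Rightarrow> J i n | OG i n \<Rightarrow> sqrt M *\<^sub>R g i n)"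

lemma fock_wmod:
  assumes "wlevel M J L g"
  shows "wmod cscale M (\<lambda>b. app (fock_op M J L g b))"
proof -
  interpret wlevel M J L g by (rule assms)
  have cr: "cscale (complex_of_real r) x = r *\<^sub>R x" "cscale (of_int z) x = of_int z *\<^sub>R x" for r z x
    using cscale_simps(7)[of "of_int z" x] by (simp_all add: cscale_simps(7))
  have ci: "cscale (if Q then complex_of_real r else 0) x = (if Q then r *\<^sub>R x else 0)" for Q r x
    by (simp add: cr cscale_simps)
  have sq: "sqrt M * sqrt M = M" "M \<noteq> 0" "\<bar>M\<bar> = M" using M_ge by auto
  show ?thesis
  proof unfold_locales
    fix c d :: complex and x y w :: fock and b i k m n
    show "cscale c (x + y) = cscale c x + cscale c y" "cscale (c + d) x = cscale c x + cscale d x"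
      "cscale c (cscale d x) = cscale (c * d) x" "cscale 1 x = x"
      by (simp_all add: cscale_simps)
    show "app (fock_op M J L g b) (x + y) = app (fock_op M J L g b) x + app (fock_op M J L g b) y"
      "app (fock_op M J L g b) (cscale c x) = cscale c (app (fock_op M J L g b) x)"
      by (simp_all add: app_add app_cscale)
    show "app (fock_op M J L g (OJ i m)) (app (fock_op M J L g (OJ k n)) w) =
       app (fock_op M J L g (OJ k n)) (app (fock_op M J L g (OJ i m)) w) +
       cscale (of_real (cf i k)) (app (fock_op M J L g (OJ (brk i k) (m + n))) w) +
       cscale (if m + n = 0 then of_real (M * (of_int m / 2 * dt i k)) else 0) w"
      unfolding cr ci using arg_cong[OF JJ[of i m k n], of "\<lambda>z. app z w"] by (simp add: fock_op_def split: if_splits)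
    show "app (fock_op M J L g (OJ i m)) (app (fock_op M J L g (OG k n)) w) =
       app (fock_op M J L g (OG k n)) (app (fock_op M J L g (OJ i m)) w) +
       cscale (of_real (cf i k)) (app (fock_op M J L g (OG (brk i k) (m + n))) w)"
      unfolding cr using arg_cong[OF Jg[of i m k n], of "\<lambda>z. sqrt M *\<^sub>R app z w"]
      by (simp add: fock_op_def app_scaleR scaleR_add_right mult.commute)
    show "app (fock_op M J L g (OL m)) (app (fock_op M J L g (OJ i n)) w) =
       app (fock_op M J L g (OJ i n)) (app (fock_op M J L g (OL m)) w) +
       cscale (of_int (- n)) (app (fock_op M J L g (OJ i (m + n))) w)"
      unfolding cr using arg_cong[OF LJ[of m i n], of "\<lambda>z. app z w"] by (simp add: fock_op_def)
    show "app (fock_op M J L g (OL m)) (app (fock_op M J L g (OG i n)) w) =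
       app (fock_op M J L g (OG i n)) (app (fock_op M J L g (OL m)) w) +
       cscale (of_real (of_int m / 2 - of_int n)) (app (fock_op M J L g (OG i (m + n))) w)"
      unfolding cr using arg_cong[OF Lg[of m i n], of "\<lambda>z. sqrt M *\<^sub>R app z w"]
      by (simp add: fock_op_def app_scaleR scaleR_add_right mult.commute)
    show "app (fock_op M J L g (OL m)) (app (fock_op M J L g (OL n)) w) =
       app (fock_op M J L g (OL n)) (app (fock_op M J L g (OL m)) w) +
       cscale (of_int (m - n)) (app (fock_op M J L g (OL (m + n))) w) +
       cscale (if m + n = 0 then of_real ((3 * M - 1) / 2 / 12 * (of_int m ^ 3 - of_int m)) else 0) w"
      unfolding cr ci using arg_cong[OF LL[unfolded virasoro_def, rule_format, of m n], of "\<lambda>z. app z w"]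
      by (simp add: fock_op_def split: if_splits)
    let ?o = "\<lambda>b. app (fock_op M J L g b)"
    obtain K1 where K1: "\<And>K'. K' \<ge> K1 \<Longrightarrow> app (nprod 1 0 (J i) (J k) (m + n)) w = (\<Sum>j=-K'..K'. app (nterm 1 0 (J i) (J k) (m + n) j) w)"
      using app_nprod[OF smooth_J smooth_J, of 1 0 i k "m + n" w] by blast
    obtain K2 where K2: "\<And>K'. K' \<ge> K2 \<Longrightarrow> app (nprod 1 0 (J k) (J i) (m + n)) w = (\<Sum>j=-K'..K'. app (nterm 1 0 (J k) (J i) (m + n) j) w)"
      using app_nprod[OF smooth_J smooth_J, of 1 0 k i "m + n" w] by blast
    have nt: "app (nterm 1 0 (J i) (J k) q j) w = nt (\<lambda>n. ?o (OJ i n)) (\<lambda>n. ?o (OJ k n)) q j w" for i k q j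
      by (simp add: nterm_def nt_def fock_op_def)
    show "\<exists>K. \<forall>K'\<ge>K. ?o (OG i m) (?o (OG k n) w) = cscale (-1) (?o (OG k n) (?o (OG i m) w)) + (cscale (of_real (M * dt i k)) (?o (OL (m + n)) w)
      + cscale (-1/2) (\<Sum>j=-K'..K'. nt (\<lambda>n. ?o (OJ i n)) (\<lambda>n. ?o (OJ k n)) (m + n) j w + nt (\<lambda>n. ?o (OJ k n)) (\<lambda>n. ?o (OJ i n)) (m + n) j w)
      + cscale (of_real ((M - 1) * (of_int (m - n) / 2 * cf i k))) (?o (OJ (brk i k) (m + n)) w)
      + cscale (if m + n = 0 then of_real (M * (M - 1) / 4 * (of_int m ^ 2 - 1 / 4) * dt i k) else 0) w)"
    proof (intro exI[of _ "max K1 K2"] allI impI)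
      fix K' assume "max K1 K2 \<le> K'"
      then have K: "K' \<ge> K1" "K' \<ge> K2" by auto
      have s: "(\<Sum>j=-K'..K'. nt (\<lambda>n. ?o (OJ i n)) (\<lambda>n. ?o (OJ k n)) (m + n) j w + nt (\<lambda>n. ?o (OJ k n)) (\<lambda>n. ?o (OJ i n)) (m + n) j w)
         = 2 *\<^sub>R app (psym J i k (m + n)) w"
        unfolding sum.distrib nt[symmetric] K1[OF K(1), symmetric] K2[OF K(2), symmetric] by (simp add: psym_def)
      have h: "cscale (-1/2) (2 *\<^sub>R z) = - z" "cscale (-1) z = - z" for z
        by (rule fock_eqI; simp)+
      have "?o (OG i m) (?o (OG k n) w) = M *\<^sub>R app (g i m * g k n) w" "?o (OG k n) (?o (OG i m) w) = M *\<^sub>R app (g k n * g i m) w"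
        by (simp_all add: fock_op_def app_scaleR sq)
      moreover have "M *\<^sub>R app (g i m * g k n) w = - (M *\<^sub>R app (g k n * g i m) w) + ((M * dt i k) *\<^sub>R app (L (m + n)) w - app (psym J i k (m + n)) w
        + ((M - 1) * (of_int (m - n) / 2 * cf i k)) *\<^sub>R app (J (brk i k) (m + n)) w
        + (if m + n = 0 then (M * (M - 1) / 4 * (of_int m ^ 2 - 1 / 4) * dt i k) *\<^sub>R w else 0))"
      proof -
        define q1 where "q1 = real_of_int (m - n) / 2 * cf i k"
        define q2 where "q2 = (real_of_int m ^ 2 - 1 / 4) * dt i k"
        have c: "M * ((M - 1) / M * q1) = (M - 1) * q1" "M * (1 / M) = 1" "M * ((M - 1) / 4 * q2) = M * (M - 1) / 4 * q2"
          using sq(2) by simp_all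
        have "g i m * g k n = - (g k n * g i m) + dt i k *\<^sub>R L (m + n) - (1 / M) *\<^sub>R psym J i k (m + n)
          + ((M - 1) / M * q1) *\<^sub>R J (brk i k) (m + n) + (if m + n = 0 then ((M - 1) / 4 * q2) *\<^sub>R 1 else 0)"
          using gg[of i m k n] by (simp only: q1_def q2_def mult.assoc)
        from arg_cong[OF this, of "\<lambda>z. M *\<^sub>R app z w"] show ?thesis
          unfolding mult.assoc[of _ _ "dt i k"] q1_def[symmetric] q2_def[symmetric] c(1)[symmetric] c(3)[symmetric]
          using c(2) by (cases "m + n = 0")
            (simp_all only: refl app_simps if_True if_False scaleR_add_right scaleR_diff_right scaleR_minus_right scaleR_scaleR scaleR_one add_0_right scaleR_zero_right add.assoc diff_conv_add_uminus)
      qed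
      ultimately show "?o (OG i m) (?o (OG k n) w) = cscale (-1) (?o (OG k n) (?o (OG i m) w)) + (cscale (of_real (M * dt i k)) (?o (OL (m + n)) w)
        + cscale (-1/2) (\<Sum>j=-K'..K'. nt (\<lambda>n. ?o (OJ i n)) (\<lambda>n. ?o (OJ k n)) (m + n) j w + nt (\<lambda>n. ?o (OJ k n)) (\<lambda>n. ?o (OJ i n)) (m + n) j w)
        + cscale (of_real ((M - 1) * (of_int (m - n) / 2 * cf i k))) (?o (OJ (brk i k) (m + n)) w)
        + cscale (if m + n = 0 then of_real (M * (M - 1) / 4 * (of_int m ^ 2 - 1 / 4) * dt i k) else 0) w)"
        unfolding s h cr ci by (simp only: fock_op_def wop.case diff_conv_add_uminus)
    qed
  qed
qed

lemma fock_module_exists: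
  assumes "M1 \<ge> 1" "s = 0 \<or> s = 1/2"
  shows "\<exists>opF v0. wmod_hw cscale (real M1) opF v0 (of_real ((real M1 - 1) / 16 + real M1 * (s * s))) (of_real (real M1 * s)) \<and>
    (\<forall>b x y. inner_fock (opF b x) y = inner_fock x (opF (dual b) y)) \<and> opF (OG Z 0) v0 = 0 \<and> v0 \<noteq> 0"
proof -
  obtain J L g v where w: "wlevel (real M1) J L g" and a: "wadj J L g" and h: "whw (real M1) s J L g v" and v: "v \<noteq> 0"
    using fock_system[OF assms] by blast
  let ?o = "\<lambda>b. app (fock_op (real M1) J L g b)"
  interpret wmod cscale "real M1" ?o by (rule fock_wmod[OF w])
  have "wmod_hw cscale (real M1) ?o v (of_real ((real M1 - 1) / 16 + real M1 * (s * s))) (of_real (real M1 * s))"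
  proof -
    have "hw (of_real ((real M1 - 1) / 16 + real M1 * (s * s))) (of_real (real M1 * s)) v"
      using h unfolding hw_def whw_def cscale_simps(7) by (simp add: fock_op_def)
    then show ?thesis by unfold_locales
  qed
  moreover have "inner_fock (?o b x) y = inner_fock x (?o (dual b) y)" for b x y
  proof -
    have "adjoint_ops (fock_op (real M1) J L g b) (fock_op (real M1) J L g (dual b))"
      using a unfolding wadj_def by (cases b) (auto simp: fock_op_def intro: adjoint_scaleR)
    then show ?thesis by (simp add: adjoint_ops_def)
  qed
  moreover have "?o (OG Z 0) v = 0" using h by (simp add: whw_def fock_op_def)
  ultimately show ?thesis using v by blast
qed

section \<open>Coordinates in spo(2|3)\<close>

lemma UNIV_23: "(UNIV :: (2 + 3) set) = {Inl 1, Inl 2, Inr 1, Inr 2, Inr 3}"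
  unfolding UNIV_Plus_UNIV[symmetric] Plus_def UNIV_2 UNIV_3 by auto

lemma num_neq: "(1::2) \<noteq> 2" "(2::2) \<noteq> 1" "(1::3) \<noteq> 2" "(2::3) \<noteq> 1" "(1::3) \<noteq> 3" "(3::3) \<noteq> 1" "(2::3) \<noteq> 3" "(3::3) \<noteq> 2"
  by simp_all

lemma all_23: "(\<forall>i :: 2 + 3. Q i) \<longleftrightarrow> Q (Inl 1) \<and> Q (Inl 2) \<and> Q (Inr 1) \<and> Q (Inr 2) \<and> Q (Inr 3)"
proof -
  have "(\<forall>i :: 2 + 3. Q i) \<longleftrightarrow> (\<forall>i \<in> UNIV. Q i)" by simp
  then show ?thesis unfolding UNIV_23 by simp
qed

lemma sum_23: "(\<Sum>i\<in>(UNIV :: (2 + 3) set). f i) = f (Inl 1) + f (Inl 2) + f (Inr 1) + f (Inr 2) + f (Inr 3)"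
  unfolding UNIV_23 by (simp add: num_neq add.assoc)

definition nm :: "complex \<Rightarrow> complex \<Rightarrow> complex \<Rightarrow> smat" where
  "nm x y z = mscale x (nat_basis 1) + mscale y (nat_basis 2) + mscale z (nat_basis 3)"

text \<open>The signs make the linear map from \<open>nm x y z\<close> to \<open>mh x y z\<close> equivariant.\<close>

definition mh :: "complex \<Rightarrow> complex \<Rightarrow> complex \<Rightarrow> smat" where
  "mh x y z = mscale (- x) (mhalf_basis 1) + mscale y (mhalf_basis 2) + mscale (- z) (mhalf_basis 3)"

definition mat23 :: "(2 + 3 \<Rightarrow> 2 + 3 \<Rightarrow> complex) \<Rightarrow> smat" where "mat23 f = (\<chi> i j. f i j)"

lemma mat23_nth [simp]: "mat23 f $ i $ j = f i j" by (simp add: mat23_def)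

lemma nm_entries:
  "nm x y z $ Inl i $ j = 0" "nm x y z $ j $ Inl i = 0"
  "nm x y z $ Inr 1 $ Inr 1 = y" "nm x y z $ Inr 1 $ Inr 2 = x" "nm x y z $ Inr 1 $ Inr 3 = 0"
  "nm x y z $ Inr 2 $ Inr 1 = z" "nm x y z $ Inr 2 $ Inr 2 = 0" "nm x y z $ Inr 2 $ Inr 3 = - x"
  "nm x y z $ Inr 3 $ Inr 1 = 0" "nm x y z $ Inr 3 $ Inr 2 = - z" "nm x y z $ Inr 3 $ Inr 3 = - y"
  by (simp_all add: nm_def mscale_def nat_basis_def munit_def num_neq)

lemma mh_entries:
  "mh x y z $ Inl i $ Inl j = 0" "mh x y z $ Inr i' $ Inr j' = 0"
  "mh x y z $ Inr i' $ Inl 2 = 0" "mh x y z $ Inl 1 $ Inr j' = 0"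
  "mh x y z $ Inr 1 $ Inl 1 = - x" "mh x y z $ Inr 2 $ Inl 1 = y" "mh x y z $ Inr 3 $ Inl 1 = - z"
  "mh x y z $ Inl 2 $ Inr 1 = z" "mh x y z $ Inl 2 $ Inr 2 = - y" "mh x y z $ Inl 2 $ Inr 3 = x"
  by (simp_all add: mh_def mscale_def mhalf_basis_def munit_def num_neq)

lemma UNIV_bool_sum: "(\<Sum>p\<in>UNIV. f p) = f False + (f True :: smat)"
  by (simp add: UNIV_bool add.commute)

lemmas smat_simps = vec_eq_iff all_23 sbracket_def UNIV_bool_sum matrix_matrix_mult_def sum_23 mpart_def mscale_def
  koszul_def munit_def num_neq nm_entries mh_entries

lemma e_entries:
  "e_mat $ i $ j = (if i = Inl 1 \<and> j = Inl 2 then 1 else 0)"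
  "f_mat $ i $ j = (if i = Inl 2 \<and> j = Inl 1 then 1/2 else 0)"
  "x_mat $ i $ j = (if i = Inl 1 \<and> j = Inl 1 then 1/2 else if i = Inl 2 \<and> j = Inl 2 then -1/2 else 0)"
  by (auto simp: e_mat_def f_mat_def x_mat_def munit_def mscale_def num_neq)

lemma bracket_nm: "sbracket (nm x y z) (nm x' y' z') = nm (y * x' - x * y') (x * z' - z * x') (z * y' - y * z')"
  by (simp add: smat_simps)

lemma bracket_nm_mh: "sbracket (nm x y z) (mh x' y' z') = mh (y * x' - x * y') (x * z' - z * x') (z * y' - y * z')"
  by (simp add: smat_simps algebra_simps)

lemma bracket_mh_nm: "sbracket (mh x y z) (nm x' y' z') = mh (y * x' - x * y') (x * z' - z * x') (z * y' - y * z')"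
  by (simp add: smat_simps algebra_simps)

lemma bracket_mh_mh: "sbracket (mh x y z) (mh x' y' z') = mscale (-4 * (x * z' + y * y' + z * x')) f_mat"
  by (simp add: smat_simps e_entries algebra_simps)

lemma inv_form_nm: "inv_form (nm x y z) (nm x' y' z') = -2 * (x * z' + y * y' + z * x')"
  by (simp add: inv_form_def str_def smat_simps algebra_simps)

lemma ang_mh: "ang (mh x y z) (mh x' y' z') = -2 * (x * z' + y * y' + z * x')"
  unfolding ang_def bracket_mh_mh by (simp add: inv_form_def str_def smat_simps e_entries algebra_simps)

lemma proj_mh: "proj_nat (sbracket (sbracket e_mat (mh x y z)) (mh x' y' z')) = nm (y * x' - x * y') (x * z' - z * x') (z * y' - y * z')"
proof -
  show ?thesis
    by (simp add: proj_nat_def inv_form_def str_def smat_simps e_entries algebra_simps)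
qed

lemma nm_coords: "nat_basis 1 = nm 1 0 0" "nat_basis 2 = nm 0 1 0" "nat_basis 3 = nm 0 0 1"
  "nat_dual 1 = nm 0 0 (-1/2)" "nat_dual 2 = nm 0 (-1/2) 0" "nat_dual 3 = nm (-1/2) 0 0"
  by (simp_all add: nat_dual_def num_neq vec_eq_iff all_23 nm_entries mscale_def nat_basis_def munit_def)

lemma mh_coords: "mhalf_basis 1 = mh (-1) 0 0" "mhalf_basis 2 = mh 0 1 0" "mhalf_basis 3 = mh 0 0 (-1)"
  by (simp_all add: vec_eq_iff all_23 mh_entries mhalf_basis_def munit_def num_neq)

lemma nm_linear: "nm x y z + nm x' y' z' = nm (x + x') (y + y') (z + z')" "mscale c (nm x y z) = nm (c * x) (c * y) (c * z)"
  "mh x y z + mh x' y' z' = mh (x + x') (y + y') (z + z')" "mscale c (mh x y z) = mh (c * x) (c * y) (c * z)"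
  by (simp_all add: vec_eq_iff all_23 nm_entries mh_entries mscale_def algebra_simps)

lemma nm_eq: "nm x y z = nm x' y' z' \<longleftrightarrow> x = x' \<and> y = y' \<and> z = z'" "mh x y z = mh x' y' z' \<longleftrightarrow> x = x' \<and> y = y' \<and> z = z'"
  by (auto simp: vec_eq_iff all_23 nm_entries mh_entries)

lemma complex_neg_half: "a = - (a / 2) \<longleftrightarrow> a = (0::complex)"
  by (auto simp: complex_eq_iff)

lemma complex_double_0: "a + a = 0 \<longleftrightarrow> a = (0::complex)"
  by (simp flip: mult_2)

lemma spo23_iff:
  "A \<in> spo23 \<longleftrightarrow> A $ Inl 2 $ Inl 2 = - A $ Inl 1 $ Inl 1 \<and>
     A $ Inr 1 $ Inr 3 = 0 \<and> A $ Inr 3 $ Inr 1 = 0 \<and> A $ Inr 2 $ Inr 2 = 0 \<and> A $ Inr 3 $ Inr 3 = - A $ Inr 1 $ Inr 1 \<and>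
     A $ Inr 2 $ Inr 3 = - A $ Inr 1 $ Inr 2 \<and> A $ Inr 3 $ Inr 2 = - A $ Inr 2 $ Inr 1 \<and>
     A $ Inl 2 $ Inr 1 = - A $ Inr 3 $ Inl 1 \<and> A $ Inl 2 $ Inr 2 = - A $ Inr 2 $ Inl 1 \<and> A $ Inl 2 $ Inr 3 = - A $ Inr 1 $ Inl 1 \<and>
     A $ Inl 1 $ Inr 1 = A $ Inr 3 $ Inl 2 \<and> A $ Inl 1 $ Inr 2 = A $ Inr 2 $ Inl 2 \<and> A $ Inl 1 $ Inr 3 = A $ Inr 1 $ Inl 2"
  unfolding spo23_def mem_Collect_eq all_bool_eq all_23 sum_23
  by (simp add: mpart_def form23_def koszul_def num_neq complex_double_0 eq_neg_iff_add_eq_0 neg_eq_iff_add_eq_0 add.commute)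
    (rule iffI; elim conjE; intro conjI; (assumption | rule sym, assumption))

lemma spo23_nm: "nm x y z \<in> spo23" and spo23_mh: "mh x y z \<in> spo23"
  by (simp_all add: spo23_iff nm_entries mh_entries)

lemma nm_g_nat: "nm x y z \<in> g_nat"
  unfolding g_nat_def by (simp add: spo23_nm) (simp add: smat_simps e_entries)

lemma mh_g_mhalf: "mh x y z \<in> g_mhalf"
  unfolding g_mhalf_def by (simp add: spo23_mh) (simp add: smat_simps e_entries)

lemma g_nat_nm: "A \<in> g_nat \<Longrightarrow> \<exists>x y z. A = nm x y z"
proof -
  assume A: "A \<in> g_nat"
  then have s: "A \<in> spo23" and e: "sbracket e_mat A = 0" and f: "sbracket f_mat A = 0" and x: "sbracket x_mat A = 0"
    by (auto simp: g_nat_def)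
  note E = s[unfolded spo23_iff]
  have "A $ Inl 1 $ Inl 1 = 0" "A $ Inl 1 $ Inl 2 = 0" "A $ Inl 2 $ Inl 1 = 0" "\<forall>j. A $ Inl 1 $ Inr j = 0" "\<forall>j. A $ Inl 2 $ Inr j = 0"
    "\<forall>j. A $ Inr j $ Inl 1 = 0" "\<forall>j. A $ Inr j $ Inl 2 = 0"
    using e f x E
    by (simp_all add: smat_simps e_entries forall_3)
  then have "A = nm (A $ Inr 1 $ Inr 2) (A $ Inr 1 $ Inr 1) (A $ Inr 2 $ Inr 1)"
    using E by (simp add: vec_eq_iff all_23 nm_entries)
  then show ?thesis by blast
qed

lemma g_mhalf_mh: "A \<in> g_mhalf \<Longrightarrow> \<exists>x y z. A = mh x y z"
proof -
  assume A: "A \<in> g_mhalf"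
  then have s: "A \<in> spo23" and x: "sbracket x_mat A = mscale (-1/2) A"
    by (auto simp: g_mhalf_def)
  note E = s[unfolded spo23_iff]
  have "A $ Inl 1 $ Inl 1 = 0" "A $ Inl 1 $ Inl 2 = 0" "A $ Inl 2 $ Inl 1 = 0" "A $ Inl 2 $ Inl 2 = 0" "\<forall>j. A $ Inl 1 $ Inr j = 0"
    "\<forall>j. A $ Inr j $ Inl 2 = 0" "\<forall>i j. A $ Inr i $ Inr j = 0"
    using x by (simp_all add: smat_simps e_entries forall_3 complex_neg_half)
  then have "A = mh (- A $ Inr 1 $ Inl 1) (A $ Inr 2 $ Inl 1) (- A $ Inr 3 $ Inl 1)"
    using E by (simp add: vec_eq_iff all_23 mh_entries)
  then show ?thesis by blast
qed

lemma killing_nm: "killing_nat (nm x y z) (nm x y z) = 2 * (2 * x * z + y * y)"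
  unfolding killing_nat_def sum_3 nm_coords bracket_nm inv_form_nm by (simp add: algebra_simps)

interpretation smat_vs: vector_space mscale
  by unfold_locales (simp_all add: mscale_def vec_eq_iff algebra_simps)

text \<open>A linear isomorphism between the even and the odd part of \<open>spo(2|3)\<close>, which shows that the
  superdimension vanishes.\<close>

definition flip23 :: "smat \<Rightarrow> smat" where
  "flip23 A = mat23 (\<lambda>i j. case i of
      Inl i \<Rightarrow> (case j of Inl j \<Rightarrow> (if i = 1 \<and> j = 1 then A $ Inr 1 $ Inl 1 else if i = 2 \<and> j = 2 then - A $ Inr 1 $ Inl 1
             else if i = 1 then A $ Inr 2 $ Inl 1 else A $ Inr 3 $ Inl 1)
        | Inr j \<Rightarrow> (if i = 2 then - (if j = 1 then A $ Inl 2 $ Inl 1 else if j = 2 then A $ Inl 1 $ Inl 2 else A $ Inl 1 $ Inl 1)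
             else (if j = 1 then A $ Inr 2 $ Inr 1 else if j = 2 then A $ Inr 1 $ Inr 2 else A $ Inr 1 $ Inr 1)))
    | Inr i \<Rightarrow> (case j of Inl j \<Rightarrow> (if j = 1 then (if i = 1 then A $ Inl 1 $ Inl 1 else if i = 2 then A $ Inl 1 $ Inl 2 else A $ Inl 2 $ Inl 1)
             else (if i = 1 then A $ Inr 1 $ Inr 1 else if i = 2 then A $ Inr 1 $ Inr 2 else A $ Inr 2 $ Inr 1))
        | Inr j \<Rightarrow> (if i = 1 \<and> j = 1 then A $ Inr 1 $ Inl 2 else if i = 3 \<and> j = 3 then - A $ Inr 1 $ Inl 2
             else if i = 1 \<and> j = 2 then A $ Inr 2 $ Inl 2 else if i = 2 \<and> j = 3 then - A $ Inr 2 $ Inl 2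
             else if i = 2 \<and> j = 1 then A $ Inr 3 $ Inl 2 else if i = 3 \<and> j = 2 then - A $ Inr 3 $ Inl 2 else 0)))"

lemma sdim_zero: "sdim_spo23 = 0"
proof -
  have lin: "Vector_Spaces.linear mscale mscale flip23"
    by unfold_locales (simp_all add: flip23_def vec_eq_iff all_23 mscale_def num_neq algebra_simps)
  let ?E = "{A \<in> spo23. mpart False A = A}" and ?O = "{A \<in> spo23. mpart True A = A}"
  \<comment> \<open>\<open>flip23\<close> matches the six free entries of an even matrix with the
    six of an odd one, and back.\<close>
  have inv: "flip23 (flip23 A) = A" if "A \<in> ?E \<or> A \<in> ?O" for A
    using that unfolding mem_Collect_eq spo23_iff
    by (elim disjE; simp add: vec_eq_iff all_23 mpart_def flip23_def num_neq)
  have EO: "flip23 A \<in> ?O" if "A \<in> ?E" for A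
    using that unfolding mem_Collect_eq spo23_iff
    by (simp add: vec_eq_iff all_23 mpart_def flip23_def num_neq)
  have OE: "flip23 A \<in> ?E" if "A \<in> ?O" for A
    using that unfolding mem_Collect_eq spo23_iff
    by (simp add: vec_eq_iff all_23 mpart_def flip23_def num_neq)
  have im: "flip23 ` ?E = ?O"
  proof (intro subset_antisym subsetI)
    show "B \<in> ?O" if "B \<in> flip23 ` ?E" for B using that EO by blast
    show "B \<in> flip23 ` ?E" if "B \<in> ?O" for B
      using OE[OF that] inv[of B] that by (metis (no_types, lifting) image_eqI)
  qed
  have sub: "smat_vs.subspace ?E"
    unfolding smat_vs.subspace_def mem_Collect_eq spo23_iff
    by (auto simp: vec_eq_iff all_23 mpart_def mscale_def)
  interpret F: Vector_Spaces.linear mscale mscale flip23 by (rule lin)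
  obtain B where B: "B \<subseteq> ?E" "smat_vs.independent B" "?E \<subseteq> smat_vs.span B" "card B = smat_vs.dim ?E"
    using smat_vs.basis_exists[of ?E] by blast
  have inj: "inj_on flip23 (smat_vs.span B)"
  proof (rule inj_on_subset)
    show "inj_on flip23 ?E" using inv by (metis (no_types, lifting) inj_onI)
    show "smat_vs.span B \<subseteq> ?E" using B(1) sub by (rule smat_vs.span_minimal)
  qed
  have "smat_vs.dim (flip23 ` ?E) = card (flip23 ` B)"
  proof (rule smat_vs.dim_unique)
    show "flip23 ` B \<subseteq> flip23 ` ?E" using B(1) by blast
    show "flip23 ` ?E \<subseteq> smat_vs.span (flip23 ` B)" unfolding F.span_image using B(3) by blast
    show "smat_vs.independent (flip23 ` B)" by (rule F.independent_injective_image[OF B(2) inj])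
  qed simp
  also have "\<dots> = smat_vs.dim ?E"
    using B(4) card_image[OF inj_on_subset[OF inj smat_vs.span_superset]] by simp
  finally have "smat_vs.dim (flip23 ` ?E) = smat_vs.dim ?E" .
  then show ?thesis unfolding im sdim_spo23_def by simp
qed

section \<open>Consequences of the Borcherds identity in twisted modules\<close>

lemma Sum_any_lessThan: "(\<And>j. j \<ge> n \<Longrightarrow> f j = 0) \<Longrightarrow> Sum_any f = (\<Sum>j<n. f (j::nat))"
  by (rule Sum_any.expand_superset) (auto simp: not_less[symmetric])

lemma neg_one_gchoose: "(-1) ^ j * ((-1::complex) gchoose j) = 1"
  using gbinomial_minus[of "1::complex" j] by (simp flip: power_add binomial_gbinomial mult_2 add: power_mult)

context parity_twisted_module
begin

lemma md_zero [simp]: "md 0 r w = 0" "md a r 0 = 0"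
  using md_add_left[of 0 0 r w] md_add_right[of a r 0 0] by simp_all

text \<open>The Borcherds identity at l = 0, where the binomial coefficients of 0 leave only the
  supercommutator on the right.\<close>

lemma commutator:
  assumes par: "a \<in> parV p" "b \<in> parV q" and coset: "r - of_bool p / 2 \<in> \<int>" "s - of_bool q / 2 \<in> \<int>"
    and lb: "lambda_bracket a b = nth_default 0 cs"
  shows "md a r (md b s w) = sM (koszul p q) (md b s (md a r w))
    + (\<Sum>j<length cs. sM ((of_rat r gchoose j) * fact j) (md (nth_default 0 cs j) (r + s - of_nat j) w))"
proof -
  have prd: "prd a (int j) b = sV (fact j) (nth_default 0 cs j)" for j
    unfolding fun_cong[OF lb, of j, symmetric] lambda_bracket_def by simp
  have "Sum_any (\<lambda>j. sM (of_rat r gchoose j) (md (prd a (0 + int j) b) (r + s - of_nat j) w))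
      = (\<Sum>j<length cs. sM ((of_rat r gchoose j) * fact j) (md (nth_default 0 cs j) (r + s - of_nat j) w))"
    by (subst Sum_any_lessThan[of "length cs"]) (simp_all add: prd md_scale_left nth_default_beyond)
  moreover have "Sum_any (\<lambda>j. sM ((-1) ^ j * (of_int 0 gchoose j))
        (md a (r + of_int 0 - of_nat j) (md b (s + of_nat j) w)
          - sM (koszul p q * (-1) powi 0) (md b (s + of_int 0 - of_nat j) (md a (r + of_nat j) w))))
      = md a r (md b s w) - sM (koszul p q) (md b s (md a r w))"
  proof (subst Sum_any_lessThan[of 1])
    fix j :: nat assume "1 \<le> j"
    then obtain i where "j = Suc i" by (cases j) auto
    then show "sM ((-1) ^ j * (of_int 0 gchoose j))
        (md a (r + of_int 0 - of_nat j) (md b (s + of_nat j) w)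
          - sM (koszul p q * (-1) powi 0) (md b (s + of_int 0 - of_nat j) (md a (r + of_nat j) w))) = 0"
      by simp
  qed simp
  ultimately show ?thesis using md_borcherds[OF par coset, where l = 0 and w = w] by (simp add: algebra_simps)
qed

text \<open>The Borcherds identity with the vacuum as second field and l = -2. On the right the
  vacuum only has modes of index j or -2 - j with j >= 0, never -1, so everything vanishes
  there.\<close>

lemma md_translation:
  assumes par: "a \<in> parV p" and coset: "r - of_bool p / 2 \<in> \<int>"
  shows "md (translation a) r w = sM (- of_rat r) (md a (r - 1) w)"
proof -
  have pv: "prd a (-2 + int j) vac = (if j = 0 then translation a else if j = 1 then a else 0)" for j
    by (cases j; cases "j - 1") (auto simp: translation_def vac_right)
  have c0: "(0::rat) - of_bool False / 2 \<in> \<int>" by simp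
  have "Sum_any (\<lambda>j. sM (of_rat r gchoose j) (md (prd a (-2 + int j) vac) (r + 0 - of_nat j) w))
      = (\<Sum>j<2. sM (of_rat r gchoose j) (md (if j = 0 then translation a else if j = 1 then a else 0) (r + 0 - of_nat j) w))"
    unfolding pv by (rule Sum_any_lessThan) simp
  also have "\<dots> = md (translation a) r w + sM (of_rat r) (md a (r - 1) w)"
    by (simp add: numeral_2_eq_2)
  finally have "Sum_any (\<lambda>j. sM (of_rat r gchoose j) (md (prd a (-2 + int j) vac) (r + 0 - of_nat j) w))
      = md (translation a) r w + sM (of_rat r) (md a (r - 1) w)" .
  moreover have nv: "md vac (0 + of_nat j) w' = 0" "md vac (0 + of_int (-2) - of_nat j) w' = 0" for j w'
  proof -
    have "0 + of_nat j \<noteq> (-1 :: rat)" "0 + of_int (-2) - of_nat j \<noteq> (-1 :: rat)"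
      using of_nat_0_le_iff[of j, where 'a = rat] by linarith+
    then show "md vac (0 + of_nat j) w' = 0" "md vac (0 + of_int (-2) - of_nat j) w' = 0"
      unfolding md_vac by (simp_all only: if_False)
  qed
  ultimately show ?thesis
    using md_borcherds[OF par vac_even coset c0, where l = "-2" and w = w]
    by (simp only: nv md_zero M.scale_zero_right diff_self Sum_any.neutral) (simp add: eq_neg_iff_add_eq_0)
qed

text \<open>The Borcherds identity at l = -1 with first mode 0: on the left only the normally
  ordered product is left, and on the right the binomial coefficients of -1 cancel the
  signs.\<close>

lemma md_normal_ord:
  assumes par: "a \<in> parV False" "b \<in> parV False"
  shows "\<exists>K. \<forall>K'\<ge>K. md (normal_ord a b) (of_int (p + 1)) w
    = (\<Sum>j = - int K'..int K'. nt (\<lambda>n. md a (of_int n)) (\<lambda>n. md b (of_int n)) p j w)"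
proof -
  let ?nt = "\<lambda>j. nt (\<lambda>n. md a (of_int n)) (\<lambda>n. md b (of_int n)) p j w"
  obtain N1 N2 where N: "\<And>r. r \<ge> N1 \<Longrightarrow> md a r w = 0" "\<And>r. r \<ge> N2 \<Longrightarrow> md b r w = 0"
    using md_truncation by meson
  define K where "K = nat (\<bar>\<lceil>N1\<rceil>\<bar> + \<bar>\<lceil>N2\<rceil>\<bar> + \<bar>p\<bar>)"
  have big: "md a (of_int i) w = 0" "md b (of_int (p + i)) w = 0" if "i \<ge> int K" for i
  proof -
    have "\<lceil>N1\<rceil> \<le> i" "\<lceil>N2\<rceil> \<le> p + i" using that unfolding K_def by auto
    then show "md a (of_int i) w = 0" "md b (of_int (p + i)) w = 0"
      by (auto intro!: N simp only: ceiling_le_iff)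
  qed
  have z: "?nt j = 0" if "j \<ge> int K \<or> j < - int K" for j
  proof (cases "j < 0")
    case True
    then show ?thesis using big(2)[of "- j"] that by (simp add: nt_def)
  next
    case False
    then show ?thesis using big(1)[of j] that by (simp add: nt_def)
  qed
  have c: "(0::rat) - of_bool False / 2 \<in> \<int>" "of_int (p + 1) - of_bool False / 2 \<in> (\<int> :: rat set)" by simp_all
  have "Sum_any (\<lambda>j. sM (of_rat 0 gchoose j) (md (prd a (-1 + int j) b) (0 + of_int (p + 1) - of_nat j) w))
     = md (normal_ord a b) (of_int (p + 1)) w"
  proof (subst Sum_any_lessThan[of 1])
    fix j :: nat assume "1 \<le> j"
    then obtain i where "j = Suc i" by (cases j) auto
    then show "sM (of_rat 0 gchoose j) (md (prd a (-1 + int j) b) (0 + of_int (p + 1) - of_nat j) w) = 0" by simp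
  qed (simp add: normal_ord_def)
  then have *: "md (normal_ord a b) (of_int (p + 1)) w = Sum_any (\<lambda>j. ?nt (- 1 - int j) + ?nt (int j))"
  proof -
    have t: "sM ((-1) ^ j * (of_int (-1) gchoose j))
        (md a (0 + of_int (-1) - of_nat j) (md b (of_int (p + 1) + of_nat j) w)
          - sM (koszul False False * (-1) powi (-1)) (md b (of_int (p + 1) + of_int (-1) - of_nat j) (md a (0 + of_nat j) w)))
      = ?nt (- 1 - int j) + ?nt (int j)" for j
    proof -
      have "(-1 :: complex) ^ j * (of_int (-1) gchoose j) = 1" using neg_one_gchoose[of j] by simp
      moreover have "of_int (-1) - of_nat j = (of_int (- 1 - int j) :: rat)" by simp
      ultimately show ?thesis by (simp add: nt_def koszul_def power_int_minus algebra_simps)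
    qed
    show ?thesis
      using md_borcherds[OF par c, where l = "-1" and w = w] \<open>Sum_any _ = _\<close> unfolding t by simp
  qed
  \<comment> \<open>The right side pairs the indices -1 - j and j; the one index left over in a
    symmetric range is n, whose term vanishes for large n.\<close>
  have s: "(\<Sum>j = - int n..int n. ?nt j) = (\<Sum>j<n. ?nt (- 1 - int j) + ?nt (int j)) + ?nt (int n)" for n
  proof (induction n)
    case (Suc n)
    have "{- int (Suc n)..int (Suc n)} = insert (- 1 - int n) (insert (int n + 1) {- int n..int n})" by auto
    then show ?case using Suc by (simp add: algebra_simps)
  qed simp
  have "md (normal_ord a b) (of_int (p + 1)) w = (\<Sum>j = - int K'..int K'. ?nt j)" if "K' \<ge> K" for K'
    unfolding * s using that z by (subst Sum_any_lessThan[of K']) auto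
  then show ?thesis by blast
qed

end

section \<open>The brackets of the W-algebra in coordinates\<close>

context minimal_W_spo23
begin

lemma prd_zero [simp]: "prd 0 n b = 0" "prd a n 0 = 0"
  using prd_add_left[of 0 0 n b] prd_add_right[of a n 0 0] by simp_all

lemma J_linear: "sV c (J (nm x y z)) = J (nm (c * x) (c * y) (c * z))"
  "J (nm x y z) + J (nm x' y' z') = J (nm (x + x') (y + y') (z + z'))"
  by (simp_all add: J_add[symmetric] J_scale[symmetric] nm_g_nat nm_linear)

lemma normal_ord_sum: "normal_ord (\<Sum>\<alpha>\<in>A. sV (p \<alpha>) (X \<alpha>)) (\<Sum>\<beta>\<in>B. sV (q \<beta>) (Y \<beta>))
   = (\<Sum>\<alpha>\<in>A. \<Sum>\<beta>\<in>B. sV (p \<alpha> * q \<beta>) (normal_ord (X \<alpha>) (Y \<beta>)))"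
proof -
  have 1: "prd (sum f A) n b = (\<Sum>\<alpha>\<in>A. prd (f \<alpha>) n b)" for f n b
    by (induction A rule: infinite_finite_induct) (simp_all add: prd_add_left)
  have 2: "prd a n (sum f B) = (\<Sum>\<alpha>\<in>B. prd a n (f \<alpha>))" for f n a
    by (induction B rule: infinite_finite_induct) (simp_all add: prd_add_right)
  show ?thesis unfolding normal_ord_def 1 unfolding 2 by (simp add: prd_scale_left prd_scale_right mult.commute)
qed

text \<open>The commutator formula for the modes -1, applied to the vacuum; the central term drops
  out because \<open>vac\<close> has the single nonzero mode -1.\<close>

lemma normal_ord_J_commute:
  assumes "a \<in> g_nat" "b \<in> g_nat"
  shows "normal_ord (J a) (J b) = normal_ord (J b) (J a) + translation (J (sbracket a b))"
proof -
  have prd: "prd (J a) (int j) (J b) = sV (fact j) (nth_default 0 [J (sbracket a b), sV (of_real (k + 1/2) * inv_form a b) vac] j)" for j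
    unfolding fun_cong[OF JJ[OF assms], of j, symmetric] lambda_bracket_def by simp
  have "Sum_any (\<lambda>j. sV (of_int (-1) gchoose j) (prd (prd (J a) (0 + int j) (J b)) (-1 + -1 - int j) vac))
      = translation (J (sbracket a b))"
    by (subst Sum_any_lessThan[of 2])
      (auto simp: prd nth_default_def numeral_2_eq_2 translation_def prd_scale_left vac_left)
  moreover have "Sum_any (\<lambda>j. sV ((-1) ^ j * (of_int 0 gchoose j))
        (prd (J a) (-1 + 0 - int j) (prd (J b) (-1 + int j) vac)
          - sV (koszul False False * (-1) powi 0) (prd (J b) (-1 + 0 - int j) (prd (J a) (-1 + int j) vac))))
      = normal_ord (J a) (J b) - normal_ord (J b) (J a)"
  proof (subst Sum_any_lessThan[of 1])
    fix j :: nat assume "1 \<le> j"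
    then obtain i where "j = Suc i" by (cases j) auto
    then show "sV ((-1) ^ j * (of_int 0 gchoose j))
        (prd (J a) (-1 + 0 - int j) (prd (J b) (-1 + int j) vac)
          - sV (koszul False False * (-1) powi 0) (prd (J b) (-1 + 0 - int j) (prd (J a) (-1 + int j) vac))) = 0"
      by simp
  qed (simp add: normal_ord_def koszul_def vac_right)
  ultimately show ?thesis
    using borcherds[OF J_even[OF assms(1)] J_even[OF assms(2)], where m = "-1" and l = 0 and n = "-1" and c = vac]
    by (simp add: algebra_simps)
qed

text \<open>The matrix of coefficients of the products of basis currents has rank one: it is the
  product of a coordinate of \<open>v\<close> and a coordinate of \<open>u\<close>. So the quadratic
  terms collapse to one product of two currents.\<close>

lemma GG_coeff0:
  fixes x y z x' y' z' :: complex
  defines "u \<equiv> mh x y z" and "v \<equiv> mh x' y' z'"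
  shows "sV (ang u v) (\<Sum>\<alpha>\<in>UNIV. normal_ord (J (nat_dual \<alpha>)) (J (nat_basis \<alpha>)))
          + sV 2 (\<Sum>\<alpha>\<in>UNIV. \<Sum>\<beta>\<in>UNIV.
              sV (ang (sbracket (nat_basis \<alpha>) u) (sbracket v (nat_dual \<beta>)))
                 (normal_ord (J (nat_dual \<alpha>)) (J (nat_basis \<beta>))))
      = normal_ord (J (nm x' y' z')) (J (nm x y z))"
proof -
  define C where "C \<alpha> \<beta> = ang (sbracket (nat_basis \<alpha>) u) (sbracket v (nat_dual \<beta>))" for \<alpha> \<beta>
  define p where "p \<alpha> = inv_form (nm x' y' z') (nat_basis \<alpha>)" for \<alpha> :: 3
  define q where "q \<beta> = (if \<beta> = 1 then x else if \<beta> = 2 then y else z)" for \<beta> :: 3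
  have C: "(if \<alpha> = \<beta> then ang u v else 0) + 2 * C \<alpha> \<beta> = p \<alpha> * q \<beta>" for \<alpha> \<beta>
    using exhaust_3[of \<alpha>] exhaust_3[of \<beta>]
    by (elim disjE; simp add: C_def p_def q_def u_def v_def nm_coords bracket_nm_mh bracket_mh_nm ang_mh inv_form_nm num_neq algebra_simps)
  have 1: "sV c (\<Sum>\<alpha>\<in>UNIV. X \<alpha> \<alpha>) + sV 2 (\<Sum>\<alpha>\<in>UNIV. \<Sum>\<beta>\<in>UNIV. sV (D \<alpha> \<beta>) (X \<alpha> \<beta>))
     = (\<Sum>\<alpha>\<in>(UNIV :: 3 set). \<Sum>\<beta>\<in>(UNIV :: 3 set). sV ((if \<alpha> = \<beta> then c else 0) + 2 * D \<alpha> \<beta>) (X \<alpha> \<beta>))" for c D X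
    by (simp add: sum_3 num_neq scale_left_distrib scale_right_distrib add_ac)
  have 2: "J (nm x' y' z') = (\<Sum>\<alpha>\<in>UNIV. sV (p \<alpha>) (J (nat_dual \<alpha>)))"
    by (simp add: sum_3 p_def nm_coords inv_form_nm J_linear)
  have 3: "J (nm x y z) = (\<Sum>\<beta>\<in>UNIV. sV (q \<beta>) (J (nat_basis \<beta>)))"
    by (simp add: sum_3 q_def nm_coords num_neq J_linear)
  show ?thesis
    unfolding C_def[symmetric] 2 3 normal_ord_sum C[symmetric]
    by (rule 1[where c = "ang u v" and D = C and X = "\<lambda>\<alpha> \<beta>. normal_ord (J (nat_dual \<alpha>)) (J (nat_basis \<beta>))"])
qed

text \<open>The double sum contributes minus the current of the bracket, which turns 4 (k + 1) into
  4 k + 3.\<close>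

lemma GG_coeff1:
  fixes x y z x' y' z' :: complex
  defines "u \<equiv> mh x y z" and "v \<equiv> mh x' y' z'"
  shows "sV (of_real (4 * (k + 1))) (J (proj_nat (sbracket (sbracket e_mat u) v)))
          + sV 2 (\<Sum>\<alpha>\<in>UNIV. \<Sum>\<beta>\<in>UNIV.
              sV (ang (sbracket (nat_basis \<alpha>) u) (sbracket v (nat_dual \<beta>)))
                 (J (sbracket (nat_dual \<alpha>) (nat_basis \<beta>))))
      = sV (of_real (4 * k + 3)) (J (proj_nat (sbracket (sbracket e_mat u) v)))"
  unfolding u_def v_def proj_mh sum_3 nm_coords bracket_nm_mh bracket_mh_nm bracket_nm ang_mh J_linear
  by (rule arg_cong[where f = J]) (simp add: nm_eq algebra_simps)

lemma lambda_GG: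
  "lambda_bracket (G (mh x y z)) (G (mh x' y' z')) = nth_default 0
     [sV (of_real (4 * (k + 1/2)) * (x * z' + y * y' + z * x')) L + normal_ord (J (nm x' y' z')) (J (nm x y z))
        + sV (of_real (2 * (k + 1))) (translation (J (nm (y * x' - x * y') (x * z' - z * x') (z * y' - y * z')))),
      sV (of_real (4 * k + 3)) (J (nm (y * x' - x * y') (x * z' - z * x') (z * y' - y * z'))),
      sV (of_real (-4 * p_poly k) * (x * z' + y * y' + z * x')) vac]"
proof -
  have "- 2 * complex_of_real (k + h_dual) * ang (mh x y z) (mh x' y' z') = of_real (4 * (k + 1/2)) * (x * z' + y * y' + z * x')"
    "2 * ang (mh x y z) (mh x' y' z') * of_real (p_poly k) = of_real (-4 * p_poly k) * (x * z' + y * y' + z * x')"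
    by (simp_all add: ang_mh h_dual_def algebra_simps)
  moreover have "A + B + C + D = A + (B + C) + D" for A B C D :: 'v by (simp add: add_ac)
  ultimately show ?thesis
    using GG[OF mh_g_mhalf mh_g_mhalf, of x y z x' y' z'] GG_coeff0[of x y z x' y' z'] GG_coeff1[of x y z x' y' z']
    unfolding proj_mh by (simp only:)
qed

end

lemma nm_uminus [simp]: "- nm x y z = nm (- x) (- y) (- z)" "- mh x y z = mh (- x) (- y) (- z)"
  by (simp_all add: vec_eq_iff all_23 nm_entries mh_entries)

lemma nm_eq_0 [simp]: "nm x y z = 0 \<longleftrightarrow> x = 0 \<and> y = 0 \<and> z = 0" "mh x y z = 0 \<longleftrightarrow> x = 0 \<and> y = 0 \<and> z = 0"
  by (auto simp: vec_eq_iff all_23 nm_entries mh_entries)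

section \<open>A basis adapted to the involution\<close>

text \<open>One set of coordinates for \<open>g_nat\<close> and \<open>g_mhalf\<close>, which are
  isomorphic over \<open>g_nat\<close>; \<open>dot\<close> is -1/2 times the form on either of
  them.\<close>

type_synonym trip = "complex \<times> complex \<times> complex"

fun nmt :: "trip \<Rightarrow> smat" where "nmt (x, y, z) = nm x y z"
fun mht :: "trip \<Rightarrow> smat" where "mht (x, y, z) = mh x y z"
fun bk :: "trip \<Rightarrow> trip \<Rightarrow> trip" where
  "bk (x, y, z) (x', y', z') = (y * x' - x * y', x * z' - z * x', z * y' - y * z')"
fun dot :: "trip \<Rightarrow> trip \<Rightarrow> complex" where "dot (x, y, z) (x', y', z') = x * z' + y * y' + z * x'"
fun sct :: "complex \<Rightarrow> trip \<Rightarrow> trip" where "sct c (x, y, z) = (c * x, c * y, c * z)"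

lemma trip_simps:
  "sbracket (nmt a) (nmt b) = nmt (bk a b)" "sbracket (nmt a) (mht b) = mht (bk a b)"
  "inv_form (nmt a) (nmt b) = -2 * dot a b" "ang (mht a) (mht b) = -2 * dot a b"
  "proj_nat (sbracket (sbracket e_mat (mht a)) (mht b)) = nmt (bk a b)"
  "nmt (sct c a) = mscale c (nmt a)" "mht (sct c a) = mscale c (mht a)"
  "nmt a \<in> g_nat" "mht a \<in> g_mhalf" "nmt a \<in> spo23" "mht a \<in> spo23"
  by (cases a; cases b; simp add: bracket_nm bracket_nm_mh inv_form_nm ang_mh proj_mh nm_linear nm_g_nat mh_g_mhalf spo23_nm spo23_mh)+

text \<open>In this basis the involution exchanges P and N up to sign, so that the modes form
  adjoint pairs as in the Fock space. The involution need not preserve the Cartan subalgebra, so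
  \<open>tr Z\<close> may contain a multiple of the raising vector; as that kills highest weight
  vectors, the weight can still be read off from \<open>tr Z\<close>.\<close>

definition adapted :: "(smat \<Rightarrow> smat) \<Rightarrow> (idx \<Rightarrow> trip) \<Rightarrow> bool" where
  "adapted \<phi> tr \<longleftrightarrow>
     (\<forall>i k. bk (tr i) (tr k) = sct (of_real (cf i k)) (tr (brk i k)) \<and> dot (tr i) (tr k) = of_real (dt i k)) \<and>
     (\<forall>i. \<phi> (nmt (tr i)) = mscale (-1) (nmt (tr (st i))) \<and> \<phi> (mht (tr i)) = mscale (-1) (mht (tr (st i)))) \<and>
     (\<forall>t. \<exists>c1 c2 c3. t = sct c1 (tr P) + sct c2 (tr Z) + sct c3 (tr N)) \<and>
     (\<exists>\<rho>. tr P = (\<rho>, 0, 0)) \<and> (\<exists>\<beta>. tr Z = (\<beta>, 1, 0))"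

lemma adapted_basis:
  assumes ac: "almost_compact \<phi>" and pos: "\<forall>u\<in>g_mhalf. u \<noteq> 0 \<longrightarrow> Re (ang (\<phi> u) u) > 0"
  shows "\<exists>tr. adapted \<phi> tr"
proof -
  have phi: "\<And>a. a \<in> spo23 \<Longrightarrow> \<phi> a \<in> spo23" "\<And>a. a \<in> spo23 \<Longrightarrow> \<phi> (\<phi> a) = a"
    "\<And>a b. a \<in> spo23 \<Longrightarrow> b \<in> spo23 \<Longrightarrow> \<phi> (a + b) = \<phi> a + \<phi> b"
    "\<And>a c. a \<in> spo23 \<Longrightarrow> \<phi> (mscale c a) = mscale (cnj c) (\<phi> a)"
    "\<And>a b. a \<in> spo23 \<Longrightarrow> b \<in> spo23 \<Longrightarrow> \<phi> (sbracket a b) = sbracket (\<phi> a) (\<phi> b)"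
    "\<phi> e_mat = e_mat" "\<phi> x_mat = x_mat" "\<phi> f_mat = f_mat"
    and kill: "\<And>a. a \<in> g_nat \<Longrightarrow> \<phi> a = a \<Longrightarrow> a \<noteq> 0 \<Longrightarrow> Re (killing_nat a a) < 0"
    using ac unfolding almost_compact_def by blast+
  have exf: "e_mat \<in> spo23" "x_mat \<in> spo23" "f_mat \<in> spo23"
    by (simp_all add: spo23_iff e_entries)
  have phi0: "\<phi> 0 = 0"
    using phi(4)[OF exf(1), of 0] by (simp add: mscale_def vec_eq_iff zero_vec_def)
  have phi_g: "\<phi> a \<in> g_nat" if "a \<in> g_nat" for a
    using that phi(5)[OF exf(1), of a] phi(5)[OF exf(2), of a] phi(5)[OF exf(3), of a] phi(1,6,7,8) phi0
    by (simp add: g_nat_def)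
  have phi_m: "\<phi> u \<in> g_mhalf" if "u \<in> g_mhalf" for u
    using that phi(5)[OF exf(2), of u] phi(4)[of u "-1/2"] phi(1,7)
    by (simp add: g_mhalf_def)
  have ex_nm: "\<exists>t. \<phi> (nmt a) = nmt t" for a
    using g_nat_nm[OF phi_g[OF trip_simps(8)[of a]]] by (metis nmt.simps)
  have ex_mh: "\<exists>t. \<phi> (mht a) = mht t" for a
    using g_mhalf_mh[OF phi_m[OF trip_simps(9)[of a]]] by (metis mht.simps)
  have inj: "nmt a = nmt b \<longleftrightarrow> a = b" "mht a = mht b \<longleftrightarrow> a = b" for a b
    by (cases a; cases b; simp add: nm_eq)+
  obtain x y z where g: "\<phi> (nmt (1, 0, 0)) = nmt (x, y, z)" using ex_nm by (metis prod_cases3)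
  obtain h1 h2 h3 where h: "\<phi> (nmt (0, 1, 0)) = nmt (h1, h2, h3)" using ex_nm by (metis prod_cases3)
  obtain f1 f2 f3 where f: "\<phi> (nmt (0, 0, 1)) = nmt (f1, f2, f3)" using ex_nm by (metis prod_cases3)
  have phi_bk: "\<phi> (nmt (bk a b)) = sbracket (\<phi> (nmt a)) (\<phi> (nmt b))" for a b
    using phi(5)[OF trip_simps(10)[of a] trip_simps(10)[of b]] by (simp only: trip_simps)
  \<comment> \<open>The identity (ad g)^2 w = (g.g) w - (g.w) g, to be used on the images of (ad
    e)^2 f = -e and (ad e)^2 h = 0, where g = (x, y, z) is the image of the raising vector
    e.\<close>
  have dbl: "bk (x, y, z) (bk (x, y, z) w) = sct (dot (x, y, z) (x, y, z)) w + sct (- dot (x, y, z) w) (x, y, z)" for w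
    by (cases w) (simp add: algebra_simps)
  have ee: "\<phi> (nmt (bk (1, 0, 0) (bk (1, 0, 0) w))) = sbracket (\<phi> (nmt (1, 0, 0))) (sbracket (\<phi> (nmt (1, 0, 0))) (\<phi> (nmt w)))" for w
    by (simp only: phi_bk)
  define q where "q = dot (x, y, z) (x, y, z)"
  have gf: "sct q (f1, f2, f3) + sct (- dot (x, y, z) (f1, f2, f3)) (x, y, z) = (- x, - y, - z)"
  proof -
    have "nmt (bk (1, 0, 0) (bk (1, 0, 0) (0, 0, 1))) = mscale (-1) (nmt (1, 0, 0))"
      by (simp add: nm_linear)
    then have "\<phi> (nmt (bk (1, 0, 0) (bk (1, 0, 0) (0, 0, 1)))) = nmt (- x, - y, - z)"
      using phi(4)[OF trip_simps(10)[of "(1, 0, 0)"], of "-1"] g by (simp add: nm_linear)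
    then show ?thesis unfolding ee g f trip_simps(1) dbl inj q_def by (rule sym[OF sym])
  qed
  have gh: "sct q (h1, h2, h3) + sct (- dot (x, y, z) (h1, h2, h3)) (x, y, z) = (0, 0, 0)"
  proof -
    have m0: "nm 0 0 0 = 0" by simp
    have "\<phi> (nmt (bk (1, 0, 0) (bk (1, 0, 0) (0, 1, 0)))) = nmt (0, 0, 0)"
      by (simp add: m0 phi0)
    then show ?thesis unfolding ee g h trip_simps(1) dbl inj q_def by (rule sym[OF sym])
  qed
  have gne: "(x, y, z) \<noteq> (0, 0, 0)"
  proof
    assume "(x, y, z) = (0, 0, 0)"
    then have "\<phi> (nmt (1, 0, 0)) = mscale 0 (nmt (1, 0, 0))" using g by (simp add: nm_linear)
    then have "\<phi> (\<phi> (nmt (1, 0, 0))) = mscale 0 (\<phi> (nmt (1, 0, 0)))"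
      using phi(4)[OF trip_simps(10)[of "(1, 0, 0)"], of 0] by simp
    then show False using phi(2)[OF trip_simps(10)[of "(1, 0, 0)"]] g by (simp add: nm_linear nm_eq)
  qed
  \<comment> \<open>Otherwise the image of f would be a multiple of the image of e, against
    injectivity.\<close>
  have q0: "q = 0"
  proof (rule ccontr)
    assume "q \<noteq> 0"
    define c where "c = (dot (x, y, z) (f1, f2, f3) - 1) / q"
    have "f1 = c * x" "f2 = c * y" "f3 = c * z"
      using gf \<open>q \<noteq> 0\<close> unfolding c_def by (auto simp: divide_simps) (auto simp: algebra_simps)
    then have "\<phi> (nmt (0, 0, 1)) = mscale c (\<phi> (nmt (1, 0, 0)))" using f g by (simp add: nm_linear)
    then have "\<phi> (\<phi> (nmt (0, 0, 1))) = mscale (cnj c) (\<phi> (\<phi> (nmt (1, 0, 0))))"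
      using phi(4)[OF phi(1)[OF trip_simps(10)[of "(1, 0, 0)"]], of c] by simp
    then show False
      using phi(2)[OF trip_simps(10)[of "(1, 0, 0)"]] phi(2)[OF trip_simps(10)[of "(0, 0, 1)"]] by (simp add: nm_linear nm_eq)
  qed
  have d1: "dot (x, y, z) (f1, f2, f3) = 1" and d2: "dot (x, y, z) (h1, h2, h3) = 0"
    using gf gh gne unfolding q0 by (auto simp del: dot.simps)
  \<comment> \<open>As \<phi> is an involution, e is the image of (x, y, z). Pairing e with (x, y,
    z) gives z directly, and the conjugate of z after expanding that image.\<close>
  have zr: "cnj z = z"
  proof -
    have sp': "mscale c (nmt t) \<in> spo23" "mscale c (nmt t) + mscale d (nmt s) \<in> spo23" for c d s t
      by (cases t; cases s; simp add: nm_linear spo23_nm)+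
    have "\<phi> (nmt (x, y, z)) = \<phi> (mscale x (nmt (1, 0, 0)) + (mscale y (nmt (0, 1, 0)) + mscale z (nmt (0, 0, 1))))"
      by (simp add: nm_linear)
    also have "\<dots> = mscale (cnj x) (nmt (x, y, z)) + (mscale (cnj y) (nmt (h1, h2, h3)) + mscale (cnj z) (nmt (f1, f2, f3)))"
      by (simp only: phi(3)[OF sp'(1) sp'(2)] phi(3)[OF sp'(1) sp'(1)] phi(4)[OF trip_simps(10)] g h f)
    finally have "nmt (1, 0, 0) = mscale (cnj x) (nmt (x, y, z)) + (mscale (cnj y) (nmt (h1, h2, h3)) + mscale (cnj z) (nmt (f1, f2, f3)))"
      using phi(2)[OF trip_simps(10)[of "(1, 0, 0)"]] g by (simp only:)
    then have e: "1 = cnj x * x + (cnj y * h1 + cnj z * f1)" "0 = cnj x * y + (cnj y * h2 + cnj z * f2)" "0 = cnj x * z + (cnj y * h3 + cnj z * f3)"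
      unfolding nmt.simps nm_linear nm_eq by blast+
    have "z * (cnj x * x + (cnj y * h1 + cnj z * f1)) + y * (cnj x * y + (cnj y * h2 + cnj z * f2)) + x * (cnj x * z + (cnj y * h3 + cnj z * f3))
       = cnj x * dot (x, y, z) (x, y, z) + cnj y * dot (x, y, z) (h1, h2, h3) + cnj z * dot (x, y, z) (f1, f2, f3)"
      by (simp add: algebra_simps)
    then have "z * 1 + y * 0 + x * 0 = cnj x * 0 + cnj y * 0 + cnj z * 1"
      unfolding e[symmetric] d1 d2 q0[unfolded q_def] .
    then show ?thesis by simp
  qed
  have y2: "y * y = - 2 * x * z" using q0 unfolding q_def by (simp add: algebra_simps eq_neg_iff_add_eq_0)
  \<comment> \<open>The vector e + (x, y, z) is fixed by \<phi>, and its Killing form is 4 z. If it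
    is 0, then i e is a nonzero fixed vector with Killing form 0, which compactness
    excludes.\<close>
  have z_neg: "Re z < 0"
  proof (cases "(1 + x, y, z) = (0, 0, 0)")
    case False
    let ?a = "nmt (1 + x, y, z)"
    have a: "?a = nmt (1, 0, 0) + nmt (x, y, z)" by (simp add: nm_linear)
    have "\<phi> (nmt (x, y, z)) = nmt (1, 0, 0)"
      using phi(2)[OF trip_simps(10)[of "(1, 0, 0)"]] g by (simp only:)
    then have "\<phi> ?a = ?a"
      unfolding a phi(3)[OF trip_simps(10) trip_simps(10)] g by (simp only: add.commute)
    moreover have "?a \<noteq> 0"
      using False by auto
    ultimately have "Re (killing_nat ?a ?a) < 0" using kill trip_simps(8) by blast
    moreover have "killing_nat ?a ?a = 4 * z"
      by (simp only: nmt.simps killing_nm y2) (simp add: algebra_simps)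
    ultimately show ?thesis by simp
  next
    case True
    let ?a = "nmt (\<i>, 0, 0)"
    have a: "?a = mscale \<i> (nmt (1, 0, 0))" by (simp add: nm_linear)
    have "x = -1" "y = 0" "z = 0" using True by (simp_all add: add_eq_0_iff)
    then have "\<phi> ?a = ?a"
      unfolding a phi(4)[OF trip_simps(10)] g by (simp add: nm_linear)
    moreover have "?a \<noteq> 0" by simp
    ultimately have "Re (killing_nat ?a ?a) < 0" using kill trip_simps(8) by blast
    then show ?thesis by (simp add: killing_nm)
  qed
  \<comment> \<open>Scales \<open>tr P\<close> so that its product with \<open>tr N\<close>, which
    is -r^2 z, has the required value 2.\<close>
  define r where "r = sqrt (- 2 / Re z)"
  have z0: "z \<noteq> 0" using z_neg by auto
  have zRe: "z = of_real (Re z)" using zr by (simp add: complex_eq_iff)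
  have rr: "r * r * Re z = -2"
  proof -
    have "0 \<le> - 2 / Re z" using z_neg by (intro divide_nonpos_neg) auto
    then have "r * r = - 2 / Re z" unfolding r_def by (simp only: real_sqrt_mult_self abs_of_nonneg)
    then show ?thesis using z_neg by simp
  qed
  define R where "R = complex_of_real r"
  define t where "t = R * z"
  \<comment> \<open>Since its square is 0, (x, y, z) equals z times (-w^2/2, w, 1).\<close>
  define w where "w = y / z"
  have cR: "cnj R = R" by (simp add: R_def)
  have "of_real (r * r * Re z) = (-2 :: complex)" using rr by simp
  then have Rt: "R * t = -2" unfolding t_def R_def by (subst zRe) (simp add: mult.assoc)
  have Rt': "t * R = -2" "R * (t * c) = -2 * c" "t * (R * c) = -2 * c" for c
    using Rt by (simp_all add: mult.commute flip: mult.assoc)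
  have R0: "R \<noteq> 0" and t0: "t \<noteq> 0" using Rt by auto
  have yw: "y = w * z" using z0 by (simp add: w_def)
  have xw: "x = - (w * w * z / 2)"
  proof -
    have "(2 * x + w * w * z) * z = 0" using y2 unfolding yw by (simp add: algebra_simps)
    then have "2 * x + w * w * z = 0" using z0 by simp
    then have "2 * x = - (w * w * z)" by (simp add: eq_neg_iff_add_eq_0)
    then show ?thesis by (simp add: field_simps)
  qed
  \<comment> \<open>\<open>tr N\<close> is minus the image of \<open>tr P\<close>, and
    \<open>tr Z\<close> is half the bracket of the two.\<close>
  define tr where "tr i = (case i of P \<Rightarrow> (R, 0, 0) | Z \<Rightarrow> (- w, 1, 0) | N \<Rightarrow> (t * (w * w / 2), - (t * w), - t))" for i
  have rel: "bk (tr i) (tr k) = sct (of_real (cf i k)) (tr (brk i k)) \<and> dot (tr i) (tr k) = of_real (dt i k)" for i k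
    by (cases i; cases k; simp add: tr_def Rt Rt' algebra_simps)
  have tN: "tr N = sct (- 1) (sct R (x, y, z))" and tP: "tr P = sct R (1, 0, 0)"
    by (simp_all add: tr_def t_def xw yw mult_ac)
  have span: "\<exists>u1 u2 u3. s = sct u1 (tr P) + sct u2 (tr Z) + sct u3 (tr N)" for s
  proof (cases s)
    case (fields s1 s2 s3)
    define u3 where "u3 = - s3 / t"
    define u2 where "u2 = s2 + u3 * (t * w)"
    define u1 where "u1 = (s1 + u2 * w - u3 * (t * (w * w / 2))) / R"
    have "u1 * R = s1 + u2 * w - u3 * (t * (w * w / 2))" using R0 by (simp add: u1_def)
    then have "s1 = u1 * R + u2 * (- w) + u3 * (t * (w * w / 2))" by (simp add: algebra_simps)
    moreover have "s2 = u1 * 0 + u2 * 1 + u3 * (- (t * w))" by (simp add: u2_def)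
    moreover have "s3 = u1 * 0 + u2 * 0 + u3 * (- t)" using t0 by (simp add: u3_def)
    ultimately have "s = sct u1 (tr P) + sct u2 (tr Z) + sct u3 (tr N)"
      unfolding fields tr_def idx.case sct.simps add_Pair prod.inject by blast
    then show ?thesis by blast
  qed
  have sp: "nmt (sct c a) \<in> spo23" "mht (sct c a) \<in> spo23" for c a by (rule trip_simps)+
  have fP: "\<phi> (nmt (tr P)) = mscale (-1) (nmt (tr N))"
    unfolding tP tN trip_simps(6) phi(4)[OF trip_simps(10)] g cR smat_vs.scale_scale by simp
  have fN: "\<phi> (nmt (tr N)) = mscale (-1) (nmt (tr P))"
  proof -
    have "nmt (tr N) = mscale (-1) (\<phi> (nmt (tr P)))" unfolding fP smat_vs.scale_scale by simp
    then show ?thesis using phi(4)[OF phi(1)[OF trip_simps(10)[of "tr P"]], of "-1"] phi(2)[OF trip_simps(10)[of "tr P"]] by simp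
  qed
  have sb: "sbracket (mscale (-1) (nmt a)) (mscale (-1) (nmt b)) = nmt (bk a b)" "sbracket (mscale (-1) (nmt a)) (mscale c (mht b)) = mscale (- c) (mht (bk a b))" for a b c
    by (cases a; cases b; simp add: nm_linear bracket_nm bracket_nm_mh algebra_simps)+
  have fZ: "\<phi> (nmt (tr Z)) = mscale (-1) (nmt (tr Z))"
  proof -
    have "mscale 2 (\<phi> (nmt (tr Z))) = \<phi> (nmt (bk (tr P) (tr N)))"
      using phi(4)[OF trip_simps(10)[of "tr Z"], of 2] rel[of P N] by (simp add: trip_simps)
    also have "\<dots> = nmt (bk (tr N) (tr P))" unfolding phi_bk fP fN sb ..
    also have "\<dots> = mscale 2 (mscale (-1) (nmt (tr Z)))" using rel[of N P] by (simp add: trip_simps)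
    finally show ?thesis by (rule smat_vs.scale_left_imp_eq[rotated]) simp
  qed
  obtain u where u: "\<phi> (mht (tr P)) = mht u" using ex_mh by blast
  have phi_bkm: "\<phi> (mht (bk a b)) = sbracket (\<phi> (nmt a)) (\<phi> (mht b))" for a b
    using phi(5)[OF trip_simps(10)[of a] trip_simps(11)[of b]] by (simp only: trip_simps)
  \<comment> \<open>\<open>mht (tr P)\<close> is killed by \<open>tr P\<close>, so its image is
    killed by the image of \<open>tr P\<close>, that is by \<open>tr N\<close>. The vectors of
    \<open>g_mhalf\<close> with this property form a line.\<close>
  obtain \<kappa> where k: "\<phi> (mht (tr P)) = mscale \<kappa> (mht (tr N))"
  proof -
    have m0: "mh 0 0 0 = 0" by simp
    have "\<phi> (mht (bk (tr P) (tr P))) = 0" by (simp add: tr_def m0 phi0)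
    moreover have "\<phi> (mht (bk (tr P) (tr P))) = mht (sct (-1) (bk (tr N) u))"
      unfolding phi_bkm fP u using sb(2)[of "tr N" 1 u] by (simp add: trip_simps)
    ultimately have "mht (sct (-1) (bk (tr N) u)) = mht (0, 0, 0)" by (simp only: mht.simps m0)
    then have z': "sct (-1) (bk (tr N) u) = (0, 0, 0)" unfolding inj .
    obtain u1 u2 u3 where c: "u = sct u1 (tr P) + sct u2 (tr Z) + sct u3 (tr N)" using span by blast
    have "bk (tr N) u = sct (- 2 * u1) (tr Z) + sct u2 (tr N)"
      unfolding c by (simp add: tr_def Rt Rt' algebra_simps) (simp add: field_simps)
    then have "u2 = 0" "u1 = 0" using z' t0 by (auto simp: tr_def)
    then have "u = sct u3 (tr N)" using c by (simp add: tr_def)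
    then show ?thesis using that[of u3] u by (simp add: trip_simps)
  qed
  have mZ: "\<phi> (mht (tr Z)) = mscale \<kappa> (mht (tr Z))"
  proof -
    have "mscale (-2) (\<phi> (mht (tr Z))) = \<phi> (mht (bk (tr N) (tr P)))"
      using phi(4)[OF trip_simps(11)[of "tr Z"], of "-2"] rel[of N P] by (simp add: trip_simps)
    also have "\<dots> = mscale (- \<kappa>) (mht (bk (tr P) (tr N)))" unfolding phi_bkm fN k sb ..
    also have "\<dots> = mscale (-2) (mscale \<kappa> (mht (tr Z)))" using rel[of P N] by (simp add: trip_simps mult.commute)
    finally show ?thesis by (rule smat_vs.scale_left_imp_eq[rotated]) simp
  qed
  \<comment> \<open>The bracket of \<open>mht (tr Z)\<close> with itself is a multiple of
    \<open>f_mat\<close>, which \<phi> fixes, so the square of \<kappa> is 1. The positivity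
    assumption on \<open>ang\<close> then selects the sign -1.\<close>
  have k1: "\<kappa> = -1"
  proof -
    have bb: "sbracket (mscale c (mht (tr Z))) (mscale c (mht (tr Z))) = mscale (-4 * (c * c)) f_mat" for c
      by (simp add: tr_def nm_linear bracket_mh_mh mult_ac)
    have "\<phi> (sbracket (mht (tr Z)) (mht (tr Z))) = mscale (-4) f_mat"
      using bb[of 1] phi(4)[OF exf(3), of "-4"] phi(8) by simp
    moreover have "\<phi> (sbracket (mht (tr Z)) (mht (tr Z))) = mscale (-4 * (\<kappa> * \<kappa>)) f_mat"
      unfolding phi(5)[OF trip_simps(11) trip_simps(11)] mZ bb ..
    ultimately have "mscale (-4) f_mat = mscale (-4 * (\<kappa> * \<kappa>)) f_mat" by simp
    then have "mscale (-4) f_mat $ Inl 2 $ Inl 1 = mscale (-4 * (\<kappa> * \<kappa>)) f_mat $ Inl 2 $ Inl 1" by (rule arg_cong)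
    then have "-4 * (1 / 2) = -4 * (\<kappa> * \<kappa>) * (1 / 2 :: complex)"
      unfolding mscale_def vec_lambda_beta e_entries by simp
    then have "\<kappa> * \<kappa> = 1" by (auto simp: field_simps)
    then have "\<kappa> = 1 \<or> \<kappa> = -1" using square_eq_1_iff by blast
    moreover have "mht (tr Z) \<noteq> 0" by (simp add: tr_def)
    then have "Re (ang (\<phi> (mht (tr Z))) (mht (tr Z))) > 0" using pos trip_simps(9) by blast
    then have "Re (-2 * \<kappa>) > 0"
      unfolding mZ trip_simps(7)[symmetric] trip_simps(4) by (simp add: tr_def)
    ultimately show ?thesis by auto
  qed
  have mN: "\<phi> (mht (tr N)) = mscale (-1) (mht (tr P))"
  proof -
    have "mht (tr N) = mscale (-1) (\<phi> (mht (tr P)))" unfolding k k1 smat_vs.scale_scale by simp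
    then show ?thesis using phi(4)[OF phi(1)[OF trip_simps(11)[of "tr P"]], of "-1"] phi(2)[OF trip_simps(11)[of "tr P"]] by simp
  qed
  have st: "\<phi> (nmt (tr i)) = mscale (-1) (nmt (tr (st i))) \<and> \<phi> (mht (tr i)) = mscale (-1) (mht (tr (st i)))" for i
    using fP fN fZ k mZ mN k1 by (cases i) simp_all
  have "tr P = (R, 0, 0)" "tr Z = (- w, 1, 0)" by (simp_all add: tr_def)
  then have "adapted \<phi> tr"
    unfolding adapted_def using rel st span by blast
  then show ?thesis by blast
qed

lemma gchoose_fact:
  "((x::complex) gchoose 0) * fact 0 = 1" "(x gchoose 1) * fact 1 = x" "(x gchoose 2) * fact 2 = x * (x - 1)"
  "(x gchoose 3) * fact 3 = x * (x - 1) * (x - 2)"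
  unfolding gbinomial_mult_fact' by (simp_all add: eval_nat_numeral algebra_simps)

lemma sum_length:
  "(\<Sum>j<length [a]. f j) = f 0" "(\<Sum>j<length [a, b]. f j) = f 0 + f 1"
  "(\<Sum>j<length [a, b, c]. f j) = f 0 + f 1 + f 2" "(\<Sum>j<length [a, b, c, d]. f j) = f 0 + f 1 + f 2 + f 3"
  for f :: "nat \<Rightarrow> 'x::comm_monoid_add"
  by (simp_all add: eval_nat_numeral add.assoc)

lemma nth_default_cons:
  "nth_default z (a # as) 0 = a" "nth_default z (a # b # as) 1 = b" "nth_default z (a # b # c # as) 2 = c"
  "nth_default z (a # b # c # d # as) 3 = d"
  by (simp_all add: eval_nat_numeral)

lemma coset_simps:
  "of_int n - of_bool False / 2 \<in> (\<int> :: rat set)" "of_int n + 1 - of_bool False / 2 \<in> (\<int> :: rat set)"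
  "of_int n + 2 - of_bool False / 2 \<in> (\<int> :: rat set)"
  "of_int n + 1/2 - of_bool True / 2 \<in> (\<int> :: rat set)" "of_int n + 3/2 - of_bool True / 2 \<in> (\<int> :: rat set)"
proof -
  have "of_int n + 3/2 - of_bool True / 2 = (of_int (n + 1) :: rat)" by simp
  then show "of_int n + 3/2 - of_bool True / 2 \<in> (\<int> :: rat set)" by (metis Ints_of_int)
qed simp_all

lemma of_int_simps:
  "of_int n + 2 - 1 = (of_int n + 1 :: rat)" "of_int n + 1 - 1 = (of_int n :: rat)" "of_int n + 3/2 - 1 = (of_int n + 1/2 :: rat)"
  "- of_rat (of_int n + 2) = (- of_int (n + 2) :: complex)" "- of_rat (of_int n + 1) = (- of_int (n + 1) :: complex)"
  "- of_rat (of_int n + 3/2) = (- (of_int n + 3/2) :: complex)"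
  by (simp_all add: of_rat_add of_rat_divide)

lemma rat_vac: "of_int n - 1 = (-1 :: rat) \<longleftrightarrow> n = 0"
  by simp

section \<open>The mode relations in the given module\<close>

locale adapted_module = Ramond_W_module sV parV vac prd k L J G sM parM md
  for sV :: "complex \<Rightarrow> 'v::ab_group_add \<Rightarrow> 'v" and parV :: "bool \<Rightarrow> 'v set"
    and vac :: 'v and prd :: "'v \<Rightarrow> int \<Rightarrow> 'v \<Rightarrow> 'v"
    and k :: real and L :: 'v and J :: "smat \<Rightarrow> 'v" and G :: "smat \<Rightarrow> 'v"
    and sM :: "complex \<Rightarrow> 'm::ab_group_add \<Rightarrow> 'm" and parM :: "bool \<Rightarrow> 'm set"
    and md :: "'v \<Rightarrow> rat \<Rightarrow> 'm \<Rightarrow> 'm" +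
  fixes \<phi> :: "smat \<Rightarrow> smat" and tr :: "idx \<Rightarrow> trip" and M1 :: nat
  assumes adapted: "adapted \<phi> tr" and level: "real M1 = - 4 * k - 2"
begin

text \<open>The factor i changes the leading term -M1 dt L in the bracket of \<open>G\<close> with
  itself into M1 dt L. It also absorbs the sign of \<phi> on \<open>g_mhalf\<close>: the adjoint of
  i G with index j has index \<open>st j\<close> and no sign.\<close>

definition gop :: "wop \<Rightarrow> 'm \<Rightarrow> 'm" where
  "gop b = (case b of OL n \<Rightarrow> md L (of_int n + 1) | OJ i n \<Rightarrow> md (J (nmt (tr i))) (of_int n)
     | OG i n \<Rightarrow> (\<lambda>w. sM \<i> (md (G (mht (tr i))) (of_int n + 1/2) w)))"

lemma gop_simps: "gop (OL n) = md L (of_int n + 1)" "gop (OJ i n) = md (J (nmt (tr i))) (of_int n)"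
  "gop (OG i n) = (\<lambda>w. sM \<i> (md (G (mht (tr i))) (of_int n + 1/2) w))"
  by (simp_all add: gop_def)

lemma tr_rel: "bk (tr i) (tr j) = sct (of_real (cf i j)) (tr (brk i j))" "dot (tr i) (tr j) = of_real (dt i j)"
  using adapted unfolding adapted_def by blast+

lemma even_odd: "J (nmt a) \<in> parV False" "G (mht a) \<in> parV True"
  by (intro J_even G_odd trip_simps)+

lemma J_sct: "J (nmt (sct c a)) = sV c (J (nmt a))" and G_sct: "G (mht (sct c a)) = sV c (G (mht a))"
  by (simp_all only: trip_simps J_scale G_scale)

lemma lambda_JJ: "lambda_bracket (J (nmt a)) (J (nmt b)) = nth_default 0 [J (nmt (bk a b)), sV (of_real (real M1 / 2) * dot a b) vac]"
proof -
  have "k + 1/2 = - (real M1 / 4)" using level by linarith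
  then have E: "complex_of_real (k + 1/2) * inv_form (nmt a) (nmt b) = of_real (real M1 / 2) * dot a b"
    unfolding trip_simps(3) by simp
  show ?thesis using JJ[OF trip_simps(8)[of a] trip_simps(8)[of b]] unfolding E trip_simps(1) .
qed

lemma lambda_JG: "lambda_bracket (J (nmt a)) (G (mht b)) = nth_default 0 [G (mht (bk a b))]"
  using JG[OF trip_simps(8)[of a] trip_simps(9)[of b]] unfolding trip_simps .

lemma lambda_GG_trip: "lambda_bracket (G (mht a)) (G (mht b)) = nth_default 0
     [sV (- of_real (real M1) * dot a b) L + normal_ord (J (nmt b)) (J (nmt a))
        + sV (of_real (1 - real M1 / 2)) (translation (J (nmt (bk a b)))),
      sV (of_real (1 - real M1)) (J (nmt (bk a b))),
      sV (- of_real (real M1 * (real M1 - 1) / 4) * dot a b) vac]"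
proof -
  have kv: "k = - (real M1 + 2) / 4" unfolding level by simp
  have kk: "4 * (k + 1/2) = - real M1" "2 * (k + 1) = 1 - real M1 / 2" "4 * k + 3 = 1 - real M1"
    unfolding kv by (simp_all add: field_simps)
  have pp: "- 4 * p_poly k = - (real M1 * (real M1 - 1) / 4)"
    unfolding p_poly_def kv by (simp add: field_simps)
  obtain x y z where a: "a = (x, y, z)" using prod_cases3 .
  obtain x' y' z' where b: "b = (x', y', z')" using prod_cases3 .
  show ?thesis
    unfolding a b mht.simps lambda_GG nmt.simps bk.simps dot.simps kk pp of_real_minus ..
qed

lemma LL_modes: "gop (OL m) (gop (OL n) w) = gop (OL n) (gop (OL m) w) + sM (of_int (m - n)) (gop (OL (m + n)) w)
      + sM (if m + n = 0 then of_real ((3 * real M1 - 1) / 2 / 12 * (of_int m ^ 3 - of_int m)) else 0) w"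
proof -
  let ?x = "complex_of_rat (of_int m + 1)" and ?X = "md L (of_int (m + n) + 1) w"
  have i: "of_int m + 1 + (of_int n + 1) - of_nat 0 = (of_int (m + n) + 2 :: rat)" "of_int m + 1 + (of_int n + 1) - of_nat 1 = (of_int (m + n) + 1 :: rat)"
    "of_int m + 1 + (of_int n + 1) - of_nat 3 = (of_int (m + n) - 1 :: rat)" by simp_all
  have t: "md (translation L) (of_int (m + n) + 2) w = sM (- of_int (m + n + 2)) ?X"
    using md_translation[OF L_even coset_simps(3), of "m + n" w]
    unfolding of_int_simps(1) of_int_simps(4) .
  \<comment> \<open>As the superdimension is 0, the central charge is -6 k - 7/2.\<close>
  have cc: "central_charge k = (3 * real M1 - 1) / 2"
    using level by (simp add: central_charge_def sdim_zero h_dual_def)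
  have x: "?x = of_int m + 1" by (simp add: of_rat_add)
  have V: "md (sV c vac) (of_int (m + n) - 1) w = sM (if m + n = 0 then c else 0) w" for c
    unfolding md_scale_left md_vac rat_vac by simp
  have "gop (OL m) (gop (OL n) w) = gop (OL n) (gop (OL m) w) +
     (sM (- of_int (m + n + 2)) ?X + sM ?x (sM 2 ?X) + sM (?x * (?x - 1) * (?x - 2)) (sM (if m + n = 0 then of_real (central_charge k / 12) else 0) w))"
    using commutator[OF L_even L_even coset_simps(2) coset_simps(2) LL, of m n w]
    unfolding sum_length nth_default_cons gchoose_fact i t V gop_simps by (simp add: koszul_def md_scale_left)
  also have "\<dots> = gop (OL n) (gop (OL m) w) + sM (- of_int (m + n + 2) + ?x * 2) ?X
     + sM (?x * (?x - 1) * (?x - 2) * (if m + n = 0 then of_real (central_charge k / 12) else 0)) w"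
    by (simp add: M.scale_left_distrib add.assoc)
  also have "- of_int (m + n + 2) + ?x * 2 = of_int (m - n)" unfolding x by simp
  also have "?x * (?x - 1) * (?x - 2) * (if m + n = 0 then of_real (central_charge k / 12) else 0)
      = (if m + n = 0 then of_real ((3 * real M1 - 1) / 2 / 12 * (of_int m ^ 3 - of_int m)) else 0)"
    unfolding x cc by (simp add: field_simps power3_eq_cube)
  finally show ?thesis by (simp only: gop_simps)
qed

lemma LJ_modes: "gop (OL m) (gop (OJ i n) w) = gop (OJ i n) (gop (OL m) w) + sM (of_int (- n)) (gop (OJ i (m + n)) w)"
proof -
  let ?x = "complex_of_rat (of_int m + 1)" and ?X = "md (J (nmt (tr i))) (of_int (m + n)) w"
  have i: "of_int m + 1 + of_int n - of_nat 0 = (of_int (m + n) + 1 :: rat)" "of_int m + 1 + of_int n - of_nat 1 = (of_int (m + n) :: rat)"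
    by simp_all
  have t: "md (translation (J (nmt (tr i)))) (of_int (m + n) + 1) w = sM (- of_int (m + n + 1)) ?X"
    using md_translation[OF even_odd(1) coset_simps(2), of "tr i" "m + n" w]
    unfolding of_int_simps(2) of_int_simps(5) .
  have x: "?x = of_int m + 1" by (simp add: of_rat_add)
  have "gop (OL m) (gop (OJ i n) w) = gop (OJ i n) (gop (OL m) w) + (sM (- of_int (m + n + 1)) ?X + sM ?x ?X)"
    using commutator[OF L_even even_odd(1) coset_simps(2) coset_simps(1) LJ[OF trip_simps(8)], of m "tr i" n w]
    unfolding sum_length nth_default_cons gchoose_fact i t gop_simps by (simp add: koszul_def)
  also have "sM (- of_int (m + n + 1)) ?X + sM ?x ?X = sM (- of_int (m + n + 1) + ?x) ?X"
    by (simp only: M.scale_left_distrib)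
  also have "- of_int (m + n + 1) + ?x = of_int (- n)" unfolding x by simp
  finally show ?thesis by (simp only: gop_simps)
qed

lemma LG_modes: "gop (OL m) (gop (OG i n) w) = gop (OG i n) (gop (OL m) w) + sM (of_real (of_int m / 2 - of_int n)) (gop (OG i (m + n)) w)"
proof -
  let ?x = "complex_of_rat (of_int m + 1)" and ?X = "md (G (mht (tr i))) (of_int (m + n) + 1/2) w"
  have i: "of_int m + 1 + (of_int n + 1/2) - of_nat 0 = (of_int (m + n) + 3/2 :: rat)" "of_int m + 1 + (of_int n + 1/2) - of_nat 1 = (of_int (m + n) + 1/2 :: rat)"
    by simp_all
  have t: "md (translation (G (mht (tr i)))) (of_int (m + n) + 3/2) w = sM (- (of_int (m + n) + 3/2)) ?X"
    using md_translation[OF even_odd(2) coset_simps(5), of "tr i" "m + n" w]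
    unfolding of_int_simps(3) of_int_simps(6) .
  have x: "?x = of_int m + 1" by (simp add: of_rat_add)
  have "md L (of_int m + 1) (md (G (mht (tr i))) (of_int n + 1/2) w) = md (G (mht (tr i))) (of_int n + 1/2) (md L (of_int m + 1) w)
     + (sM (- (of_int (m + n) + 3/2)) ?X + sM ?x (sM (3/2) ?X))"
    using commutator[OF L_even even_odd(2) coset_simps(2) coset_simps(4) LG[OF trip_simps(9)], of m "tr i" n w]
    unfolding sum_length nth_default_cons gchoose_fact i t by (simp add: koszul_def md_scale_left)
  also have "sM (- (of_int (m + n) + 3/2)) ?X + sM ?x (sM (3/2) ?X) = sM (- (of_int (m + n) + 3/2) + ?x * (3/2)) ?X"
    by (simp only: M.scale_left_distrib M.scale_scale)
  also have "- (of_int (m + n) + 3/2) + ?x * (3/2) = of_real (of_int m / 2 - of_int n)" unfolding x by (simp add: field_simps)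
  finally show ?thesis unfolding gop_simps md_scale_right by (simp add: M.scale_right_distrib mult.commute)
qed

lemma JJ_modes: "gop (OJ i m) (gop (OJ j n) w) = gop (OJ j n) (gop (OJ i m) w) + sM (of_real (cf i j)) (gop (OJ (brk i j) (m + n)) w)
      + sM (if m + n = 0 then of_real (real M1 * (of_int m / 2 * dt i j)) else 0) w"
proof -
  have i: "of_int m + of_int n - of_nat 0 = (of_int (m + n) :: rat)" "of_int m + of_int n - of_nat 1 = (of_int (m + n) - 1 :: rat)"
    by simp_all
  have V: "md (sV c vac) (of_int (m + n) - 1) w = sM (if m + n = 0 then c else 0) w" for c
    unfolding md_scale_left md_vac rat_vac by simp
  have "gop (OJ i m) (gop (OJ j n) w) = gop (OJ j n) (gop (OJ i m) w) + (sM (of_real (cf i j)) (gop (OJ (brk i j) (m + n)) w)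
     + sM (of_int m) (sM (if m + n = 0 then of_real (real M1 / 2) * of_real (dt i j) else 0) w))"
    using commutator[OF even_odd(1) even_odd(1) coset_simps(1) coset_simps(1) lambda_JJ, of "tr i" m "tr j" n w]
    unfolding sum_length nth_default_cons gchoose_fact i V tr_rel J_sct gop_simps by (simp add: koszul_def md_scale_left)
  also have "sM (of_int m) (sM (if m + n = 0 then of_real (real M1 / 2) * of_real (dt i j) else 0) w)
     = sM (if m + n = 0 then of_real (real M1 * (of_int m / 2 * dt i j)) else 0) w"
    by (simp add: mult_ac)
  finally show ?thesis by (simp only: add.assoc)
qed

lemma JG_modes: "gop (OJ i m) (gop (OG j n) w) = gop (OG j n) (gop (OJ i m) w) + sM (of_real (cf i j)) (gop (OG (brk i j) (m + n)) w)"
proof -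
  have i: "of_int m + (of_int n + 1/2) - of_nat 0 = (of_int (m + n) + 1/2 :: rat)" by simp
  show ?thesis
    using commutator[OF even_odd(1) even_odd(2) coset_simps(1) coset_simps(4) lambda_JG, of "tr i" m "tr j" n w]
    unfolding sum_length nth_default_cons gchoose_fact i tr_rel G_sct gop_simps md_scale_right
    by (simp add: koszul_def md_scale_left M.scale_right_distrib mult.commute)
qed

lemma GG_modes: "\<exists>K. \<forall>K'\<ge>K. gop (OG i m) (gop (OG j n) w) = sM (-1) (gop (OG j n) (gop (OG i m) w)) + (sM (of_real (real M1 * dt i j)) (gop (OL (m + n)) w)
      + sM (-1/2) (\<Sum>l=-K'..K'. nt (\<lambda>n. gop (OJ i n)) (\<lambda>n. gop (OJ j n)) (m + n) l w + nt (\<lambda>n. gop (OJ j n)) (\<lambda>n. gop (OJ i n)) (m + n) l w)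
      + sM (of_real ((real M1 - 1) * (of_int (m - n) / 2 * cf i j))) (gop (OJ (brk i j) (m + n)) w)
      + sM (if m + n = 0 then of_real (real M1 * (real M1 - 1) / 4 * (of_int m ^ 2 - 1 / 4) * dt i j) else 0) w)"
proof -
  let ?a = "tr i" and ?b = "tr j"
  let ?x = "complex_of_rat (of_int m + 1/2)" and ?r = "of_int (m + n + 1) :: rat"
  define X where "X = md (normal_ord (J (nmt ?b)) (J (nmt ?a))) ?r w"
  define Y where "Y = md (normal_ord (J (nmt ?a)) (J (nmt ?b))) ?r w"
  define Lw where "Lw = gop (OL (m + n)) w"
  define Jw where "Jw = gop (OJ (brk i j) (m + n)) w"
  define c where "c = complex_of_real (cf i j)"
  define d where "d = complex_of_real (dt i j)"
  define \<mu> where "\<mu> = complex_of_real (real M1)"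
  have Jbk: "md (J (nmt (bk ?a ?b))) (of_int (m + n)) w = sM c Jw"
    unfolding tr_rel J_sct md_scale_left Jw_def gop_simps c_def ..
  have T: "md (translation (J (nmt (bk ?a ?b)))) ?r w = sM (- of_int (m + n + 1)) (sM c Jw)"
  proof -
    have "of_int (m + n + 1) - 1 = (of_int (m + n) :: rat)" by simp
    moreover have "- of_rat ?r = (- of_int (m + n + 1) :: complex)" by (simp only: of_rat_of_int_eq)
    ultimately show ?thesis
      using md_translation[OF even_odd(1) coset_simps(1), of "bk ?a ?b" "m + n + 1" w] by (simp only: Jbk)
  qed
  have "bk ?b ?a = sct (-1) (bk ?a ?b)"
    by (cases ?a; cases ?b) (simp add: algebra_simps)
  then have "translation (J (sbracket (nmt ?b) (nmt ?a))) = sV (-1) (translation (J (nmt (bk ?a ?b))))"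
    unfolding trip_simps(1) by (simp only: J_sct translation_def prd_scale_left)
  then have "normal_ord (J (nmt ?b)) (J (nmt ?a)) = normal_ord (J (nmt ?a)) (J (nmt ?b)) + sV (-1) (translation (J (nmt (bk ?a ?b))))"
    using normal_ord_J_commute[OF trip_simps(8)[of ?b] trip_simps(8)[of ?a]] by simp
  note NO = this
  \<comment> \<open>The bracket of \<open>G\<close> with itself contains the product in one order
    only, whereas \<open>wmod\<close> uses the symmetrised one. Half the difference of the two
    orders is a multiple of the current in the bracket and is moved to its coefficient.\<close>
  have XY: "X = Y + sM (of_int (m + n + 1) * c) Jw"
  proof -
    have "- 1 * (- of_int l * c) = of_int l * c" for l by simp
    then show ?thesis
      unfolding X_def Y_def NO
      by (simp only: md_add_left md_scale_left T M.scale_scale)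
  qed
  have "sM (1/2) (Y + X) = sM (1/2) (X + X - sM (of_int (m + n + 1) * c) Jw)"
    unfolding XY by (simp add: algebra_simps)
  also have "\<dots> = sM (1/2 + 1/2) X - sM (of_int (m + n + 1) * c / 2) Jw"
    unfolding M.scale_right_diff_distrib M.scale_right_distrib M.scale_left_distrib by simp
  finally have X: "X = sM (1/2) (Y + X) + sM (of_int (m + n + 1) * c / 2) Jw" by simp
  have ix: "of_int m + 1/2 + (of_int n + 1/2) - of_nat 0 = ?r" "of_int m + 1/2 + (of_int n + 1/2) - of_nat 1 = (of_int (m + n) :: rat)"
    "of_int m + 1/2 + (of_int n + 1/2) - of_nat 2 = (of_int (m + n) - 1 :: rat)" by simp_all
  have V: "md (sV e vac) (of_int (m + n) - 1) w = sM (if m + n = 0 then e else 0) w" for e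
    unfolding md_scale_left md_vac rat_vac by simp
  have x: "?x = of_int m + 1/2" by (simp add: of_rat_add of_rat_divide)
  have Lr: "md L ?r w = Lw" unfolding Lw_def gop_simps by simp
  have "md (G (mht ?a)) (of_int m + 1/2) (md (G (mht ?b)) (of_int n + 1/2) w)
     = sM (-1) (md (G (mht ?b)) (of_int n + 1/2) (md (G (mht ?a)) (of_int m + 1/2) w))
      + (sM (- \<mu> * d) Lw + X + sM (1 - \<mu> / 2) (sM (- of_int (m + n + 1)) (sM c Jw)) + sM ?x (sM (1 - \<mu>) (sM c Jw))
         + sM (?x * (?x - 1)) (sM (if m + n = 0 then - (\<mu> * (\<mu> - 1) / 4) * d else 0) w))"
    using commutator[OF even_odd(2) even_odd(2) coset_simps(4) coset_simps(4) lambda_GG_trip, of ?a m ?b n w]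
    unfolding sum_length nth_default_cons gchoose_fact ix V
    unfolding md_add_left md_scale_left Lr X_def[symmetric] T Jbk tr_rel(2) d_def[symmetric]
    by (simp add: koszul_def \<mu>_def)
  also have "sM (- \<mu> * d) Lw + X + sM (1 - \<mu> / 2) (sM (- of_int (m + n + 1)) (sM c Jw)) + sM ?x (sM (1 - \<mu>) (sM c Jw))
     = sM (- \<mu> * d) Lw + sM (1/2) (Y + X) + (sM (of_int (m + n + 1) * c / 2) Jw
        + (sM (1 - \<mu> / 2) (sM (- of_int (m + n + 1)) (sM c Jw)) + sM ?x (sM (1 - \<mu>) (sM c Jw))))"
    by (subst (1) X) (simp only: add.assoc)
  also have "sM (of_int (m + n + 1) * c / 2) Jw + (sM (1 - \<mu> / 2) (sM (- of_int (m + n + 1)) (sM c Jw)) + sM ?x (sM (1 - \<mu>) (sM c Jw)))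
     = sM (of_int (m + n + 1) * c / 2 + ((1 - \<mu> / 2) * (- of_int (m + n + 1) * c) + ?x * ((1 - \<mu>) * c))) Jw"
    by (simp only: M.scale_left_distrib M.scale_scale)
  also have "of_int (m + n + 1) * c / 2 + ((1 - \<mu> / 2) * (- of_int (m + n + 1) * c) + ?x * ((1 - \<mu>) * c)) = - ((\<mu> - 1) * (of_int (m - n) / 2 * c))"
    unfolding x by (simp add: field_simps)
  also have "sM (?x * (?x - 1)) (sM (if m + n = 0 then - (\<mu> * (\<mu> - 1) / 4) * d else 0) w)
     = sM (if m + n = 0 then - (\<mu> * (\<mu> - 1) / 4 * (of_int m ^ 2 - 1/4) * d) else 0) w"
    unfolding x by (simp add: field_simps power2_eq_square)
  finally have main: "md (G (mht ?a)) (of_int m + 1/2) (md (G (mht ?b)) (of_int n + 1/2) w)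
     = sM (-1) (md (G (mht ?b)) (of_int n + 1/2) (md (G (mht ?a)) (of_int m + 1/2) w))
      + (sM (- \<mu> * d) Lw + sM (1/2) (Y + X) + sM (- ((\<mu> - 1) * (of_int (m - n) / 2 * c))) Jw
         + sM (if m + n = 0 then - (\<mu> * (\<mu> - 1) / 4 * (of_int m ^ 2 - 1/4) * d) else 0) w)" .
  have ii: "gop (OG i m) (gop (OG j n) w) = sM (-1) (md (G (mht ?a)) (of_int m + 1/2) (md (G (mht ?b)) (of_int n + 1/2) w))"
    "sM (-1) (gop (OG j n) (gop (OG i m) w)) = md (G (mht ?b)) (of_int n + 1/2) (md (G (mht ?a)) (of_int m + 1/2) w)"
    unfolding gop_simps md_scale_right by simp_all
  have fin: "gop (OG i m) (gop (OG j n) w) = sM (-1) (gop (OG j n) (gop (OG i m) w)) + (sM (\<mu> * d) Lw + sM (-1/2) (Y + X) + sM ((\<mu> - 1) * (of_int (m - n) / 2 * c)) Jw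
         + sM (if m + n = 0 then \<mu> * (\<mu> - 1) / 4 * (of_int m ^ 2 - 1/4) * d else 0) w)"
    unfolding ii main by (simp add: M.scale_right_distrib)
  obtain K1 where K1: "\<And>K'. K' \<ge> K1 \<Longrightarrow> Y = (\<Sum>l = - int K'..int K'. nt (\<lambda>n. gop (OJ i n)) (\<lambda>n. gop (OJ j n)) (m + n) l w)"
    unfolding Y_def gop_simps using md_normal_ord[OF even_odd(1) even_odd(1), of ?a ?b "m + n" w] by blast
  obtain K2 where K2: "\<And>K'. K' \<ge> K2 \<Longrightarrow> X = (\<Sum>l = - int K'..int K'. nt (\<lambda>n. gop (OJ j n)) (\<lambda>n. gop (OJ i n)) (m + n) l w)"
    unfolding X_def gop_simps using md_normal_ord[OF even_odd(1) even_odd(1), of ?b ?a "m + n" w] by blast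
  have YX: "Y + X = (\<Sum>l=-K'..K'. nt (\<lambda>n. gop (OJ i n)) (\<lambda>n. gop (OJ j n)) (m + n) l w + nt (\<lambda>n. gop (OJ j n)) (\<lambda>n. gop (OJ i n)) (m + n) l w)"
    if "K' \<ge> int (max K1 K2)" for K'
    using K1[of "nat K'"] K2[of "nat K'"] that by (simp add: sum.distrib)
  have co: "\<mu> * d = of_real (real M1 * dt i j)" "(\<mu> - 1) * (of_int (m - n) / 2 * c) = of_real ((real M1 - 1) * (of_int (m - n) / 2 * cf i j))"
    "\<mu> * (\<mu> - 1) / 4 * (of_int m ^ 2 - 1/4) * d = of_real (real M1 * (real M1 - 1) / 4 * (of_int m ^ 2 - 1 / 4) * dt i j)"
    unfolding \<mu>_def c_def d_def by simp_all
  show ?thesis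
  proof (intro exI[of _ "int (max K1 K2)"] allI impI)
    fix K' assume "int (max K1 K2) \<le> K'"
    note YX = YX[OF this]
    show "gop (OG i m) (gop (OG j n) w) = sM (-1) (gop (OG j n) (gop (OG i m) w)) + (sM (of_real (real M1 * dt i j)) (gop (OL (m + n)) w)
      + sM (-1/2) (\<Sum>l=-K'..K'. nt (\<lambda>n. gop (OJ i n)) (\<lambda>n. gop (OJ j n)) (m + n) l w + nt (\<lambda>n. gop (OJ j n)) (\<lambda>n. gop (OJ i n)) (m + n) l w)
      + sM (of_real ((real M1 - 1) * (of_int (m - n) / 2 * cf i j))) (gop (OJ (brk i j) (m + n)) w)
      + sM (if m + n = 0 then of_real (real M1 * (real M1 - 1) / 4 * (of_int m ^ 2 - 1 / 4) * dt i j) else 0) w)"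
      unfolding YX[symmetric] co[symmetric] Lw_def[symmetric] Jw_def[symmetric] by (rule fin)
  qed
qed

lemma gop_wmod: "wmod sM (real M1) gop"
proof unfold_locales
  show "gop b (x + y) = gop b x + gop b y" for b x y
    by (cases b) (simp_all add: gop_simps md_add_right M.scale_right_distrib)
  show "gop b (sM c x) = sM c (gop b x)" for b c x
    by (cases b) (simp_all add: gop_simps md_scale_right mult.commute)
qed (rule JJ_modes JG_modes LJ_modes LG_modes LL_modes GG_modes)+

end

section \<open>Parity components and graded submodules\<close>

lemma trip_add: "nmt (a + b) = nmt a + nmt b" "mht (a + b) = mht a + mht b"
  by (cases a; cases b; simp add: nm_linear)+

definition odd_op :: "wop \<Rightarrow> bool" where
  "odd_op b \<longleftrightarrow> (\<exists>i n. b = OG i n)"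

lemma odd_op_simps [simp]: "\<not> odd_op (OL n)" "\<not> odd_op (OJ i n)" "odd_op (OG i n)" "odd_op (dual b) = odd_op b"
  by (auto simp: odd_op_def; cases b; simp)+

context superspace
begin

text \<open>The locale only asserts that a decomposition exists, hence the choice;
  \<open>component_unique\<close> shows that it is determined.\<close>

definition component :: "bool \<Rightarrow> 'v \<Rightarrow> 'v" where
  "component p m = (let a = SOME a. a \<in> par False \<and> m - a \<in> par True in if p then m - a else a)"

lemma component: "component p m \<in> par p" "component False m + component True m = m"
proof -
  define a where "a = (SOME a. a \<in> par False \<and> m - a \<in> par True)"
  obtain a' b' where "a' \<in> par False" "b' \<in> par True" "m = a' + b'" using par_sum by blast
  then have "a' \<in> par False \<and> m - a' \<in> par True" by simp
  then have "a \<in> par False \<and> m - a \<in> par True" unfolding a_def by (rule someI)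
  then show "component p m \<in> par p" "component False m + component True m = m"
    unfolding component_def Let_def a_def[symmetric] by (cases p; simp)+
qed

lemma component_unique:
  assumes "a \<in> par False" "b \<in> par True"
  shows "component False (a + b) = a \<and> component True (a + b) = b"
proof -
  let ?d = "component False (a + b) - a"
  have e: "?d = b - component True (a + b)" using component(2)[of "a + b"] by (simp add: algebra_simps)
  have "?d \<in> par False" using component(1)[of False "a + b"] assms(1) by (intro subspace_diff par_subspace) simp_all
  moreover have "?d \<in> par True" unfolding e using component(1)[of True "a + b"] assms(2) by (intro subspace_diff par_subspace) simp_all
  ultimately have "?d = 0" using par_disjoint by blast
  then show ?thesis using e by simp
qed

lemma component_add: "component p (x + y) = component p x + component p y"
proof -
  have "component False ((component False x + component False y) + (component True x + component True y)) = component False x + component False y \<and>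
    component True ((component False x + component False y) + (component True x + component True y)) = component True x + component True y"
    by (intro component_unique subspace_add par_subspace component)
  moreover have "(component False x + component False y) + (component True x + component True y) = x + y"
    using component(2)[of x] component(2)[of y] by (metis add.assoc add.left_commute)
  ultimately show ?thesis by (cases p) simp_all
qed

lemma component_scale: "component p (scale c x) = scale c (component p x)"
proof -
  have "component False (scale c (component False x) + scale c (component True x)) = scale c (component False x) \<and>
    component True (scale c (component False x) + scale c (component True x)) = scale c (component True x)"
    by (intro component_unique subspace_scale par_subspace component)
  then show ?thesis
    unfolding scale_right_distrib[symmetric] component(2) by (cases p) simp_all
qed

lemma component_homogeneous: "x \<in> par p \<Longrightarrow> component q x = (if q = p then x else 0)"
  using component_unique[of x 0] component_unique[of 0 x] subspace_0[OF par_subspace] by (cases p; cases q) auto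

lemma component_0: "component p 0 = 0"
  using component_add[of p 0 0] by simp

end

lemma Ints_of_bool_rat: "of_bool b \<in> (\<int> :: rat set)"
  by (cases b) simp_all

lemma (in superspace) sum_mem: "subspace S \<Longrightarrow> (\<And>j. f j \<in> S) \<Longrightarrow> Sum_any f \<in> S"
  unfolding Sum_any.expand_set by (rule subspace_sum)

context adapted_module
begin

sublocale W: wmod sM "real M1" gop by (rule gop_wmod)

lemma gop_par: "w \<in> parM p \<Longrightarrow> gop b w \<in> parM (p \<noteq> odd_op b)"
proof (cases b)
  case (OG i n)
  assume "w \<in> parM p"
  then have "md (G (mht (tr i))) (of_int n + 1/2) w \<in> parM (True \<noteq> p)" by (intro md_par even_odd)
  then have "md (G (mht (tr i))) (of_int n + 1/2) w \<in> parM (p \<noteq> True)" by (simp add: eq_commute)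
  moreover have "(p \<noteq> odd_op b) = (p \<noteq> True)" unfolding OG by simp
  ultimately show ?thesis unfolding OG gop_simps by (simp only:) (intro M.subspace_scale M.par_subspace)
qed (use md_par[OF L_even] md_par[OF even_odd(1)] in \<open>auto simp: gop_simps\<close>)

lemma component_gop: "M.component p (gop b x) = gop b (M.component (p \<noteq> odd_op b) x)"
proof -
  let ?a = "gop b (M.component False x)" and ?b = "gop b (M.component True x)"
  have e: "gop b x = ?a + ?b" using M.component(2)[of x] by (metis W.op_add)
  have "?a \<in> parM (False \<noteq> odd_op b)" "?b \<in> parM (True \<noteq> odd_op b)" by (intro gop_par M.component)+
  then show ?thesis
    unfolding e M.component_add by (simp add: M.component_homogeneous)
qed

text \<open>For large n the product is 0. Going down from there, the Borcherds identity expresses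
  the modes of \<open>prd a l b\<close> by modes of \<open>a\<close> and \<open>b\<close> and by
  modes of \<open>prd a (l + j) b\<close> with j >= 1.\<close>

lemma prd_closed:
  assumes S: "M.subspace S" and hom: "a \<in> parV p" "b \<in> parV q"
    and a: "\<And>r w. w \<in> S \<Longrightarrow> md a r w \<in> S" and b: "\<And>r w. w \<in> S \<Longrightarrow> md b r w \<in> S"
  shows "w \<in> S \<Longrightarrow> md (prd a n b) t w \<in> S"
proof -
  obtain N where N: "\<And>n. n \<ge> N \<Longrightarrow> prd a n b = 0" using prd_truncation by blast
  have "\<forall>l t. \<forall>w\<in>S. l \<ge> N - int d \<longrightarrow> md (prd a l b) t w \<in> S" for d
  proof (induction d)
    case 0
    show ?case using N M.subspace_0[OF S] by auto
  next
    case (Suc d)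
    show ?case
    proof (intro allI ballI impI)
      fix l t w assume w: "w \<in> S" and l: "N - int (Suc d) \<le> l"
      show "md (prd a l b) t w \<in> S"
      proof (cases "t - of_bool (p \<noteq> q) / 2 \<in> \<int>")
        case False
        then show ?thesis using md_twist[OF prd_par[OF hom]] M.subspace_0[OF S] by metis
      next
        case True
        \<comment> \<open>Any index in the coset of \<open>a\<close> would do; the second index is
          then fixed by \<open>t\<close>.\<close>
        let ?r = "of_bool p / 2 :: rat"
        have r: "?r - of_bool p / 2 \<in> \<int>" by simp
        have "t - ?r - of_bool q / 2 = t - of_bool (p \<noteq> q) / 2 - of_bool (p \<and> q)" by (cases p; cases q) simp_all
        then have s: "t - ?r - of_bool q / 2 \<in> \<int>" using True by (simp only: Ints_diff Ints_of_bool_rat)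
        let ?f = "\<lambda>j. sM (of_rat ?r gchoose j) (md (prd a (l + int j) b) (?r + (t - ?r) - of_nat j) w)"
        have f: "?f (Suc j) \<in> S" for j
        proof -
          have "md (prd a (l + int (Suc j)) b) (?r + (t - ?r) - of_nat (Suc j)) w \<in> S"
          proof -
            have "N - int d \<le> l + int (Suc j)" using l by simp
            then show ?thesis using Suc.IH w by blast
          qed
          then show ?thesis by (rule M.subspace_scale[OF S])
        qed
        have "Sum_any ?f = (\<Sum>j<Suc (nat (N - l)). ?f j)"
        proof (rule Sum_any_lessThan)
          fix j assume "Suc (nat (N - l)) \<le> j"
          then have "prd a (l + int j) b = 0" by (intro N) linarith
          then show "?f j = 0" by (simp only: md_zero M.scale_zero_right)
        qed
        also have "\<dots> = md (prd a l b) t w + (\<Sum>j<nat (N - l). ?f (Suc j))"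
          unfolding sum.lessThan_Suc_shift by simp
        finally have 1: "Sum_any ?f = md (prd a l b) t w + (\<Sum>j<nat (N - l). ?f (Suc j))" .
        have "Sum_any ?f \<in> S"
          unfolding md_borcherds[OF hom r s]
          by (intro M.sum_mem S M.subspace_scale[OF S] M.subspace_diff[OF S] a b w)
        moreover have "(\<Sum>j<nat (N - l). ?f (Suc j)) \<in> S" by (intro M.subspace_sum S f)
        ultimately have "Sum_any ?f - (\<Sum>j<nat (N - l). ?f (Suc j)) \<in> S" by (rule M.subspace_diff[OF S])
        then show ?thesis unfolding 1 add_diff_cancel_right' .
      qed
    qed
  qed
  from this[of "nat (N - n)"] show "w \<in> S \<Longrightarrow> md (prd a n b) t w \<in> S" by auto
qed

text \<open>By strong generation it suffices to control the generators: the elements of the vertex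
  algebra whose modes preserve \<open>S\<close> form a subspace, which by \<open>prd_closed\<close>
  contains all PBW monomials. Their parities are carried along because \<open>prd_closed\<close>
  concerns homogeneous elements.\<close>

lemma submodI:
  assumes S: "M.subspace S" and gop: "\<And>b w. w \<in> S \<Longrightarrow> gop b w \<in> S"
    and comp: "\<And>p w. w \<in> S \<Longrightarrow> M.component p w \<in> S"
  shows "submod S"
proof -
  define A where "A = {a. \<forall>r. \<forall>w\<in>S. md a r w \<in> S}"
  have A: "subspace A"
    unfolding subspace_def A_def
    by (auto simp: md_add_left md_scale_left M.subspace_0[OF S] M.subspace_add[OF S] M.subspace_scale[OF S])
  have mem: "a \<in> A" if "a \<in> parV p" "\<And>n w. w \<in> S \<Longrightarrow> md a (of_int n + of_bool p / 2) w \<in> S" for a p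
    unfolding A_def mem_Collect_eq
  proof (intro allI ballI)
    fix r w assume w: "w \<in> S"
    show "md a r w \<in> S"
    proof (cases "r - of_bool p / 2 \<in> \<int>")
      case True
      then obtain n where "r - of_bool p / 2 = of_int n" by (auto elim: Ints_cases)
      then have "r = of_int n + of_bool p / 2" by (simp add: algebra_simps)
      then show ?thesis using that(2)[OF w, of n] by simp
    next
      case False
      then show ?thesis using md_twist[OF that(1)] M.subspace_0[OF S] by metis
    qed
  qed
  have LA: "L \<in> A"
  proof (rule mem[OF L_even])
    fix n w assume "w \<in> S"
    then show "md L (of_int n + of_bool False / 2) w \<in> S" using gop[of w "OL (n - 1)"] by (simp add: gop_simps)
  qed
  have Jtr: "J (nmt (tr i)) \<in> A" for i
  proof (rule mem[OF even_odd(1)])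
    fix n w assume "w \<in> S"
    then show "md (J (nmt (tr i))) (of_int n + of_bool False / 2) w \<in> S" using gop[of w "OJ i n"] by (simp add: gop_simps)
  qed
  have Gtr: "G (mht (tr i)) \<in> A" for i
  proof (rule mem[OF even_odd(2)])
    fix n w assume "w \<in> S"
    then have "sM (- \<i>) (gop (OG i n) w) \<in> S" using gop by (intro M.subspace_scale S)
    then show "md (G (mht (tr i))) (of_int n + of_bool True / 2) w \<in> S" by (simp add: gop_simps)
  qed
  have JG_A: "J (nmt t) \<in> A" "G (mht t) \<in> A" for t
  proof -
    obtain c1 c2 c3 where t: "t = sct c1 (tr P) + sct c2 (tr Z) + sct c3 (tr N)"
      using adapted unfolding adapted_def by blast
    have add: "J (nmt (a + b)) = J (nmt a) + J (nmt b)" "G (mht (a + b)) = G (mht a) + G (mht b)" for a b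
      unfolding trip_add by (intro J_add G_add trip_simps)+
    have "J (nmt t) = sV c1 (J (nmt (tr P))) + sV c2 (J (nmt (tr Z))) + sV c3 (J (nmt (tr N)))"
      unfolding t add J_sct ..
    then show "J (nmt t) \<in> A" using Jtr by (simp only:) (intro subspace_add subspace_scale A)
    have "G (mht t) = sV c1 (G (mht (tr P))) + sV c2 (G (mht (tr Z))) + sV c3 (G (mht (tr N)))"
      unfolding t add G_sct ..
    then show "G (mht t) \<in> A" using Gtr by (simp only:) (intro subspace_add subspace_scale A)
  qed
  let ?gs = "[L, J (nat_basis 1), J (nat_basis 2), J (nat_basis 3), G (mhalf_basis 1), G (mhalf_basis 2), G (mhalf_basis 3)]"
  have gs: "\<forall>g\<in>set ?gs. g \<in> A \<and> (\<exists>p. g \<in> parV p)"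
  proof -
    have "J (nm x y z) \<in> A \<and> (\<exists>p. J (nm x y z) \<in> parV p)" "G (mh x y z) \<in> A \<and> (\<exists>p. G (mh x y z) \<in> parV p)" for x y z
      using JG_A[of "(x, y, z)"] even_odd[of "(x, y, z)"] by auto
    then show ?thesis unfolding nm_coords mh_coords using LA L_even by auto
  qed
  have vacA: "vac \<in> A" unfolding A_def by (simp add: md_vac M.subspace_0[OF S])
  have foldrA: "(\<forall>(i, m)\<in>set xs. i < length ?gs) \<Longrightarrow> foldr (\<lambda>(i, m) w. prd (?gs ! i) (-1 - int m) w) xs vac \<in> A
      \<and> (\<exists>p. foldr (\<lambda>(i, m) w. prd (?gs ! i) (-1 - int m) w) xs vac \<in> parV p)" for xs
  proof (induction xs)
    case Nil
    show ?case using vacA vac_even by auto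
  next
    case (Cons x xs)
    obtain i m where x: "x = (i, m)" by (cases x)
    let ?w = "foldr (\<lambda>(i, m) w. prd (?gs ! i) (-1 - int m) w) xs vac"
    have "i < length ?gs" using Cons.prems unfolding x by (simp del: list.size)
    then have "?gs ! i \<in> set ?gs" by (rule nth_mem)
    then obtain p where g: "?gs ! i \<in> A" "?gs ! i \<in> parV p" using gs by meson
    obtain q where w: "?w \<in> A" "?w \<in> parV q" using Cons by (metis list.set_intros(2))
    have "prd (?gs ! i) (-1 - int m) ?w \<in> A"
      using prd_closed[OF S g(2) w(2)] g(1) w(1) unfolding A_def mem_Collect_eq by blast
    moreover have "prd (?gs ! i) (-1 - int m) ?w \<in> parV (p \<noteq> q)" by (rule prd_par[OF g(2) w(2)])
    ultimately show ?case unfolding x foldr_Cons comp_def prod.case by blast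
  qed
  have "pbw_monomial ?gs ` pbw_lists ?gs \<subseteq> A"
    using foldrA unfolding pbw_monomial_def pbw_lists_def by blast
  then have "span (pbw_monomial ?gs ` pbw_lists ?gs) \<subseteq> A" using A by (rule span_minimal)
  then have "A = UNIV" using generation unfolding strongly_freely_generated_def by blast
  then have "\<forall>a r. \<forall>w\<in>S. md a r w \<in> S" unfolding A_def by blast
  moreover have "\<exists>w0\<in>S \<inter> parM False. \<exists>w1\<in>S \<inter> parM True. w = w0 + w1" if "w \<in> S" for w
  proof (intro bexI)
    show "w = M.component False w + M.component True w" by (simp only: M.component(2))
  qed (use comp[OF that] M.component(1) in blast)+
  ultimately show ?thesis unfolding submod_def using S by blast
qed

text \<open>The given highest weight vector need not be homogeneous, but each mode keeps or
  exchanges the two components, so either of them satisfies the same conditions.\<close>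

lemma hw_gop:
  assumes "highest_weight_vector \<nu> l0 v"
  shows "W.hw l0 (\<nu> (nat_basis 2)) (M.component p v)"
proof -
  note h = assms[unfolded highest_weight_vector_def L_mode_def J_mode_def G_mode_def]
  have cartan: "h \<in> cartan_nat \<longleftrightarrow> (\<exists>c. h = nm 0 c 0)" for h
    unfolding cartan_nat_def nm_coords nm_linear by auto
  have th: "theta1 (nm x y z) = y" for x y z by (simp add: theta1_def nm_entries)
  have ws: "nm x 0 0 \<in> weight_space g_nat theta1" "mh x 0 0 \<in> weight_space g_mhalf theta1" for x
    unfolding weight_space_def by (auto simp: cartan th nm_g_nat mh_g_mhalf bracket_nm bracket_nm_mh nm_linear)
  obtain \<rho> \<beta> where tr: "tr P = (\<rho>, 0, 0)" "tr Z = (\<beta>, 1, 0)" using adapted unfolding adapted_def by blast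
  have z1: "gop (OL n) v = 0" "gop (OJ i n) v = 0" "gop (OG i n) v = 0" if "n > 0" for n i
    using h that trip_simps(8,9) unfolding gop_simps by simp_all
  have z2: "gop (OJ P 0) v = 0" "gop (OG P 0) v = 0"
    using h ws unfolding gop_simps tr by simp_all
  have z3: "gop (OL 0) v = sM l0 v" using h unfolding gop_simps by blast
  have z4: "gop (OJ Z 0) v = sM (\<nu> (nat_basis 2)) v"
  proof -
    \<comment> \<open>The part of \<open>tr Z\<close> along the raising vector kills
      \<open>v\<close>, so the eigenvalue is that of \<open>nat_basis 2\<close>.\<close>
    have "nmt (tr Z) = nm \<beta> 0 0 + nm 0 1 0" unfolding tr by (simp add: nm_linear)
    then have "gop (OJ Z 0) v = md (J (nm \<beta> 0 0)) 0 v + md (J (nm 0 1 0)) 0 v"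
      unfolding gop_simps by (simp add: J_add nm_g_nat md_add_left)
    moreover have "md (J (nm \<beta> 0 0)) 0 v = 0" using h ws by simp
    moreover have "md (J (nm 0 1 0)) 0 v = sM (\<nu> (nm 0 1 0)) v" using h cartan[of "nm 0 1 0"] by auto
    ultimately show ?thesis unfolding nm_coords by simp
  qed
  have c: "gop b (M.component p v) = M.component (p \<noteq> odd_op b) (gop b v)" for b
    unfolding component_gop by (cases "odd_op b") auto
  show ?thesis
    unfolding W.hw_def c using z1 z2 z3 z4 by (simp add: M.component_0 M.component_scale)
qed

theorem unitary_from_fock:
  assumes ac: "almost_compact \<phi>" and irr: "irreducible_highest_weight \<nu> l0"
    and F: "wmod_hw cscale (real M1) opF v0 l0 (\<nu> (nat_basis 2))"
    and adj: "\<And>b x y. inner_fock (opF b x) y = inner_fock x (opF (dual b) y)"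
    and GZ: "opF (OG Z 0) v0 = 0" and v0: "v0 \<noteq> 0"
  shows "unitary \<phi>"
proof -
  interpret F: wmod_hw cscale "real M1" opF v0 l0 "\<nu> (nat_basis 2)" by (rule F)
  obtain v where v: "highest_weight_vector \<nu> l0 v" and irred: "irreducible_module"
    using irr unfolding irreducible_highest_weight_def by blast
  have "v \<noteq> 0" using v unfolding highest_weight_vector_def by blast
  then obtain p0 where p0: "M.component p0 v \<noteq> 0" using M.component(2)[of v] by (metis add.right_neutral)
  define u where "u = M.component p0 v"
  have u: "u \<in> parM p0" "u \<noteq> 0" unfolding u_def using p0 M.component by auto
  have uc: "M.component p u = (if p = p0 then u else 0)" for p by (rule M.component_homogeneous[OF u(1)])
  have simple: "N = {0} \<or> N = UNIV" if "submod N" for N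
    using irred that unfolding irreducible_module_def by blast
  have cc: "M.component p (M.component q x) = (if p = q then M.component p x else 0)" for p q x
    using M.component_homogeneous[OF M.component(1)[of q x]] by auto
  have hw: "wmod_hw sM (real M1) gop u l0 (\<nu> (nat_basis 2))"
    by unfold_locales (unfold u_def, rule hw_gop[OF v])
  \<comment> \<open>The submodules in \<open>irreducible_module\<close> are graded, but
    \<open>S\<close> need not be; so irreducibility is applied to the vectors all of whose
    components lie in \<open>S\<close>.\<close>
  have gen: "S = UNIV" if S: "u \<in> S" "0 \<in> S" "\<And>x y. x \<in> S \<Longrightarrow> y \<in> S \<Longrightarrow> x + y \<in> S" "\<And>c x. x \<in> S \<Longrightarrow> sM c x \<in> S"
      "\<And>b x. x \<in> S \<Longrightarrow> gop b x \<in> S" for S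
  proof -
    let ?S = "{x. \<forall>p. M.component p x \<in> S}"
    have "submod ?S"
    proof (rule submodI)
      show "M.subspace ?S"
        unfolding M.subspace_def using S by (auto simp: M.component_0 M.component_add M.component_scale)
    qed (use S(2,5) in \<open>auto simp: component_gop cc\<close>)
    moreover have "u \<in> ?S" using S(1,2) by (simp add: uc)
    ultimately have "?S = UNIV" using simple u(2) by blast
    then show ?thesis using S(3) M.component(2) by (metis (mono_tags, lifting) UNIV_eq_I UNIV_I mem_Collect_eq)
  qed
  obtain f where f: "\<And>x y. f (x + y) = f x + f y" "\<And>c x. f (sM c x) = cscale c (f x)"
    "\<And>b x. f (gop b x) = opF b (f x)" "f u = v0"
    using glue[OF hw F adj GZ v0 u(2) gen] by blast
  have f0: "f 0 = 0" using f(1)[of 0 0] by simp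
  \<comment> \<open>The kernel of \<open>f\<close> may fail to be graded; this is the largest graded
    subspace in it, and irreducibility makes it 0.\<close>
  let ?K = "{x. \<forall>p. f (M.component p x) = 0}"
  have "submod ?K"
  proof (rule submodI)
    show "M.subspace ?K"
      unfolding M.subspace_def by (auto simp: M.component_0 M.component_add M.component_scale f f0 F.scale_zero_right)
  qed (auto simp: component_gop cc f f0 F.op_zero)
  moreover have "u \<notin> ?K" using f(4) v0 by (auto simp: uc)
  ultimately have K0: "?K = {0}" using simple by blast
  define g where "g p x = f (M.component p x)" for p x
  define H where "H x y = (\<Sum>p\<in>UNIV. inner_fock (g p x) (g p y))" for x y
  have g: "g p (x + y) = g p x + g p y" "g p (sM c x) = cscale c (g p x)" "g p (gop b x) = opF b (g (p \<noteq> odd_op b) x)" for p x y c b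
    unfolding g_def M.component_add M.component_scale component_gop f by simp_all
  have Hadd: "H w (w1 + w2) = H w w1 + H w w2" for w w1 w2
    unfolding H_def g inner_fock_right by (simp add: sum.distrib)
  have Hscale: "H w (sM t w') = t * H w w'" for w w' t
    unfolding H_def g inner_fock_right by (simp add: sum_distrib_left)
  have Hcnj: "H w w' = cnj (H w' w)" for w w'
    unfolding H_def cnj_sum by (simp flip: inner_fock_cnj)
  have Hadd_left: "H (w1 + w2) w = H w1 w + H w2 w" for w w1 w2
    by (metis Hadd Hcnj complex_cnj_add)
  have Hscale_left: "H (sM t w) w' = cnj t * H w w'" for w w' t
    by (metis Hscale Hcnj complex_cnj_mult)
  have Hpos: "Re (H w w) > 0" if "w \<noteq> 0" for w
  proof -
    have nn: "Re (inner_fock x x) \<ge> 0" for x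
      using inner_fock_pos[of x] inner_fock_zero by (cases "x = 0") (auto simp: less_imp_le)
    have "w \<notin> ?K" using that K0 by blast
    then obtain p where "g p w \<noteq> 0" unfolding g_def by blast
    then have "Re (inner_fock (g p w) (g p w)) > 0" by (rule inner_fock_pos)
    then show ?thesis
      unfolding H_def using nn[of "g False w"] nn[of "g True w"] by (cases p) (simp_all add: UNIV_bool)
  qed
  \<comment> \<open>An odd mode exchanges the two summands of \<open>H\<close>, so invariance holds
    for the sum over both parities and not for each pullback.\<close>
  have Hadj: "H (gop b x) y = H x (gop (dual b) y)" for b x y
    unfolding H_def g adj odd_op_simps
    by (cases "odd_op b") (simp_all add: UNIV_bool)
  have ph: "\<And>a b. a \<in> spo23 \<Longrightarrow> b \<in> spo23 \<Longrightarrow> \<phi> (a + b) = \<phi> a + \<phi> b"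
    "\<And>a c. a \<in> spo23 \<Longrightarrow> \<phi> (mscale c a) = mscale (cnj c) (\<phi> a)"
    using ac unfolding almost_compact_def by blast+
  have tr: "\<phi> (nmt (tr i)) = nmt (sct (-1) (tr (st i)))" "\<phi> (mht (tr i)) = mht (sct (-1) (tr (st i)))" for i
    unfolding trip_simps using adapted unfolding adapted_def by blast+
  have ph_sum: "\<phi> (nmt (sct c1 (tr P) + sct c2 (tr Z) + sct c3 (tr N))) = nmt (sct (- cnj c3) (tr P) + sct (- cnj c2) (tr Z) + sct (- cnj c1) (tr N))"
    "\<phi> (mht (sct c1 (tr P) + sct c2 (tr Z) + sct c3 (tr N))) = mht (sct (- cnj c3) (tr P) + sct (- cnj c2) (tr Z) + sct (- cnj c1) (tr N))" for c1 c2 c3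
  proof -
    have n: "\<phi> (nmt (a + b)) = \<phi> (nmt a) + \<phi> (nmt b)" "\<phi> (mht (a + b)) = \<phi> (mht a) + \<phi> (mht b)" for a b
      unfolding trip_add by (intro ph trip_simps)+
    have m: "\<phi> (nmt (sct c (tr i))) = nmt (sct (- cnj c) (tr (st i)))" "\<phi> (mht (sct c (tr i))) = mht (sct (- cnj c) (tr (st i)))" for c i
    proof -
      have s: "mscale c (mscale (-1) A) = mscale (- c) A" for c A by simp
      show "\<phi> (nmt (sct c (tr i))) = nmt (sct (- cnj c) (tr (st i)))"
        unfolding trip_simps(6) ph(2)[OF trip_simps(10)] tr(1) s ..
      show "\<phi> (mht (sct c (tr i))) = mht (sct (- cnj c) (tr (st i)))"
        unfolding trip_simps(7) ph(2)[OF trip_simps(11)] tr(2) s ..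
    qed
    show "\<phi> (nmt (sct c1 (tr P) + sct c2 (tr Z) + sct c3 (tr N))) = nmt (sct (- cnj c3) (tr P) + sct (- cnj c2) (tr Z) + sct (- cnj c1) (tr N))"
      "\<phi> (mht (sct c1 (tr P) + sct c2 (tr Z) + sct c3 (tr N))) = mht (sct (- cnj c3) (tr P) + sct (- cnj c2) (tr Z) + sct (- cnj c1) (tr N))"
      unfolding n m st.simps unfolding trip_add by (simp_all only: add_ac)
  qed
  have Jm: "J_mode (nmt (sct c1 (tr P) + sct c2 (tr Z) + sct c3 (tr N))) n w = sM c1 (gop (OJ P n) w) + sM c2 (gop (OJ Z n) w) + sM c3 (gop (OJ N n) w)" for c1 c2 c3 n w
  proof -
    have "J (nmt (a + b)) = J (nmt a) + J (nmt b)" for a b unfolding trip_add by (intro J_add trip_simps)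
    then show ?thesis unfolding J_mode_def by (simp only: J_sct md_add_left md_scale_left gop_simps)
  qed
  have Gm: "G_mode (mht (sct c1 (tr P) + sct c2 (tr Z) + sct c3 (tr N))) n w = sM (- \<i> * c1) (gop (OG P n) w) + sM (- \<i> * c2) (gop (OG Z n) w) + sM (- \<i> * c3) (gop (OG N n) w)" for c1 c2 c3 n w
  proof -
    have "G (mht (a + b)) = G (mht a) + G (mht b)" for a b unfolding trip_add by (intro G_add trip_simps)
    moreover have "sM (- \<i> * c) (sM \<i> y) = sM c y" for c y
    proof -
      have "- \<i> * c * \<i> = c" by (simp add: mult.assoc mult.left_commute mult.commute)
      then show ?thesis unfolding M.scale_scale by (rule arg_cong)
    qed
    ultimately show ?thesis unfolding G_mode_def by (simp only: G_sct md_add_left md_scale_left gop_simps)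
  qed
  have span: "\<exists>c1 c2 c3. t = sct c1 (tr P) + sct c2 (tr Z) + sct c3 (tr N)" for t
    using adapted unfolding adapted_def by blast
  have HL: "H (L_mode n w) w' = H w (L_mode (-n) w')" for n w w'
    using Hadj[of "OL n" w w'] unfolding L_mode_def by (simp add: gop_simps)
  have HJ: "H (J_mode a n w) w' = - H w (J_mode (\<phi> a) (-n) w')" if aa: "a \<in> g_nat" for a n w w'
  proof -
    obtain t where at: "a = nmt t" using g_nat_nm[OF aa] by (metis nmt.simps)
    obtain c1 c2 c3 where t: "t = sct c1 (tr P) + sct c2 (tr Z) + sct c3 (tr N)" using span[of t] by blast
    note a = at[unfolded t]
    show ?thesis
      unfolding a ph_sum Jm Hadd Hscale Hadd_left Hscale_left Hadj dual.simps st.simps by simp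
  qed
  have HG: "H (G_mode a n w) w' = H w (G_mode (\<phi> a) (-n) w')" if aa: "a \<in> g_mhalf" for a n w w'
  proof -
    obtain t where at: "a = mht t" using g_mhalf_mh[OF aa] by (metis mht.simps)
    obtain c1 c2 c3 where t: "t = sct c1 (tr P) + sct c2 (tr Z) + sct c3 (tr N)" using span[of t] by blast
    note a = at[unfolded t]
    show ?thesis
      unfolding a ph_sum Gm Hadd Hscale Hadd_left Hscale_left Hadj dual.simps st.simps by simp
  qed
  show ?thesis
    unfolding unitary_def
    by (intro exI[of _ H] conjI allI ballI impI) (assumption | rule Hadd Hscale Hcnj Hpos HL HJ HG)+
qed

end

section \<open>The two extremal weights as spin 0 and spin 1/2 at every site\<close>

theorem proposition11p1:
  fixes k :: real and M1 :: nat
    and sV :: "complex \<Rightarrow> 'v::ab_group_add \<Rightarrow> 'v" and parV :: "bool \<Rightarrow> 'v set"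
    and vac :: 'v and prd :: "'v \<Rightarrow> int \<Rightarrow> 'v \<Rightarrow> 'v"
    and L :: 'v and J :: "smat \<Rightarrow> 'v" and G :: "smat \<Rightarrow> 'v"
    and \<phi> :: "smat \<Rightarrow> smat"
  assumes "M1 \<ge> 1" and "real M1 = - 4 * k - 2"
    and "minimal_W_spo23 sV parV vac prd k L J G"
    and "almost_compact \<phi>"
    and "\<forall>u\<in>g_mhalf. u \<noteq> 0 \<longrightarrow> Re (ang (\<phi> u) u) > 0"
  shows
    "(\<forall>(sM :: complex \<Rightarrow> 'm::ab_group_add \<Rightarrow> 'm) parM md.
        Ramond_W_module sV parV vac prd k L J G sM parM md \<and>
        Ramond_W_module.irreducible_highest_weight L J G sM parM md
          (\<lambda>h. 0) (of_real ((real M1 - 1) / 16))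
        \<longrightarrow> Ramond_W_module.unitary L J G sM md \<phi>) \<and>
     (\<forall>(sM :: complex \<Rightarrow> 'm \<Rightarrow> 'm) parM md.
        Ramond_W_module sV parV vac prd k L J G sM parM md \<and>
        Ramond_W_module.irreducible_highest_weight L J G sM parM md
          (\<lambda>h. of_real (real M1 / 2) * theta1 h) (of_real ((real M1 - 1) / 16 + real M1 / 4))
        \<longrightarrow> Ramond_W_module.unitary L J G sM md \<phi>)"
  (is "?A \<and> ?B")
proof -
  obtain tr where tr: "adapted \<phi> tr" using adapted_basis[OF assms(4,5)] by blast
  \<comment> \<open>A common spin \<open>s\<close> at all M1 sites gives the weight M1 s and the
    energy M1 s^2 above (M1 - 1)/16; the values s = 0 and s = 1/2 are the two cases of the
    theorem.\<close>
  have unitary: "Ramond_W_module.unitary L J G sM md \<phi>"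
    if W: "Ramond_W_module sV parV vac prd k L J G sM parM md"
      and irr: "Ramond_W_module.irreducible_highest_weight L J G sM parM md \<nu> l0"
      and s: "s = 0 \<or> s = 1/2" "l0 = of_real ((real M1 - 1) / 16 + real M1 * (s * s))" "\<nu> (nat_basis 2) = of_real (real M1 * s)"
    for sM :: "complex \<Rightarrow> 'm \<Rightarrow> 'm" and parM md \<nu> l0 s
  proof -
    interpret Ramond_W_module sV parV vac prd k L J G sM parM md by (rule W)
    interpret adapted_module sV parV vac prd k L J G sM parM md \<phi> tr M1
      by unfold_locales (rule tr assms(2))+
    obtain opF v0 where F: "wmod_hw cscale (real M1) opF v0 l0 (\<nu> (nat_basis 2))"
      "\<And>b x y. inner_fock (opF b x) y = inner_fock x (opF (dual b) y)" "opF (OG Z 0) v0 = 0" "v0 \<noteq> 0"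
      using fock_module_exists[OF assms(1) s(1)] unfolding s(2,3) by blast
    show ?thesis by (rule unitary_from_fock[OF assms(4) irr F])
  qed
  have th: "theta1 (nat_basis 2) = 1" by (simp add: nm_coords theta1_def nm_entries)
  have ?A
    by (intro allI impI, elim conjE, rule unitary[where s = 0]) (assumption | simp)+
  moreover have ?B
    by (intro allI impI, elim conjE, rule unitary[where s = "1/2"]) (assumption | simp add: th)+
  ultimately show ?thesis by blast
qed

end
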